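(* Let $d\ge 1$ and let $V$ be a real inner product space of finite dimension $n$. The mapping space signature $\Phi:\mathrm{Lip}_J(\square^d,V)\to \mathbf{H}_d((V))$, where $\mathbf{H}_d((V))\subset\mathbf{T}_d((V))$ is the Hilbert space of finite norm elements of $\mathbf{T}_d((V))$, has the following properties. (AN1) It has factorial decay at each level $m\in\mathbb{N}$: $$\|\Phi_m(\mathbf{x})\|^2\le \binom{n}{d}^m\frac{\|J[\mathbf{x}]\|_\infty^{dm}}{(m!)^d},$$ and it is continuous with respect to the Jacobian Lipschitz metric $\mu_\infty$ on $\mathrm{Lip}_J(\square^d,V)$. (AL0') It is coordinate-wise reparametrization invariant: if $\psi_1,\dots,\psi_d:[0,1]\to[0,1]$ are Lipschitz, orientation-preserving bijections and $\psi(s_1,\dots,s_d)=(\psi_1(s_1),\dots,\psi_d(s_d))$, then $\Phi(\mathbf{x})=\Phi(\mathbf{x}\circ\psi)$. (AL1') It satisfies a modified Chen's identity when the permutation index is restricted to be the identity: let $q\in[d]$, let $\mathbf{x},\mathbf{y}\in \mathrm{Lip}(\square^d,V)$ be $q$-composable, let $\mathbf{P}=(P_1,\dots,P_m)\in\mathcal{O}_{d,n}^m$, and put $\overline{\mathbf{P}}_r=(P_1,\dots,P_r)$ and $\underline{\mathbf{P}}_r=(P_{m-r+1},\dots,P_m)$. Then $$\Phi_m^{\mathbf{P},\mathbf{id}}(\mathbf{x}*_q\mathbf{y})=\Phi_m^{\mathbf{P},\mathbf{id}}(\mathbf{x})+\Phi_m^{\mathbf{P},\mathbf{id}}(\mathbf{y})+\sum_{r=1}^{m-1}\int_{\hat{\mathbf{t}}_q\in\square^{d-1}}\frac{\partial}{\partial\hat{\mathbf{t}}_q}\Phi_r^{\overline{\mathbf{P}}_r,\mathbf{id}}(\mathbf{x})_{\mathbf{0},\hat{\mathbf{t}}_q^1}\cdot\Phi_{m-r}^{\underline{\mathbf{P}}_{m-r},\mathbf{id}}(\mathbf{y})_{\hat{\mathbf{t}}_q^0,\mathbf{1}}\;d\hat{\mathbf{t}}_q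 .$$ (AL2) It has a generalized shuffle product structure: the finite linear functionals $\ell\in\mathbf{H}_d(V)$, viewed as functions $\langle\ell,\Phi(\cdot)\rangle:\mathrm{Lip}_J(\square^d,V)\to\mathbb{R}$, form a subalgebra of $C(\mathrm{Lip}_J(\square^d,V),\mathbb{R})$. (AL3) It is equivariant with respect to both the action of the hyperoctahedral group $B_d$ on the domain and the action of $GL(V)$ on the codomain: for every $\mathbf{x}\in\mathrm{Lip}_J(\square^d,V)$ one has $\Phi(\mathbf{x}_\sigma^{\boldsymbol\tau})=\Phi(\mathbf{x})\cdot(\boldsymbol\tau,\sigma)$ for every $(\boldsymbol\tau,\sigma)\in B_d$, and $\Phi(A\mathbf{x})=\mathbf{A}\,\Phi(\mathbf{x})$ for every $A\in GL(V)$.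
   Context: Notation: $\square^d=[0,1]^d$, $[k]=\{1,\dots,k\}$, $\Sigma_m$ is the symmetric group on $[m]$. Fix an orthonormal basis $e_1,\dots,e_n$ of $V$ and write $\mathbf{x}=(x_1,\dots,x_n)$. $\mathrm{Lip}(\square^d,V)$ is the set of Lipschitz maps $\square^d\to V$ (differentiable a.e.). $\mathcal{O}_{d,n}$ is the set of order-preserving injections $P:[d]\to[n]$; $e^P=e_{P(1)}\wedge\dots\wedge e_{P(d)}$, and $\{e^P\}$ is an orthonormal basis of $\Lambda^dV$. Jacobian minors: $J[\mathbf{x}_P](\mathbf{s})=\det\big(\partial x_{P(i)}/\partial s_j(\mathbf{s})\big)_{i,j\in[d]}$ and $J[\mathbf{x}]=\hat d\mathbf{x}=\sum_P J[\mathbf{x}_P]\,e^P\in L^\infty(\square^d,\Lambda^dV)$; $\|\cdot\|_\infty$ is the $L^\infty$ norm. Two Lipschitz maps are Jacobian equivalent if $\hat d\mathbf{x}=\hat d\mathbf{y}$ in $L^\infty$; $\mathrm{Lip}_J(\square^d,V)$ is the set of equivalence classes, with the Jacobian Lipschitz metric $\mu_\infty(\mathbf{x},\mathbf{y})=\|\hat d\mathbf{x}-\hat d\mathbf{y}\|_\infty$. Integration domains: for $\pi\in\Sigma_m$ and $a<b$ in $[0,1]$, $\Delta^m_\pi(a,b)=\{a\le t_{\pi(1)}<\dots<t_{\pi(m)}\le b\}$. For $\boldsymbol\pi=(\pi_1,\dots,\pi_d)\in\Sigma_m^d$ and $\mathbf{a},\mathbf{b}\in\square^d$ with $a_j<b_j$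 for all $j$, $D^m_{\boldsymbol\pi}(\mathbf{a},\mathbf{b})=\prod_{j=1}^d\Delta^m_{\pi_j}(a_j,b_j)$, with coordinates $\mathbf{t}=(t_{i,j})_{i\in[m],j\in[d]}$, where $(t_{1,j},\dots,t_{m,j})\in\Delta^m_{\pi_j}(a_j,b_j)$, and $\mathbf{t}_i=(t_{i,1},\dots,t_{i,d})$. Signature: for $m\ge1$ and $(\mathbf{P},\boldsymbol\pi)\in\mathcal{O}_{d,n}^m\times\Sigma_m^d$, $\Phi_m^{\mathbf{P},\boldsymbol\pi}(\mathbf{x})_{\mathbf{a},\mathbf{b}}=\int_{D^m_{\boldsymbol\pi}(\mathbf{a},\mathbf{b})}\prod_{i=1}^mJ[\mathbf{x}_{P_i}](\mathbf{t}_i)\,d\mathbf{t}$, and $\Phi_m^{\mathbf{P},\boldsymbol\pi}(\mathbf{x})=\Phi_m^{\mathbf{P},\boldsymbol\pi}(\mathbf{x})_{\mathbf{0},\mathbf{1}}$, where $\mathbf{0}=(0,\dots,0)$ and $\mathbf{1}=(1,\dots,1)$. Let $\mathbf{T}_d^{(0)}(V)=\mathbb{R}$, $\mathbf{T}_d^{(m)}(V)=\prod_{\boldsymbol\pi\in\Sigma_m^d}(\Lambda^dV)^{\otimes m}$, with orthonormal basis $e^{\mathbf{P},\boldsymbol\pi}$ ($e^{P_1}\otimes\dots\otimes e^{P_m}$ in the $\boldsymbol\pi$ factor), and $\mathbf{T}_d((V))=\prod_{m\ge0}\mathbf{T}_d^{(m)}(V)$. Then $\Phi_0(\mathbf{x})=1$,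 $\Phi_m(\mathbf{x})\in\mathbf{T}_d^{(m)}(V)$ has coordinates $\Phi_m^{\mathbf{P},\boldsymbol\pi}(\mathbf{x})$, and $\Phi(\mathbf{x})=(\Phi_m(\mathbf{x}))_{m\ge0}$; it depends only on the Jacobian equivalence class of $\mathbf{x}$. $\mathbf{H}_d((V))=\{(\mathbf{r}_m)\in\mathbf{T}_d((V)):\sum_m\|\mathbf{r}_m\|^2<\infty\}$, and $\mathbf{H}_d(V)=\bigoplus_{m\ge0}\mathbf{T}_d^{(m)}(V)$ (the finite linear functionals). Composition: $\mathbf{x},\mathbf{y}\in\mathrm{Lip}(\square^d,V)$ are $q$-composable if $\mathbf{x}(s_1,\dots,s_{q-1},1,s_{q+1},\dots,s_d)=\mathbf{y}(s_1,\dots,s_{q-1},0,s_{q+1},\dots,s_d)$ for all values of the other coordinates; then $\mathbf{x}*_q\mathbf{y}(\mathbf{s})$ equals $\mathbf{x}(s_1,\dots,2s_q,\dots,s_d)$ if $s_q\in[0,1/2)$ and $\mathbf{y}(s_1,\dots,2s_q-1,\dots,s_d)$ if $s_q\in[1/2,1]$. $\mathbf{id}$ is the tuple of identity permutations. $\hat{\mathbf{t}}_q=(t_1,\dots,t_{q-1},t_{q+1},\dots,t_d)\in\square^{d-1}$; $\hat{\mathbf{t}}_q^0,\hat{\mathbf{t}}_q^1\in\square^d$ are obtained by inserting $0$, respectively $1$, in position $q$; $\frac{\partial}{\partial\hat{\mathbf{t}}_q}=\frac{\partial}{\partial t_1}\cdots\frac{\partial}{\partial t_{q-1}}\frac{\partial}{\partial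 t_{q+1}}\cdots\frac{\partial}{\partial t_d}$. Group actions: $B_d=\mathbb{Z}_2^d\rtimes\Sigma_d$ ($\Sigma_d$ permuting components). For $(\boldsymbol\tau,\sigma)\in B_d$ let $\rho_{\boldsymbol\tau,\sigma}(\mathbf{s})=(s_{\sigma(1)}^{\tau_{\sigma(1)}},\dots,s_{\sigma(d)}^{\tau_{\sigma(d)}})$, where $s_j^0=s_j$ and $s_j^1=1-s_j$; $\mathbf{x}_\sigma^{\boldsymbol\tau}=\mathbf{x}\circ\rho_{\boldsymbol\tau,\sigma}$. For $\pi\in\Sigma_m$ let $\pi^0=\pi$ and $\pi^1=\overleftarrow{\pi}$, the reversal $\overleftarrow{\pi}(i)=\pi(m+1-i)$; $\boldsymbol\pi_\sigma^{\boldsymbol\tau}=(\pi_{\sigma(1)}^{\tau_{\sigma(1)}},\dots,\pi_{\sigma(d)}^{\tau_{\sigma(d)}})$. For $\mathbf{r}\in\mathbf{H}_d((V))$ with $\boldsymbol\pi$-components $\mathbf{r}_m^{\boldsymbol\pi}\in(\Lambda^dV)^{\otimes m}$, $\mathbf{r}\cdot(\boldsymbol\tau,\sigma)$ has level-$m$ $\boldsymbol\pi$-component $(-1)^{m(|\boldsymbol\tau|+\mathrm{sgn}(\sigma))}\,\mathbf{r}_m^{\boldsymbol\pi_\sigma^{\boldsymbol\tau}}$, where $|\boldsymbol\tau|$ is the number of nonzero entries of $\boldsymbol\tau$ and $\mathrm{sgn}(\sigma)\in\{0,1\}$ is the parity of $\sigma$. For $A\in GL(V)$, $A\mathbf{x}$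 is the (class of the) pointwise image, and $\mathbf{A}:\mathbf{H}_d((V))\to\mathbf{H}_d((V))$ is the induced map, given by the identity on level $0$ and by $(\Lambda^dA)^{\otimes m}$ on each $\boldsymbol\pi$-factor of level $m$.
   Formalization: In (AN1) the exponent of ‖J[x]‖_∞ is 2m instead of dm; the printed bound fails for d≠2 (e.g. d=n=m=1, x(s)=2s would give 4≤2), and the corrected one agrees with it for d=2. *)

theory Defs
  imports
    "HOL-Analysis.Analysis"
    "HOL-Probability.Essential_Supremum"
    "HOL-Combinatorics.Permutations"
    "Jordan_Normal_Form.Determinant"
begin

text \<open>
  All index sets are zero-based: \<open>{..<k}\<close> plays the role of \<open>[k] = {1,...,k}\<close>. Points of the
  \<open>d\<close>-cube are extensional functions on \<open>{..<d}\<close>, so that coordinates can be deleted and inserted.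
  The space \<open>V\<close> is the universe of a type \<open>'v :: real_inner\<close> that is spanned by a
  fixed orthonormal family \<open>e 0, ..., e (n-1)\<close>.
\<close>

definition orthonormal_basis :: "nat \<Rightarrow> (nat \<Rightarrow> 'v::real_inner) \<Rightarrow> bool" where
  "orthonormal_basis n e \<longleftrightarrow>
     (\<forall>i<n. \<forall>j<n. inner (e i) (e j) = (if i = j then 1 else 0)) \<and> span (e ` {..<n}) = UNIV"


section \<open>Lipschitz maps on the cube and their Jacobian minors\<close>

type_synonym point = "nat \<Rightarrow> real"

definition unit_cube :: "nat set \<Rightarrow> point set" where
  "unit_cube I = PiE I (\<lambda>_. {0..1})"

definition cube_measure :: "nat set \<Rightarrow> point measure" where
  "cube_measure I = PiM I (\<lambda>_. restrict_space lborel {0..1})"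

text \<open>Values outside the cube are irrelevant: nothing below depends on them.\<close>

definition Lip :: "nat \<Rightarrow> (point \<Rightarrow> 'v::real_inner) set" where
  "Lip d = {x. \<exists>L. \<forall>s\<in>unit_cube {..<d}. \<forall>t\<in>unit_cube {..<d}.
                 dist (x s) (x t) \<le> L * L2_set (\<lambda>j. s j - t j) {..<d}}"

text \<open>
  Derivatives are taken within the unit interval, hence one-sided on the faces of the cube, so that
  only values on the cube matter. Where the derivative does not exist, the value is
  a fixed unspecified constant.
\<close>

definition partial :: "nat \<Rightarrow> (point \<Rightarrow> real) \<Rightarrow> point \<Rightarrow> real" where
  "partial j f s = vector_derivative (\<lambda>u. f (s(j := u))) (at (s j) within {0..1})"

definition ord_inj :: "nat \<Rightarrow> nat \<Rightarrow> (nat \<Rightarrow> nat) set" where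
  "ord_inj d n = {P \<in> {..<d} \<rightarrow>\<^sub>E {..<n}. strict_mono_on {..<d} P}"

definition jac_minor ::
  "nat \<Rightarrow> (nat \<Rightarrow> 'v::real_inner) \<Rightarrow> (point \<Rightarrow> 'v) \<Rightarrow> (nat \<Rightarrow> nat) \<Rightarrow> point \<Rightarrow> real" where
  "jac_minor d e x P s =
     Determinant.det (Matrix.mat d d (\<lambda>(i, j). partial j (\<lambda>u. inner (x u) (e (P i))) s))"

text \<open>
  Elements of the exterior power \<open>\<Lambda>\<^sup>d V\<close> are given by their coordinates with respect to the
  orthonormal basis \<open>e\<^sup>P\<close>, \<open>P \<in> ord_inj d n\<close>.
\<close>

definition Linf_norm :: "nat \<Rightarrow> nat \<Rightarrow> ((nat \<Rightarrow> nat) \<Rightarrow> point \<Rightarrow> real) \<Rightarrow> real" where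
  "Linf_norm d n F =
     real_of_ereal (esssup (cube_measure {..<d}) (\<lambda>s. ereal (L2_set (\<lambda>P. F P s) (ord_inj d n))))"

definition jac_equiv ::
  "nat \<Rightarrow> nat \<Rightarrow> (nat \<Rightarrow> 'v::real_inner) \<Rightarrow> ((point \<Rightarrow> 'v) \<times> (point \<Rightarrow> 'v)) set" where
  "jac_equiv d n e = {(x, y). x \<in> Lip d \<and> y \<in> Lip d \<and>
     (AE s in cube_measure {..<d}. \<forall>P\<in>ord_inj d n. jac_minor d e x P s = jac_minor d e y P s)}"

lemma equiv_jac_equiv: "equiv (Lip d) (jac_equiv d n e)"
proof (rule equivI)
  show "jac_equiv d n e \<subseteq> Lip d \<times> Lip d"
    by (auto simp: jac_equiv_def)
  show "refl_on (Lip d) (jac_equiv d n e)"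
    by (auto simp: refl_on_def jac_equiv_def)
  show "sym (jac_equiv d n e)"
  proof (rule symI)
    fix x y assume "(x, y) \<in> jac_equiv d n e"
    then show "(y, x) \<in> jac_equiv d n e"
      unfolding jac_equiv_def by (auto elim!: eventually_mono)
  qed
  show "trans (jac_equiv d n e)"
  proof (rule transI)
    fix x y z assume "(x, y) \<in> jac_equiv d n e" "(y, z) \<in> jac_equiv d n e"
    then show "(x, z) \<in> jac_equiv d n e"
      unfolding jac_equiv_def by (auto elim: eventually_elim2)
  qed
qed

definition LipJ :: "nat \<Rightarrow> nat \<Rightarrow> (nat \<Rightarrow> 'v::real_inner) \<Rightarrow> (point \<Rightarrow> 'v) set set" where
  "LipJ d n e = Lip d // jac_equiv d n e"

definition jac_dist ::
  "nat \<Rightarrow> nat \<Rightarrow> (nat \<Rightarrow> 'v::real_inner) \<Rightarrow> (point \<Rightarrow> 'v) \<Rightarrow> (point \<Rightarrow> 'v) \<Rightarrow> real" where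
  "jac_dist d n e x y = Linf_norm d n (\<lambda>P s. jac_minor d e x P s - jac_minor d e y P s)"

definition mu_inf ::
  "nat \<Rightarrow> nat \<Rightarrow> (nat \<Rightarrow> 'v::real_inner) \<Rightarrow> (point \<Rightarrow> 'v) set \<Rightarrow> (point \<Rightarrow> 'v) set \<Rightarrow> real" where
  "mu_inf d n e X Y = jac_dist d n e (SOME x. x \<in> X) (SOME y. y \<in> Y)"


section \<open>The tensor spaces\<close>

text \<open>
  A level-\<open>m\<close> tensor is given by its coordinates with respect to the orthonormal basis
  \<open>e\<^bsup>P,\<pi>\<^esup>\<close>, indexed by pairs \<open>(P, \<pi>)\<close>. For \<open>m = 0\<close> there is exactly one such pair.
\<close>

type_synonym index = "(nat \<Rightarrow> nat \<Rightarrow> nat) \<times> (nat \<Rightarrow> nat \<Rightarrow> nat)"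
type_synonym tensor_seq = "nat \<Rightarrow> index \<Rightarrow> real"

definition level_index :: "nat \<Rightarrow> nat \<Rightarrow> nat \<Rightarrow> index set" where
  "level_index d n m =
     ({..<m} \<rightarrow>\<^sub>E ord_inj d n) \<times> ({..<d} \<rightarrow>\<^sub>E {p. p permutes {..<m}})"

definition level_norm :: "nat \<Rightarrow> nat \<Rightarrow> nat \<Rightarrow> (index \<Rightarrow> real) \<Rightarrow> real" where
  "level_norm d n m r = L2_set r (level_index d n m)"

definition T_space :: "nat \<Rightarrow> nat \<Rightarrow> tensor_seq set" where
  "T_space d n = {r. \<forall>m k. k \<notin> level_index d n m \<longrightarrow> r m k = 0}"

definition H_space :: "nat \<Rightarrow> nat \<Rightarrow> tensor_seq set" where
  "H_space d n = {r \<in> T_space d n. (\<lambda>m. (level_norm d n m (r m))\<^sup>2) summable_on UNIV}"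

definition H_dist :: "nat \<Rightarrow> nat \<Rightarrow> tensor_seq \<Rightarrow> tensor_seq \<Rightarrow> real" where
  "H_dist d n r r' = sqrt (\<Sum>\<^sub>\<infinity>m. (level_norm d n m (\<lambda>k. r m k - r' m k))\<^sup>2)"

definition finite_functionals :: "nat \<Rightarrow> nat \<Rightarrow> tensor_seq set" where
  "finite_functionals d n = {l \<in> T_space d n. finite {m. \<exists>k. l m k \<noteq> 0}}"

definition pairing :: "nat \<Rightarrow> nat \<Rightarrow> tensor_seq \<Rightarrow> tensor_seq \<Rightarrow> real" where
  "pairing d n l r = (\<Sum>m | \<exists>k. l m k \<noteq> 0. \<Sum>k\<in>level_index d n m. l m k * r m k)"


section \<open>The mapping space signature\<close>

definition ord_simplex :: "nat \<Rightarrow> (nat \<Rightarrow> nat) \<Rightarrow> real \<Rightarrow> real \<Rightarrow> (nat \<Rightarrow> real) set" where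
  "ord_simplex m p a b =
     {t. (\<forall>i<m. t (p i) \<in> {a..b}) \<and> strict_mono_on {..<m} (\<lambda>i. t (p i))}"

text \<open>A point \<open>t\<close> of the domain has rows \<open>t i\<close> in the \<open>d\<close>-cube, with entries \<open>t i j\<close>.\<close>

definition sig_domain ::
  "nat \<Rightarrow> nat \<Rightarrow> (nat \<Rightarrow> nat \<Rightarrow> nat) \<Rightarrow> point \<Rightarrow> point \<Rightarrow> (nat \<Rightarrow> point) set" where
  "sig_domain d m \<pi> a b = {t \<in> {..<m} \<rightarrow>\<^sub>E unit_cube {..<d}.
     \<forall>j<d. (\<lambda>i. t i j) \<in> ord_simplex m (\<pi> j) (a j) (b j)}"

definition sig_comp ::
  "nat \<Rightarrow> (nat \<Rightarrow> 'v::real_inner) \<Rightarrow> nat \<Rightarrow> (nat \<Rightarrow> nat \<Rightarrow> nat) \<Rightarrow> (nat \<Rightarrow> nat \<Rightarrow> nat) \<Rightarrow>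
     (point \<Rightarrow> 'v) \<Rightarrow> point \<Rightarrow> point \<Rightarrow> real" where
  "sig_comp d e m P \<pi> x a b =
     set_lebesgue_integral (PiM {..<m} (\<lambda>_. cube_measure {..<d})) (sig_domain d m \<pi> a b)
       (\<lambda>t. \<Prod>i<m. jac_minor d e x (P i) (t i))"

abbreviation sig_coord ::
  "nat \<Rightarrow> (nat \<Rightarrow> 'v::real_inner) \<Rightarrow> nat \<Rightarrow> (nat \<Rightarrow> nat \<Rightarrow> nat) \<Rightarrow> (nat \<Rightarrow> nat \<Rightarrow> nat) \<Rightarrow>
     (point \<Rightarrow> 'v) \<Rightarrow> real" where
  "sig_coord d e m P \<pi> x \<equiv> sig_comp d e m P \<pi> x (\<lambda>_. 0) (\<lambda>_. 1)"

definition sig :: "nat \<Rightarrow> nat \<Rightarrow> (nat \<Rightarrow> 'v::real_inner) \<Rightarrow> (point \<Rightarrow> 'v) \<Rightarrow> tensor_seq" where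
  "sig d n e x m = (\<lambda>(P, \<pi>).
     if (P, \<pi>) \<notin> level_index d n m then 0
     else if m = 0 then 1
     else sig_coord d e m P \<pi> x)"

definition sigJ :: "nat \<Rightarrow> nat \<Rightarrow> (nat \<Rightarrow> 'v::real_inner) \<Rightarrow> (point \<Rightarrow> 'v) set \<Rightarrow> tensor_seq" where
  "sigJ d n e X = sig d n e (SOME x. x \<in> X)"

abbreviation LipJ_topology ::
  "nat \<Rightarrow> nat \<Rightarrow> (nat \<Rightarrow> 'v::real_inner) \<Rightarrow> (point \<Rightarrow> 'v) set topology" where
  "LipJ_topology d n e \<equiv> Metric_space.mtopology (LipJ d n e) (mu_inf d n e)"

abbreviation H_topology :: "nat \<Rightarrow> nat \<Rightarrow> tensor_seq topology" where
  "H_topology d n \<equiv> Metric_space.mtopology (H_space d n) (H_dist d n)"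


section \<open>Reparametrization and composition\<close>

definition reparam :: "nat \<Rightarrow> (nat \<Rightarrow> real \<Rightarrow> real) \<Rightarrow> point \<Rightarrow> point" where
  "reparam d \<psi> s = (\<lambda>j\<in>{..<d}. \<psi> j (s j))"

definition composable ::
  "nat \<Rightarrow> nat \<Rightarrow> (point \<Rightarrow> 'v::real_inner) \<Rightarrow> (point \<Rightarrow> 'v) \<Rightarrow> bool" where
  "composable d q x y \<longleftrightarrow> (\<forall>s\<in>unit_cube {..<d}. x (s(q := 1)) = y (s(q := 0)))"

definition compose_at ::
  "nat \<Rightarrow> (point \<Rightarrow> 'v::real_inner) \<Rightarrow> (point \<Rightarrow> 'v) \<Rightarrow> point \<Rightarrow> 'v" where
  "compose_at q x y s = (if s q < 1/2 then x (s(q := 2 * s q)) else y (s(q := 2 * s q - 1)))"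

text \<open>The iterated derivative in all coordinates below \<open>d\<close> other than \<open>q\<close>, the last one innermost.\<close>

definition mixed_partial :: "nat \<Rightarrow> nat \<Rightarrow> (point \<Rightarrow> real) \<Rightarrow> point \<Rightarrow> real" where
  "mixed_partial d q f = foldr partial (filter (\<lambda>j. j \<noteq> q) [0..<d]) f"

text \<open>
  The integral is taken with respect to the completed measure, because iterated partial derivatives
  are a priori only almost everywhere equal to a Borel function.
\<close>

definition chen_integral ::
  "nat \<Rightarrow> (nat \<Rightarrow> 'v::real_inner) \<Rightarrow> nat \<Rightarrow> nat \<Rightarrow> (nat \<Rightarrow> nat \<Rightarrow> nat) \<Rightarrow>
     (point \<Rightarrow> 'v) \<Rightarrow> (point \<Rightarrow> 'v) \<Rightarrow> nat \<Rightarrow> real" where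
  "chen_integral d e q m P x y r =
     (LINT t | completion (cube_measure ({..<d} - {q})).
        mixed_partial d q (\<lambda>t. sig_comp d e r P (\<lambda>_. id) x (\<lambda>_. 0) (t(q := 1))) t *
        sig_comp d e (m - r) (\<lambda>i. P (i + r)) (\<lambda>_. id) y (t(q := 0)) (\<lambda>_. 1))"


section \<open>Subalgebras of the algebra of continuous functions\<close>

text \<open>Functions on the topological space are extensional; subalgebras contain the constants.\<close>

definition continuous_subalgebra :: "'a topology \<Rightarrow> ('a \<Rightarrow> real) set \<Rightarrow> bool" where
  "continuous_subalgebra X F \<longleftrightarrow>
     F \<subseteq> {f \<in> extensional (topspace X). continuous_map X euclideanreal f} \<and>
     (\<lambda>x\<in>topspace X. 1) \<in> F \<and>
     (\<forall>f\<in>F. \<forall>g\<in>F. (\<lambda>x\<in>topspace X. f x + g x) \<in> F) \<and>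
     (\<forall>c. \<forall>f\<in>F. (\<lambda>x\<in>topspace X. c * f x) \<in> F) \<and>
     (\<forall>f\<in>F. \<forall>g\<in>F. (\<lambda>x\<in>topspace X. f x * g x) \<in> F)"


section \<open>Group actions\<close>

text \<open>
  An element \<open>(\<tau>, \<sigma>)\<close> of the hyperoctahedral group is a pair with \<open>\<tau> :: nat \<Rightarrow> bool\<close>
  (only the entries below \<open>d\<close> matter, \<open>True\<close> being the nonzero element) and \<open>\<sigma> permutes {..<d}\<close>.
\<close>

definition cube_sym :: "nat \<Rightarrow> (nat \<Rightarrow> bool) \<Rightarrow> (nat \<Rightarrow> nat) \<Rightarrow> point \<Rightarrow> point" where
  "cube_sym d \<tau> \<sigma> s = (\<lambda>k\<in>{..<d}. if \<tau> (\<sigma> k) then 1 - s (\<sigma> k) else s (\<sigma> k))"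

definition rev_perm :: "nat \<Rightarrow> (nat \<Rightarrow> nat) \<Rightarrow> nat \<Rightarrow> nat" where
  "rev_perm m p i = (if i < m then p (m - 1 - i) else i)"

definition perm_sym ::
  "nat \<Rightarrow> nat \<Rightarrow> (nat \<Rightarrow> bool) \<Rightarrow> (nat \<Rightarrow> nat) \<Rightarrow> (nat \<Rightarrow> nat \<Rightarrow> nat) \<Rightarrow> nat \<Rightarrow> nat \<Rightarrow> nat" where
  "perm_sym d m \<tau> \<sigma> \<pi> = (\<lambda>k\<in>{..<d}. if \<tau> (\<sigma> k) then rev_perm m (\<pi> (\<sigma> k)) else \<pi> (\<sigma> k))"

definition hyperoct_act ::
  "nat \<Rightarrow> nat \<Rightarrow> (nat \<Rightarrow> bool) \<Rightarrow> (nat \<Rightarrow> nat) \<Rightarrow> tensor_seq \<Rightarrow> tensor_seq" where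
  "hyperoct_act d n \<tau> \<sigma> r m = (\<lambda>(P, \<pi>).
     if (P, \<pi>) \<in> level_index d n m then
       (-1) ^ (m * (card {j\<in>{..<d}. \<tau> j} + (if evenperm \<sigma> then 0 else 1))) *
         r m (P, perm_sym d m \<tau> \<sigma> \<pi>)
     else 0)"

text \<open>
  The \<open>e\<^sup>Q\<close>-coordinate of \<open>v 0 \<and> ... \<and> v (d-1)\<close>; with \<open>v j = A (e (P j))\<close> this gives the
  matrix of \<open>\<Lambda>\<^sup>d A\<close>.
\<close>

definition wedge_coord :: "nat \<Rightarrow> (nat \<Rightarrow> 'v::real_inner) \<Rightarrow> (nat \<Rightarrow> 'v) \<Rightarrow> (nat \<Rightarrow> nat) \<Rightarrow> real" where
  "wedge_coord d e v Q = Determinant.det (Matrix.mat d d (\<lambda>(i, j). inner (v j) (e (Q i))))"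

definition GL_act ::
  "nat \<Rightarrow> nat \<Rightarrow> (nat \<Rightarrow> 'v::real_inner) \<Rightarrow> ('v \<Rightarrow> 'v) \<Rightarrow> tensor_seq \<Rightarrow> tensor_seq" where
  "GL_act d n e A r m = (\<lambda>(Q, \<pi>).
     if (Q, \<pi>) \<in> level_index d n m then
       (\<Sum>P\<in>{..<m} \<rightarrow>\<^sub>E ord_inj d n.
          (\<Prod>i<m. wedge_coord d e (\<lambda>j. A (e (P i j))) (Q i)) * r m (P, \<pi>))
     else 0)"

end

theory Submission
  imports Defs "HOL-Probability.Probability"
begin

text \<open>
  All domains carry products of the uniform distribution on \<open>[0,1]\<close>, so that every integral is an
  expectation. A map of the cube acting on each coordinate, weighted by its derivative, leaves this
  distribution invariant; applied to all rows of an integration domain, this one principle yields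
  reparametrization invariance, equivariance under the hyperoctahedral group and, with the two
  halves of a coordinate interval, the decomposition behind Chen's identity. The mixed partial derivative in
  Chen's identity is undone by Lebesgue differentiation in one coordinate at a time. The decay
  estimate rests on the fact that permuting the entries of each column preserves the measure, so
  that each of the \<open>(m!)\<^sup>d\<close> disjoint domains has measure at most \<open>1/(m!)\<^sup>d\<close>. The product of two
  integration domains is, up to a null set, a disjoint union of such domains, which makes the finite
  functionals an algebra; linear maps of the target act by the Cauchy-Binet formula.
\<close>

section \<open>Lipschitz functions of one variable\<close>

text \<open>\<open>vector_derivative\<close> is defined everywhere but meaningful only almost
  everywhere, and this shapes the proof. Before Fubini can carry one-variable statements from
  coordinate lines to the cube, partial derivatives must be measurable; hence the Dini derivatives
  along rational increments, and continuity along lines as a notion of its own for concatenated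
  maps. Moreover the null set where a map is not differentiable may pull back under a
  reparametrization to a set of positive measure, on which the reparametrization has derivative
  zero. There the weight vanishes, and so does a column of the Jacobian matrix of the composite. In
  Chen's identity the derivative is iterated: each step differentiates the previous derivative along
  a whole line and not only at almost every point, so the exceptional sets may depend only on the
  coordinates treated so far. The derivative of a Lipschitz function of one variable comes from
  Radon-Nikodym, after a steep linear term has made the function increasing.\<close>

lemma lebesgue_differentiation:
  fixes F g :: "real \<Rightarrow> real"
  assumes g: "\<And>a b. set_integrable lborel {a..b} g"
    and F: "\<And>a b. a \<le> b \<Longrightarrow> F b - F a = (LINT u:{a..b}|lborel. g u)"
  shows "AE u in lborel. (F has_vector_derivative g u) (at u)"
proof -
  have g_int: "g integrable_on {a..b}" for a b
    by (rule set_borel_integral_eq_integral[OF g])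
  have F_int: "F b - F a = integral {a..b} g" if "a \<le> b" for a b
    using F[OF that] set_borel_integral_eq_integral(2)[OF g] by simp
  obtain N1 where N1: "negligible N1" "\<And>x e. \<lbrakk>x \<notin> N1; 0 < e\<rbrakk> \<Longrightarrow>
      \<exists>d>0. \<forall>h. 0 < h \<and> h < d \<longrightarrow>
        norm (integral (cbox x (x + h *\<^sub>R One)) g /\<^sub>R h ^ DIM(real) - g x) < e"
    using integrable_ccontinuous_explicit[of g] g_int by (metis cbox_interval)
  \<comment> \<open>\<open>N1\<close> controls averages over intervals to the right of
    \<open>x\<close>. Intervals to the left are reached by reflecting the integrand, which produces
    a second null set that has to be reflected back.\<close>
  have g'_int: "(\<lambda>u. g (- u)) integrable_on {a..b}" for a b
    using g_int Henstock_Kurzweil_Integration.integrable_reflect_real[where f=g and a="-b" and b="-a"]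
    by simp
  obtain N2 where N2: "negligible N2" "\<And>x e. \<lbrakk>x \<notin> N2; 0 < e\<rbrakk> \<Longrightarrow>
      \<exists>d>0. \<forall>h. 0 < h \<and> h < d \<longrightarrow>
        norm (integral (cbox x (x + h *\<^sub>R One)) (\<lambda>u. g (- u)) /\<^sub>R h ^ DIM(real) - g (- x)) < e"
    using integrable_ccontinuous_explicit[of "\<lambda>u. g (- u)"] g'_int by (metis cbox_interval)
  have neg2: "negligible (uminus ` N2)"
  proof (rule negligible_locally_Lipschitz_image[OF _ N2(1)])
    show "\<exists>T B. open T \<and> x \<in> T \<and> (\<forall>y\<in>N2 \<inter> T. norm (- y - - x) \<le> B * norm (y - x))" for x
      by (rule exI[of _ UNIV], rule exI[of _ 1]) (simp add: abs_minus_commute)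
  qed simp
  have "(F has_vector_derivative g x) (at x)" if x1: "x \<notin> N1" and x2: "- x \<notin> N2" for x
  proof -
    have "(F has_real_derivative g x) (at x)"
      unfolding DERIV_def LIM_eq
    proof (intro allI impI)
      fix e :: real assume "0 < e"
      obtain d1 where d1: "d1 > 0" "\<And>h. 0 < h \<Longrightarrow> h < d1 \<Longrightarrow> \<bar>integral {x..x + h} g / h - g x\<bar> < e"
        using N1(2)[OF x1 \<open>0 < e\<close>] by (auto simp: cbox_interval divide_inverse mult.commute)
      obtain d2 where d2: "d2 > 0"
        "\<And>h. 0 < h \<Longrightarrow> h < d2 \<Longrightarrow> \<bar>integral {-x..-x + h} (\<lambda>u. g (- u)) / h - g x\<bar> < e"
        using N2(2)[OF x2 \<open>0 < e\<close>] by (auto simp: cbox_interval divide_inverse mult.commute)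
      have "norm ((F (x + h) - F x) / h - g x) < e" if h: "h \<noteq> 0" "\<bar>h\<bar> < min d1 d2" for h
      proof (cases "h > 0")
        case True
        then have "\<bar>integral {x..x + h} g / h - g x\<bar> < e" using h d1 by auto
        then show ?thesis using True F_int[of x "x + h"] by simp
      next
        case False
        then have h0: "h < 0" using h by simp
        have "integral {- x .. - (x + h)} (\<lambda>u. g (- u)) = integral {x + h..x} g"
          by (rule Henstock_Kurzweil_Integration.integral_reflect_real)
        then have "\<bar>integral {x + h..x} g / (- h) - g x\<bar> < e" using h h0 d2(2)[of "-h"] by auto
        moreover have "(F (x + h) - F x) / h = integral {x + h..x} g / (- h)"
          using F_int[of "x + h" x] h0 by (simp add: field_simps)
        ultimately show ?thesis by simp
      qed
      then show "\<exists>s>0. \<forall>h. h \<noteq> 0 \<and> norm (h - 0) < s \<longrightarrow> norm ((F (x + h) - F x) / h - g x) < e"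
        using d1(1) d2(1) by (intro exI[of _ "min d1 d2"]) auto
    qed
    then show ?thesis by (simp add: has_real_derivative_iff_has_vector_derivative)
  qed
  moreover have "N1 \<union> uminus ` N2 \<in> null_sets lebesgue"
    using N1(1) neg2 by (simp add: negligible_iff_null_sets[symmetric])
  then have "AE x in lebesgue. x \<notin> N1 \<union> uminus ` N2"
    by (rule AE_not_in)
  then have "AE x in lborel. x \<notin> N1 \<union> uminus ` N2"
    by (simp add: AE_completion_iff)
  ultimately show ?thesis
    by (elim eventually_mono) (metis UnCI image_eqI minus_minus)
qed

text \<open>Adding a linear term of slope \<open>L + 1\<close> turns \<open>F\<close> into an
  increasing bi-Lipschitz bijection \<open>G\<close>. The image of Lebesgue measure under the
  inverse \<open>H\<close> gives an interval the mass \<open>G b - G a\<close>, and Lipschitz images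
  of null sets are null, so Radon-Nikodym yields a density; subtracting the slope leaves the
  derivative of \<open>F\<close>.\<close>

lemma lipschitz_ftc_UNIV:
  fixes F :: "real \<Rightarrow> real"
  assumes F: "L-lipschitz_on UNIV F"
  obtains g where "g \<in> borel_measurable borel" "\<And>a b. set_integrable lborel {a..b} g"
    "\<And>a b. a \<le> b \<Longrightarrow> F b - F a = (LINT u:{a..b}|lborel. g u)"
proof -
  have L0: "0 \<le> L" using lipschitz_on_nonneg[OF F] .
  have FL: "\<bar>F v - F u\<bar> \<le> L * \<bar>v - u\<bar>" for u v
    using lipschitz_onD[OF F, of v u] by (auto simp: dist_real_def)
  \<comment> \<open>Slope \<open>L + 1\<close> rather than \<open>L\<close>: increments of
    \<open>G\<close> are then at least those of the identity, which gives both injectivity and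
    surjectivity.\<close>
  define G where "G u = F u + (L + 1) * u" for u
  have lower: "v - u \<le> G v - G u" and upper: "G v - G u \<le> (2 * L + 1) * (v - u)" if "u \<le> v" for u v
    using FL[of v u] that unfolding G_def by (auto simp: algebra_simps abs_le_iff)
  have G_bnd: "\<bar>G v - G u\<bar> \<le> (2 * L + 1) * \<bar>v - u\<bar>" for u v
    using lower[of u v] upper[of u v] lower[of v u] upper[of v u] by (cases "u \<le> v") auto
  have contG: "continuous_on UNIV G"
    unfolding G_def using lipschitz_on_continuous_on[OF F] by (intro continuous_intros) auto
  have mono_iff: "G u \<le> G v \<longleftrightarrow> u \<le> v" for u v
    using lower[of u v] lower[of v u] by linarith
  have "\<exists>u. G u = y" for y
  proof -
    \<comment> \<open>As \<open>G\<close> grows at least at rate 1, it reaches \<open>y\<close>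
      within distance \<open>\<bar>y - G 0\<bar>\<close> of the origin.\<close>
    have "G (min 0 (y - G 0)) \<le> y" "y \<le> G (max 0 (y - G 0))"
      using lower[of "min 0 (y - G 0)" 0] lower[of 0 "max 0 (y - G 0)"] by auto
    then show ?thesis
      using IVT'[of G "min 0 (y - G 0)" y "max 0 (y - G 0)"] continuous_on_subset[OF contG subset_UNIV]
      by fastforce
  qed
  then have surjG: "surj G" by (metis surj_def)
  have injG: "inj G" by (metis injI mono_iff order_antisym order_refl)
  define H where "H = inv_into UNIV G"
  have GH[simp]: "G (H y) = y" "H (G u) = u" for y u
    using surjG injG by (auto simp: H_def surj_f_inv_f)
  have Hmono: "mono H" by (rule monoI) (metis GH(1) mono_iff)
  then have H_meas[measurable]: "H \<in> borel_measurable borel" by (rule borel_measurable_mono)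
  define \<nu> where "\<nu> = distr lborel borel H"
  have vimage: "H -` A = G ` A" for A
  proof safe
    fix y assume "H y \<in> A"
    then have "G (H y) \<in> G ` A" by (rule imageI)
    then show "y \<in> G ` A" by simp
  qed simp
  have \<nu>: "emeasure \<nu> {a..b} = ennreal (G b - G a)" if "a \<le> b" for a b
  proof -
    have "a \<le> H y \<longleftrightarrow> G a \<le> y" "H y \<le> b \<longleftrightarrow> y \<le> G b" for y
      using mono_iff[of a "H y"] mono_iff[of "H y" b] by simp_all
    then have "H -` {a..b} = {G a..G b}" by auto
    then show ?thesis using that by (simp add: \<nu>_def emeasure_distr mono_iff)
  qed
  have "absolutely_continuous lborel \<nu>"
    unfolding absolutely_continuous_def
  proof
    fix A :: "real set" assume A: "A \<in> null_sets lborel"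
    then have "negligible A"
      by (simp add: negligible_iff_null_sets null_sets_completionI)
    then have "negligible (G ` A)"
    proof (rule negligible_locally_Lipschitz_image[rotated])
      show "\<exists>T B. open T \<and> x \<in> T \<and> (\<forall>y\<in>A \<inter> T. norm (G y - G x) \<le> B * norm (y - x))" for x
        using G_bnd by (intro exI[of _ UNIV] exI[of _ "2 * L + 1"]) auto
    qed simp
    moreover have "G ` A \<in> sets borel" using A H_meas vimage[of A, symmetric]
      by (metis (no_types, lifting) Int_UNIV_right measurable_sets null_setsD2 sets_lborel space_borel)
    ultimately have "emeasure lborel (G ` A) = 0"
      by (auto simp: negligible_iff_null_sets null_sets_completion_iff)
    then show "A \<in> null_sets \<nu>"
      using A by (auto simp: null_sets_def \<nu>_def emeasure_distr vimage)
  qed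
  then obtain f where f: "f \<in> borel_measurable lborel" "density lborel f = \<nu>"
    using sigma_finite_measure.Radon_Nikodym[OF sigma_finite_lborel, of \<nu>] by (auto simp: \<nu>_def)
  have f_int: "(\<integral>\<^sup>+u. f u * indicator {a..b} u \<partial>lborel) = ennreal (G b - G a)" if "a \<le> b" for a b
    using \<nu>[OF that] f by (metis emeasure_density atLeastAtMost_borel sets_lborel)
  define g0 where "g0 u = enn2real (f u)" for u
  have [measurable]: "g0 \<in> borel_measurable borel" "f \<in> borel_measurable borel"
    using f unfolding g0_def by measurable
  have main: "has_bochner_integral lborel (\<lambda>u. indicator {a..b} u *\<^sub>R g0 u) (G b - G a)" if "a \<le> b" for a b
  proof (rule has_bochner_integral_nn_integral)
    \<comment> \<open>The density has finite mass on bounded intervals, hence is finite almost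
      everywhere there, and \<open>enn2real\<close> loses nothing.\<close>
    have "AE u in lborel. f u * indicator {a..b} u \<noteq> \<infinity>"
      using f_int[OF that] by (intro nn_integral_PInf_AE) auto
    then have "(\<integral>\<^sup>+u. ennreal (indicator {a..b} u *\<^sub>R g0 u) \<partial>lborel) = (\<integral>\<^sup>+u. f u * indicator {a..b} u \<partial>lborel)"
      by (intro nn_integral_cong_AE) (auto elim!: eventually_mono simp: g0_def less_top split: split_indicator)
    then show "(\<integral>\<^sup>+u. ennreal (indicator {a..b} u *\<^sub>R g0 u) \<partial>lborel) = ennreal (G b - G a)"
      using f_int[OF that] by simp
    show "0 \<le> G b - G a" using mono_iff that by simp
  qed (auto simp: g0_def split: split_indicator)
  define g where "g u = g0 u - (L + 1)" for u
  have const: "has_bochner_integral lborel (\<lambda>u. indicator {a..b} u *\<^sub>R (L + 1)) ((b - a) * (L + 1))" if "a \<le> b" for a b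
    using has_bochner_integral_scaleR_left[where c="L + 1", OF has_bochner_integral_real_indicator[of "{a..b}" lborel]] that
    by simp
  have gb: "has_bochner_integral lborel (\<lambda>u. indicator {a..b} u *\<^sub>R g u) (F b - F a)" if "a \<le> b" for a b
    using has_bochner_integral_diff[OF main const, OF that that]
    by (simp add: g_def G_def algebra_simps)
  show thesis
  proof
    show "g \<in> borel_measurable borel" unfolding g_def by measurable
    show "set_integrable lborel {a..b} g" for a b
      using gb[of a b] by (cases "a \<le> b") (auto simp: set_integrable_def has_bochner_integral_iff)
    show "F b - F a = (LINT u:{a..b}|lborel. g u)" if "a \<le> b" for a b
      using gb[OF that] by (simp add: set_lebesgue_integral_def has_bochner_integral_iff)
  qed
qed

section \<open>The uniform distribution on the unit interval\<close>

abbreviation I01 :: "real measure" where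
  "I01 \<equiv> restrict_space lborel {0..1}"

lemma space_I01 [simp]: "space I01 = {0..1}"
  by (simp add: space_restrict_space)

lemma sets_I01: "sets I01 = {A \<in> sets borel. A \<subseteq> {0..1}}"
  by (auto simp: sets_restrict_space)

lemma measurable_I01: "f \<in> measurable borel N \<Longrightarrow> f \<in> measurable I01 N"
  by (intro measurable_restrict_space1) auto

lemma prob_space_I01: "prob_space I01"
  by (rule prob_spaceI) (simp add: emeasure_restrict_space)

lemma AE_I01_iff: "(AE u in I01. P u) \<longleftrightarrow> (AE u in lborel. u \<in> {0..1} \<longrightarrow> P u)"
  by (rule AE_restrict_space_iff) auto

lemma AE_I01_ne: "AE u in I01. u \<noteq> c"
  unfolding AE_I01_iff by (rule AE_mp[OF AE_lborel_singleton[of c]]) auto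

lemma lipschitz_ftc:
  fixes f :: "real \<Rightarrow> real"
  assumes f: "L-lipschitz_on {0..1} f"
  obtains g where "g \<in> borel_measurable borel"
    "AE u in I01. (f has_vector_derivative g u) (at u within {0..1})"
    "\<And>c. c \<in> {0..1} \<Longrightarrow> set_integrable lborel {0..c} g"
    "\<And>c. c \<in> {0..1} \<Longrightarrow> f c - f 0 = (LINT u:{0..c}|lborel. g u)"
proof -
  \<comment> \<open>Clamping to the unit interval is 1-Lipschitz, so this extension to the line
    keeps the constant \<open>L\<close>.\<close>
  define F where "F u = f (max 0 (min 1 u))" for u
  have "L-lipschitz_on UNIV F"
  proof (rule lipschitz_onI)
    show "0 \<le> L" using lipschitz_on_nonneg[OF f] .
    fix u v :: real
    have "dist (F u) (F v) \<le> L * dist (max 0 (min 1 u)) (max 0 (min 1 v))"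
      unfolding F_def by (rule lipschitz_onD[OF f]) auto
    also have "\<dots> \<le> L * dist u v"
      using \<open>0 \<le> L\<close> by (intro mult_left_mono) (auto simp: dist_real_def)
    finally show "dist (F u) (F v) \<le> L * dist u v" .
  qed
  then obtain g where g: "g \<in> borel_measurable borel" "\<And>a b. set_integrable lborel {a..b} g"
    "\<And>a b. a \<le> b \<Longrightarrow> F b - F a = (LINT u:{a..b}|lborel. g u)"
    using lipschitz_ftc_UNIV by blast
  have AE: "AE u in lborel. (F has_vector_derivative g u) (at u)"
    by (rule lebesgue_differentiation[OF g(2,3)])
  show thesis
  proof
    show "AE u in I01. (f has_vector_derivative g u) (at u within {0..1})"
      unfolding AE_I01_iff using AE
    proof (elim eventually_mono, intro impI)
      fix u :: real assume u: "(F has_vector_derivative g u) (at u)" "u \<in> {0..1}"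
      then have "(F has_vector_derivative g u) (at u within {0..1})"
        by (rule_tac has_vector_derivative_at_within)
      then show "(f has_vector_derivative g u) (at u within {0..1})"
        by (rule has_vector_derivative_transform[rotated -1]) (use u in \<open>auto simp: F_def\<close>)
    qed
    show "f c - f 0 = (LINT u:{0..c}|lborel. g u)" if "c \<in> {0..1}" for c
      using g(3)[of 0 c] that by (simp add: F_def)
  qed (use g in auto)
qed

text \<open>Lebesgue differentiation in the form used on the coordinate lines of the cube: the
  integral is over the uniform distribution and the derivative is taken within the interval, as in
  \<open>partial\<close>.\<close>

lemma AE_has_derivative_indefinite_integral:
  fixes g :: "real \<Rightarrow> real"
  assumes g: "g \<in> borel_measurable I01" and B: "\<And>u. u \<in> {0..1} \<Longrightarrow> \<bar>g u\<bar> \<le> B"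
  shows "AE u in I01. ((\<lambda>c. LINT v|I01. indicator {..c} v * g v) has_vector_derivative g u) (at u within {0..1})"
proof -
  define h where "h u = indicator {0..1} u *\<^sub>R g u" for u
  define F where "F c = (LINT v|I01. indicator {..c} v * g v)" for c
  have hm[measurable]: "h \<in> borel_measurable borel"
    using g by (simp add: borel_measurable_restrict_space_iff h_def[abs_def])
  have "integrable lborel (\<lambda>u. indicator A u * h u)" if [measurable]: "A \<in> sets borel" for A
  proof (rule Bochner_Integration.integrable_bound)
    show "integrable lborel (\<lambda>u. B * indicator {0..1::real} u)" by simp
    show "AE u in lborel. norm (indicator A u * h u) \<le> norm (B * indicator {0..1} u)"
      using B by (force simp: h_def intro!: AE_I2 split: split_indicator)
  qed measurable
  note hint = this
  have Fh: "F c = (LINT u|lborel. indicator {..c} u * h u)" for c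
    unfolding F_def by (subst integral_restrict_space) (auto simp: h_def mult_ac)
  have "AE u in lborel. (F has_vector_derivative h u) (at u)"
  proof (rule lebesgue_differentiation)
    show "set_integrable lborel {a..b} h" for a b
      using hint[of "{a..b}"] by (simp add: set_integrable_def)
    fix a b :: real assume ab: "a \<le> b"
    have "F b - F a = (LINT u|lborel. indicator {..b} u * h u - indicator {..a} u * h u)"
      unfolding Fh by (rule Bochner_Integration.integral_diff[symmetric]) (auto intro: hint)
    also have "\<dots> = (LINT u|lborel. indicator {a..b} u * h u)"
    proof (rule integral_cong_AE)
      show "AE u in lborel. indicator {..b} u * h u - indicator {..a} u * h u = indicator {a..b} u * h u"
        using AE_lborel_singleton[of a] by eventually_elim (use ab in \<open>auto split: split_indicator\<close>)
    qed measurable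
    finally show "F b - F a = (LINT u:{a..b}|lborel. h u)"
      by (simp add: set_lebesgue_integral_def)
  qed
  then have "AE u in I01. (F has_vector_derivative g u) (at u within {0..1})"
    unfolding AE_I01_iff
    by (elim eventually_mono) (auto simp: h_def intro: has_vector_derivative_at_within)
  then show ?thesis by (simp add: F_def[abs_def])
qed

section \<open>Measurability of derivatives\<close>

text \<open>Only rational increments are used, so that the Dini derivative of a family of continuous
  functions is a countable infimum of suprema of measurable functions of the parameter.\<close>

definition dini :: "(real \<Rightarrow> real) \<Rightarrow> real \<Rightarrow> ereal" where
  "dini f c = (INF k::nat. SUP u\<in>\<rat> \<inter> {0..1}.
     if u \<noteq> c \<and> \<bar>u - c\<bar> < inverse (real (Suc k)) then ereal ((f u - f c) / (u - c)) else - \<infinity>)"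

lemma rational_near:
  fixes c \<delta> :: real
  assumes "c \<in> {0..1}" "\<delta> > 0"
  obtains u where "u \<in> \<rat>" "u \<in> {0..1}" "u \<noteq> c" "\<bar>u - c\<bar> < \<delta>"
proof (cases "c < 1")
  case True
  then have "c < min 1 (c + \<delta>)" using assms by simp
  then show thesis using Rats_dense_in_real[of c "min 1 (c + \<delta>)"] assms that by fastforce
next
  case False
  then have "max 0 (c - \<delta>) < c" using assms by auto
  then show thesis using Rats_dense_in_real[of "max 0 (c - \<delta>)" c] assms that by fastforce
qed

lemma dini_le:
  assumes "\<delta> > 0" "\<And>u. u \<in> {0..1} \<Longrightarrow> u \<noteq> c \<Longrightarrow> \<bar>u - c\<bar> < \<delta> \<Longrightarrow> (f u - f c) / (u - c) \<le> a"
  shows "dini f c \<le> ereal a"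
proof -
  obtain k where k: "inverse (real (Suc k)) < \<delta>" using reals_Archimedean[OF assms(1)] by blast
  show ?thesis unfolding dini_def
  proof (rule INF_lower2[of k])
    show "(SUP u\<in>\<rat> \<inter> {0..1}. if u \<noteq> c \<and> \<bar>u - c\<bar> < inverse (real (Suc k))
      then ereal ((f u - f c) / (u - c)) else - \<infinity>) \<le> ereal a"
      by (rule SUP_least) (use k assms(2) in auto)
  qed simp
qed

lemma dini_ge:
  assumes "\<delta> > 0" "\<And>u. u \<in> {0..1} \<Longrightarrow> u \<noteq> c \<Longrightarrow> \<bar>u - c\<bar> < \<delta> \<Longrightarrow> a \<le> (f u - f c) / (u - c)"
    and c: "c \<in> {0..1}"
  shows "ereal a \<le> dini f c"
  unfolding dini_def
proof (rule INF_greatest)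
  fix k :: nat
  obtain u where u: "u \<in> \<rat>" "u \<in> {0..1}" "u \<noteq> c" "\<bar>u - c\<bar> < min \<delta> (inverse (real (Suc k)))"
    using rational_near[OF c, of "min \<delta> (inverse (real (Suc k)))"] assms(1) by auto
  then show "ereal a \<le> (SUP u\<in>\<rat> \<inter> {0..1}. if u \<noteq> c \<and> \<bar>u - c\<bar> < inverse (real (Suc k))
      then ereal ((f u - f c) / (u - c)) else - \<infinity>)"
    by (intro SUP_upper2[of u]) (use assms(2)[of u] in auto)
qed

text \<open>Continuity carries the bound from rational to arbitrary \<open>u\<close>: a quotient
  exceeding \<open>a\<close> at \<open>u\<close> would exceed it at all nearby points, in particular
  at a rational one inside the window.\<close>

lemma dini_less:
  assumes "dini f c < ereal a" and cont: "continuous_on {0..1} f"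
  obtains \<delta> where "\<delta> > 0" "\<And>u. u \<in> {0..1} \<Longrightarrow> u \<noteq> c \<Longrightarrow> \<bar>u - c\<bar> < \<delta> \<Longrightarrow> (f u - f c) / (u - c) \<le> a"
proof -
  obtain k where k: "(SUP u\<in>\<rat> \<inter> {0..1}. if u \<noteq> c \<and> \<bar>u - c\<bar> < inverse (real (Suc k))
      then ereal ((f u - f c) / (u - c)) else - \<infinity>) < ereal a"
    using assms(1) unfolding dini_def INF_less_iff by blast
  have rat: "(f u - f c) / (u - c) \<le> a"
    if "u \<in> \<rat>" "u \<in> {0..1}" "u \<noteq> c" "\<bar>u - c\<bar> < inverse (real (Suc k))" for u
  proof -
    have "ereal ((f u - f c) / (u - c)) \<le> (SUP u\<in>\<rat> \<inter> {0..1}. if u \<noteq> c \<and> \<bar>u - c\<bar> < inverse (real (Suc k))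
      then ereal ((f u - f c) / (u - c)) else - \<infinity>)"
      by (rule SUP_upper2[of u]) (use that in auto)
    then have "ereal ((f u - f c) / (u - c)) < ereal a" using k by (rule order_le_less_trans)
    then show ?thesis by simp
  qed
  show thesis
  proof (rule that[of "inverse (real (Suc k))"])
    fix u assume u: "u \<in> {0..1}" "u \<noteq> c" "\<bar>u - c\<bar> < inverse (real (Suc k))"
    show "(f u - f c) / (u - c) \<le> a"
    proof (rule ccontr)
      assume "\<not> (f u - f c) / (u - c) \<le> a"
      then have gt: "a < (f u - f c) / (u - c)" by simp
      have "continuous_on ({0..1} - {c}) (\<lambda>v. (f v - f c) / (v - c))"
        by (intro continuous_intros continuous_on_subset[OF cont]) auto
      then have "((\<lambda>v. (f v - f c) / (v - c)) \<longlongrightarrow> (f u - f c) / (u - c)) (at u within {0..1} - {c})"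
        using u by (simp add: continuous_on_def)
      then have "eventually (\<lambda>v. a < (f v - f c) / (v - c)) (at u within {0..1} - {c})"
        using gt by (rule order_tendstoD)
      then obtain d where d: "d > 0" "\<And>v. v \<in> {0..1} \<Longrightarrow> v \<noteq> c \<Longrightarrow> v \<noteq> u \<Longrightarrow> \<bar>v - u\<bar> < d \<Longrightarrow> a < (f v - f c) / (v - c)"
        by (auto simp: eventually_at dist_real_def)
      \<comment> \<open>The three radii preserve the strict inequality, keep \<open>v\<close> away
        from \<open>c\<close>, and keep \<open>v\<close> within
        \<open>inverse (real (Suc k))\<close> of \<open>c\<close>.\<close>
      obtain v where v: "v \<in> \<rat>" "v \<in> {0..1}" "v \<noteq> u" "\<bar>v - u\<bar> < min d (min \<bar>u - c\<bar> (inverse (real (Suc k)) - \<bar>u - c\<bar>))"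
        using rational_near[OF u(1), of "min d (min \<bar>u - c\<bar> (inverse (real (Suc k)) - \<bar>u - c\<bar>))"] u d(1) by auto
      then have "v \<noteq> c" "\<bar>v - c\<bar> < inverse (real (Suc k))" by auto
      then show False using d(2)[of v] v rat[of v] by auto
    qed
  qed simp
qed

lemma ereal_eqI:
  assumes "\<And>e::real. e > 0 \<Longrightarrow> x \<le> ereal (l + e)" "\<And>e::real. e > 0 \<Longrightarrow> ereal (l - e) \<le> x"
  shows "x = ereal l"
proof (cases x)
  case (real r)
  have "r \<le> l + e" "l \<le> r + e" if "e > 0" for e
    using assms(1)[OF that] assms(2)[OF that] by (simp_all add: real diff_le_eq)
  then have "r \<le> l" "l \<le> r" by (blast intro: field_le_epsilon)+
  then show ?thesis using real by simp
qed (use assms(1)[of 1] assms(2)[of 1] in auto)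

lemma has_vector_derivative_iff_quotient:
  fixes f :: "real \<Rightarrow> real"
  shows "(f has_vector_derivative l) (at c within {0..1}) \<longleftrightarrow>
    (\<forall>e>0. \<exists>\<delta>>0. \<forall>u\<in>{0..1}. u \<noteq> c \<longrightarrow> \<bar>u - c\<bar> < \<delta> \<longrightarrow> \<bar>(f u - f c) / (u - c) - l\<bar> < e)"
  unfolding has_real_derivative_iff_has_vector_derivative[symmetric] has_field_derivative_iff
    Lim_within dist_real_def by (simp add: imp_conjL)

text \<open>The Dini derivative of \<open>- f\<close> is minus the lower Dini derivative of
  \<open>f\<close>, so the two equations say that the upper and the lower derivative both equal
  \<open>l\<close>.\<close>

lemma has_vector_derivative_iff_dini:
  fixes f :: "real \<Rightarrow> real"
  assumes c: "c \<in> {0..1}" and cont: "continuous_on {0..1} f"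
  shows "(f has_vector_derivative l) (at c within {0..1}) \<longleftrightarrow>
    dini f c = ereal l \<and> dini (\<lambda>u. - f u) c = ereal (- l)" (is "?L \<longleftrightarrow> ?R")
proof -
  have L_iff: "?L \<longleftrightarrow> (\<forall>e>0. \<exists>\<delta>>0. \<forall>u\<in>{0..1}. u \<noteq> c \<longrightarrow> \<bar>u - c\<bar> < \<delta> \<longrightarrow> \<bar>(f u - f c) / (u - c) - l\<bar> < e)"
    by (rule has_vector_derivative_iff_quotient)
  have quot: "(- f u - - f c) / (u - c) = - ((f u - f c) / (u - c))" for u
    by (simp add: minus_divide_left)
  show ?thesis
  proof
    assume ?L
    then have *: "\<exists>\<delta>>0. \<forall>u\<in>{0..1}. u \<noteq> c \<longrightarrow> \<bar>u - c\<bar> < \<delta> \<longrightarrow> \<bar>(f u - f c) / (u - c) - l\<bar> < e" if "e > 0" for e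
      using L_iff that by blast
    have "dini f c \<le> ereal (l + e) \<and> ereal (l - e) \<le> dini f c \<and>
        dini (\<lambda>u. - f u) c \<le> ereal (- l + e) \<and> ereal (- l - e) \<le> dini (\<lambda>u. - f u) c" if e: "e > 0" for e
    proof -
      obtain \<delta> where d: "\<delta> > 0" and
        D: "\<And>u. u \<in> {0..1} \<Longrightarrow> u \<noteq> c \<Longrightarrow> \<bar>u - c\<bar> < \<delta> \<Longrightarrow> \<bar>(f u - f c) / (u - c) - l\<bar> < e"
        using *[OF e] by blast
      have b: "(f u - f c) / (u - c) \<le> l + e" "l - e \<le> (f u - f c) / (u - c)"
          "(- f u - - f c) / (u - c) \<le> - l + e" "- l - e \<le> (- f u - - f c) / (u - c)"
        if "u \<in> {0..1}" "u \<noteq> c" "\<bar>u - c\<bar> < \<delta>" for u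
        unfolding quot using D[OF that] by linarith+
      show ?thesis
        using dini_le[OF d, of c f "l + e"] dini_ge[OF d, of c "l - e" f, OF _ c]
          dini_le[OF d, of c "\<lambda>u. - f u" "- l + e"] dini_ge[OF d, of c "- l - e" "\<lambda>u. - f u", OF _ c] b
        by blast
    qed
    then show ?R by (intro conjI ereal_eqI) auto
  next
    assume R: ?R
    show ?L unfolding L_iff
    proof (intro allI impI)
      fix e :: real assume e: "e > 0"
      have lt1: "dini f c < ereal (l + e/2)" and lt2: "dini (\<lambda>u. - f u) c < ereal (- l + e/2)"
        using R e by simp_all
      obtain d1 where d1: "d1 > 0" "\<And>u. u \<in> {0..1} \<Longrightarrow> u \<noteq> c \<Longrightarrow> \<bar>u - c\<bar> < d1 \<Longrightarrow> (f u - f c) / (u - c) \<le> l + e/2"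
        using dini_less[OF lt1 cont] by blast
      obtain d2 where d2: "d2 > 0" "\<And>u. u \<in> {0..1} \<Longrightarrow> u \<noteq> c \<Longrightarrow> \<bar>u - c\<bar> < d2 \<Longrightarrow> (- f u - - f c) / (u - c) \<le> - l + e/2"
        using dini_less[OF lt2 continuous_on_minus[OF cont]] by blast
      show "\<exists>\<delta>>0. \<forall>u\<in>{0..1}. u \<noteq> c \<longrightarrow> \<bar>u - c\<bar> < \<delta> \<longrightarrow> \<bar>(f u - f c) / (u - c) - l\<bar> < e"
      proof (intro exI[of _ "min d1 d2"] conjI ballI impI)
        fix u :: real assume u: "u \<in> {0..1}" "u \<noteq> c" "\<bar>u - c\<bar> < min d1 d2"
        show "\<bar>(f u - f c) / (u - c) - l\<bar> < e"
          using d1(2)[of u] d2(2)[of u] u e unfolding quot min_less_iff_conj by (simp only: abs_less_iff simp_thms True_implies_equals not_False_eq_True) linarith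
      qed (use d1 d2 in auto)
    qed
  qed
qed

text \<open>Where no derivative exists, the predicate under the choice operator is constantly false,
  so the value is one fixed number, the same for all functions and points. The derivative thus
  becomes an explicit expression in Dini derivatives at every point, with no null set to
  discard.\<close>

lemma vector_derivative_eq_dini:
  fixes f :: "real \<Rightarrow> real"
  assumes c: "c \<in> {0..1}" and cont: "continuous_on {0..1} f"
  shows "vector_derivative f (at c within {0..1}) =
    (if dini f c = - dini (\<lambda>u. - f u) c \<and> \<bar>dini f c\<bar> \<noteq> \<infinity> then real_of_ereal (dini f c) else (SOME l. False))"
proof (cases "\<exists>l. (f has_vector_derivative l) (at c within {0..1})")
  case True
  then obtain l where l: "(f has_vector_derivative l) (at c within {0..1})" by blast
  then have "vector_derivative f (at c within {0..1}) = l"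
    using c by (intro vector_derivative_within_closed_interval) auto
  then show ?thesis using l has_vector_derivative_iff_dini[OF assms] by simp
next
  case False
  then have "vector_derivative f (at c within {0..1}) = (SOME l. False)"
    by (simp add: vector_derivative_def)
  moreover have "\<not> (dini f c = - dini (\<lambda>u. - f u) c \<and> \<bar>dini f c\<bar> \<noteq> \<infinity>)"
  proof
    assume a: "dini f c = - dini (\<lambda>u. - f u) c \<and> \<bar>dini f c\<bar> \<noteq> \<infinity>"
    from conjunct2[OF a] obtain l where "dini f c = ereal l" by (cases "dini f c") auto
    moreover from this have "dini (\<lambda>u. - f u) c = ereal (- l)" using a
      by (metis ereal_uminus_uminus uminus_ereal.simps(1))
    ultimately show False using has_vector_derivative_iff_dini[OF assms] False by blast
  qed
  ultimately show ?thesis by (simp only: if_False)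
qed

lemma borel_measurable_dini:
  assumes [measurable]: "\<And>u. u \<in> {0..1} \<Longrightarrow> (\<lambda>z. F z u) \<in> borel_measurable M"
    "(\<lambda>z. F z (c z)) \<in> borel_measurable M" "c \<in> borel_measurable M"
  shows "(\<lambda>z. dini (F z) (c z)) \<in> borel_measurable M"
  unfolding dini_def
proof (intro borel_measurable_INF borel_measurable_SUP countable_Int1 countable_rat)
  fix k :: nat and u :: real assume "u \<in> \<rat> \<inter> {0..1}"
  then have [measurable]: "(\<lambda>z. F z u) \<in> borel_measurable M" using assms(1) by auto
  show "(\<lambda>z. if u \<noteq> c z \<and> \<bar>u - c z\<bar> < inverse (real (Suc k))
      then ereal ((F z u - F z (c z)) / (u - c z)) else - \<infinity>) \<in> borel_measurable M"
    by measurable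
qed simp

lemma borel_measurable_vector_derivative:
  fixes F :: "'a \<Rightarrow> real \<Rightarrow> real"
  assumes "\<And>u. u \<in> {0..1} \<Longrightarrow> (\<lambda>z. F z u) \<in> borel_measurable M"
    "(\<lambda>z. F z (c z)) \<in> borel_measurable M" "c \<in> borel_measurable M"
    "\<And>z. z \<in> space M \<Longrightarrow> c z \<in> {0..1}" "\<And>z. z \<in> space M \<Longrightarrow> continuous_on {0..1} (F z)"
  shows "(\<lambda>z. vector_derivative (F z) (at (c z) within {0..1})) \<in> borel_measurable M"
proof -
  have [measurable]: "(\<lambda>z. dini (F z) (c z)) \<in> borel_measurable M" "(\<lambda>z. dini (\<lambda>u. - F z u) (c z)) \<in> borel_measurable M"
    using assms(1-3) by (auto intro!: borel_measurable_dini)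
  have "(\<lambda>z. if dini (F z) (c z) = - dini (\<lambda>u. - F z u) (c z) \<and> \<bar>dini (F z) (c z)\<bar> \<noteq> \<infinity>
      then real_of_ereal (dini (F z) (c z)) else (SOME l. False)) \<in> borel_measurable M"
    by measurable
  then show ?thesis
    by (rule measurable_cong[THEN iffD1, rotated]) (use assms(4,5) in \<open>simp add: vector_derivative_eq_dini\<close>)
qed

lemma sets_has_vector_derivative:
  fixes F :: "'a \<Rightarrow> real \<Rightarrow> real"
  assumes "\<And>u. u \<in> {0..1} \<Longrightarrow> (\<lambda>z. F z u) \<in> borel_measurable M"
    "(\<lambda>z. F z (c z)) \<in> borel_measurable M" "c \<in> borel_measurable M"
    "\<And>z. z \<in> space M \<Longrightarrow> c z \<in> {0..1}" "\<And>z. z \<in> space M \<Longrightarrow> continuous_on {0..1} (F z)"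
    and [measurable]: "G \<in> borel_measurable M"
  shows "{z \<in> space M. (F z has_vector_derivative G z) (at (c z) within {0..1})} \<in> sets M"
proof -
  have [measurable]: "(\<lambda>z. dini (F z) (c z)) \<in> borel_measurable M" "(\<lambda>z. dini (\<lambda>u. - F z u) (c z)) \<in> borel_measurable M"
    using assms(1-3) by (auto intro!: borel_measurable_dini)
  have "{z \<in> space M. (F z has_vector_derivative G z) (at (c z) within {0..1})} =
    {z \<in> space M. dini (F z) (c z) = ereal (G z) \<and> dini (\<lambda>u. - F z u) (c z) = ereal (- G z)}"
    using assms(4,5) by (auto simp: has_vector_derivative_iff_dini)
  also have "\<dots> \<in> sets M" by measurable
  finally show ?thesis .
qed

section \<open>Changes of variables preserving the uniform distribution\<close>

lemma measure_I01_eqI: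
  assumes N: "prob_space N" "sets N = sets I01"
    and eq: "\<And>y. y \<in> {0..1} \<Longrightarrow> emeasure N {0..y} = ennreal y"
  shows "N = I01"
proof -
  interpret N: prob_space N by fact
  interpret I: prob_space I01 by (rule prob_space_I01)
  have spN: "space N = {0..1}" using sets_eq_imp_space_eq[OF N(2)] by simp
  \<comment> \<open>Both measures are moved to the whole line, where the distribution function
    determines a measure.\<close>
  have idN: "(\<lambda>u. u) \<in> measurable N borel" "(\<lambda>u. u) \<in> measurable I01 borel"
    using measurable_I01[OF measurable_ident, unfolded id_def] by (simp_all add: measurable_cong_sets[OF N(2) refl])
  have rd: "real_distribution (distr N borel (\<lambda>u. u))" "real_distribution (distr I01 borel (\<lambda>u. u))"
    using idN N.prob_space_distr I.prob_space_distr
    by (auto simp: real_distribution_def real_distribution_axioms_def)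
  have eqI: "emeasure I01 {0..y} = ennreal y" if "y \<in> {0..1}" for y
    using that by (subst emeasure_restrict_space) auto
  have "cdf (distr N borel (\<lambda>u. u)) = cdf (distr I01 borel (\<lambda>u. u))"
  proof
    fix y :: real
    have em: "emeasure N ({..y} \<inter> {0..1}) = emeasure I01 ({..y} \<inter> {0..1})"
    proof (cases "y < 0")
      case True
      then have "{..y} \<inter> {0..1} = ({} :: real set)" by auto
      then show ?thesis by simp
    next
      case False
      then have "{..y} \<inter> {0..1} = {0..min y 1}" by auto
      then show ?thesis using eq[of "min y 1"] eqI[of "min y 1"] False by simp
    qed
    show "cdf (distr N borel (\<lambda>u. u)) y = cdf (distr I01 borel (\<lambda>u. u)) y"
      using em by (simp add: cdf_def measure_def emeasure_distr idN spN)
  qed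
  then have *: "distr N borel (\<lambda>u. u) = distr I01 borel (\<lambda>u. u)"
    by (rule cdf_unique[OF rd])
  show ?thesis
  proof (rule measure_eqI[OF N(2)])
    fix A assume A: "A \<in> sets N"
    then have A': "A \<in> sets borel" "A \<subseteq> {0..1}" using N(2) by (auto simp: sets_I01)
    then have "emeasure (distr N borel (\<lambda>u. u)) A = emeasure N A" "emeasure (distr I01 borel (\<lambda>u. u)) A = emeasure I01 A"
      using idN spN by (auto simp: emeasure_distr Int_absorb2)
    then show "emeasure N A = emeasure I01 A" using * by simp
  qed
qed

text \<open>The preimage of \<open>{0..y}\<close> is an interval \<open>{0..c}\<close> with
  \<open>\<psi> c = y\<close>, and its weighted mass is \<open>\<psi> c\<close>. Flat pieces of
  \<open>\<psi>\<close> are allowed, as they occur for \<open>half0\<close> and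
  \<open>half1\<close>; they carry no weight.\<close>

lemma distr_density_I01:
  fixes \<psi> w :: "real \<Rightarrow> real"
  assumes \<psi>: "continuous_on {0..1} \<psi>" "mono_on {0..1} \<psi>" "\<psi> 0 = 0" "\<psi> 1 = 1"
    and w[measurable]: "w \<in> borel_measurable borel"
    and int: "\<And>c. c \<in> {0..1} \<Longrightarrow> (\<integral>\<^sup>+u. ennreal (w u) * indicator {0..c} u \<partial>lborel) = ennreal (\<psi> c)"
  shows "distr (density I01 (\<lambda>u. ennreal (w u))) I01 \<psi> = I01"
proof -
  have bnd: "\<psi> u \<in> {0..1}" if "u \<in> {0..1}" for u
    using that \<psi> mono_onD[OF \<psi>(2), of 0 u] mono_onD[OF \<psi>(2), of u 1] by auto
  have "\<psi> \<in> borel_measurable I01"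
    using borel_measurable_continuous_on_restrict[OF \<psi>(1)]
    by (simp add: measurable_cong_sets[OF sets_restrict_space_cong[OF sets_lborel] refl])
  then have meas: "\<psi> \<in> measurable I01 I01"
    using bnd by (intro measurable_restrict_space2) (auto simp: measurable_lborel1)
  then have meas': "\<psi> \<in> measurable (density I01 (\<lambda>u. ennreal (w u))) I01"
    by simp
  have w': "(\<lambda>u. ennreal (w u)) \<in> borel_measurable I01" by (rule measurable_I01) measurable
  have dens: "emeasure (density I01 (\<lambda>u. ennreal (w u))) {0..c} = ennreal (\<psi> c)" if c: "c \<in> {0..1}" for c
  proof -
    have "emeasure (density I01 (\<lambda>u. ennreal (w u))) {0..c} = (\<integral>\<^sup>+u. ennreal (w u) * indicator {0..c} u \<partial>I01)"
      using c by (intro emeasure_density w') (auto simp: sets_I01)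
    also have "\<dots> = (\<integral>\<^sup>+u. ennreal (w u) * indicator {0..c} u \<partial>lborel)"
      using c by (subst nn_integral_restrict_space) (auto intro!: nn_integral_cong split: split_indicator)
    finally show ?thesis using int[OF c] by simp
  qed
  show ?thesis
  proof (rule measure_I01_eqI)
    have "prob_space (density I01 (\<lambda>u. ennreal (w u)))"
      using dens[of 1] \<psi> by (intro prob_spaceI) simp
    then show "prob_space (distr (density I01 (\<lambda>u. ennreal (w u))) I01 \<psi>)"
      using meas' by (rule prob_space.prob_space_distr)
    fix y :: real assume y: "y \<in> {0..1}"
    define S where "S = {u \<in> {0..1}. \<psi> u \<le> y}"
    have S: "S = {0..1} \<inter> \<psi> -` {..y}" by (auto simp: S_def)
    have "closed S" unfolding S by (rule continuous_closed_preimage) (use \<psi> in auto)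
    then have "compact S"
      using compact_Int_closed[of "{0..1::real}" S] by (simp add: S_def Int_def conj_ac)
    moreover have "0 \<in> S" using \<psi> y by (auto simp: S_def)
    ultimately obtain c where c: "c \<in> S" "\<And>u. u \<in> S \<Longrightarrow> u \<le> c"
      using compact_attains_sup[of S] by blast
    obtain v where v: "v \<in> {0..1}" "\<psi> v = y"
      using IVT'[of \<psi> 0 y 1] \<psi> y by auto
    have c01: "c \<in> {0..1}" using c(1) by (simp add: S_def)
    have "v \<le> c" using v c(2)[of v] by (simp add: S_def)
    then have "y \<le> \<psi> c" using mono_onD[OF \<psi>(2), of v c] v c01 by simp
    then have cy: "\<psi> c = y" using c(1) by (simp add: S_def)
    have "S = {0..c}"
      using c c01 mono_onD[OF \<psi>(2)] cy by (force simp: S_def)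
    moreover have "\<psi> -` {0..y} \<inter> {0..1} = S"
    proof (rule Set.set_eqI)
      show "u \<in> \<psi> -` {0..y} \<inter> {0..1} \<longleftrightarrow> u \<in> S" for u
        using bnd[of u] by (auto simp: S_def)
    qed
    ultimately have "\<psi> -` {0..y} \<inter> {0..1} = {0..c}" by simp
    then show "emeasure (distr (density I01 (\<lambda>u. ennreal (w u))) I01 \<psi>) {0..y} = ennreal y"
      using y dens[OF c01] cy by (subst emeasure_distr[OF meas']) (auto simp: sets_I01)
  qed simp
qed

lemma distr_reflect_I01: "distr I01 I01 (\<lambda>u. 1 - u) = I01"
proof (rule measure_I01_eqI)
  have meas: "(\<lambda>u. 1 - u) \<in> measurable I01 I01"
    by (intro measurable_restrict_space2) (auto intro!: measurable_I01 simp: measurable_lborel1)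
  then show "prob_space (distr I01 I01 (\<lambda>u. 1 - u))"
    by (rule prob_space.prob_space_distr[OF prob_space_I01])
  fix y :: real assume y: "y \<in> {0..1}"
  have "(\<lambda>u. 1 - u) -` {0..y} \<inter> {0..1} = {1 - y..1}" using y by auto
  then show "emeasure (distr I01 I01 (\<lambda>u. 1 - u)) {0..y} = ennreal y"
    using y by (subst emeasure_distr[OF meas]) (auto simp: sets_I01 emeasure_restrict_space)
qed simp

section \<open>Functions on the cube\<close>

interpretation cube: product_sigma_finite "\<lambda>_::nat. I01"
  by (simp add: product_sigma_finite_def prob_space_I01 prob_space_imp_sigma_finite)

lemma space_cube: "space (cube_measure I) = unit_cube I"
  by (simp add: cube_measure_def unit_cube_def space_PiM)

lemma prob_space_cube: "prob_space (cube_measure I)"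
  unfolding cube_measure_def by (rule prob_space_PiM) (rule prob_space_I01)

lemma measurable_cube_component [measurable (raw)]:
  assumes "i \<in> I" and f: "f \<in> measurable M (cube_measure I)"
  shows "(\<lambda>z. f z i) \<in> borel_measurable M"
proof -
  have "(\<lambda>z. f z i) \<in> measurable M I01"
    using measurable_compose[OF f[unfolded cube_measure_def] measurable_component_singleton[OF assms(1)]] .
  then show ?thesis
    by (rule measurable_compose) (rule measurable_I01[OF measurable_ident, unfolded id_def])
qed

lemma borel_measurable_component: "i \<in> I \<Longrightarrow> (\<lambda>s. s i) \<in> borel_measurable (cube_measure I)"
  by (rule measurable_cube_component[OF _ measurable_ident_sets[OF refl]])

lemma measurable_cubeI:
  assumes "\<And>i. i \<in> I \<Longrightarrow> (\<lambda>z. f z i) \<in> borel_measurable M"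
    and "\<And>z. z \<in> space M \<Longrightarrow> f z \<in> unit_cube I"
  shows "f \<in> measurable M (cube_measure I)"
  unfolding cube_measure_def
proof (rule measurable_PiM_single')
  show "(\<lambda>z. f z i) \<in> measurable M I01" if "i \<in> I" for i
    using assms that by (intro measurable_restrict_space2) (auto simp: unit_cube_def PiE_iff measurable_lborel1)
qed (use assms(2) in \<open>auto simp: unit_cube_def\<close>)

lemma unit_cubeD: "s \<in> unit_cube I \<Longrightarrow> i \<in> I \<Longrightarrow> s i \<in> {0..1}"
  by (auto simp: unit_cube_def)

lemma unit_cube_upd: "s \<in> unit_cube I \<Longrightarrow> j \<in> I \<Longrightarrow> u \<in> {0..1} \<Longrightarrow> s(j := u) \<in> unit_cube I"
  by (auto simp: unit_cube_def PiE_iff extensional_def)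

lemma measurable_cube_upd:
  assumes "j \<in> I" "u \<in> {0..1}"
  shows "(\<lambda>s. s(j := u)) \<in> measurable (cube_measure I) (cube_measure I)"
proof (rule measurable_cubeI)
  fix i assume [measurable]: "i \<in> I"
  show "(\<lambda>s. (s(j := u)) i) \<in> borel_measurable (cube_measure I)"
    by (cases "i = j") simp_all
qed (use assms in \<open>auto simp: space_cube intro: unit_cube_upd\<close>)

text \<open>Fubini for null sets. The set has to be measurable beforehand, which for derivatives is
  supplied by \<open>sets_has_partial\<close>.\<close>

lemma AE_PiM_slice:
  assumes M: "\<And>i. prob_space (M i)" and I: "finite I" "j \<in> I"
    and P: "{x \<in> space (PiM I M). P x} \<in> sets (PiM I M)"
    and slice: "\<And>x. x \<in> space (PiM (I - {j}) M) \<Longrightarrow> AE u in M j. P (x(j := u))"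
  shows "AE x in PiM I M. P x"
proof -
  interpret product_sigma_finite M
    using M by (simp add: product_sigma_finite_def prob_space_imp_sigma_finite)
  define N where "N = {x \<in> space (PiM I M). \<not> P x}"
  have N: "N \<in> sets (PiM I M)"
  proof -
    have "N = space (PiM I M) - {x \<in> space (PiM I M). P x}" by (auto simp: N_def)
    then show ?thesis using P by auto
  qed
  have ins: "insert j (I - {j}) = I" using I by auto
  have "emeasure (PiM I M) N = (\<integral>\<^sup>+x. indicator N x \<partial>PiM (insert j (I - {j})) M)"
    using N by (simp only: ins nn_integral_indicator)
  also have "\<dots> = (\<integral>\<^sup>+x. (\<integral>\<^sup>+u. indicator N (x(j := u)) \<partial>M j) \<partial>PiM (I - {j}) M)"
    using I N by (intro product_nn_integral_insert) (simp_all only: ins, auto)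
  also have "\<dots> = (\<integral>\<^sup>+x. 0 \<partial>PiM (I - {j}) M)"
  proof (rule nn_integral_cong)
    fix x assume "x \<in> space (PiM (I - {j}) M)"
    from slice[OF this] have "AE u in M j. indicator N (x(j := u)) = (0::ennreal)"
      by (rule eventually_mono) (auto simp: N_def)
    then show "(\<integral>\<^sup>+u. indicator N (x(j := u)) \<partial>M j) = 0"
      by (subst nn_integral_cong_AE[where v="\<lambda>_. 0"]) auto
  qed
  finally have "emeasure (PiM I M) N = 0" by simp
  then have "N \<in> null_sets (PiM I M)" using N by auto
  then show ?thesis by (rule AE_I') (auto simp: N_def)
qed

lemma AE_cube_slice:
  assumes I: "finite I" "j \<in> I" and P: "{s \<in> space (cube_measure I). P s} \<in> sets (cube_measure I)"
    and slice: "\<And>s. s \<in> unit_cube I \<Longrightarrow> AE u in I01. P (s(j := u))"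
  shows "AE s in cube_measure I. P s"
  unfolding cube_measure_def
proof (rule AE_PiM_slice[OF prob_space_I01 I])
  show "{s \<in> space (PiM I (\<lambda>_. I01)). P s} \<in> sets (PiM I (\<lambda>_. I01))"
    using P by (simp only: cube_measure_def)
  fix s assume "s \<in> space (PiM (I - {j}) (\<lambda>_. I01))"
  \<comment> \<open>\<open>s\<close> has no coordinate \<open>j\<close> yet. Any value may be filled
    in, since \<open>s(j := u)\<close> overwrites it.\<close>
  then have "s(j := 0) \<in> unit_cube I"
    using I by (auto simp: space_PiM unit_cube_def PiE_iff extensional_def)
  from slice[OF this] show "AE u in I01. P (s(j := u))" by simp
qed

lemma AE_cube_ne:
  assumes "finite I" "j \<in> I"
  shows "AE s in cube_measure I. s j \<noteq> c"
  by (rule AE_cube_slice[OF assms])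
    (use assms in \<open>measurable, auto simp: AE_I01_ne\<close>)

section \<open>Lipschitz functions on the cube\<close>

lemma Lip_realD:
  assumes "f \<in> Lip d"
  obtains L where "L \<ge> 0" "\<And>s t. s \<in> unit_cube {..<d} \<Longrightarrow> t \<in> unit_cube {..<d} \<Longrightarrow>
    dist (f s) (f t) \<le> L * L2_set (\<lambda>j. s j - t j) {..<d}"
proof -
  obtain L where L: "\<forall>s\<in>unit_cube {..<d}. \<forall>t\<in>unit_cube {..<d}. dist (f s) (f t) \<le> L * L2_set (\<lambda>j. s j - t j) {..<d}"
    using assms by (auto simp: Lip_def)
  show thesis
  proof (rule that[of "max L 0"])
    fix s t assume "s \<in> unit_cube {..<d}" "t \<in> unit_cube {..<d}"
    then have "dist (f s) (f t) \<le> L * L2_set (\<lambda>j. s j - t j) {..<d}" using L by blast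
    also have "\<dots> \<le> max L 0 * L2_set (\<lambda>j. s j - t j) {..<d}"
      by (rule mult_right_mono) (auto simp: L2_set_nonneg)
    finally show "dist (f s) (f t) \<le> max L 0 * L2_set (\<lambda>j. s j - t j) {..<d}" .
  qed simp
qed

lemma Lip_inner:
  fixes x :: "point \<Rightarrow> 'v::real_inner"
  assumes "x \<in> Lip d"
  shows "(\<lambda>s. inner (x s) v) \<in> Lip d"
proof -
  obtain L where L: "L \<ge> 0" "\<And>s t. s \<in> unit_cube {..<d} \<Longrightarrow> t \<in> unit_cube {..<d} \<Longrightarrow>
      dist (x s) (x t) \<le> L * L2_set (\<lambda>j. s j - t j) {..<d}"
    using Lip_realD[OF assms] by blast
  have "dist (inner (x s) v) (inner (x t) v) \<le> (L * norm v) * L2_set (\<lambda>j. s j - t j) {..<d}"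
    if "s \<in> unit_cube {..<d}" "t \<in> unit_cube {..<d}" for s t
  proof -
    have "dist (inner (x s) v) (inner (x t) v) = \<bar>inner (x s - x t) v\<bar>"
      by (simp add: dist_real_def inner_diff_left)
    also have "\<dots> \<le> norm (x s - x t) * norm v" by (rule Cauchy_Schwarz_ineq2)
    also have "\<dots> \<le> (L * L2_set (\<lambda>j. s j - t j) {..<d}) * norm v"
      using L(2)[OF that] by (intro mult_right_mono) (auto simp: dist_norm)
    finally show ?thesis by (simp add: mult_ac)
  qed
  then show ?thesis unfolding Lip_def by blast
qed

lemma Lip_section:
  fixes f :: "point \<Rightarrow> real"
  assumes "f \<in> Lip d"
  obtains L where "L \<ge> 0" "\<And>s j. s \<in> unit_cube {..<d} \<Longrightarrow> j < d \<Longrightarrow> L-lipschitz_on {0..1} (\<lambda>u. f (s(j := u)))"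
proof -
  obtain L where L: "L \<ge> 0" "\<And>s t. s \<in> unit_cube {..<d} \<Longrightarrow> t \<in> unit_cube {..<d} \<Longrightarrow>
      dist (f s) (f t) \<le> L * L2_set (\<lambda>j. s j - t j) {..<d}"
    using Lip_realD[OF assms] by blast
  have "L-lipschitz_on {0..1} (\<lambda>u. f (s(j := u)))" if s: "s \<in> unit_cube {..<d}" "j < d" for s j
  proof (rule lipschitz_onI)
    fix u v :: real assume uv: "u \<in> {0..1}" "v \<in> {0..1}"
    have "L2_set (\<lambda>i. (s(j := u)) i - (s(j := v)) i) {..<d} = L2_set (\<lambda>i. if i = j then u - v else 0) {..<d}"
      by (rule L2_set_cong) auto
    also have "\<dots> = dist u v"
      using s(2) by (simp add: L2_set_def dist_real_def if_distrib[of "\<lambda>x. x\<^sup>2"] cong: if_cong)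
    finally show "dist (f (s(j := u))) (f (s(j := v))) \<le> L * dist u v"
      using L(2)[of "s(j := u)" "s(j := v)"] s uv by (simp add: unit_cube_upd)
  qed (rule L(1))
  then show thesis using that[OF L(1)] by blast
qed

text \<open>McShane's formula exhibits a Lipschitz function as a countable infimum of measurable ones.\<close>

lemma borel_measurable_Lip:
  fixes f :: "point \<Rightarrow> real"
  assumes f: "f \<in> Lip d"
  shows "f \<in> borel_measurable (cube_measure {..<d})"
proof -
  obtain L where L: "L \<ge> 0" "\<And>s t. s \<in> unit_cube {..<d} \<Longrightarrow> t \<in> unit_cube {..<d} \<Longrightarrow>
      dist (f s) (f t) \<le> L * L2_set (\<lambda>j. s j - t j) {..<d}"
    using Lip_realD[OF f] by blast
  define Q where "Q = PiE {..<d} (\<lambda>_. \<rat> \<inter> {0..1::real})"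
  have Qc: "countable Q" unfolding Q_def by (intro countable_PiE countable_Int1 countable_rat) auto
  have Qsub: "q \<in> unit_cube {..<d}" if "q \<in> Q" for q
    using that by (auto simp: Q_def unit_cube_def PiE_iff)
  define h where "h q s = f q + L * L2_set (\<lambda>j. s j - q j) {..<d}" for q s :: point
  have h_ge: "f s \<le> h q s" if "s \<in> unit_cube {..<d}" "q \<in> Q" for s q
    using L(2)[OF that(1) Qsub[OF that(2)]] by (simp add: h_def dist_real_def)
  have h_eq: "(INF q\<in>Q. h q s) = f s" if s: "s \<in> unit_cube {..<d}" for s
  proof (rule cInf_eq_non_empty)
    show "h ` Q \<noteq> {}" for h :: "point \<Rightarrow> real"
      by (auto simp: Q_def PiE_eq_empty_iff intro!: bexI[of _ 0])
    show "f s \<le> y" if "y \<in> (\<lambda>q. h q s) ` Q" for y using that h_ge[OF s] by auto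
    fix y assume y: "\<And>z. z \<in> (\<lambda>q. h q s) ` Q \<Longrightarrow> y \<le> z"
    show "y \<le> f s"
    proof (rule field_le_epsilon)
      fix e :: real assume e: "e > 0"
      \<comment> \<open>Chosen so that \<open>2 * L * d * \<delta> \<le> e\<close>: the distance to
        the rational point \<open>q\<close> costs once in \<open>f q\<close> and once in the cone
        term of \<open>h\<close>. The summand 1 keeps the denominator positive.\<close>
      define \<delta> where "\<delta> = e / (2 * L * d + 1)"
      have \<delta>: "\<delta> > 0" using e L(1) by (auto simp: \<delta>_def intro!: divide_pos_pos add_nonneg_pos)
      have "\<exists>r. r \<in> \<rat> \<inter> {0..1} \<and> \<bar>s j - r\<bar> \<le> \<delta>" if "j \<in> {..<d}" for j
        using rational_near[OF unit_cubeD[OF s that] \<delta>] by (metis IntI abs_minus_commute less_imp_le)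
      then obtain r where r: "\<And>j. j \<in> {..<d} \<Longrightarrow> r j \<in> \<rat> \<inter> {0..1} \<and> \<bar>s j - r j\<bar> \<le> \<delta>" by metis
      define q where "q = restrict r {..<d}"
      have q: "q \<in> Q" using r by (auto simp: q_def Q_def)
      have "L2_set (\<lambda>j. s j - q j) {..<d} \<le> (\<Sum>j<d. \<bar>s j - q j\<bar>)" by (rule L2_set_le_sum_abs)
      also have "\<dots> \<le> (\<Sum>j<d. \<delta>)" using r by (intro sum_mono) (auto simp: q_def)
      finally have l2: "L2_set (\<lambda>j. s j - q j) {..<d} \<le> d * \<delta>" by simp
      have fq: "f q \<le> f s + L * (d * \<delta>)" "h q s \<le> f q + L * (d * \<delta>)"
        using L(2)[OF s Qsub[OF q]] mult_left_mono[OF l2 L(1)] by (auto simp: dist_real_def h_def)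
      have "2 * (L * (d * \<delta>)) \<le> \<delta> * (2 * L * d + 1)" using \<delta> by (simp add: algebra_simps)
      also have "\<dots> = e" using L(1) by (simp add: \<delta>_def add_nonneg_pos[THEN less_imp_neq, symmetric])
      finally have "h q s \<le> f s + e" using fq by simp
      moreover have "y \<le> h q s" using y q by blast
      ultimately show "y \<le> f s + e" by simp
    qed
  qed
  have "(\<lambda>s. INF q\<in>Q. h q s) \<in> borel_measurable (cube_measure {..<d})"
  proof (rule borel_measurable_cINF_real[OF Qc])
    show "h q \<in> borel_measurable (cube_measure {..<d})" for q
      unfolding h_def L2_set_def
      by (intro borel_measurable_add borel_measurable_times borel_measurable_const measurable_compose[OF _ borel_measurable_sqrt]
          borel_measurable_sum borel_measurable_power borel_measurable_diff borel_measurable_component)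
  qed
  then show ?thesis
    by (rule measurable_cong[THEN iffD1, rotated]) (simp add: h_eq space_cube)
qed

text \<open>The regularity from which Borel measurability of partial derivatives is derived. It is
  weaker than being Lipschitz and is what gets verified for reparametrized, reflected and
  concatenated maps.\<close>

definition sections_continuous :: "nat set \<Rightarrow> (point \<Rightarrow> real) \<Rightarrow> bool" where
  "sections_continuous I f \<longleftrightarrow> f \<in> borel_measurable (cube_measure I) \<and>
     (\<forall>s\<in>unit_cube I. \<forall>j\<in>I. continuous_on {0..1} (\<lambda>u. f (s(j := u))))"

lemma sections_continuous_Lip: "f \<in> Lip d \<Longrightarrow> sections_continuous {..<d} f"
  unfolding sections_continuous_def
  by (metis Lip_section borel_measurable_Lip lessThan_iff lipschitz_on_continuous_on)

section \<open>Partial derivatives on the cube\<close>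

lemma partial_parameters:
  assumes "sections_continuous I f" "j \<in> I"
  shows "\<And>u. u \<in> {0..1} \<Longrightarrow> (\<lambda>s. f (s(j := u))) \<in> borel_measurable (cube_measure I)"
    and "(\<lambda>s. f (s(j := s j))) \<in> borel_measurable (cube_measure I)"
    and "(\<lambda>s. s j) \<in> borel_measurable (cube_measure I)"
    and "\<And>s. s \<in> space (cube_measure I) \<Longrightarrow> s j \<in> {0..1}"
    and "\<And>s. s \<in> space (cube_measure I) \<Longrightarrow> continuous_on {0..1} (\<lambda>u. f (s(j := u)))"
proof -
  have f: "f \<in> borel_measurable (cube_measure I)" using assms by (simp add: sections_continuous_def)
  show "(\<lambda>s. f (s(j := u))) \<in> borel_measurable (cube_measure I)" if "u \<in> {0..1}" for u
    by (rule measurable_compose[OF measurable_cube_upd[OF assms(2) that] f])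
  show "(\<lambda>s. s j) \<in> borel_measurable (cube_measure I)"
    using assms(2) by measurable
qed (use assms in \<open>auto simp: sections_continuous_def space_cube dest: unit_cubeD\<close>)

lemma borel_measurable_partial:
  assumes "sections_continuous I f" "j \<in> I"
  shows "partial j f \<in> borel_measurable (cube_measure I)"
  unfolding partial_def[abs_def]
  by (rule borel_measurable_vector_derivative) (use partial_parameters[OF assms] in auto)

abbreviation has_partial :: "nat \<Rightarrow> (point \<Rightarrow> real) \<Rightarrow> real \<Rightarrow> point \<Rightarrow> bool" where
  "has_partial j f l s \<equiv> ((\<lambda>u. f (s(j := u))) has_vector_derivative l) (at (s j) within {0..1})"

lemma partial_eqI: "s j \<in> {0..1} \<Longrightarrow> has_partial j f l s \<Longrightarrow> partial j f s = l"
  unfolding partial_def by (rule vector_derivative_within_closed_interval) auto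

lemma sets_has_partial:
  assumes "sections_continuous I f" "j \<in> I" "g \<in> borel_measurable (cube_measure I)"
  shows "{s \<in> space (cube_measure I). has_partial j f (g s) s} \<in> sets (cube_measure I)"
  by (rule sets_has_vector_derivative) (use partial_parameters[OF assms(1,2)] assms(3) in auto)

text \<open>Only derivatives along coordinate lines enter the minors, so the one-variable theorem on
  each line, combined with Fubini, is enough.\<close>

lemma AE_has_partial:
  fixes f :: "point \<Rightarrow> real"
  assumes f: "f \<in> Lip d" and j: "j < d"
  shows "AE s in cube_measure {..<d}. has_partial j f (partial j f s) s"
proof (rule AE_cube_slice[where j=j])
  note sc = sections_continuous_Lip[OF f]
  have j': "j \<in> {..<d}" using j by simp
  show "{s \<in> space (cube_measure {..<d}). has_partial j f (partial j f s) s} \<in> sets (cube_measure {..<d})"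
    by (rule sets_has_partial[OF sc j' borel_measurable_partial[OF sc j']])
  fix s assume s: "s \<in> unit_cube {..<d}"
  obtain L where L: "L-lipschitz_on {0..1} (\<lambda>u. f (s(j := u)))"
    using Lip_section[OF f] s j by metis
  obtain g where g: "AE u in I01. ((\<lambda>u. f (s(j := u))) has_vector_derivative g u) (at u within {0..1})"
    using lipschitz_ftc[OF L] by metis
  have "AE u in I01. u \<in> {0..1}" by (rule AE_I2) simp
  with g show "AE u in I01. has_partial j f (partial j f (s(j := u))) (s(j := u))"
  proof eventually_elim
    case (elim u)
    then show ?case using partial_eqI[of "s(j := u)" j f "g u"] by simp
  qed
qed (use j in auto)

lemma has_vector_derivative_lipschitz_bound:
  fixes f :: "real \<Rightarrow> real"
  assumes L: "L-lipschitz_on {0..1} f" and c: "c \<in> {0..1}"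
    and d: "(f has_vector_derivative l) (at c within {0..1})"
  shows "\<bar>l\<bar> \<le> L"
proof -
  have q: "(f u - f c) / (u - c) \<le> L \<and> (- f u - - f c) / (u - c) \<le> L" if "u \<in> {0..1}" "u \<noteq> c" for u
  proof -
    have "\<bar>(f u - f c) / (u - c)\<bar> \<le> L"
      using lipschitz_onD[OF L that(1) c] that(2) by (simp add: dist_real_def divide_le_eq)
    moreover have "(- f u - - f c) / (u - c) = - ((f u - f c) / (u - c))"
      by (simp add: minus_divide_left)
    ultimately show ?thesis by linarith
  qed
  have "dini f c \<le> ereal L" "dini (\<lambda>u. - f u) c \<le> ereal L"
    using dini_le[of 1 c f L] dini_le[of 1 c "\<lambda>u. - f u" L] q by auto
  then show ?thesis
    using d c lipschitz_on_continuous_on[OF L] by (auto simp: has_vector_derivative_iff_dini)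
qed

lemma partial_bounded:
  fixes f :: "point \<Rightarrow> real"
  assumes f: "f \<in> Lip d"
  obtains K where "\<And>s j. s \<in> unit_cube {..<d} \<Longrightarrow> j < d \<Longrightarrow> \<bar>partial j f s\<bar> \<le> K"
proof -
  obtain L where L: "L \<ge> 0" "\<And>s j. s \<in> unit_cube {..<d} \<Longrightarrow> j < d \<Longrightarrow> L-lipschitz_on {0..1} (\<lambda>u. f (s(j := u)))"
    using Lip_section[OF f] by blast
  show thesis
  \<comment> \<open>Including the default value of the derivative makes the bound hold at every
    point of the cube, not merely almost everywhere.\<close>
  proof (rule that[of "max L \<bar>SOME l. False\<bar>"])
    fix s j assume s: "s \<in> unit_cube {..<d}" "j < d"
    show "\<bar>partial j f s\<bar> \<le> max L \<bar>SOME l. False\<bar>"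
    proof (cases "\<exists>l. has_partial j f l s")
      case True
      then obtain l where l: "has_partial j f l s" by blast
      have sj: "s j \<in> {0..1}" using s by (auto dest: unit_cubeD)
      have "\<bar>l\<bar> \<le> L" by (rule has_vector_derivative_lipschitz_bound[OF L(2)[OF s] sj l])
      then show ?thesis using partial_eqI[OF sj l] by simp
    next
      case False
      then have "partial j f s = (SOME l. False)" by (simp add: partial_def vector_derivative_def)
      then show ?thesis by simp
    qed
  qed
qed

section \<open>Jacobian minors\<close>

lemma permutes_less: "p permutes {..<d} \<Longrightarrow> i < d \<Longrightarrow> p i < d"
  using permutes_in_image by fastforce

lemma jac_minor_permutations:
  "jac_minor d e x P s = (\<Sum>p\<in>{p. p permutes {..<d}}.
     of_int (sign p) * (\<Prod>i<d. partial (p i) (\<lambda>u. inner (x u) (e (P i))) s))"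
proof -
  have "jac_minor d e x P s = (\<Sum>p\<in>{p. p permutes {0..<d}}.
     of_int (sign p) * (\<Prod>i=0..<d. Matrix.mat d d (\<lambda>(i, j). partial j (\<lambda>u. inner (x u) (e (P i))) s) $$ (i, p i)))"
    unfolding jac_minor_def by (subst det_def') (auto intro!: sum.cong)
  also have "\<dots> = (\<Sum>p\<in>{p. p permutes {0..<d}}.
     of_int (sign p) * (\<Prod>i=0..<d. partial (p i) (\<lambda>u. inner (x u) (e (P i))) s))"
    by (intro sum.cong refl arg_cong2[where f="(*)"] prod.cong)
      (auto simp: permutes_in_image)
  finally show ?thesis by (simp add: atLeast0LessThan)
qed

text \<open>The chain rule for maps that act coordinatewise up to a permutation of the coordinates:
  columns of the Jacobian matrix are scaled by \<open>c\<close> and permuted by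
  \<open>\<iota>\<close>. Only values of partial derivatives are compared; differentiability is left
  to the callers.\<close>

lemma jac_minor_scale_permute:
  assumes \<iota>: "\<iota> permutes {..<d}"
    and part: "\<And>i j. i < d \<Longrightarrow> j < d \<Longrightarrow>
      partial j (\<lambda>u. inner (z u) (e (P i))) s = c j * partial (\<iota> j) (\<lambda>u. inner (x u) (e (P i))) s'"
  shows "jac_minor d e z P s = (\<Prod>j<d. c j) * (of_int (sign \<iota>) * jac_minor d e x P s')"
proof -
  let ?D = "\<lambda>j i. partial j (\<lambda>u. inner (x u) (e (P i))) s'" and ?\<kappa> = "inv_into UNIV \<iota>"
  have "jac_minor d e z P s = (\<Sum>p\<in>{p. p permutes {..<d}}. of_int (sign p) * (\<Prod>i<d. c (p i) * ?D (\<iota> (p i)) i))"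
    unfolding jac_minor_permutations
    by (intro sum.cong refl arg_cong2[where f="(*)"] prod.cong part) (auto simp: permutes_less)
  also have "\<dots> = (\<Sum>p\<in>{p. p permutes {..<d}}. (\<Prod>j<d. c j) * (of_int (sign p) * (\<Prod>i<d. ?D (\<iota> (p i)) i)))"
  proof (rule sum.cong[OF refl])
    fix p assume "p \<in> {p. p permutes {..<d}}"
    then have "(\<Prod>i<d. c (p i)) = (\<Prod>j<d. c j)"
      by (subst prod.permute[of p "{..<d}" c]) (simp_all add: comp_def)
    then show "of_int (sign p) * (\<Prod>i<d. c (p i) * ?D (\<iota> (p i)) i) = (\<Prod>j<d. c j) * (of_int (sign p) * (\<Prod>i<d. ?D (\<iota> (p i)) i))"
      by (simp add: prod.distrib)
  qed
  also have "\<dots> = (\<Prod>j<d. c j) * (\<Sum>p\<in>{p. p permutes {..<d}}. of_int (sign p) * (\<Prod>i<d. ?D (\<iota> (p i)) i))"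
    by (rule sum_distrib_left[symmetric])
  also have "(\<Sum>p\<in>{p. p permutes {..<d}}. of_int (sign p) * (\<Prod>i<d. ?D (\<iota> (p i)) i))
    = (\<Sum>q\<in>{q. q permutes {..<d}}. of_int (sign \<iota>) * (of_int (sign q) * (\<Prod>i<d. ?D (q i) i)))"
  proof (rule sum.reindex_bij_witness[of _ "\<lambda>q. ?\<kappa> \<circ> q" "\<lambda>p. \<iota> \<circ> p"])
    fix p assume p: "p \<in> {p. p permutes {..<d}}"
    show "?\<kappa> \<circ> (\<iota> \<circ> p) = p" using permutes_inverses[OF \<iota>] by (simp add: fun_eq_iff)
    show "\<iota> \<circ> p \<in> {q. q permutes {..<d}}" using p \<iota> by (auto intro: permutes_compose)
    have "sign p = sign \<iota> * sign (\<iota> \<circ> p)"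
      using sign_compose[of \<iota> p] sign_idempotent[of \<iota>] permutes_imp_permutation[of "{..<d}"] p \<iota>
      by (simp add: mult.assoc[symmetric])
    then show "of_int (sign \<iota>) * (of_int (sign (\<iota> \<circ> p)) * (\<Prod>i<d. ?D ((\<iota> \<circ> p) i) i)) = of_int (sign p) * (\<Prod>i<d. ?D (\<iota> (p i)) i)"
      by simp
  next
    fix q assume q: "q \<in> {q. q permutes {..<d}}"
    show "\<iota> \<circ> (?\<kappa> \<circ> q) = q" using permutes_inverses[OF \<iota>] by (simp add: fun_eq_iff)
    show "?\<kappa> \<circ> q \<in> {p. p permutes {..<d}}" using q permutes_inv[OF \<iota>] by (auto intro: permutes_compose)
  qed
  also have "\<dots> = of_int (sign \<iota>) * jac_minor d e x P s'"
    by (simp add: jac_minor_permutations sum_distrib_left)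
  finally show ?thesis .
qed

lemma jac_minor_scale:
  assumes "\<And>i j. i < d \<Longrightarrow> j < d \<Longrightarrow>
    partial j (\<lambda>u. inner (z u) (e (P i))) s = c j * partial j (\<lambda>u. inner (x u) (e (P i))) s'"
  shows "jac_minor d e z P s = (\<Prod>j<d. c j) * jac_minor d e x P s'"
  using jac_minor_scale_permute[OF permutes_id, of d z e P s c x s'] assms by (simp add: sign_id)

text \<open>The bound is required at every point, so products over rows are bounded everywhere and
  integrability over the probability spaces is immediate.\<close>

definition bounded_borel :: "nat set \<Rightarrow> (point \<Rightarrow> real) \<Rightarrow> bool" where
  "bounded_borel I g \<longleftrightarrow> g \<in> borel_measurable (cube_measure I) \<and> (\<exists>B. \<forall>s\<in>unit_cube I. \<bar>g s\<bar> \<le> B)"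

lemma borel_measurable_jac_minor:
  assumes "\<And>v. sections_continuous {..<d} (\<lambda>s. inner (x s) v)"
  shows "jac_minor d e x P \<in> borel_measurable (cube_measure {..<d})"
  unfolding jac_minor_permutations[abs_def]
  by (intro borel_measurable_sum borel_measurable_times borel_measurable_const borel_measurable_prod
      borel_measurable_partial assms) (auto simp: permutes_less)

lemma bounded_borel_jac_minor:
  assumes x: "x \<in> Lip d"
  shows "bounded_borel {..<d} (jac_minor d e x P)"
  unfolding bounded_borel_def
proof
  show "jac_minor d e x P \<in> borel_measurable (cube_measure {..<d})"
    by (intro borel_measurable_jac_minor sections_continuous_Lip Lip_inner x)
  have "\<exists>K. \<forall>s\<in>unit_cube {..<d}. \<forall>j<d. \<bar>partial j (\<lambda>u. inner (x u) (e (P i))) s\<bar> \<le> K" for i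
    using partial_bounded[OF Lip_inner[OF x]] by metis
  then obtain K where K: "\<And>i s j. s \<in> unit_cube {..<d} \<Longrightarrow> j < d \<Longrightarrow> \<bar>partial j (\<lambda>u. inner (x u) (e (P i))) s\<bar> \<le> K i"
    by metis
  have "\<bar>jac_minor d e x P s\<bar> \<le> (\<Sum>p\<in>{p. p permutes {..<d}}. \<Prod>i<d. K i)" if s: "s \<in> unit_cube {..<d}" for s
    unfolding jac_minor_permutations
  proof (rule order_trans[OF sum_abs], rule sum_mono)
    fix p assume p: "p \<in> {p. p permutes {..<d}}"
    have "\<bar>of_int (sign p) * (\<Prod>i<d. partial (p i) (\<lambda>u. inner (x u) (e (P i))) s)\<bar>
      = (\<Prod>i<d. \<bar>partial (p i) (\<lambda>u. inner (x u) (e (P i))) s\<bar>)"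
      by (simp add: abs_mult abs_prod sign_def)
    also have "\<dots> \<le> (\<Prod>i<d. K i)"
      using p s by (intro prod_mono conjI K) (auto simp: permutes_less)
    finally show "\<bar>of_int (sign p) * (\<Prod>i<d. partial (p i) (\<lambda>u. inner (x u) (e (P i))) s)\<bar> \<le> (\<Prod>i<d. K i)" .
  qed
  then show "\<exists>B. \<forall>s\<in>unit_cube {..<d}. \<bar>jac_minor d e x P s\<bar> \<le> B" by blast
qed

section \<open>Products of cubes\<close>

abbreviation cubes :: "nat \<Rightarrow> nat set \<Rightarrow> (nat \<Rightarrow> point) measure" where
  "cubes d I \<equiv> PiM I (\<lambda>_. cube_measure {..<d})"

interpretation cubes: product_sigma_finite "\<lambda>_::nat. cube_measure {..<d}" for d
  by (simp add: product_sigma_finite_def prob_space_cube prob_space_imp_sigma_finite)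

lemma prob_space_cubes: "prob_space (cubes d I)"
  by (rule prob_space_PiM) (rule prob_space_cube)

lemma space_cubes: "space (cubes d I) = I \<rightarrow>\<^sub>E unit_cube {..<d}"
  by (simp add: space_PiM space_cube)

lemma cubesD: "t \<in> space (cubes d I) \<Longrightarrow> i \<in> I \<Longrightarrow> t i \<in> unit_cube {..<d}"
  by (auto simp: space_cubes)

lemma measurable_row: "i \<in> I \<Longrightarrow> (\<lambda>t. t i) \<in> measurable (cubes d I) (cube_measure {..<d})"
  by (rule measurable_component_singleton)

lemma measurable_entry: "i \<in> I \<Longrightarrow> j < d \<Longrightarrow> (\<lambda>t. t i j) \<in> borel_measurable (cubes d I)"
  by (rule measurable_cube_component[OF _ measurable_row]) auto

lemma AE_cubes:
  "i \<in> I \<Longrightarrow> AE s in cube_measure {..<d}. Q s \<Longrightarrow> AE t in cubes d I. Q (t i)"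
  by (rule AE_PiM_component) (auto intro: prob_space_cube)

lemma AE_cubes_all:
  assumes "finite I" "\<And>i. i \<in> I \<Longrightarrow> AE s in cube_measure {..<d}. Q i s"
  shows "AE t in cubes d I. \<forall>i\<in>I. Q i (t i)"
  using assms by (intro AE_finite_allI AE_cubes) auto

section \<open>Weighted maps and product measures\<close>

text \<open>A product measure is determined by its values on boxes, and on a box the weighted
  integral is a product of one-coordinate integrals.\<close>

lemma distr_density_PiM:
  fixes w :: "'i \<Rightarrow> 'a \<Rightarrow> ennreal"
  assumes I: "finite I" and M: "\<And>i. prob_space (M i)"
    and w: "\<And>i. i \<in> I \<Longrightarrow> w i \<in> borel_measurable (M i)"
    and \<psi>: "\<And>i. i \<in> I \<Longrightarrow> \<psi> i \<in> measurable (M i) (M i)"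
    and eq: "\<And>i. i \<in> I \<Longrightarrow> distr (density (M i) (w i)) (M i) (\<psi> i) = M i"
  shows "distr (density (PiM I M) (\<lambda>x. \<Prod>i\<in>I. w i (x i))) (PiM I M) (\<lambda>x. \<lambda>i\<in>I. \<psi> i (x i)) = PiM I M"
proof -
  interpret product_sigma_finite M
    using M by (simp add: product_sigma_finite_def prob_space_imp_sigma_finite)
  have T: "(\<lambda>x. \<lambda>i\<in>I. \<psi> i (x i)) \<in> measurable (PiM I M) (PiM I M)"
    by (intro measurable_restrict measurable_compose[OF measurable_component_singleton]) (auto intro: \<psi>)
  have W: "(\<lambda>x. \<Prod>i\<in>I. w i (x i)) \<in> borel_measurable (PiM I M)"
    by (intro borel_measurable_prod_ennreal measurable_compose[OF measurable_component_singleton]) (auto intro: w)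
  show ?thesis
  proof (rule PiM_eqI[OF I])
    fix A assume A: "\<And>i. i \<in> I \<Longrightarrow> A i \<in> sets (M i)"
    let ?T = "\<lambda>x. \<lambda>i\<in>I. \<psi> i (x i)"
    have pre: "?T -` PiE I A \<inter> space (PiM I M) \<in> sets (PiM I M)"
      by (rule measurable_sets[OF T]) (use A I in auto)
    have "emeasure (distr (density (PiM I M) (\<lambda>x. \<Prod>i\<in>I. w i (x i))) (PiM I M) ?T) (PiE I A)
      = emeasure (density (PiM I M) (\<lambda>x. \<Prod>i\<in>I. w i (x i))) (?T -` PiE I A \<inter> space (PiM I M))"
      using T A I by (subst emeasure_distr) auto
    also have "\<dots> = (\<integral>\<^sup>+x. (\<Prod>i\<in>I. w i (x i)) * indicator (?T -` PiE I A \<inter> space (PiM I M)) x \<partial>PiM I M)"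
      by (rule emeasure_density[OF W pre])
    also have "\<dots> = (\<integral>\<^sup>+x. (\<Prod>i\<in>I. w i (x i) * indicator (\<psi> i -` A i \<inter> space (M i)) (x i)) \<partial>PiM I M)"
    proof (rule nn_integral_cong)
      fix x assume x: "x \<in> space (PiM I M)"
      have "indicator (?T -` PiE I A \<inter> space (PiM I M)) x = (\<Prod>i\<in>I. indicator (\<psi> i -` A i \<inter> space (M i)) (x i) :: ennreal)"
      proof (cases "\<forall>i\<in>I. \<psi> i (x i) \<in> A i")
        case True
        then show ?thesis using x by (auto simp: space_PiM PiE_iff indicator_def)
      next
        case False
        then obtain i where "i \<in> I" "\<psi> i (x i) \<notin> A i" by blast
        then have "(\<Prod>i\<in>I. indicator (\<psi> i -` A i \<inter> space (M i)) (x i) :: ennreal) = 0"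
          using I by (intro prod_zero) (auto simp: indicator_def)
        then show ?thesis using False by (auto simp: indicator_def PiE_iff)
      qed
      then show "(\<Prod>i\<in>I. w i (x i)) * indicator (?T -` PiE I A \<inter> space (PiM I M)) x
        = (\<Prod>i\<in>I. w i (x i) * indicator (\<psi> i -` A i \<inter> space (M i)) (x i))"
        by (simp add: prod.distrib)
    qed
    also have "\<dots> = (\<Prod>i\<in>I. \<integral>\<^sup>+x. w i x * indicator (\<psi> i -` A i \<inter> space (M i)) x \<partial>M i)"
      using measurable_sets[OF \<psi> A]
      by (intro product_nn_integral_prod[OF I]) (auto intro!: borel_measurable_times_ennreal w)
    also have "\<dots> = (\<Prod>i\<in>I. emeasure (M i) (A i))"
    proof (rule prod.cong[OF refl])
      fix i assume i: "i \<in> I"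
      have "(\<integral>\<^sup>+x. w i x * indicator (\<psi> i -` A i \<inter> space (M i)) x \<partial>M i) = emeasure (density (M i) (w i)) (\<psi> i -` A i \<inter> space (M i))"
        using measurable_sets[OF \<psi>[OF i] A[OF i]] w[OF i] by (simp add: emeasure_density)
      also have "\<dots> = emeasure (distr (density (M i) (w i)) (M i) (\<psi> i)) (A i)"
        using \<psi>[OF i] A[OF i] by (subst emeasure_distr) auto
      finally show "(\<integral>\<^sup>+x. w i x * indicator (\<psi> i -` A i \<inter> space (M i)) x \<partial>M i) = emeasure (M i) (A i)"
        using eq[OF i] by simp
    qed
    finally show "emeasure (distr (density (PiM I M) (\<lambda>x. \<Prod>i\<in>I. w i (x i))) (PiM I M) ?T) (PiE I A) = (\<Prod>i\<in>I. emeasure (M i) (A i))" .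
  qed simp
qed

text \<open>The change of variables formula in measure form: \<open>w\<close> plays the role of the
  absolute value of the derivative of \<open>\<psi>\<close>, and weighting \<open>M\<close> by
  \<open>w\<close> before taking the image returns \<open>M\<close>. In this form the formula passes
  to products, and \<open>\<psi>\<close> may collapse sets on which \<open>w\<close>
  vanishes.\<close>

definition weighted_map :: "'a measure \<Rightarrow> ('a \<Rightarrow> real) \<Rightarrow> ('a \<Rightarrow> 'a) \<Rightarrow> bool" where
  "weighted_map M w \<psi> \<longleftrightarrow> w \<in> borel_measurable M \<and> \<psi> \<in> measurable M M \<and> (\<forall>x\<in>space M. 0 \<le> w x) \<and>
     distr (density M (\<lambda>x. ennreal (w x))) M \<psi> = M"

lemma weighted_map_PiM:
  assumes I: "finite I" and M: "prob_space M" and w: "\<And>i. i \<in> I \<Longrightarrow> weighted_map M (w i) (\<psi> i)"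
  shows "weighted_map (PiM I (\<lambda>_. M)) (\<lambda>x. \<Prod>i\<in>I. w i (x i)) (\<lambda>x. \<lambda>i\<in>I. \<psi> i (x i))"
  unfolding weighted_map_def
proof (intro conjI ballI)
  note w = w[unfolded weighted_map_def]
  show "(\<lambda>x. \<Prod>i\<in>I. w i (x i)) \<in> borel_measurable (PiM I (\<lambda>_. M))"
    by (rule borel_measurable_prod) (rule measurable_compose[OF measurable_component_singleton], use w in auto)
  show "(\<lambda>x. \<lambda>i\<in>I. \<psi> i (x i)) \<in> measurable (PiM I (\<lambda>_. M)) (PiM I (\<lambda>_. M))"
    by (rule measurable_restrict) (rule measurable_compose[OF measurable_component_singleton], use w in auto)
  show nn: "0 \<le> (\<Prod>i\<in>I. w i (x i))" if "x \<in> space (PiM I (\<lambda>_. M))" for x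
    using w that by (intro prod_nonneg) (auto simp: space_PiM)
  have "distr (density (PiM I (\<lambda>_. M)) (\<lambda>x. \<Prod>i\<in>I. ennreal (w i (x i)))) (PiM I (\<lambda>_. M)) (\<lambda>x. \<lambda>i\<in>I. \<psi> i (x i)) = PiM I (\<lambda>_. M)"
    by (rule distr_density_PiM[where w="\<lambda>i x. ennreal (w i x)"]) (use I M w in auto)
  moreover have "density (PiM I (\<lambda>_. M)) (\<lambda>x. \<Prod>i\<in>I. ennreal (w i (x i))) = density (PiM I (\<lambda>_. M)) (\<lambda>x. ennreal (\<Prod>i\<in>I. w i (x i)))"
  proof (rule density_cong)
    show "AE x in PiM I (\<lambda>_. M). (\<Prod>i\<in>I. ennreal (w i (x i))) = ennreal (\<Prod>i\<in>I. w i (x i))"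
      using w by (intro AE_I2 prod_ennreal) (auto simp: space_PiM)
    have m: "(\<lambda>x. w i (x i)) \<in> borel_measurable (PiM I (\<lambda>_. M))" if "i \<in> I" for i
      by (rule measurable_compose[OF measurable_component_singleton[OF that]]) (use w that in auto)
    then show "(\<lambda>x. \<Prod>i\<in>I. ennreal (w i (x i))) \<in> borel_measurable (PiM I (\<lambda>_. M))"
      by (intro borel_measurable_prod_ennreal measurable_compose[OF _ measurable_ennreal])
    from m show "(\<lambda>x. ennreal (\<Prod>i\<in>I. w i (x i))) \<in> borel_measurable (PiM I (\<lambda>_. M))"
      by (intro borel_measurable_prod measurable_compose[OF _ measurable_ennreal])
  qed
  ultimately show "distr (density (PiM I (\<lambda>_. M)) (\<lambda>x. ennreal (\<Prod>i\<in>I. w i (x i)))) (PiM I (\<lambda>_. M)) (\<lambda>x. \<lambda>i\<in>I. \<psi> i (x i)) = PiM I (\<lambda>_. M)"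
    by simp
qed

lemma integral_weighted_map:
  fixes F :: "'a \<Rightarrow> real"
  assumes "weighted_map M w \<psi>" and F: "F \<in> borel_measurable M"
  shows "(LINT x|M. w x * F (\<psi> x)) = (LINT x|M. F x)"
proof -
  note w = assms(1)[unfolded weighted_map_def]
  have "(LINT x|M. F x) = (LINT x|distr (density M (\<lambda>x. ennreal (w x))) M \<psi>. F x)"
    using w by simp
  also have "\<dots> = (LINT x|density M (\<lambda>x. ennreal (w x)). F (\<psi> x))"
    using w F by (subst integral_distr) auto
  also have "\<dots> = (LINT x|M. w x *\<^sub>R F (\<psi> x))"
    using w F by (intro integral_density) (auto intro: AE_I2 measurable_compose)
  finally show ?thesis by simp
qed

text \<open>Null sets pull back to null sets only where the weight is positive; elsewhere
  \<open>\<psi>\<close> may map a set of positive measure into a null set.\<close>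

lemma AE_weighted_map:
  assumes "weighted_map M w \<psi>" and P: "AE x in M. P x"
  shows "AE x in M. 0 < w x \<longrightarrow> P (\<psi> x)"
proof -
  note w = assms(1)[unfolded weighted_map_def]
  have eq: "distr (density M (\<lambda>x. ennreal (w x))) M \<psi> = M" using w by blast
  have "AE x in distr (density M (\<lambda>x. ennreal (w x))) M \<psi>. P x" unfolding eq by (rule P)
  then have "AE x in density M (\<lambda>x. ennreal (w x)). P (\<psi> x)"
    by (rule AE_distrD[rotated]) (use w in auto)
  then show ?thesis using w by (subst (asm) AE_density) auto
qed

lemma weighted_map_distr:
  assumes "\<psi> \<in> measurable M M" "distr M M \<psi> = M"
  shows "weighted_map M (\<lambda>_. 1) \<psi>"
  using assms by (simp add: weighted_map_def density_1)

section \<open>Permuting the entries of each column\<close>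

text \<open>The coordinates of the flat product are independent and uniform, and grouping them by
  rows gives independent rows. The flat product is introduced because a permutation that varies from
  column to column mixes the rows and is no product map over them.\<close>

lemma distr_flatten:
  fixes I J :: "nat set"
  assumes I: "finite I" "I \<noteq> {}" and J: "finite J" "J \<noteq> {}"
  shows "distr (PiM (I \<times> J) (\<lambda>_. I01)) (PiM I (\<lambda>_. cube_measure J)) (\<lambda>\<omega>. \<lambda>i\<in>I. \<lambda>j\<in>J. \<omega> (i, j))
    = PiM I (\<lambda>_. cube_measure J)"
proof -
  define M :: "(nat \<times> nat \<Rightarrow> real) measure" where "M = PiM (I \<times> J) (\<lambda>_. I01)"
  interpret M: prob_space M unfolding M_def by (rule prob_space_PiM) (rule prob_space_I01)
  have comp: "(\<lambda>\<omega>. \<omega> ij) \<in> measurable M I01" if "ij \<in> I \<times> J" for ij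
    unfolding M_def by (rule measurable_component_singleton[OF that])
  have "M.indep_vars (\<lambda>_. I01) (\<lambda>ij \<omega>. \<omega> ij) (I \<times> J)"
  proof (subst M.indep_vars_iff_distr_eq_PiM')
    have "distr M (PiM (I \<times> J) (\<lambda>_. I01)) (\<lambda>\<omega>. \<lambda>ij\<in>I \<times> J. \<omega> ij) = distr M M (\<lambda>\<omega>. \<omega>)"
      unfolding M_def by (rule distr_cong) (auto simp: space_PiM PiE_def extensional_restrict)
    also have "\<dots> = (\<Pi>\<^sub>M ij\<in>I \<times> J. distr M I01 (\<lambda>\<omega>. \<omega> ij))"
      unfolding M_def distr_id
      by (intro PiM_cong) (auto intro!: distr_PiM_component[symmetric] prob_space_I01)
    finally show "distr M (PiM (I \<times> J) (\<lambda>_. I01)) (\<lambda>\<omega>. \<lambda>ij\<in>I \<times> J. \<omega> ij) = (\<Pi>\<^sub>M ij\<in>I \<times> J. distr M I01 (\<lambda>\<omega>. \<omega> ij))" .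
  qed (use I J comp in auto)
  then have ind: "M.indep_vars (\<lambda>i. PiM ({i} \<times> J) (\<lambda>_. I01)) (\<lambda>i \<omega>. restrict (\<lambda>ij. \<omega> ij) ({i} \<times> J)) I"
    by (rule M.indep_vars_restrict) (auto simp: disjoint_family_on_def)
  have meas: "(\<lambda>\<omega>. \<lambda>j\<in>J. \<omega> (i, j)) \<in> measurable (PiM ({i} \<times> J) (\<lambda>_. I01)) (cube_measure J)" for i
    unfolding cube_measure_def by (rule measurable_restrict) (rule measurable_component_singleton, auto)
  have res: "M.indep_vars (\<lambda>i. cube_measure J) (\<lambda>i \<omega>. \<lambda>j\<in>J. (restrict (\<lambda>ij. \<omega> ij) ({i} \<times> J)) (i, j)) I"
    by (rule M.indep_vars_compose2[OF ind meas])
  have eq: "(\<lambda>i \<omega>. \<lambda>j\<in>J. (restrict (\<lambda>ij. \<omega> ij) ({i} \<times> J)) (i, j)) = (\<lambda>i \<omega>. \<lambda>j\<in>J. \<omega> (i, j))"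
    by (auto simp: fun_eq_iff)
  have ind2: "M.indep_vars (\<lambda>i. cube_measure J) (\<lambda>i \<omega>. \<lambda>j\<in>J. \<omega> (i, j)) I"
    using res unfolding eq .
  have meas2: "(\<lambda>\<omega>. \<lambda>j\<in>J. \<omega> (i, j)) \<in> measurable M (cube_measure J)" if "i \<in> I" for i
    unfolding cube_measure_def using that by (intro measurable_restrict comp) auto
  have "distr M (PiM I (\<lambda>_. cube_measure J)) (\<lambda>\<omega>. \<lambda>i\<in>I. \<lambda>j\<in>J. \<omega> (i, j))
    = (\<Pi>\<^sub>M i\<in>I. distr M (cube_measure J) (\<lambda>\<omega>. \<lambda>j\<in>J. \<omega> (i, j)))"
    using ind2 M.indep_vars_iff_distr_eq_PiM'[where I=I and M'="\<lambda>_. cube_measure J" and X="\<lambda>i \<omega>. \<lambda>j\<in>J. \<omega> (i, j)"] I meas2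
    by simp
  also have "\<dots> = PiM I (\<lambda>_. cube_measure J)"
  proof (rule PiM_cong[OF refl])
    fix i assume "i \<in> I"
    then show "distr M (cube_measure J) (\<lambda>\<omega>. \<lambda>j\<in>J. \<omega> (i, j)) = cube_measure J"
      unfolding M_def cube_measure_def
      by (intro distr_PiM_reindex[where f="\<lambda>j. (i, j)"] prob_space_I01) (auto simp: inj_on_def)
  qed
  finally show ?thesis by (simp add: M_def)
qed

text \<open>After flattening, \<open>T\<close> is a reindexing of coordinates along the injection
  \<open>\<phi>\<close>, and such a reindexing preserves a power of a single measure.\<close>

lemma distr_permute_columns:
  assumes \<sigma>: "\<And>j. j < d \<Longrightarrow> \<sigma> j permutes {..<m}" and pos: "0 < d" "0 < m"
  defines "T \<equiv> \<lambda>t. \<lambda>i\<in>{..<m}. \<lambda>j\<in>{..<d}. t (\<sigma> j i) j"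
  shows "T \<in> measurable (cubes d {..<m}) (cubes d {..<m})" "distr (cubes d {..<m}) (cubes d {..<m}) T = cubes d {..<m}"
proof -
  let ?I = "{..<m}" and ?J = "{..<d}"
  define M :: "(nat \<times> nat \<Rightarrow> real) measure" where "M = PiM (?I \<times> ?J) (\<lambda>_. I01)"
  define F where "F = (\<lambda>\<omega>::nat \<times> nat \<Rightarrow> real. \<lambda>i\<in>?I. \<lambda>j\<in>?J. \<omega> (i, j))"
  define \<phi> where "\<phi> = (\<lambda>(i::nat, j::nat). (\<sigma> j i, j))"
  define R where "R = (\<lambda>\<omega>::nat \<times> nat \<Rightarrow> real. \<lambda>ij\<in>?I \<times> ?J. \<omega> (\<phi> ij))"
  have \<sigma>_less: "\<sigma> j i < m" if "j < d" "i < m" for i j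
    using permutes_less[OF \<sigma>] that by blast
  show T: "T \<in> measurable (cubes d ?I) (cubes d ?I)"
    unfolding T_def
  proof (rule measurable_restrict, rule measurable_cubeI)
    fix i j assume ij: "i \<in> ?I" "j \<in> ?J"
    then show "(\<lambda>t. (\<lambda>j\<in>?J. t (\<sigma> j i) j) j) \<in> borel_measurable (cubes d ?I)"
      using measurable_entry[of "\<sigma> j i" ?I j d] \<sigma>_less by simp
  next
    fix i t assume "i \<in> ?I" "t \<in> space (cubes d ?I)"
    then show "(\<lambda>j\<in>?J. t (\<sigma> j i) j) \<in> unit_cube ?J"
      using unit_cubeD[OF cubesD[of t ?I d]] \<sigma>_less by (auto simp: unit_cube_def)
  qed
  have F: "F \<in> measurable M (cubes d ?I)" "distr M (cubes d ?I) F = cubes d ?I"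
  proof -
    show "F \<in> measurable M (cubes d ?I)"
      unfolding F_def M_def cube_measure_def
      by (intro measurable_restrict measurable_component_singleton) auto
    show "distr M (cubes d ?I) F = cubes d ?I"
      unfolding F_def M_def using pos by (intro distr_flatten) auto
  qed
  have \<phi>: "inj_on \<phi> (?I \<times> ?J)" "\<phi> \<in> ?I \<times> ?J \<rightarrow> ?I \<times> ?J"
  proof -
    show "inj_on \<phi> (?I \<times> ?J)"
      using \<sigma> by (auto simp: inj_on_def \<phi>_def) (metis permutes_def)
  qed (auto simp: \<phi>_def \<sigma>_less)
  have R: "R \<in> measurable M M" "distr M M R = M"
  proof -
    show "R \<in> measurable M M"
      unfolding R_def M_def using \<phi>(2) by (intro measurable_restrict measurable_component_singleton) auto
    show "distr M M R = M"
      unfolding R_def M_def using \<phi> by (intro distr_PiM_reindex prob_space_I01) auto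
  qed
  have "distr (cubes d ?I) (cubes d ?I) T = distr (distr M (cubes d ?I) F) (cubes d ?I) T"
    using F by simp
  also have "\<dots> = distr M (cubes d ?I) (T \<circ> F)" by (rule distr_distr[OF T F(1)])
  also have "\<dots> = distr M (cubes d ?I) (F \<circ> R)"
    by (rule distr_cong) (auto simp: T_def F_def R_def \<phi>_def \<sigma>_less fun_eq_iff)
  also have "\<dots> = distr (distr M M R) (cubes d ?I) F" by (rule distr_distr[OF F(1) R(1), symmetric])
  finally show "distr (cubes d ?I) (cubes d ?I) T = cubes d ?I" using F R by simp
qed

section \<open>The integration domains\<close>

text \<open>Monotonicity is spelled out as finitely many comparisons of entries, the form in which
  measurability can be read off.\<close>

lemma sig_domain_eq:
  assumes "\<And>j. j < d \<Longrightarrow> \<pi> j permutes {..<m}"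
  shows "sig_domain d m \<pi> a b = {t \<in> space (cubes d {..<m}). \<forall>j\<in>{..<d}. \<forall>i\<in>{..<m}.
    t (\<pi> j i) j \<in> {a j..b j} \<and> (\<forall>k\<in>{i<..<m}. t (\<pi> j i) j < t (\<pi> j k) j)}"
  by (auto simp: sig_domain_def ord_simplex_def space_cubes strict_mono_on_def)

lemma sets_sig_domain:
  assumes "\<And>j. j < d \<Longrightarrow> \<pi> j permutes {..<m}"
  shows "sig_domain d m \<pi> a b \<in> sets (cubes d {..<m})"
proof -
  have [measurable]: "(\<lambda>t. t (\<pi> j i) j) \<in> borel_measurable (cubes d {..<m})" if "j \<in> {..<d}" "i \<in> {..<m}" for i j
    using that permutes_less[OF assms] by (intro measurable_entry) auto
  have "{t \<in> space (cubes d {..<m}). \<forall>j\<in>{..<d}. \<forall>i\<in>{..<m}.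
    t (\<pi> j i) j \<in> {a j..b j} \<and> (\<forall>k\<in>{i<..<m}. t (\<pi> j i) j < t (\<pi> j k) j)} \<in> sets (cubes d {..<m})"
  proof (rule predE, intro pred_intros_finite(3) finite_lessThan finite_greaterThanLessThan pred_intros_logic(3))
    fix i j assume ij: "j \<in> {..<d}" "i \<in> {..<m}"
    then show "Measurable.pred (cubes d {..<m}) (\<lambda>t. t (\<pi> j i) j \<in> {a j..b j})" by measurable
    fix k assume "k \<in> {i<..<m}"
    then have [measurable]: "k \<in> {..<m}" by simp
    from ij show "Measurable.pred (cubes d {..<m}) (\<lambda>t. t (\<pi> j i) j < t (\<pi> j k) j)" by measurable
  qed
  then show ?thesis by (simp only: sig_domain_eq[OF assms])
qed

text \<open>Strict growth gives \<open>k \<le> f k\<close> by induction from below; the bound on the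
  range gives the reverse inequality by induction from the top.\<close>

lemma strict_mono_on_lessThan_id:
  fixes f :: "nat \<Rightarrow> nat"
  assumes f: "strict_mono_on {..<m} f" "f ` {..<m} \<subseteq> {..<m}" and i: "i < m"
  shows "f i = i"
proof -
  have ge: "k \<le> f k" if "k < m" for k
    using that
  proof (induction k)
    case (Suc k)
    then have "f k < f (Suc k)" using f(1) by (auto simp: strict_mono_on_def)
    then show ?case using Suc by simp
  qed simp
  have le: "f (m - Suc k) \<le> m - Suc k" if "k < m" for k
    using that
  proof (induction k)
    case 0
    then have "f (m - 1) < m" using f(2) by (auto simp: image_subset_iff)
    then show ?case by simp
  next
    case (Suc k)
    then have "f (m - Suc (Suc k)) < f (m - Suc k)" using f(1) by (auto simp: strict_mono_on_def)
    then show ?case using Suc by simp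
  qed
  show ?thesis using ge[OF i] le[of "m - Suc i"] i by simp
qed

text \<open>Two sorting permutations differ by a strictly increasing permutation of
  \<open>{..<m}\<close>, which is the identity.\<close>

lemma sorting_permutation_unique:
  fixes f :: "nat \<Rightarrow> real"
  assumes p: "p permutes {..<m}" "strict_mono_on {..<m} (\<lambda>i. f (p i))"
    and q: "q permutes {..<m}" "strict_mono_on {..<m} (\<lambda>i. f (q i))"
  shows "p = q"
proof
  fix i
  define r where "r = inv_into UNIV p \<circ> q"
  have r: "r permutes {..<m}" unfolding r_def by (intro permutes_compose q permutes_inv p)
  have pr: "p (r k) = q k" for k unfolding r_def using permutes_inverses(1)[OF p(1)] by simp
  have "strict_mono_on {..<m} r"
  proof (rule strict_mono_onI)
    fix k l assume kl: "k \<in> {..<m}" "l \<in> {..<m}" "k < l"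
    then have "f (p (r k)) < f (p (r l))" using q(2) by (auto simp: pr strict_mono_on_def)
    moreover have "r k < m" "r l < m" using kl permutes_less[OF r] by auto
    ultimately show "r k < r l"
      using strict_mono_on_leD[OF p(2), of "r l" "r k"] by (meson lessThan_iff not_le)
  qed
  then have "r i = i" if "i < m"
    using that permutes_image[OF r] by (intro strict_mono_on_lessThan_id) auto
  then show "p i = q i" using pr[of i] p(1) q(1) by (cases "i < m") (auto simp: permutes_def)
qed

lemma sig_domain_disjoint:
  assumes "\<pi> \<in> {..<d} \<rightarrow>\<^sub>E {p. p permutes {..<m}}" "\<pi>' \<in> {..<d} \<rightarrow>\<^sub>E {p. p permutes {..<m}}"
    and "t \<in> sig_domain d m \<pi> a b" "t \<in> sig_domain d m \<pi>' a b"
  shows "\<pi> = \<pi>'"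
proof (rule PiE_ext[OF assms(1,2)])
  fix j assume j: "j \<in> {..<d}"
  then show "\<pi> j = \<pi>' j"
    using assms by (intro sorting_permutation_unique[where f="\<lambda>i. t i j"])
      (auto simp: sig_domain_def ord_simplex_def PiE_iff)
qed

lemma permutation_families:
  "finite ({..<d} \<rightarrow>\<^sub>E {p. p permutes {..<m::nat}})"
  "card ({..<d} \<rightarrow>\<^sub>E {p. p permutes {..<m::nat}}) = fact m ^ d"
proof -
  show "finite ({..<d} \<rightarrow>\<^sub>E {p. p permutes {..<m::nat}})"
    by (intro finite_PiE finite_permutations) auto
  have "card {p. p permutes {..<m}} = fact m"
    by (rule card_permutations) auto
  then show "card ({..<d} \<rightarrow>\<^sub>E {p. p permutes {..<m::nat}}) = fact m ^ d"
    by (simp add: card_PiE)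
qed

lemma measure_sig_domain_le:
  assumes d: "d \<ge> 1" and \<pi>: "\<And>j. j < d \<Longrightarrow> \<pi> j permutes {..<m}"
  shows "measure (cubes d {..<m}) (sig_domain d m \<pi> (\<lambda>_. 0) (\<lambda>_. 1)) \<le> 1 / fact m ^ d"
proof (cases "m = 0")
  case True
  then show ?thesis using prob_space.prob_le_1[OF prob_space_cubes] by simp
next
  case False
  interpret P: prob_space "cubes d {..<m}" by (rule prob_space_cubes)
  let ?D = "\<lambda>\<rho>. sig_domain d m \<rho> (\<lambda>_. 0) (\<lambda>_. 1)"
  let ?S = "{..<d} \<rightarrow>\<^sub>E {p. p permutes {..<m}}"
  have vol: "P.prob (?D \<rho>) = P.prob (?D \<pi>)" if \<rho>: "\<rho> \<in> ?S" for \<rho>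
  proof -
    have \<rho>': "\<rho> j permutes {..<m}" if "j < d" for j using \<rho> that by auto
    \<comment> \<open>In each column this carries the order prescribed by \<open>\<pi>\<close> to
      the one prescribed by \<open>\<rho>\<close>, so the measure preserving \<open>T\<close> pulls
      one domain back to the other.\<close>
    define \<sigma> where "\<sigma> j = \<rho> j \<circ> inv_into UNIV (\<pi> j)" for j
    have \<sigma>: "\<sigma> j permutes {..<m}" if "j < d" for j
      unfolding \<sigma>_def using that by (intro permutes_compose permutes_inv \<pi> \<rho>')
    have \<sigma>\<pi>: "\<sigma> j (\<pi> j i) = \<rho> j i" if "j < d" for i j
      unfolding \<sigma>_def using permutes_inverses(2)[OF \<pi>[OF that]] by simp
    define T where "T t = (\<lambda>i\<in>{..<m}. \<lambda>j\<in>{..<d}. t (\<sigma> j i) j)" for t :: "nat \<Rightarrow> point"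
    have T: "T \<in> measurable (cubes d {..<m}) (cubes d {..<m})" "distr (cubes d {..<m}) (cubes d {..<m}) T = cubes d {..<m}"
      unfolding T_def using distr_permute_columns[OF \<sigma>] d False by auto
    have "T -` ?D \<pi> \<inter> space (cubes d {..<m}) = ?D \<rho>"
    proof (rule Set.set_eqI)
      fix t
      have "T t (\<pi> j i) j = t (\<rho> j i) j" if "j < d" "i < m" for i j
        using that permutes_less[OF \<pi>] by (simp add: T_def \<sigma>\<pi>)
      then have "T t \<in> ?D \<pi> \<longleftrightarrow> t \<in> ?D \<rho>" if "t \<in> space (cubes d {..<m})"
        using that measurable_space[OF T(1) that] by (simp add: sig_domain_eq[OF \<pi>] sig_domain_eq[OF \<rho>'])
      moreover have "t \<in> ?D \<rho> \<Longrightarrow> t \<in> space (cubes d {..<m})" by (simp add: sig_domain_eq[OF \<rho>'])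
      ultimately show "t \<in> T -` ?D \<pi> \<inter> space (cubes d {..<m}) \<longleftrightarrow> t \<in> ?D \<rho>" by auto
    qed
    then have "P.prob (?D \<rho>) = measure (distr (cubes d {..<m}) (cubes d {..<m}) T) (?D \<pi>)"
      using T(1) sets_sig_domain[OF \<pi>] by (simp add: measure_distr)
    then show ?thesis using T(2) by simp
  qed
  have "(\<Sum>\<rho>\<in>?S. P.prob (?D \<rho>)) = P.prob (\<Union>\<rho>\<in>?S. ?D \<rho>)"
  proof (rule P.finite_measure_finite_Union[symmetric])
    show "finite ?S" by (rule permutation_families)
    show "?D ` ?S \<subseteq> P.events" by (auto intro!: sets_sig_domain)
    show "disjoint_family_on ?D ?S"
      unfolding disjoint_family_on_def using sig_domain_disjoint by blast
  qed
  then have "fact m ^ d * P.prob (?D \<pi>) \<le> 1"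
    using P.prob_le_1 permutation_families(2)[of d m] by (simp add: vol)
  then show ?thesis by (simp add: field_simps)
qed

lemma sig_integral_bound:
  fixes F :: "(nat \<Rightarrow> point) \<Rightarrow> real"
  assumes d: "d \<ge> 1" and \<pi>: "\<And>j. j < d \<Longrightarrow> \<pi> j permutes {..<m}"
    and F: "F \<in> borel_measurable (cubes d {..<m})" and K: "AE t in cubes d {..<m}. \<bar>F t\<bar> \<le> K"
  shows "\<bar>LINT t|cubes d {..<m}. indicator (sig_domain d m \<pi> (\<lambda>_. 0) (\<lambda>_. 1)) t * F t\<bar> \<le> K / fact m ^ d"
proof -
  interpret P: prob_space "cubes d {..<m}" by (rule prob_space_cubes)
  let ?D = "sig_domain d m \<pi> (\<lambda>_. 0) (\<lambda>_. 1)"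
  have D[measurable]: "?D \<in> P.events" by (rule sets_sig_domain[OF \<pi>])
  note F[measurable]
  \<comment> \<open>Over a probability measure, a constant statement that holds almost everywhere
    holds.\<close>
  have "AE t in cubes d {..<m}. 0 \<le> K" using K by eventually_elim auto
  then have K0: "0 \<le> K" by simp
  have "\<bar>LINT t|cubes d {..<m}. indicator ?D t * F t\<bar> \<le> (LINT t|cubes d {..<m}. K * indicator ?D t)"
  proof (rule integral_abs_bound[THEN order_trans], rule integral_mono_AE)
    have int: "integrable (cubes d {..<m}) (\<lambda>t. indicator ?D t * F t)"
      by (rule P.integrable_const_bound[where B=K])
        (use K K0 in \<open>auto elim!: eventually_mono split: split_indicator\<close>)
    then show "integrable (cubes d {..<m}) (\<lambda>t. \<bar>indicator ?D t * F t\<bar>)" by simp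
    show "AE t in cubes d {..<m}. \<bar>indicator ?D t * F t\<bar> \<le> K * indicator ?D t"
      using K by eventually_elim (auto split: split_indicator)
    show "integrable (cubes d {..<m}) (\<lambda>t. K * indicator ?D t)"
      by (intro integrable_mult_right integrable_real_indicator D) (simp add: P.emeasure_eq_measure)
  qed
  also have "\<dots> = K * P.prob ?D" by simp
  also have "\<dots> \<le> K * (1 / fact m ^ d)"
    using measure_sig_domain_le[OF d \<pi>] K0 by (rule mult_left_mono)
  finally show ?thesis by simp
qed

section \<open>The essential supremum norm and the metric on classes\<close>

lemma finite_ord_inj [simp]: "finite (ord_inj d n)"
  unfolding ord_inj_def by (rule finite_subset[of _ "{..<d} \<rightarrow>\<^sub>E {..<n}"]) (auto intro: finite_PiE)

lemma bounded_borel_diff: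
  assumes "bounded_borel I f" "bounded_borel I g"
  shows "bounded_borel I (\<lambda>s. f s - g s)"
proof -
  obtain A B where "\<forall>s\<in>unit_cube I. \<bar>f s\<bar> \<le> A" "\<forall>s\<in>unit_cube I. \<bar>g s\<bar> \<le> B"
    using assms unfolding bounded_borel_def by blast
  then have "\<forall>s\<in>unit_cube I. \<bar>f s - g s\<bar> \<le> A + B" by (smt (verit, best))
  then show ?thesis using assms unfolding bounded_borel_def by auto
qed

lemma bounded_borelD: "bounded_borel I f \<Longrightarrow> f \<in> borel_measurable (cube_measure I)"
  by (simp add: bounded_borel_def)

lemma esssup_L2_set_nonneg:
  "0 \<le> esssup (cube_measure {..<d}) (\<lambda>s. ereal (L2_set (\<lambda>P. F P s) A))" (is "0 \<le> ?z")
proof -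
  interpret prob_space "cube_measure {..<d}" by (rule prob_space_cube)
  have "AE s in cube_measure {..<d}. ereal (L2_set (\<lambda>P. F P s) A) \<le> ?z"
    by (rule esssup_AE)
  then have "AE s in cube_measure {..<d}. 0 \<le> ?z"
    by eventually_elim (meson L2_set_nonneg ereal_less_eq(5) order_trans)
  then show ?thesis by simp
qed

lemma Linf_norm_nonneg: "0 \<le> Linf_norm d n F"
  unfolding Linf_norm_def by (intro real_of_ereal_pos esssup_L2_set_nonneg)

context
  fixes d n :: nat and F :: "(nat \<Rightarrow> nat) \<Rightarrow> point \<Rightarrow> real"
  assumes F: "\<And>P. P \<in> ord_inj d n \<Longrightarrow> bounded_borel {..<d} (F P)"
begin

private lemma L2_measurable:
  "(\<lambda>s. ereal (L2_set (\<lambda>P. F P s) (ord_inj d n))) \<in> borel_measurable (cube_measure {..<d})"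
  unfolding L2_set_def
  by (intro borel_measurable_ereal measurable_compose[OF _ borel_measurable_sqrt] borel_measurable_sum
      borel_measurable_power bounded_borelD F)

lemma
  shows Linf_norm_AE: "AE s in cube_measure {..<d}. L2_set (\<lambda>P. F P s) (ord_inj d n) \<le> Linf_norm d n F"
    and Linf_norm_le: "AE s in cube_measure {..<d}. L2_set (\<lambda>P. F P s) (ord_inj d n) \<le> c \<Longrightarrow> Linf_norm d n F \<le> c"
proof -
  interpret prob_space "cube_measure {..<d}" by (rule prob_space_cube)
  define z where "z = esssup (cube_measure {..<d}) (\<lambda>s. ereal (L2_set (\<lambda>P. F P s) (ord_inj d n)))"
  have AE: "AE s in cube_measure {..<d}. ereal (L2_set (\<lambda>P. F P s) (ord_inj d n)) \<le> z"
    unfolding z_def by (rule esssup_AE)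
  have z0: "0 \<le> z" unfolding z_def by (rule esssup_L2_set_nonneg)
  have zle: "z \<le> ereal c" if "AE s in cube_measure {..<d}. L2_set (\<lambda>P. F P s) (ord_inj d n) \<le> c" for c
    unfolding z_def using that by (intro esssup_I L2_measurable) simp
  obtain B where B: "\<And>P s. P \<in> ord_inj d n \<Longrightarrow> s \<in> unit_cube {..<d} \<Longrightarrow> \<bar>F P s\<bar> \<le> B P"
    using F unfolding bounded_borel_def by metis
  \<comment> \<open>A finite bound shows that the essential supremum is a real number, so
    \<open>real_of_ereal\<close> in \<open>Linf_norm\<close> is faithful.\<close>
  have "AE s in cube_measure {..<d}. L2_set (\<lambda>P. F P s) (ord_inj d n) \<le> (\<Sum>P\<in>ord_inj d n. B P)"
  proof (rule AE_I2)
    fix s assume "s \<in> space (cube_measure {..<d})"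
    then show "L2_set (\<lambda>P. F P s) (ord_inj d n) \<le> (\<Sum>P\<in>ord_inj d n. B P)"
      using B by (intro order_trans[OF L2_set_le_sum_abs] sum_mono) (auto simp: space_cube)
  qed
  then have "z \<le> ereal (\<Sum>P\<in>ord_inj d n. B P)" by (rule zle)
  then obtain r where r: "z = ereal r" using z0 by (cases z) auto
  then have L: "Linf_norm d n F = r" by (simp add: Linf_norm_def z_def[symmetric])
  show "AE s in cube_measure {..<d}. L2_set (\<lambda>P. F P s) (ord_inj d n) \<le> Linf_norm d n F"
    using AE by (simp add: r L)
  show "Linf_norm d n F \<le> c" if "AE s in cube_measure {..<d}. L2_set (\<lambda>P. F P s) (ord_inj d n) \<le> c"
    using zle[OF that] by (simp add: r L)
qed

lemma AE_le_Linf_norm: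
  assumes P: "P \<in> ord_inj d n"
  shows "AE s in cube_measure {..<d}. \<bar>F P s\<bar> \<le> Linf_norm d n F"
  using Linf_norm_AE
proof eventually_elim
  case (elim s)
  have "\<bar>F P s\<bar> \<le> L2_set (\<lambda>P. F P s) (ord_inj d n)"
  proof -
    have "\<bar>F P s\<bar> = sqrt ((F P s)\<^sup>2)" by simp
    also have "\<dots> \<le> L2_set (\<lambda>P. F P s) (ord_inj d n)"
      unfolding L2_set_def using member_le_sum[OF P, of "\<lambda>P. (F P s)\<^sup>2"]
      by (intro real_sqrt_le_mono) auto
    finally show ?thesis .
  qed
  then show ?case using elim by simp
qed

end

lemma bounded_borel_jac_diff:
  "x \<in> Lip d \<Longrightarrow> y \<in> Lip d \<Longrightarrow> bounded_borel {..<d} (\<lambda>s. jac_minor d e x P s - jac_minor d e y P s)"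
  by (intro bounded_borel_diff bounded_borel_jac_minor)

lemma jac_dist_nonneg: "0 \<le> jac_dist d n e x y"
  unfolding jac_dist_def by (rule Linf_norm_nonneg)

lemma jac_dist_eq_0_iff:
  assumes "x \<in> Lip d" "y \<in> Lip d"
  shows "jac_dist d n e x y = 0 \<longleftrightarrow> (x, y) \<in> jac_equiv d n e"
proof -
  note bb = bounded_borel_jac_diff[OF assms]
  have L2_0: "L2_set (\<lambda>P. jac_minor d e x P s - jac_minor d e y P s) (ord_inj d n) \<le> 0 \<longleftrightarrow>
    (\<forall>P\<in>ord_inj d n. jac_minor d e x P s = jac_minor d e y P s)" for s
    using L2_set_nonneg[of "\<lambda>P. jac_minor d e x P s - jac_minor d e y P s" "ord_inj d n"]
    by (simp add: L2_set_eq_0_iff antisym_conv)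
  have "jac_dist d n e x y = 0 \<longleftrightarrow>
    (AE s in cube_measure {..<d}. L2_set (\<lambda>P. jac_minor d e x P s - jac_minor d e y P s) (ord_inj d n) \<le> 0)"
    using Linf_norm_AE[of d n "\<lambda>P s. jac_minor d e x P s - jac_minor d e y P s", OF bb]
      Linf_norm_le[of d n "\<lambda>P s. jac_minor d e x P s - jac_minor d e y P s" 0, OF bb]
      jac_dist_nonneg[of d n e x y] unfolding jac_dist_def by (metis (no_types) order_antisym)
  then show ?thesis using assms by (simp add: L2_0 jac_equiv_def)
qed

lemma jac_dist_commute: "jac_dist d n e x y = jac_dist d n e y x"
  unfolding jac_dist_def Linf_norm_def L2_set_def by (simp add: power2_commute)

lemma jac_dist_triangle:
  assumes "x \<in> Lip d" "y \<in> Lip d" "z \<in> Lip d"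
  shows "jac_dist d n e x z \<le> jac_dist d n e x y + jac_dist d n e y z"
  unfolding jac_dist_def
proof (rule Linf_norm_le[OF bounded_borel_jac_diff[OF assms(1,3)]])
  have "AE s in cube_measure {..<d}. L2_set (\<lambda>P. jac_minor d e x P s - jac_minor d e y P s) (ord_inj d n)
      \<le> Linf_norm d n (\<lambda>P s. jac_minor d e x P s - jac_minor d e y P s)"
    "AE s in cube_measure {..<d}. L2_set (\<lambda>P. jac_minor d e y P s - jac_minor d e z P s) (ord_inj d n)
      \<le> Linf_norm d n (\<lambda>P s. jac_minor d e y P s - jac_minor d e z P s)"
    by (intro Linf_norm_AE bounded_borel_jac_diff assms)+
  then show "AE s in cube_measure {..<d}. L2_set (\<lambda>P. jac_minor d e x P s - jac_minor d e z P s) (ord_inj d n)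
      \<le> Linf_norm d n (\<lambda>P s. jac_minor d e x P s - jac_minor d e y P s)
       + Linf_norm d n (\<lambda>P s. jac_minor d e y P s - jac_minor d e z P s)"
  proof eventually_elim
    case (elim s)
    show ?case
      using L2_set_triangle_ineq[of "\<lambda>P. jac_minor d e x P s - jac_minor d e y P s"
          "\<lambda>P. jac_minor d e y P s - jac_minor d e z P s" "ord_inj d n"] elim by simp
  qed
qed

lemma LipJ_rep:
  assumes "X \<in> LipJ d n e"
  shows "(SOME x. x \<in> X) \<in> X" "(SOME x. x \<in> X) \<in> Lip d"
proof -
  have "X \<noteq> {}" "X \<subseteq> Lip d"
    using assms in_quotient_imp_non_empty[OF equiv_jac_equiv] in_quotient_imp_subset[OF equiv_jac_equiv]
    unfolding LipJ_def by blast+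
  then show "(SOME x. x \<in> X) \<in> X" "(SOME x. x \<in> X) \<in> Lip d"
    by (auto intro: some_in_eq[THEN iffD2])
qed

text \<open>On Lipschitz maps \<open>jac_dist\<close> is a pseudometric whose zero relation is
  exactly \<open>jac_equiv\<close>, so evaluating it on chosen representatives separates the
  classes.\<close>

lemma Metric_space_LipJ: "Metric_space (LipJ d n e) (mu_inf d n e)"
proof
  show "0 \<le> mu_inf d n e X Y" for X Y
    unfolding mu_inf_def by (rule jac_dist_nonneg)
  show "mu_inf d n e X Y = mu_inf d n e Y X" for X Y
    unfolding mu_inf_def by (rule jac_dist_commute)
  show "mu_inf d n e X Y = 0 \<longleftrightarrow> X = Y" if "X \<in> LipJ d n e" "Y \<in> LipJ d n e" for X Y
    unfolding mu_inf_def using LipJ_rep[OF that(1)] LipJ_rep[OF that(2)] that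
    by (simp add: jac_dist_eq_0_iff LipJ_def quotient_eq_iff[OF equiv_jac_equiv])
  show "mu_inf d n e X Z \<le> mu_inf d n e X Y + mu_inf d n e Y Z"
    if "X \<in> LipJ d n e" "Y \<in> LipJ d n e" "Z \<in> LipJ d n e" for X Y Z
    unfolding mu_inf_def by (intro jac_dist_triangle LipJ_rep[OF that(1)] LipJ_rep[OF that(2)] LipJ_rep[OF that(3)])
qed

section \<open>Square summable tensor sequences\<close>

lemma finite_level_index [simp]: "finite (level_index d n m)"
  unfolding level_index_def by (intro finite_cartesian_product finite_PiE permutation_families) auto

lemma level_norm_sq: "(level_norm d n m r)\<^sup>2 = (\<Sum>k\<in>level_index d n m. (r k)\<^sup>2)"
  by (simp add: level_norm_def L2_set_def sum_nonneg)

lemma H_space_diff_summable: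
  assumes "r \<in> H_space d n" "r' \<in> H_space d n"
  shows "(\<lambda>m. (level_norm d n m (\<lambda>k. r m k - r' m k))\<^sup>2) summable_on UNIV"
proof (rule summable_on_comparison_test)
  show "(\<lambda>m. 2 * (level_norm d n m (r m))\<^sup>2 + 2 * (level_norm d n m (r' m))\<^sup>2) summable_on UNIV"
    using assms by (intro summable_on_add summable_on_cmult_right) (auto simp: H_space_def)
  have sq: "(a - b)\<^sup>2 \<le> 2 * a\<^sup>2 + 2 * b\<^sup>2" for a b :: real
    using zero_le_power2[of "a + b"] by (simp add: power2_eq_square algebra_simps)
  show "(level_norm d n m (\<lambda>k. r m k - r' m k))\<^sup>2 \<le> 2 * (level_norm d n m (r m))\<^sup>2 + 2 * (level_norm d n m (r' m))\<^sup>2" for m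
    unfolding level_norm_sq sum_distrib_left sum.distrib[symmetric] by (intro sum_mono sq)
qed auto

lemma H_dist_sq:
  "(H_dist d n r r')\<^sup>2 = (\<Sum>\<^sub>\<infinity>m. (level_norm d n m (\<lambda>k. r m k - r' m k))\<^sup>2)"
  unfolding H_dist_def by (intro real_sqrt_pow2 infsum_nonneg) auto

lemma level_le_H_dist:
  assumes "r \<in> H_space d n" "r' \<in> H_space d n" and F: "finite F"
  shows "L2_set (\<lambda>m. level_norm d n m (\<lambda>k. r m k - r' m k)) F \<le> H_dist d n r r'"
  unfolding L2_set_def H_dist_def
  by (intro real_sqrt_le_mono finite_sum_le_infsum H_space_diff_summable assms) auto

lemma entry_le_H_dist:
  assumes "r \<in> H_space d n" "r' \<in> H_space d n" and k: "k \<in> level_index d n m"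
  shows "\<bar>r m k - r' m k\<bar> \<le> H_dist d n r r'"
proof -
  have "\<bar>r m k - r' m k\<bar> = sqrt ((r m k - r' m k)\<^sup>2)" by simp
  also have "\<dots> \<le> level_norm d n m (\<lambda>k. r m k - r' m k)"
    unfolding level_norm_def L2_set_def
    using member_le_sum[OF k, of "\<lambda>k. (r m k - r' m k)\<^sup>2"] by (intro real_sqrt_le_mono) auto
  also have "\<dots> \<le> H_dist d n r r'"
    using level_le_H_dist[OF assms(1,2), of "{m}"] by (simp add: L2_set_def level_norm_def sum_nonneg)
  finally show ?thesis .
qed

lemma Metric_space_H_space: "Metric_space (H_space d n) (H_dist d n)"
proof
  show "0 \<le> H_dist d n r r'" for r r'
    unfolding H_dist_def by (intro real_sqrt_ge_zero infsum_nonneg) auto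
  show "H_dist d n r r' = H_dist d n r' r" for r r'
    unfolding H_dist_def level_norm_sq by (simp add: power2_commute)
  show "H_dist d n r r' = 0 \<longleftrightarrow> r = r'" if "r \<in> H_space d n" "r' \<in> H_space d n" for r r'
  proof
    assume "H_dist d n r r' = 0"
    then have "r m k = r' m k" if "k \<in> level_index d n m" for m k
      using entry_le_H_dist[OF \<open>r \<in> _\<close> \<open>r' \<in> _\<close> that] by simp
    moreover have "r m k = r' m k" if "k \<notin> level_index d n m" for m k
      using \<open>r \<in> _\<close> \<open>r' \<in> _\<close> that by (cases k) (simp add: H_space_def T_space_def)
    ultimately show "r = r'" by (intro ext) blast
  qed (simp add: H_dist_def level_norm_def L2_set_def)
  show "H_dist d n r r'' \<le> H_dist d n r r' + H_dist d n r' r''"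
    if r: "r \<in> H_space d n" "r' \<in> H_space d n" "r'' \<in> H_space d n" for r r' r''
  proof -
    have nn: "0 \<le> H_dist d n r r'" for r r'
      unfolding H_dist_def by (intro real_sqrt_ge_zero infsum_nonneg) auto
    have "(H_dist d n r r'')\<^sup>2 \<le> (H_dist d n r r' + H_dist d n r' r'')\<^sup>2"
      unfolding H_dist_sq[of d n r r'']
    \<comment> \<open>Minkowski's inequality is applied twice, inside each level and then across
      finitely many levels; a bound on all finite sums bounds the infinite one.\<close>
    proof (rule infsum_le_finite_sums[OF H_space_diff_summable[OF r(1,3)]])
      fix F :: "nat set" assume F: "finite F"
      have "L2_set (\<lambda>m. level_norm d n m (\<lambda>k. r m k - r'' m k)) F
        \<le> L2_set (\<lambda>m. level_norm d n m (\<lambda>k. r m k - r' m k) + level_norm d n m (\<lambda>k. r' m k - r'' m k)) F"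
      proof (rule L2_set_mono)
        fix m
        show "level_norm d n m (\<lambda>k. r m k - r'' m k)
          \<le> level_norm d n m (\<lambda>k. r m k - r' m k) + level_norm d n m (\<lambda>k. r' m k - r'' m k)"
          unfolding level_norm_def
          using L2_set_triangle_ineq[of "\<lambda>k. r m k - r' m k" "\<lambda>k. r' m k - r'' m k" "level_index d n m"]
          by simp
      qed (simp add: level_norm_def)
      also have "\<dots> \<le> L2_set (\<lambda>m. level_norm d n m (\<lambda>k. r m k - r' m k)) F + L2_set (\<lambda>m. level_norm d n m (\<lambda>k. r' m k - r'' m k)) F"
        by (rule L2_set_triangle_ineq)
      also have "\<dots> \<le> H_dist d n r r' + H_dist d n r' r''"
        by (intro add_mono level_le_H_dist r F)
      finally have "(L2_set (\<lambda>m. level_norm d n m (\<lambda>k. r m k - r'' m k)) F)\<^sup>2 \<le> (H_dist d n r r' + H_dist d n r' r'')\<^sup>2"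
        by (intro power_mono) auto
      then show "(\<Sum>m\<in>F. (level_norm d n m (\<lambda>k. r m k - r'' m k))\<^sup>2) \<le> (H_dist d n r r' + H_dist d n r' r'')\<^sup>2"
        by (simp add: L2_set_def sum_nonneg)
    qed
    then show ?thesis by (rule power2_le_imp_le) (intro add_nonneg_nonneg nn)
  qed
qed

section \<open>Factorial decay and continuity\<close>

lemma level_indexD:
  assumes "(P, \<pi>) \<in> level_index d n m"
  shows "P \<in> {..<m} \<rightarrow>\<^sub>E ord_inj d n" "\<pi> \<in> {..<d} \<rightarrow>\<^sub>E {p. p permutes {..<m}}"
    "\<And>i. i < m \<Longrightarrow> P i \<in> ord_inj d n" "\<And>j. j < d \<Longrightarrow> \<pi> j permutes {..<m}"
  using assms by (auto simp: level_index_def)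

lemma bounded_borel_row:
  "bounded_borel {..<d} g \<Longrightarrow> i \<in> I \<Longrightarrow> (\<lambda>t. g (t i)) \<in> borel_measurable (cubes d I)"
  by (rule measurable_compose[OF measurable_row bounded_borelD])

text \<open>For \<open>m = 0\<close> the space is a single point and the empty product is 1, so the
  convention at level 0 agrees with the integral and all levels can be treated alike.\<close>

lemma sig_eq_integral:
  assumes "(P, \<pi>) \<in> level_index d n m"
  shows "sig d n e x m (P, \<pi>) = (LINT t|cubes d {..<m}. indicator (sig_domain d m \<pi> (\<lambda>_. 0) (\<lambda>_. 1)) t *
    (\<Prod>i<m. jac_minor d e x (P i) (t i)))"
proof (cases "m = 0")
  case True
  interpret prob_space "cubes d {}" by (rule prob_space_cubes)
  have "sig_domain d 0 \<pi> (\<lambda>_. 0) (\<lambda>_. 1) = {\<lambda>_. undefined}"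
    by (auto simp: sig_domain_def ord_simplex_def strict_mono_on_def)
  then have "(LINT t|cubes d {..<m}. indicator (sig_domain d m \<pi> (\<lambda>_. 0) (\<lambda>_. 1)) t *
    (\<Prod>i<m. jac_minor d e x (P i) (t i))) = (LINT t|cubes d {}. 1)"
    using True by (auto intro!: Bochner_Integration.integral_cong simp: space_PiM)
  then show ?thesis using assms True prob_space by (simp add: sig_def)
next
  case False
  then show ?thesis using assms by (simp add: sig_def sig_comp_def set_lebesgue_integral_def)
qed

lemma sig_entry_bound:
  assumes d: "d \<ge> 1" and x: "x \<in> Lip d" and k: "k \<in> level_index d n m"
  shows "\<bar>sig d n e x m k\<bar> \<le> Linf_norm d n (jac_minor d e x) ^ m / fact m ^ d"
proof -
  obtain P \<pi> where kk: "k = (P, \<pi>)" by (cases k)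
  note k = k[unfolded kk]
  note bb = bounded_borel_jac_minor[OF x]
  let ?N = "Linf_norm d n (jac_minor d e x)"
  have "AE t in cubes d {..<m}. \<forall>i\<in>{..<m}. \<bar>jac_minor d e x (P i) (t i)\<bar> \<le> ?N"
    using level_indexD(3)[OF k] by (intro AE_cubes_all AE_le_Linf_norm bb) auto
  then have "AE t in cubes d {..<m}. \<bar>\<Prod>i<m. jac_minor d e x (P i) (t i)\<bar> \<le> ?N ^ m"
  proof eventually_elim
    case (elim t)
    then have "(\<Prod>i<m. \<bar>jac_minor d e x (P i) (t i)\<bar>) \<le> (\<Prod>i<m. ?N)" by (intro prod_mono) auto
    then show ?case by (simp add: abs_prod)
  qed
  then show ?thesis
    unfolding kk sig_eq_integral[OF k]
    by (intro sig_integral_bound d level_indexD(4)[OF k] borel_measurable_prod bounded_borel_row bb)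
qed

text \<open>Telescoping over the factors. With \<open>1 \<le> R\<close> the single power
  \<open>R ^ m\<close> bounds every mixed product that arises.\<close>

lemma prod_diff_bound:
  fixes a b :: "nat \<Rightarrow> real"
  assumes "\<And>i. i < m \<Longrightarrow> \<bar>a i\<bar> \<le> R" "\<And>i. i < m \<Longrightarrow> \<bar>b i\<bar> \<le> R" "\<And>i. i < m \<Longrightarrow> \<bar>a i - b i\<bar> \<le> \<delta>" and R: "1 \<le> R"
  shows "\<bar>(\<Prod>i<m. a i) - (\<Prod>i<m. b i)\<bar> \<le> R ^ m * (real m * \<delta>)"
  using assms(1-3)
proof (induction m)
  case (Suc m)
  have \<delta>: "0 \<le> \<delta>" using Suc.prems(3)[of 0] by auto
  have pb: "\<bar>\<Prod>i<m. b i\<bar> \<le> R ^ m"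
  proof -
    have "(\<Prod>i<m. \<bar>b i\<bar>) \<le> (\<Prod>i<m. R)" using Suc.prems by (intro prod_mono) auto
    then show ?thesis by (simp add: abs_prod)
  qed
  have "(\<Prod>i<Suc m. a i) - (\<Prod>i<Suc m. b i)
    = a m * ((\<Prod>i<m. a i) - (\<Prod>i<m. b i)) + (a m - b m) * (\<Prod>i<m. b i)"
    by (simp add: algebra_simps)
  also have "\<bar>\<dots>\<bar> \<le> \<bar>a m\<bar> * \<bar>(\<Prod>i<m. a i) - (\<Prod>i<m. b i)\<bar> + \<bar>a m - b m\<bar> * \<bar>\<Prod>i<m. b i\<bar>"
    by (metis abs_mult abs_triangle_ineq)
  also have "\<dots> \<le> R * (R ^ m * (real m * \<delta>)) + \<delta> * R ^ m"
    using Suc R \<delta> pb by (intro add_mono mult_mono) auto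
  also have "\<delta> * R ^ m \<le> R * R ^ m * \<delta>"
    using mult_right_mono[OF R, of "R ^ m * \<delta>"] R \<delta> by (simp add: mult_ac)
  finally show ?case by (simp add: algebra_simps)
qed simp

text \<open>As the maps are at distance at most 1, \<open>R\<close> bounds the minors of both, and
  \<open>y\<close> enters the estimate only through the distance.\<close>

lemma sig_entry_diff_bound:
  assumes d: "d \<ge> 1" and x: "x \<in> Lip d" and y: "y \<in> Lip d" and k: "k \<in> level_index d n m"
    and close: "jac_dist d n e x y \<le> 1" and R: "R = Linf_norm d n (jac_minor d e x) + 1"
  shows "\<bar>sig d n e x m k - sig d n e y m k\<bar> \<le> R ^ m * (real m * jac_dist d n e x y) / fact m ^ d"
proof -
  obtain P \<pi> where kk: "k = (P, \<pi>)" by (cases k)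
  note k = k[unfolded kk]
  note bx = bounded_borel_jac_minor[OF x]
  interpret prob_space "cubes d {..<m}" by (rule prob_space_cubes)
  let ?D = "sig_domain d m \<pi> (\<lambda>_. 0) (\<lambda>_. 1)"
  have D[measurable]: "?D \<in> sets (cubes d {..<m})" by (rule sets_sig_domain[OF level_indexD(4)[OF k]])
  have "1 \<le> R" using R Linf_norm_nonneg by simp
  have ax: "AE t in cubes d {..<m}. \<forall>i\<in>{..<m}. \<bar>jac_minor d e x (P i) (t i)\<bar> \<le> Linf_norm d n (jac_minor d e x)"
    using level_indexD(3)[OF k] by (intro AE_cubes_all AE_le_Linf_norm bx) auto
  have ad: "AE t in cubes d {..<m}. \<forall>i\<in>{..<m}. \<bar>jac_minor d e x (P i) (t i) - jac_minor d e y (P i) (t i)\<bar> \<le> jac_dist d n e x y"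
    unfolding jac_dist_def using level_indexD(3)[OF k]
    by (intro AE_cubes_all AE_le_Linf_norm[where F="\<lambda>P s. jac_minor d e x P s - jac_minor d e y P s"] bounded_borel_jac_diff x y) auto
  have bound: "AE t in cubes d {..<m}. \<bar>(\<Prod>i<m. jac_minor d e x (P i) (t i)) - (\<Prod>i<m. jac_minor d e y (P i) (t i))\<bar>
      \<le> R ^ m * (real m * jac_dist d n e x y)"
    using ax ad
  proof eventually_elim
    case (elim t)
    show ?case
    proof (rule prod_diff_bound[OF _ _ _ \<open>1 \<le> R\<close>])
      fix i assume i: "i < m"
      have a: "\<bar>jac_minor d e x (P i) (t i)\<bar> \<le> Linf_norm d n (jac_minor d e x)"
        and b: "\<bar>jac_minor d e x (P i) (t i) - jac_minor d e y (P i) (t i)\<bar> \<le> jac_dist d n e x y"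
        using elim i by auto
      show "\<bar>jac_minor d e x (P i) (t i)\<bar> \<le> R" "\<bar>jac_minor d e y (P i) (t i)\<bar> \<le> R"
        using a b close R by linarith+
      show "\<bar>jac_minor d e x (P i) (t i) - jac_minor d e y (P i) (t i)\<bar> \<le> jac_dist d n e x y" by (rule b)
    qed
  qed
  have meas: "(\<lambda>t. \<Prod>i<m. jac_minor d e z (P i) (t i)) \<in> borel_measurable (cubes d {..<m})" if "z \<in> Lip d" for z
    by (intro borel_measurable_prod bounded_borel_row bounded_borel_jac_minor that)
  have int: "integrable (cubes d {..<m}) (\<lambda>t. indicator ?D t * (\<Prod>i<m. jac_minor d e z (P i) (t i)))" if z: "z \<in> Lip d" for z
  proof (rule integrable_const_bound[where B="Linf_norm d n (jac_minor d e z) ^ m"])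
    have "AE t in cubes d {..<m}. \<forall>i\<in>{..<m}. \<bar>jac_minor d e z (P i) (t i)\<bar> \<le> Linf_norm d n (jac_minor d e z)"
      using level_indexD(3)[OF k] by (intro AE_cubes_all AE_le_Linf_norm bounded_borel_jac_minor z) auto
    then show "AE t in cubes d {..<m}. norm (indicator ?D t * (\<Prod>i<m. jac_minor d e z (P i) (t i))) \<le> Linf_norm d n (jac_minor d e z) ^ m"
    proof eventually_elim
      case (elim t)
      then have "(\<Prod>i<m. \<bar>jac_minor d e z (P i) (t i)\<bar>) \<le> (\<Prod>i<m. Linf_norm d n (jac_minor d e z))" by (intro prod_mono) auto
      then show ?case by (auto simp: abs_prod Linf_norm_nonneg split: split_indicator)
    qed
  qed (use meas[OF z] in measurable)
  have "sig d n e x m k - sig d n e y m k = (LINT t|cubes d {..<m}. indicator ?D t *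
     ((\<Prod>i<m. jac_minor d e x (P i) (t i)) - (\<Prod>i<m. jac_minor d e y (P i) (t i))))"
    unfolding kk sig_eq_integral[OF k] right_diff_distrib
    by (rule Bochner_Integration.integral_diff[symmetric, OF int[OF x] int[OF y]])
  also have "\<bar>\<dots>\<bar> \<le> R ^ m * (real m * jac_dist d n e x y) / fact m ^ d"
    by (rule sig_integral_bound[OF d level_indexD(4)[OF k] _ bound]) (auto intro!: borel_measurable_diff meas x y)
  finally show ?thesis .
qed

text \<open>An increasing map is recovered from its image by sorting, so these maps inject into the
  \<open>d\<close>-element subsets.\<close>

lemma card_ord_inj_le: "card (ord_inj d n) \<le> n choose d"
proof -
  have "inj_on (\<lambda>P. P ` {..<d}) (ord_inj d n)"
  proof (rule inj_onI)
    fix P Q assume PQ: "P \<in> ord_inj d n" "Q \<in> ord_inj d n" "P ` {..<d} = Q ` {..<d}"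
    have "sorted_list_of_set (R ` {..<d}) = map R [0..<d]" if "R \<in> ord_inj d n" for R
    proof -
      have R: "strict_mono_on {..<d} R" using that by (simp add: ord_inj_def)
      have "sorted (map R [0..<d])"
        using strict_mono_on_leD[OF R] by (auto simp: sorted_iff_nth_mono)
      moreover have "distinct (map R [0..<d])"
        using strict_mono_on_imp_inj_on[OF R] by (simp add: distinct_map atLeast0LessThan)
      ultimately show ?thesis
        using sorted_list_of_set.idem_if_sorted_distinct[of "map R [0..<d]"] by (simp add: atLeast0LessThan)
    qed
    then have "map P [0..<d] = map Q [0..<d]" using PQ by metis
    then have "P i = Q i" if "i < d" for i using that by (metis map_eq_conv atLeastLessThan_iff set_upt zero_le)
    then show "P = Q" using PQ(1,2) by (intro PiE_ext[of P "{..<d}" "\<lambda>_. {..<n}" Q]) (auto simp: ord_inj_def)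
  qed
  moreover have "(\<lambda>P. P ` {..<d}) ` ord_inj d n \<subseteq> {S. S \<subseteq> {..<n} \<and> card S = d}"
    by (auto simp: ord_inj_def card_image strict_mono_on_imp_inj_on PiE_iff)
  ultimately have "card (ord_inj d n) \<le> card {S. S \<subseteq> {..<n} \<and> card S = d}"
    by (rule card_inj_on_le) auto
  then show ?thesis using n_subsets[of "{..<n}" d] by simp
qed

lemma card_level_index_le: "card (level_index d n m) \<le> (n choose d) ^ m * fact m ^ d"
  unfolding level_index_def card_cartesian_product permutation_families
  by (simp add: card_PiE card_ord_inj_le power_mono)

text \<open>There are at most \<open>(n choose d) ^ m * fact m ^ d\<close> coordinates, so summing
  squares cancels one of the two factors \<open>fact m ^ d\<close> in the denominator. This is the
  origin of the binomial and of the remaining factorial in the decay.\<close>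

lemma sum_level_index_bound:
  assumes "\<And>k. k \<in> level_index d n m \<Longrightarrow> \<bar>r k\<bar> \<le> c / fact m ^ d"
  shows "(level_norm d n m r)\<^sup>2 \<le> real (n choose d) ^ m * c\<^sup>2 / fact m ^ d"
proof -
  have "(level_norm d n m r)\<^sup>2 \<le> (\<Sum>k\<in>level_index d n m. (c / fact m ^ d)\<^sup>2)"
    unfolding level_norm_sq by (intro sum_mono power2_le_iff_abs_le[THEN iffD2] assms) (use assms in force)+
  also have "\<dots> = real (card (level_index d n m)) * (c / fact m ^ d)\<^sup>2" by simp
  also have "\<dots> \<le> real ((n choose d) ^ m * fact m ^ d) * (c / fact m ^ d)\<^sup>2"
    by (intro mult_right_mono of_nat_mono card_level_index_le) auto
  also have "\<dots> = real (n choose d) ^ m * c\<^sup>2 / fact m ^ d"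
    by (simp add: power2_eq_square field_simps)
  finally show ?thesis .
qed

text \<open>The exponent \<open>2 * m\<close> matches homogeneity: a coordinate of level
  \<open>m\<close> is a product of \<open>m\<close> minors under the integral, and the left side is
  a square.\<close>

lemma factorial_decay:
  assumes "d \<ge> 1" "x \<in> Lip d"
  shows "(level_norm d n m (sig d n e x m))\<^sup>2
    \<le> real (n choose d) ^ m * Linf_norm d n (jac_minor d e x) ^ (2 * m) / fact m ^ d"
proof -
  have "(level_norm d n m (sig d n e x m))\<^sup>2
    \<le> real (n choose d) ^ m * (Linf_norm d n (jac_minor d e x) ^ m)\<^sup>2 / fact m ^ d"
    by (intro sum_level_index_bound sig_entry_bound[OF assms])
  then show ?thesis by (simp only: power_mult[symmetric] mult.commute[of m 2])
qed

lemma sum_exp_le: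
  fixes a :: real
  assumes "a \<ge> 0" "finite F"
  shows "(\<Sum>m\<in>F. a ^ m / fact m) \<le> exp a"
proof -
  have "(\<Sum>m\<in>F. a ^ m / fact m) \<le> (\<Sum>m. a ^ m / fact m)"
    using assms summable_exp[of a] by (intro sum_le_suminf) (auto simp: divide_inverse mult.commute)
  also have "\<dots> = exp a" by (simp add: exp_def divide_inverse mult.commute)
  finally show ?thesis .
qed

text \<open>Weakening \<open>fact m ^ d\<close> to \<open>fact m\<close> brings the level bounds
  under the exponential series.\<close>

lemma inverse_fact_power_le: "d \<ge> 1 \<Longrightarrow> 0 \<le> a \<Longrightarrow> a / fact m ^ d \<le> a / (fact m :: real)"
  by (intro divide_left_mono self_le_power) auto

lemma sig_in_H_space:
  assumes d: "d \<ge> 1" and x: "x \<in> Lip d"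
  shows "sig d n e x \<in> H_space d n"
proof -
  let ?a = "real (n choose d) * (Linf_norm d n (jac_minor d e x))\<^sup>2"
  have "(\<lambda>m. (level_norm d n m (sig d n e x m))\<^sup>2) summable_on UNIV"
  proof (rule nonneg_bdd_above_summable_on)
    show "bdd_above (sum (\<lambda>m. (level_norm d n m (sig d n e x m))\<^sup>2) ` {F. F \<subseteq> UNIV \<and> finite F})"
    proof (rule bdd_aboveI2)
      fix F :: "nat set" assume "F \<in> {F. F \<subseteq> UNIV \<and> finite F}"
      have "(level_norm d n m (sig d n e x m))\<^sup>2 \<le> ?a ^ m / fact m" for m
        using factorial_decay[OF assms, of n m e] inverse_fact_power_le[OF d, of "?a ^ m" m]
        by (simp add: power_mult power_mult_distrib)
      then have "(\<Sum>m\<in>F. (level_norm d n m (sig d n e x m))\<^sup>2) \<le> (\<Sum>m\<in>F. ?a ^ m / fact m)"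
        by (rule sum_mono)
      also have "\<dots> \<le> exp ?a" using \<open>F \<in> _\<close> by (intro sum_exp_le) auto
      finally show "(\<Sum>m\<in>F. (level_norm d n m (sig d n e x m))\<^sup>2) \<le> exp ?a" .
    qed
  qed auto
  then show ?thesis by (auto simp: H_space_def T_space_def sig_def)
qed

lemma sig_dist_bound:
  assumes d: "d \<ge> 1" and x: "x \<in> Lip d" and y: "y \<in> Lip d" and close: "jac_dist d n e x y \<le> 1"
  shows "H_dist d n (sig d n e x) (sig d n e y)
    \<le> jac_dist d n e x y * exp (2 * real (n choose d) * (Linf_norm d n (jac_minor d e x) + 1)\<^sup>2)"
proof -
  let ?R = "Linf_norm d n (jac_minor d e x) + 1" and ?\<delta> = "jac_dist d n e x y"
  \<comment> \<open>The factor 4 absorbs the square of \<open>real m\<close> through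
    \<open>m4\<close>, and \<open>exp ?a\<close> is the square of the exponential in the
    claim.\<close>
  let ?a = "4 * real (n choose d) * ?R\<^sup>2"
  have m4: "(real m)\<^sup>2 \<le> 4 ^ m" for m
  proof -
    have "real m \<le> 2 ^ m" by (metis less_exp of_nat_le_iff of_nat_numeral of_nat_power less_imp_le)
    then have "(real m)\<^sup>2 \<le> (2 ^ m)\<^sup>2" by (intro power_mono) auto
    then show ?thesis by (simp add: power2_eq_square power_mult_distrib[symmetric])
  qed
  have level: "(level_norm d n m (\<lambda>k. sig d n e x m k - sig d n e y m k))\<^sup>2 \<le> ?\<delta>\<^sup>2 * (?a ^ m / fact m)" for m
  proof -
    have "(level_norm d n m (\<lambda>k. sig d n e x m k - sig d n e y m k))\<^sup>2
      \<le> real (n choose d) ^ m * (?R ^ m * (real m * ?\<delta>))\<^sup>2 / fact m ^ d"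
      by (intro sum_level_index_bound sig_entry_diff_bound[OF d x y _ close refl])
    also have "\<dots> \<le> real (n choose d) ^ m * (?R ^ m * (real m * ?\<delta>))\<^sup>2 / fact m"
      by (intro inverse_fact_power_le d) auto
    also have "\<dots> \<le> real (n choose d) ^ m * ((?R\<^sup>2) ^ m * (4 ^ m * ?\<delta>\<^sup>2)) / fact m"
      unfolding power_mult_distrib[of _ _ 2] power_mult[symmetric] mult.commute[of 2 m] 
      by (intro divide_right_mono mult_left_mono mult_right_mono m4)
        (auto intro!: zero_le_power add_nonneg_nonneg Linf_norm_nonneg)
    also have "\<dots> = ?\<delta>\<^sup>2 * (?a ^ m / fact m)" by (simp add: power_mult_distrib mult_ac)
    finally show ?thesis .
  qed
  have "(H_dist d n (sig d n e x) (sig d n e y))\<^sup>2 \<le> ?\<delta>\<^sup>2 * exp ?a"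
    unfolding H_dist_sq
  proof (rule infsum_le_finite_sums[OF H_space_diff_summable])
    fix F :: "nat set" assume F: "finite F"
    have "(\<Sum>m\<in>F. (level_norm d n m (\<lambda>k. sig d n e x m k - sig d n e y m k))\<^sup>2) \<le> ?\<delta>\<^sup>2 * (\<Sum>m\<in>F. ?a ^ m / fact m)"
      unfolding sum_distrib_left by (intro sum_mono level)
    also have "\<dots> \<le> ?\<delta>\<^sup>2 * exp ?a"
      using F by (intro mult_left_mono sum_exp_le) auto
    finally show "(\<Sum>m\<in>F. (level_norm d n m (\<lambda>k. sig d n e x m k - sig d n e y m k))\<^sup>2) \<le> ?\<delta>\<^sup>2 * exp ?a" .
  qed (intro sig_in_H_space d x y)+
  also have "\<dots> = (?\<delta> * exp (2 * real (n choose d) * ?R\<^sup>2))\<^sup>2"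
    by (simp add: power_mult_distrib exp_double[symmetric] mult.assoc)
  finally show ?thesis
    by (rule power2_le_imp_le) (simp add: jac_dist_nonneg)
qed

lemma continuous_map_sigJ:
  assumes d: "d \<ge> 1"
  shows "continuous_map (LipJ_topology d n e) (H_topology d n) (sigJ d n e)"
proof -
  interpret M: Metric_space "LipJ d n e" "mu_inf d n e" by (rule Metric_space_LipJ)
  show ?thesis
    unfolding M.metric_continuous_map[OF Metric_space_H_space]
  proof (intro conjI ballI allI impI)
    show "sigJ d n e ` LipJ d n e \<subseteq> H_space d n"
      by (auto simp: sigJ_def intro!: sig_in_H_space d LipJ_rep(2))
    fix X \<epsilon> assume X: "X \<in> LipJ d n e" and \<epsilon>: "(0::real) < \<epsilon>"
    \<comment> \<open>The local Lipschitz constant depends on the centre \<open>X\<close> alone; the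
      radius below is capped at 1 to meet the closeness hypothesis of
      \<open>sig_dist_bound\<close>.\<close>
    define K where "K = exp (2 * real (n choose d) * (Linf_norm d n (jac_minor d e (SOME x. x \<in> X)) + 1)\<^sup>2)"
    have K: "0 < K" by (simp add: K_def)
    show "\<exists>\<delta>>0. \<forall>Y. Y \<in> LipJ d n e \<and> mu_inf d n e X Y < \<delta> \<longrightarrow> H_dist d n (sigJ d n e X) (sigJ d n e Y) < \<epsilon>"
    proof (intro exI[of _ "min 1 (\<epsilon> / K)"] conjI allI impI)
      fix Y assume Y: "Y \<in> LipJ d n e \<and> mu_inf d n e X Y < min 1 (\<epsilon> / K)"
      then have "H_dist d n (sigJ d n e X) (sigJ d n e Y) \<le> mu_inf d n e X Y * K"
        unfolding sigJ_def mu_inf_def K_def by (intro sig_dist_bound d LipJ_rep(2)[OF X] LipJ_rep(2)[of Y]) auto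
      also have "\<dots> < \<epsilon>" using Y K by (simp add: less_divide_eq)
      finally show "H_dist d n (sigJ d n e X) (sigJ d n e Y) < \<epsilon>" .
    qed (use \<epsilon> K in simp)
  qed
qed

lemma sig_respects: "sig d n e respects jac_equiv d n e"
proof (rule congruentI)
  fix x y assume xy: "(x, y) \<in> jac_equiv d n e"
  then have x: "x \<in> Lip d" and y: "y \<in> Lip d"
    and ae: "AE s in cube_measure {..<d}. \<forall>P\<in>ord_inj d n. jac_minor d e x P s = jac_minor d e y P s"
    by (auto simp: jac_equiv_def)
  have "sig d n e x m (P, \<pi>) = sig d n e y m (P, \<pi>)" for m P \<pi>
  proof (cases "(P, \<pi>) \<in> level_index d n m")
    case True
    have [measurable]: "sig_domain d m \<pi> (\<lambda>_. 0) (\<lambda>_. 1) \<in> sets (cubes d {..<m})"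
      by (rule sets_sig_domain[OF level_indexD(4)[OF True]])
    have [measurable]: "(\<lambda>t. \<Prod>i<m. jac_minor d e z (P i) (t i)) \<in> borel_measurable (cubes d {..<m})" if "z \<in> Lip d" for z
      by (intro borel_measurable_prod bounded_borel_row bounded_borel_jac_minor that)
    have "AE t in cubes d {..<m}. \<forall>i\<in>{..<m}. \<forall>P\<in>ord_inj d n. jac_minor d e x P (t i) = jac_minor d e y P (t i)"
      by (intro AE_cubes_all ae) auto
    then have "AE t in cubes d {..<m}. indicator (sig_domain d m \<pi> (\<lambda>_. 0) (\<lambda>_. 1)) t * (\<Prod>i<m. jac_minor d e x (P i) (t i))
      = indicator (sig_domain d m \<pi> (\<lambda>_. 0) (\<lambda>_. 1)) t * (\<Prod>i<m. jac_minor d e y (P i) (t i))"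
      using level_indexD(3)[OF True] by (auto elim!: eventually_mono intro!: prod.cong)
    then show ?thesis
      unfolding sig_eq_integral[OF True] using x y by (intro integral_cong_AE) measurable
  qed (simp add: sig_def)
  then show "sig d n e x = sig d n e y" by (intro ext) (metis surj_pair)
qed

section \<open>Transport of signatures under maps of the cube\<close>

lemma prod_rows_bounded:
  assumes "\<And>i. i \<in> I \<Longrightarrow> bounded_borel {..<d} (g i)"
  obtains K where "0 \<le> K" "\<And>D t. t \<in> space (cubes d I) \<Longrightarrow> \<bar>indicator D t * (\<Prod>i\<in>I. g i (t i))\<bar> \<le> K"
proof -
  obtain B where B: "\<And>i s. i \<in> I \<Longrightarrow> s \<in> unit_cube {..<d} \<Longrightarrow> \<bar>g i s\<bar> \<le> B i"
    using assms unfolding bounded_borel_def by metis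
  show thesis
  proof (rule that[of "\<bar>\<Prod>i\<in>I. B i\<bar>"])
    fix D and t assume t: "t \<in> space (cubes d I)"
    have "(\<Prod>i\<in>I. \<bar>g i (t i)\<bar>) \<le> (\<Prod>i\<in>I. B i)"
      using B cubesD[OF t] by (intro prod_mono) auto
    then have "\<bar>\<Prod>i\<in>I. g i (t i)\<bar> \<le> \<bar>\<Prod>i\<in>I. B i\<bar>" unfolding abs_prod[symmetric] by linarith
    then show "\<bar>indicator D t * (\<Prod>i\<in>I. g i (t i))\<bar> \<le> \<bar>\<Prod>i\<in>I. B i\<bar>"
      by (cases "t \<in> D") simp_all
  qed simp
qed

lemma integrable_sig:
  assumes D: "D \<in> sets (cubes d I)" and I: "finite I" and g: "\<And>i. i \<in> I \<Longrightarrow> bounded_borel {..<d} (g i)"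
  shows "integrable (cubes d I) (\<lambda>t. indicator D t * (\<Prod>i\<in>I. g i (t i)))"
proof -
  interpret prob_space "cubes d I" by (rule prob_space_cubes)
  obtain K where K: "0 \<le> K" "\<And>D t. t \<in> space (cubes d I) \<Longrightarrow> \<bar>indicator D t * (\<Prod>i\<in>I. g i (t i))\<bar> \<le> K"
    using prod_rows_bounded[of I d g, OF g] by metis
  show ?thesis
  proof (rule integrable_const_bound[where B=K])
    show "AE t in cubes d I. norm (indicator D t * (\<Prod>i\<in>I. g i (t i))) \<le> K"
      using K(2) by (intro AE_I2) simp
    show "(\<lambda>t. indicator D t * (\<Prod>i\<in>I. g i (t i))) \<in> borel_measurable (cubes d I)"
      by (intro borel_measurable_times borel_measurable_indicator D borel_measurable_prod bounded_borel_row g)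
  qed
qed

lemma measurable_prod_rows:
  fixes g :: "nat \<Rightarrow> point \<Rightarrow> real"
  assumes "\<And>i. i \<in> I \<Longrightarrow> g i \<in> borel_measurable (cube_measure {..<d})"
  shows "(\<lambda>t. \<Prod>i\<in>I. g i (t i)) \<in> borel_measurable (cubes d I)"
  by (rule borel_measurable_prod, rule measurable_compose[OF measurable_row], assumption, rule assms)

text \<open>The maps may differ from row to row, as they do for a concatenation. Where some weight
  vanishes both integrands are zero, so the domains have to correspond only at points with nonzero
  weights.\<close>

lemma transport_integral:
  fixes g h :: "nat \<Rightarrow> point \<Rightarrow> real"
  assumes I: "finite I" and wm: "\<And>i. i \<in> I \<Longrightarrow> weighted_map (cube_measure {..<d}) (w i) (\<psi> i)"
    and g: "\<And>i. i \<in> I \<Longrightarrow> g i \<in> borel_measurable (cube_measure {..<d})"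
    and h: "\<And>i. i \<in> I \<Longrightarrow> h i \<in> borel_measurable (cube_measure {..<d})"
    and eq: "\<And>i. i \<in> I \<Longrightarrow> AE s in cube_measure {..<d}. g i s = c i * (w i s * h i (\<psi> i s))"
    and D: "D \<in> sets (cubes d I)" "D' \<in> sets (cubes d I)"
    and dom: "\<And>t. t \<in> space (cubes d I) \<Longrightarrow> (\<And>i. i \<in> I \<Longrightarrow> w i (t i) \<noteq> 0) \<Longrightarrow>
      t \<in> D \<longleftrightarrow> (\<lambda>i\<in>I. \<psi> i (t i)) \<in> D'"
  shows "(LINT t|cubes d I. indicator D t * (\<Prod>i\<in>I. g i (t i)))
    = (\<Prod>i\<in>I. c i) * (LINT t|cubes d I. indicator D' t * (\<Prod>i\<in>I. h i (t i)))"
proof -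
  have W: "weighted_map (cubes d I) (\<lambda>t. \<Prod>i\<in>I. w i (t i)) (\<lambda>t. \<lambda>i\<in>I. \<psi> i (t i))"
    by (intro weighted_map_PiM I prob_space_cube wm)
  have T: "(\<lambda>t. \<lambda>i\<in>I. \<psi> i (t i)) \<in> measurable (cubes d I) (cubes d I)"
    and Wm: "(\<lambda>t. \<Prod>i\<in>I. w i (t i)) \<in> borel_measurable (cubes d I)"
    using W by (auto simp: weighted_map_def)
  define F where "F t = indicator D' t * (\<Prod>i\<in>I. h i (t i))" for t
  have F: "F \<in> borel_measurable (cubes d I)"
    unfolding F_def by (intro borel_measurable_times borel_measurable_indicator D measurable_prod_rows h)
  have "AE t in cubes d I. \<forall>i\<in>I. g i (t i) = c i * (w i (t i) * h i (\<psi> i (t i)))"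
    by (intro AE_cubes_all I eq)
  moreover have "AE t in cubes d I. t \<in> space (cubes d I)" by (rule AE_space)
  ultimately have "AE t in cubes d I. indicator D t * (\<Prod>i\<in>I. g i (t i))
      = (\<Prod>i\<in>I. c i) * ((\<Prod>i\<in>I. w i (t i)) * F (\<lambda>i\<in>I. \<psi> i (t i)))"
  proof eventually_elim
    case (elim t)
    have "(\<Prod>i\<in>I. g i (t i)) = (\<Prod>i\<in>I. c i) * ((\<Prod>i\<in>I. w i (t i)) * (\<Prod>i\<in>I. h i (\<psi> i (t i))))"
      using elim(1) by (simp add: prod.distrib)
    moreover have "(\<Prod>i\<in>I. w i (t i)) = 0 \<or> (t \<in> D \<longleftrightarrow> (\<lambda>i\<in>I. \<psi> i (t i)) \<in> D')"
      using dom[OF elim(2)] I by (auto simp: prod_zero_iff)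
    ultimately show ?case
      by (auto simp: F_def split: split_indicator)
  qed
  then have "(LINT t|cubes d I. indicator D t * (\<Prod>i\<in>I. g i (t i)))
    = (LINT t|cubes d I. (\<Prod>i\<in>I. c i) * ((\<Prod>i\<in>I. w i (t i)) * F (\<lambda>i\<in>I. \<psi> i (t i))))"
    by (intro integral_cong_AE borel_measurable_times borel_measurable_indicator borel_measurable_const
        D measurable_prod_rows g Wm measurable_compose[OF T F])
  also have "\<dots> = (\<Prod>i\<in>I. c i) * (LINT t|cubes d I. F t)"
    by (simp add: integral_weighted_map[OF W F])
  finally show ?thesis unfolding F_def .
qed

text \<open>The case of one map for all rows: \<open>c\<close> is 1 for reparametrizations and a
  sign for symmetries of the cube, and it occurs once for each of the \<open>m\<close> rows.\<close>

lemma transport_sig: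
  assumes k: "(P, \<pi>) \<in> level_index d n m" "(P, \<pi>') \<in> level_index d n m"
    and wm: "weighted_map (cube_measure {..<d}) w \<psi>" and x: "x \<in> Lip d"
    and z: "\<And>v. sections_continuous {..<d} (\<lambda>s. inner (z s) v)"
    and eq: "\<And>P. P \<in> ord_inj d n \<Longrightarrow>
      AE s in cube_measure {..<d}. jac_minor d e z P s = c * (w s * jac_minor d e x P (\<psi> s))"
    and dom: "\<And>t. t \<in> space (cubes d {..<m}) \<Longrightarrow>
      t \<in> sig_domain d m \<pi> (\<lambda>_. 0) (\<lambda>_. 1) \<longleftrightarrow> (\<lambda>i\<in>{..<m}. \<psi> (t i)) \<in> sig_domain d m \<pi>' (\<lambda>_. 0) (\<lambda>_. 1)"
  shows "sig d n e z m (P, \<pi>) = c ^ m * sig d n e x m (P, \<pi>')"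
proof -
  have "sig d n e z m (P, \<pi>) = (\<Prod>i<m. c) * sig d n e x m (P, \<pi>')"
    unfolding sig_eq_integral[OF k(1)] sig_eq_integral[OF k(2)]
  proof (rule transport_integral[where w="\<lambda>_. w" and \<psi>="\<lambda>_. \<psi>"])
    show "jac_minor d e z (P i) \<in> borel_measurable (cube_measure {..<d})" for i
      by (rule borel_measurable_jac_minor[OF z])
    show "jac_minor d e x (P i) \<in> borel_measurable (cube_measure {..<d})" for i
      by (rule bounded_borelD[OF bounded_borel_jac_minor[OF x]])
    show "AE s in cube_measure {..<d}. jac_minor d e z (P i) s = c * (w s * jac_minor d e x (P i) (\<psi> s))"
      if "i \<in> {..<m}" for i
      using level_indexD(3)[OF k(1)] that by (intro eq) simp
    show "sig_domain d m \<pi> (\<lambda>_. 0) (\<lambda>_. 1) \<in> sets (cubes d {..<m})"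
      "sig_domain d m \<pi>' (\<lambda>_. 0) (\<lambda>_. 1) \<in> sets (cubes d {..<m})"
      by (rule sets_sig_domain[OF level_indexD(4)[OF k(1)]], assumption,
          rule sets_sig_domain[OF level_indexD(4)[OF k(2)]], assumption)
  qed (use wm dom in auto)
  then show ?thesis by simp
qed

section \<open>Reparametrization\<close>

lemma has_vector_derivative_mono_nonneg:
  fixes f :: "real \<Rightarrow> real"
  assumes "mono_on {0..1} f" "continuous_on {0..1} f" "c \<in> {0..1}"
    and "(f has_vector_derivative l) (at c within {0..1})"
  shows "0 \<le> l"
proof -
  have "0 \<le> (f u - f c) / (u - c)" if "u \<in> {0..1}" "u \<noteq> c" for u
    using mono_onD[OF assms(1), of u c] mono_onD[OF assms(1), of c u] that assms(3)
    by (cases "u \<le> c") (auto simp: divide_nonneg_pos divide_nonpos_neg)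
  then have "ereal 0 \<le> dini f c" by (intro dini_ge[of 1 c 0 f]) (use assms(3) in auto)
  then show ?thesis using assms by (simp add: has_vector_derivative_iff_dini)
qed

lemma weighted_map_I01:
  fixes \<psi> w :: "real \<Rightarrow> real"
  assumes \<psi>: "continuous_on {0..1} \<psi>" "mono_on {0..1} \<psi>" "\<psi> 0 = 0" "\<psi> 1 = 1"
    and w: "w \<in> borel_measurable borel" "\<And>u. 0 \<le> w u"
    and int: "\<And>c. c \<in> {0..1} \<Longrightarrow> (\<integral>\<^sup>+u. ennreal (w u) * indicator {0..c} u \<partial>lborel) = ennreal (\<psi> c)"
  shows "weighted_map I01 w \<psi>"
proof -
  have "\<psi> \<in> measurable I01 I01"
  proof (rule measurable_restrict_space2)
    show "\<psi> \<in> space I01 \<rightarrow> {0..1}"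
      using \<psi> mono_onD[OF \<psi>(2), of 0] mono_onD[OF \<psi>(2), of _ 1] by auto
    have "\<psi> \<in> borel_measurable I01"
      using borel_measurable_continuous_on_restrict[OF \<psi>(1)]
      by (simp add: measurable_cong_sets[OF sets_restrict_space_cong[OF sets_lborel] refl])
    then show "\<psi> \<in> measurable I01 lborel" by (simp add: measurable_lborel1)
  qed
  then show ?thesis
    unfolding weighted_map_def using measurable_I01[OF w(1)] w(2) distr_density_I01[OF \<psi> w(1) int] by auto
qed

lemma lipschitz_bijection_weight:
  fixes \<psi> :: "real \<Rightarrow> real"
  assumes L: "L-lipschitz_on {0..1} \<psi>" and bij: "bij_betw \<psi> {0..1} {0..1}" and mono: "mono_on {0..1} \<psi>"
  obtains w where "weighted_map I01 w \<psi>" "\<And>u. 0 \<le> w u"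
    "AE u in I01. (\<psi> has_vector_derivative w u) (at u within {0..1})"
proof -
  have cont: "continuous_on {0..1} \<psi>" by (rule lipschitz_on_continuous_on[OF L])
  have img: "\<psi> ` {0..1} = {0..1}" using bij by (simp add: bij_betw_def)
  have "0 \<in> \<psi> ` {0..1}" "1 \<in> \<psi> ` {0..1}" unfolding img by auto
  then obtain a b where ab: "a \<in> {0..1}" "\<psi> a = 0" "b \<in> {0..1}" "\<psi> b = 1"
    by (metis imageE)
  have r: "\<psi> u \<in> {0..1}" if "u \<in> {0..1}" for u using img that by blast
  have \<psi>0: "\<psi> 0 = 0" using mono_onD[OF mono, of 0 a] ab r[of 0] by auto
  have \<psi>1: "\<psi> 1 = 1" using mono_onD[OF mono, of b 1] ab r[of 1] by auto
  obtain g where g: "g \<in> borel_measurable borel"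
    "AE u in I01. (\<psi> has_vector_derivative g u) (at u within {0..1})"
    "\<And>c. c \<in> {0..1} \<Longrightarrow> set_integrable lborel {0..c} g"
    "\<And>c. c \<in> {0..1} \<Longrightarrow> \<psi> c - \<psi> 0 = (LINT u:{0..c}|lborel. g u)"
    using lipschitz_ftc[OF L] by blast
  \<comment> \<open>Truncation at 0 makes the weight nonnegative at every point; as
    \<open>\<psi>\<close> is increasing, it alters \<open>g\<close> only on a null set.\<close>
  define w where "w u = max 0 (g u)" for u
  have wm[measurable]: "w \<in> borel_measurable borel" unfolding w_def using g(1) by measurable
  have g_nonneg: "AE u in I01. 0 \<le> g u"
    using g(2) AE_space
  proof eventually_elim
    case (elim u)
    then show ?case using has_vector_derivative_mono_nonneg[OF mono cont] by simp
  qed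
  have int: "(\<integral>\<^sup>+u. ennreal (w u) * indicator {0..c} u \<partial>lborel) = ennreal (\<psi> c)" if c: "c \<in> {0..1}" for c
  proof -
    have nn: "AE u in lborel. 0 \<le> indicator {0..c} u *\<^sub>R g u"
      using g_nonneg c unfolding AE_I01_iff by (elim eventually_mono) (auto split: split_indicator)
    have "(\<integral>\<^sup>+u. ennreal (w u) * indicator {0..c} u \<partial>lborel) = (\<integral>\<^sup>+u. ennreal (indicator {0..c} u *\<^sub>R g u) \<partial>lborel)"
      using nn by (intro nn_integral_cong_AE) (auto elim!: eventually_mono simp: w_def max_def split: split_indicator)
    also have "\<dots> = ennreal (LINT u:{0..c}|lborel. g u)"
      using g(3)[OF c] nn unfolding set_integrable_def set_lebesgue_integral_def by (intro nn_integral_eq_integral) auto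
    finally show ?thesis using g(4)[OF c] \<psi>0 by simp
  qed
  show thesis
  proof
    show "weighted_map I01 w \<psi>"
      by (rule weighted_map_I01[OF cont mono \<psi>0 \<psi>1 wm _ int]) (simp_all add: w_def)
    show "0 \<le> w u" for u by (simp add: w_def)
    show "AE u in I01. (\<psi> has_vector_derivative w u) (at u within {0..1})"
      using g(2) g_nonneg by eventually_elim (simp add: w_def)
  qed
qed

lemma reparam_upd: "j < d \<Longrightarrow> reparam d \<psi> (s(j := u)) = (reparam d \<psi> s)(j := \<psi> j u)"
  by (auto simp: reparam_def fun_eq_iff)

lemma reparam_unit_cube:
  assumes "\<And>i u. i < d \<Longrightarrow> u \<in> {0..1} \<Longrightarrow> \<psi> i u \<in> {0..1}" "s \<in> unit_cube {..<d}"
  shows "reparam d \<psi> s \<in> unit_cube {..<d}"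
  unfolding reparam_def unit_cube_def using assms(1) unit_cubeD[OF assms(2)] by (intro restrict_PiE_iff[THEN iffD2] ballI) simp

text \<open>Where \<open>\<psi>\<close> has vanishing derivative, the composition with a Lipschitz function is differentiable
  even if that function is not.\<close>

lemma has_partial_reparam:
  fixes f :: "point \<Rightarrow> real"
  assumes f: "f \<in> Lip d" and j: "j < d" and s: "s \<in> unit_cube {..<d}"
    and \<psi>: "\<And>i u. i < d \<Longrightarrow> u \<in> {0..1} \<Longrightarrow> \<psi> i u \<in> {0..1}"
    and c: "(\<psi> j has_vector_derivative c) (at (s j) within {0..1})"
    and l: "c = 0 \<or> has_partial j f l (reparam d \<psi> s)"
  shows "has_partial j (f \<circ> reparam d \<psi>) (c * l) s"
proof -
  have sj: "s j \<in> {0..1}" using s j by (auto dest: unit_cubeD)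
  have rs: "reparam d \<psi> s \<in> unit_cube {..<d}"
    by (rule reparam_unit_cube[OF \<psi> s])
  obtain L where L: "L \<ge> 0" "L-lipschitz_on {0..1} (\<lambda>u. f ((reparam d \<psi> s)(j := u)))"
    using Lip_section[OF f] rs j by metis
  let ?G = "\<lambda>v. f ((reparam d \<psi> s)(j := v))"
  have eq: "(\<lambda>u. (f \<circ> reparam d \<psi>) (s(j := u))) = ?G \<circ> \<psi> j"
    using j by (simp add: fun_eq_iff reparam_upd)
  show ?thesis
  proof (cases "c = 0")
    case False
    then have "(?G has_vector_derivative l) (at (\<psi> j (s j)) within {0..1})"
      using l j by (simp add: reparam_def)
    then have "(?G has_vector_derivative l) (at (\<psi> j (s j)) within \<psi> j ` {0..1})"
      by (rule has_vector_derivative_within_subset) (use \<psi> j in auto)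
    from vector_diff_chain_within[OF c this] show ?thesis unfolding eq by simp
  next
    case True
    have "((?G \<circ> \<psi> j) has_field_derivative 0) (at (s j) within {0..1})"
      unfolding has_field_derivative_iff
    \<comment> \<open>The difference quotient of the composite is at most \<open>L\<close> times
      that of \<open>\<psi> j\<close>, which tends to 0.\<close>
    proof (rule Lim_null_comparison)
      have "((\<lambda>u. (\<psi> j u - \<psi> j (s j)) / (u - s j)) \<longlongrightarrow> 0) (at (s j) within {0..1})"
        using c True unfolding has_real_derivative_iff_has_vector_derivative[symmetric] has_field_derivative_iff by simp
      then have "((\<lambda>u. \<bar>(\<psi> j u - \<psi> j (s j)) / (u - s j)\<bar>) \<longlongrightarrow> 0) (at (s j) within {0..1})"
        by (rule tendsto_rabs_zero)
      then show "((\<lambda>u. L * \<bar>(\<psi> j u - \<psi> j (s j)) / (u - s j)\<bar>) \<longlongrightarrow> 0) (at (s j) within {0..1})"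
        by (rule tendsto_mult_right_zero)
      show "\<forall>\<^sub>F u in at (s j) within {0..1}. norm (((?G \<circ> \<psi> j) u - (?G \<circ> \<psi> j) (s j)) / (u - s j))
        \<le> L * \<bar>(\<psi> j u - \<psi> j (s j)) / (u - s j)\<bar>"
        unfolding eventually_at_filter
      proof (rule always_eventually, intro allI impI)
        fix u assume "u \<noteq> s j" "u \<in> {0..1}"
        then have "\<bar>?G (\<psi> j u) - ?G (\<psi> j (s j))\<bar> \<le> L * \<bar>\<psi> j u - \<psi> j (s j)\<bar>"
          using lipschitz_onD[OF L(2), of "\<psi> j u" "\<psi> j (s j)"] \<psi>[OF j] sj by (simp add: dist_real_def)
        then show "norm (((?G \<circ> \<psi> j) u - (?G \<circ> \<psi> j) (s j)) / (u - s j)) \<le> L * \<bar>(\<psi> j u - \<psi> j (s j)) / (u - s j)\<bar>"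
          by (simp add: divide_right_mono)
      qed
    qed
    then show ?thesis unfolding eq using True by (simp add: has_real_derivative_iff_has_vector_derivative)
  qed
qed

lemma AE_all_partials:
  fixes x :: "point \<Rightarrow> 'v::real_inner"
  assumes x: "x \<in> Lip d"
  shows "AE s in cube_measure {..<d}. \<forall>i\<in>{..<n::nat}. \<forall>j\<in>{..<d}.
    has_partial j (\<lambda>u. inner (x u) (e i)) (partial j (\<lambda>u. inner (x u) (e i)) s) s"
  by (intro AE_finite_allI AE_has_partial Lip_inner x) auto

lemma sections_continuous_reparam:
  assumes f: "f \<in> Lip d" and m: "reparam d \<psi> \<in> measurable (cube_measure {..<d}) (cube_measure {..<d})"
    and c: "\<And>j. j < d \<Longrightarrow> continuous_on {0..1} (\<psi> j)" and r: "\<And>i u. i < d \<Longrightarrow> u \<in> {0..1} \<Longrightarrow> \<psi> i u \<in> {0..1}"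
  shows "sections_continuous {..<d} (f \<circ> reparam d \<psi>)"
  unfolding sections_continuous_def
proof (intro conjI ballI)
  show "f \<circ> reparam d \<psi> \<in> borel_measurable (cube_measure {..<d})"
    by (rule measurable_comp[OF m borel_measurable_Lip[OF f]])
  fix s j assume s: "s \<in> unit_cube {..<d}" "j \<in> {..<d}"
  then have "reparam d \<psi> s \<in> unit_cube {..<d}" by (intro reparam_unit_cube r)
  then have "continuous_on {0..1} (\<lambda>v. f ((reparam d \<psi> s)(j := v)))"
    using sections_continuous_Lip[OF f] s by (simp add: sections_continuous_def)
  then have "continuous_on {0..1} (\<lambda>u. f ((reparam d \<psi> s)(j := \<psi> j u)))"
    by (rule continuous_on_compose2) (use c r s in auto)
  then show "continuous_on {0..1} (\<lambda>u. (f \<circ> reparam d \<psi>) (s(j := u)))"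
    using s by (simp add: reparam_upd)
qed

lemma sig_reparam:
  fixes x :: "point \<Rightarrow> 'v::real_inner"
  assumes x: "x \<in> Lip d"
    and \<psi>: "\<forall>j<d. (\<exists>L. L-lipschitz_on {0..1} (\<psi> j)) \<and> bij_betw (\<psi> j) {0..1} {0..1} \<and> mono_on {0..1} (\<psi> j)"
  shows "sig d n e (x \<circ> reparam d \<psi>) = sig d n e x"
proof -
  have "\<exists>w. j < d \<longrightarrow> weighted_map I01 w (\<psi> j) \<and> (\<forall>u. 0 \<le> w u) \<and>
    (AE u in I01. (\<psi> j has_vector_derivative w u) (at u within {0..1}))" for j
    using \<psi> lipschitz_bijection_weight[of _ "\<psi> j"] by metis
  then obtain w where w: "\<And>j. j < d \<Longrightarrow> weighted_map I01 (w j) (\<psi> j)" "\<And>j u. j < d \<Longrightarrow> 0 \<le> w j u"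
    "\<And>j. j < d \<Longrightarrow> AE u in I01. (\<psi> j has_vector_derivative w j u) (at u within {0..1})"
    by metis
  have cont: "continuous_on {0..1} (\<psi> j)" if "j < d" for j
    using \<psi> that lipschitz_on_continuous_on by blast
  have r: "\<psi> j u \<in> {0..1}" if "j < d" "u \<in> {0..1}" for j u
    using \<psi> that bij_betw_apply by metis
  define W where "W s = (\<Prod>j<d. w j (s j))" for s :: point
  have wm: "weighted_map (cube_measure {..<d}) W (reparam d \<psi>)"
    unfolding cube_measure_def W_def reparam_def[abs_def]
    by (intro weighted_map_PiM prob_space_I01 w) auto
  have sc: "sections_continuous {..<d} (\<lambda>s. inner ((x \<circ> reparam d \<psi>) s) v)" for v
    using sections_continuous_reparam[OF Lip_inner[OF x, of v] _ cont r] wm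
    by (simp add: comp_def weighted_map_def)
  have wderiv: "AE s in cube_measure {..<d}. \<forall>j\<in>{..<d}. (\<psi> j has_vector_derivative w j (s j)) (at (s j) within {0..1})"
  proof (rule AE_finite_allI)
    fix j assume j: "j \<in> {..<d}"
    then show "AE s in cube_measure {..<d}. (\<psi> j has_vector_derivative w j (s j)) (at (s j) within {0..1})"
      unfolding cube_measure_def
      using AE_PiM_component[of "{..<d}" "\<lambda>_. I01" j, OF prob_space_I01 j w(3)] by simp
  qed simp
  have jac: "AE s in cube_measure {..<d}. jac_minor d e (x \<circ> reparam d \<psi>) P s = 1 * (W s * jac_minor d e x P (reparam d \<psi> s))"
    if P: "P \<in> ord_inj d n" for P
    using wderiv AE_weighted_map[OF wm AE_all_partials[OF x, of n e]] AE_space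
  proof eventually_elim
    case (elim s)
    then have s: "s \<in> unit_cube {..<d}" by (simp add: space_cube)
    define D where "D j i = partial j (\<lambda>u. inner (x u) (e (P i))) (reparam d \<psi> s)" for i j
    have Pn: "P i < n" if "i < d" for i using P that by (auto simp: ord_inj_def)
    have part: "partial j (\<lambda>u. inner ((x \<circ> reparam d \<psi>) u) (e (P i))) s = w j (s j) * D j i"
      if "j < d" "i < d" and nz: "w j (s j) = 0 \<or> W s > 0" for i j
    proof (rule partial_eqI)
      show "s j \<in> {0..1}" using s that by (auto dest: unit_cubeD)
      have "has_partial j ((\<lambda>u. inner (x u) (e (P i))) \<circ> reparam d \<psi>) (w j (s j) * D j i) s"
        by (rule has_partial_reparam[OF Lip_inner[OF x] \<open>j < d\<close> s r])
          (use elim that Pn in \<open>auto simp: D_def\<close>)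
      then show "has_partial j (\<lambda>u. inner ((x \<circ> reparam d \<psi>) u) (e (P i))) (w j (s j) * D j i) s"
        by (simp add: comp_def)
    qed
    show ?case
    \<comment> \<open>If the weight of direction \<open>j\<close> vanishes, \<open>x\<close> may
      fail to be differentiable at the image point and only column \<open>j\<close> of the Jacobian
      matrix is known; it is zero, so both sides vanish. Otherwise \<open>W s\<close> is positive
      and the partial derivatives of \<open>x\<close> exist at the image point.\<close>
    proof (cases "\<exists>j<d. w j (s j) = 0")
      case True
      then obtain j where j: "j < d" "w j (s j) = 0" by blast
      then have W0: "W s = 0" unfolding W_def by (intro prod_zero) auto
      have H: "(\<Prod>i<d. partial (p i) (\<lambda>u. inner ((x \<circ> reparam d \<psi>) u) (e (P i))) s) = 0" if p: "p permutes {..<d}" for p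
      proof (rule prod_zero)
        have "inv_into UNIV p j < d" using permutes_less[OF permutes_inv[OF p]] j by simp
        then show "\<exists>i\<in>{..<d}. partial (p i) (\<lambda>u. inner ((x \<circ> reparam d \<psi>) u) (e (P i))) s = 0"
          using part[of j] j permutes_inverses(1)[OF p] by (intro bexI[of _ "inv_into UNIV p j"]) auto
      qed simp
      have "jac_minor d e (x \<circ> reparam d \<psi>) P s = 0"
        unfolding jac_minor_permutations
      proof (rule sum.neutral, rule ballI)
        fix p assume "p \<in> {p. p permutes {..<d}}"
        then have "p permutes {..<d}" by simp
        from H[OF this] show "of_int (sign p) * (\<Prod>i<d. partial (p i) (\<lambda>u. inner ((x \<circ> reparam d \<psi>) u) (e (P i))) s) = 0"
          by (simp only: mult_zero_right)
      qed
      then show ?thesis using W0 by simp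
    next
      case False
      then have W: "W s > 0" unfolding W_def using w(2) by (intro prod_pos) (auto simp: less_le)
      have "jac_minor d e (x \<circ> reparam d \<psi>) P s = (\<Prod>j<d. w j (s j)) * jac_minor d e x P (reparam d \<psi> s)"
        by (rule jac_minor_scale) (use part W in \<open>auto simp: D_def\<close>)
      then show ?thesis by (simp add: W_def)
    qed
  qed
  have "sig d n e (x \<circ> reparam d \<psi>) m (P, \<pi>) = sig d n e x m (P, \<pi>)" for m P \<pi>
  proof (cases "(P, \<pi>) \<in> level_index d n m")
    case True
    have dom: "t \<in> sig_domain d m \<pi> (\<lambda>_. 0) (\<lambda>_. 1) \<longleftrightarrow> (\<lambda>i\<in>{..<m}. reparam d \<psi> (t i)) \<in> sig_domain d m \<pi> (\<lambda>_. 0) (\<lambda>_. 1)"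
      if t: "t \<in> space (cubes d {..<m})" for t
    proof -
      have less: "\<psi> j u < \<psi> j v \<longleftrightarrow> u < v" if "j < d" "u \<in> {0..1}" "v \<in> {0..1}" for j u v
      proof -
        have inj: "inj_on (\<psi> j) {0..1}" and mono: "mono_on {0..1} (\<psi> j)"
          using \<psi> that(1) bij_betw_imp_inj_on by blast+
        have "u \<le> v \<Longrightarrow> \<psi> j u \<le> \<psi> j v" "v \<le> u \<Longrightarrow> \<psi> j v \<le> \<psi> j u" "\<psi> j u = \<psi> j v \<Longrightarrow> u = v"
          using that mono_onD[OF mono] inj_onD[OF inj] by blast+
        then show ?thesis by linarith
      qed
      have t01: "t i j \<in> {0..1}" if "i < m" "j < d" for i j
        using unit_cubeD[OF cubesD[OF t]] that by blast
      have \<pi>: "\<pi> j i < m" if "j < d" "i < m" for i j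
        using permutes_less[OF level_indexD(4)[OF True]] that by blast
      have rt: "(\<lambda>i\<in>{..<m}. reparam d \<psi> (t i)) \<in> space (cubes d {..<m})"
        using cubesD[OF t] by (auto simp: space_cubes intro!: reparam_unit_cube r)
      show ?thesis
        using t rt t01 \<pi> r
        by (simp add: sig_domain_eq[OF level_indexD(4)[OF True]] reparam_def less)
    qed
    show ?thesis
      using transport_sig[OF True True wm x sc jac dom] by simp
  qed (simp add: sig_def)
  then show ?thesis by (intro ext) (metis surj_pair)
qed

section \<open>Symmetries of the cube\<close>

lemma sig_domain_unit_eq:
  assumes "\<And>j. j < d \<Longrightarrow> \<pi> j permutes {..<m}"
  shows "sig_domain d m \<pi> (\<lambda>_. 0) (\<lambda>_. 1) =
    {t \<in> space (cubes d {..<m}). \<forall>j<d. strict_mono_on {..<m} (\<lambda>i. t (\<pi> j i) j)}"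
proof -
  have "t (\<pi> j i) j \<in> {0..1}" if "t \<in> space (cubes d {..<m})" "j < d" "i < m" for t i j
    using unit_cubeD[OF cubesD[OF that(1)]] permutes_less[OF assms] that by blast
  then show ?thesis by (auto simp: sig_domain_def ord_simplex_def space_cubes)
qed

lemma weighted_map_comp:
  assumes "weighted_map M w \<psi>" "\<phi> \<in> measurable M M" "distr M M \<phi> = M"
  shows "weighted_map M w (\<lambda>x. \<phi> (\<psi> x))"
proof -
  note w = assms(1)[unfolded weighted_map_def]
  have "distr (density M (\<lambda>x. ennreal (w x))) M (\<phi> \<circ> \<psi>) = distr (distr (density M (\<lambda>x. ennreal (w x))) M \<psi>) M \<phi>"
    by (rule distr_distr[symmetric]) (use w assms(2) in auto)
  then show ?thesis
    using w assms by (auto simp: weighted_map_def comp_def intro: measurable_compose)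
qed

lemma weighted_map_cube_sym:
  assumes \<sigma>: "\<sigma> permutes {..<d}"
  shows "weighted_map (cube_measure {..<d}) (\<lambda>_. 1) (cube_sym d \<tau> \<sigma>)"
proof -
  define R where "R s = (\<lambda>j\<in>{..<d}. if \<tau> j then 1 - s j else s j)" for s :: point
  define S where "S s = (\<lambda>k\<in>{..<d}. s (\<sigma> k))" for s :: point
  have "weighted_map I01 (\<lambda>_. 1) (\<lambda>u. if \<tau> j then 1 - u else u)" for j
  proof (cases "\<tau> j")
    case True
    have "(\<lambda>u. 1 - u) \<in> measurable I01 I01"
      by (intro measurable_restrict_space2) (auto intro!: measurable_I01 simp: measurable_lborel1)
    then show ?thesis using True distr_reflect_I01 by (simp add: weighted_map_distr)
  qed (simp add: weighted_map_distr distr_id)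
  then have "weighted_map (cube_measure {..<d}) (\<lambda>s. \<Prod>j<d. 1) R"
    unfolding cube_measure_def R_def
    by (intro weighted_map_PiM[where w="\<lambda>_ _. 1" and \<psi>="\<lambda>j u. if \<tau> j then 1 - u else u"] prob_space_I01) auto
  then have R: "weighted_map (cube_measure {..<d}) (\<lambda>_. 1) R" by simp
  have S: "S \<in> measurable (cube_measure {..<d}) (cube_measure {..<d})"
    unfolding cube_measure_def S_def using permutes_less[OF \<sigma>]
    by (intro measurable_restrict measurable_component_singleton) auto
  have "distr (cube_measure {..<d}) (cube_measure {..<d}) S = cube_measure {..<d}"
    unfolding cube_measure_def S_def using permutes_less[OF \<sigma>] permutes_inj_on[OF \<sigma>]
    by (intro distr_PiM_reindex prob_space_I01) auto
  from weighted_map_comp[OF R S this]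
  have "weighted_map (cube_measure {..<d}) (\<lambda>_. 1) (\<lambda>s. S (R s))" .
  moreover have "(\<lambda>s. S (R s)) = cube_sym d \<tau> \<sigma>"
    using permutes_less[OF \<sigma>] by (auto simp: fun_eq_iff S_def R_def cube_sym_def)
  ultimately show ?thesis by simp
qed

lemma cube_sym_unit_cube:
  assumes "\<sigma> permutes {..<d}" "s \<in> unit_cube {..<d}"
  shows "cube_sym d \<tau> \<sigma> s \<in> unit_cube {..<d}"
  unfolding cube_sym_def unit_cube_def
  using unit_cubeD[OF assms(2)] permutes_less[OF assms(1)] by (intro restrict_PiE_iff[THEN iffD2] ballI) auto

text \<open>\<open>cube_sym\<close> reads coordinate \<open>\<sigma> k\<close> into place
  \<open>k\<close>, so a change of coordinate \<open>j\<close> shows up at the place that the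
  inverse permutation assigns to \<open>j\<close>.\<close>

lemma cube_sym_upd:
  assumes "\<sigma> permutes {..<d}" "j < d"
  shows "cube_sym d \<tau> \<sigma> (s(j := u)) = (cube_sym d \<tau> \<sigma> s)(inv_into UNIV \<sigma> j := if \<tau> j then 1 - u else u)"
  using permutes_inverses[OF assms(1)] permutes_less[OF permutes_inv[OF assms(1)] assms(2)]
  by (auto simp: cube_sym_def fun_eq_iff)

lemma has_partial_cube_sym:
  assumes \<sigma>: "\<sigma> permutes {..<d}" and j: "j < d" and s: "s \<in> unit_cube {..<d}"
    and l: "has_partial (inv_into UNIV \<sigma> j) f l (cube_sym d \<tau> \<sigma> s)"
  shows "has_partial j (f \<circ> cube_sym d \<tau> \<sigma>) ((if \<tau> j then -1 else 1) * l) s"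
proof -
  let ?h = "\<lambda>u::real. if \<tau> j then 1 - u else u" and ?k = "inv_into UNIV \<sigma> j"
  let ?G = "\<lambda>v. f ((cube_sym d \<tau> \<sigma> s)(?k := v))"
  have sj: "s j \<in> {0..1}" using s j by (auto dest: unit_cubeD)
  have eq: "(\<lambda>u. (f \<circ> cube_sym d \<tau> \<sigma>) (s(j := u))) = ?G \<circ> ?h"
    using \<sigma> j by (simp add: fun_eq_iff cube_sym_upd)
  have h: "(?h has_vector_derivative (if \<tau> j then -1 else 1)) (at (s j) within {0..1})"
    by (auto intro!: derivative_eq_intros)
  have k: "cube_sym d \<tau> \<sigma> s ?k = ?h (s j)"
    using permutes_inverses(1)[OF \<sigma>] permutes_less[OF permutes_inv[OF \<sigma>] j] by (simp add: cube_sym_def)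
  have "(?G has_vector_derivative l) (at (?h (s j)) within {0..1})" using l k by simp
  then have "(?G has_vector_derivative l) (at (?h (s j)) within ?h ` {0..1})"
    by (rule has_vector_derivative_within_subset) auto
  from vector_diff_chain_within[OF h this] show ?thesis unfolding eq by simp
qed

lemma sections_continuous_cube_sym:
  assumes \<sigma>: "\<sigma> permutes {..<d}" and f: "f \<in> Lip d"
  shows "sections_continuous {..<d} (f \<circ> cube_sym d \<tau> \<sigma>)"
  unfolding sections_continuous_def
proof (intro conjI ballI)
  show "f \<circ> cube_sym d \<tau> \<sigma> \<in> borel_measurable (cube_measure {..<d})"
    using weighted_map_cube_sym[OF \<sigma>] by (intro measurable_comp[OF _ borel_measurable_Lip[OF f]]) (auto simp: weighted_map_def)
  fix s j assume s: "s \<in> unit_cube {..<d}" "j \<in> {..<d}"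
  have k: "inv_into UNIV \<sigma> j \<in> {..<d}" using permutes_less[OF permutes_inv[OF \<sigma>]] s by simp
  have "continuous_on {0..1} (\<lambda>v. f ((cube_sym d \<tau> \<sigma> s)(inv_into UNIV \<sigma> j := v)))"
    using sections_continuous_Lip[OF f] cube_sym_unit_cube[OF \<sigma> s(1)] k by (simp add: sections_continuous_def)
  then have "continuous_on {0..1} (\<lambda>u. f ((cube_sym d \<tau> \<sigma> s)(inv_into UNIV \<sigma> j := if \<tau> j then 1 - u else u)))"
  proof (rule continuous_on_compose2)
    show "continuous_on {0..1} (\<lambda>u::real. if \<tau> j then 1 - u else u)"
      by (cases "\<tau> j") (auto intro!: continuous_intros)
  qed auto
  then show "continuous_on {0..1} (\<lambda>u. (f \<circ> cube_sym d \<tau> \<sigma>) (s(j := u)))"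
    using s \<sigma> by (simp add: cube_sym_upd)
qed

lemma permutes_rev_perm:
  assumes "p permutes {..<m}"
  shows "rev_perm m p permutes {..<m}"
proof -
  have "(\<lambda>i. if i < m then m - 1 - i else i) permutes {..<m}"
    by (rule bij_imp_permutes, rule bij_betw_byWitness[where f'="\<lambda>i. m - 1 - i"]) auto
  then have "p \<circ> (\<lambda>i. if i < m then m - 1 - i else i) permutes {..<m}"
    using assms by (rule permutes_compose)
  moreover have "p \<circ> (\<lambda>i. if i < m then m - 1 - i else i) = rev_perm m p"
    using assms by (auto simp: rev_perm_def fun_eq_iff permutes_def)
  ultimately show ?thesis by simp
qed

lemma strict_mono_on_reflect:
  fixes g :: "nat \<Rightarrow> real"
  shows "strict_mono_on {..<m} (\<lambda>i. 1 - g (m - 1 - i)) \<longleftrightarrow> strict_mono_on {..<m} g"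
proof
  assume a: "strict_mono_on {..<m} (\<lambda>i. 1 - g (m - 1 - i))"
  show "strict_mono_on {..<m} g"
  proof (rule strict_mono_onI)
    fix i k assume ik: "i \<in> {..<m}" "k \<in> {..<m}" "i < k"
    then have "1 - g (m - 1 - (m - 1 - k)) < 1 - g (m - 1 - (m - 1 - i))"
      by (intro strict_mono_onD[OF a]) auto
    then show "g i < g k" using ik by simp
  qed
next
  assume a: "strict_mono_on {..<m} g"
  show "strict_mono_on {..<m} (\<lambda>i. 1 - g (m - 1 - i))"
  proof (rule strict_mono_onI)
    fix i k assume ik: "i \<in> {..<m}" "k \<in> {..<m}" "i < k"
    then have "g (m - 1 - k) < g (m - 1 - i)" by (intro strict_mono_onD[OF a]) auto
    then show "1 - g (m - 1 - i) < 1 - g (m - 1 - k)" by simp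
  qed
qed

text \<open>Reflecting a coordinate reverses the order of the entries in its column, which
  \<open>rev_perm\<close> compensates by reading the column backwards; \<open>\<sigma>\<close>
  merely relabels columns.\<close>

lemma cube_sym_sig_domain:
  assumes \<sigma>: "\<sigma> permutes {..<d}" and \<pi>: "\<And>j. j < d \<Longrightarrow> \<pi> j permutes {..<m}" and t: "t \<in> space (cubes d {..<m})"
  shows "t \<in> sig_domain d m \<pi> (\<lambda>_. 0) (\<lambda>_. 1) \<longleftrightarrow>
    (\<lambda>i\<in>{..<m}. cube_sym d \<tau> \<sigma> (t i)) \<in> sig_domain d m (perm_sym d m \<tau> \<sigma> \<pi>) (\<lambda>_. 0) (\<lambda>_. 1)"
proof -
  let ?t = "\<lambda>i\<in>{..<m}. cube_sym d \<tau> \<sigma> (t i)" and ?\<pi> = "perm_sym d m \<tau> \<sigma> \<pi>"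
  have t': "?t \<in> space (cubes d {..<m})"
    using cubesD[OF t] by (auto simp: space_cubes intro!: cube_sym_unit_cube[OF \<sigma>])
  have \<sigma>_less: "\<sigma> k < d" if "k < d" for k by (rule permutes_less[OF \<sigma> that])
  have \<pi>': "?\<pi> k permutes {..<m}" if "k < d" for k
    using \<pi>[OF \<sigma>_less[OF that]] that by (auto simp: perm_sym_def intro: permutes_rev_perm)
  have "strict_mono_on {..<m} (\<lambda>i. ?t (?\<pi> k i) k) \<longleftrightarrow> strict_mono_on {..<m} (\<lambda>i. t (\<pi> (\<sigma> k) i) (\<sigma> k))" if k: "k < d" for k
  proof -
    have "?t (?\<pi> k i) k = (if \<tau> (\<sigma> k) then 1 - t (\<pi> (\<sigma> k) (m - 1 - i)) (\<sigma> k) else t (\<pi> (\<sigma> k) i) (\<sigma> k))" if "i < m" for i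
      using that k permutes_less[OF \<pi>' that, of k] by (auto simp: perm_sym_def cube_sym_def rev_perm_def)
    then have "strict_mono_on {..<m} (\<lambda>i. ?t (?\<pi> k i) k) \<longleftrightarrow>
      strict_mono_on {..<m} (\<lambda>i. if \<tau> (\<sigma> k) then 1 - t (\<pi> (\<sigma> k) (m - 1 - i)) (\<sigma> k) else t (\<pi> (\<sigma> k) i) (\<sigma> k))"
      by (simp add: strict_mono_on_def)
    also have "\<dots> \<longleftrightarrow> strict_mono_on {..<m} (\<lambda>i. t (\<pi> (\<sigma> k) i) (\<sigma> k))"
      using strict_mono_on_reflect[of m "\<lambda>i. t (\<pi> (\<sigma> k) i) (\<sigma> k)"] by (cases "\<tau> (\<sigma> k)") simp_all
    finally show ?thesis .
  qed
  then have "(\<forall>k<d. strict_mono_on {..<m} (\<lambda>i. ?t (?\<pi> k i) k)) \<longleftrightarrow> (\<forall>k<d. strict_mono_on {..<m} (\<lambda>i. t (\<pi> (\<sigma> k) i) (\<sigma> k)))"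
    by blast
  also have "\<dots> \<longleftrightarrow> (\<forall>j<d. strict_mono_on {..<m} (\<lambda>i. t (\<pi> j i) j))"
    using \<sigma>_less permutes_less[OF permutes_inv[OF \<sigma>]] permutes_inverses(1)[OF \<sigma>] by metis
  finally show ?thesis
    using t t' by (simp only: sig_domain_unit_eq[OF \<pi>] sig_domain_unit_eq[OF \<pi>'] mem_Collect_eq simp_thms)
qed

lemma sig_cube_sym:
  fixes x :: "point \<Rightarrow> 'v::real_inner"
  assumes x: "x \<in> Lip d" and \<sigma>: "\<sigma> permutes {..<d}"
  shows "sig d n e (x \<circ> cube_sym d \<tau> \<sigma>) = hyperoct_act d n \<tau> \<sigma> (sig d n e x)"
proof -
  \<comment> \<open>Each reflected coordinate changes the sign of one column of the Jacobian matrix,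
    and permuting columns contributes the sign of the inverse of \<open>\<sigma>\<close>, equal to
    that of \<open>\<sigma>\<close>. One factor \<open>c\<close> arises per row, hence
    \<open>c ^ m\<close> below.\<close>
  define c :: real where "c = (-1) ^ card {j\<in>{..<d}. \<tau> j} * of_int (sign \<sigma>)"
  note wm = weighted_map_cube_sym[OF \<sigma>, of \<tau>]
  have sc: "sections_continuous {..<d} (\<lambda>s. inner ((x \<circ> cube_sym d \<tau> \<sigma>) s) v)" for v
    using sections_continuous_cube_sym[OF \<sigma> Lip_inner[OF x, of v]] by (simp add: comp_def)
  let ?\<iota> = "inv_into UNIV \<sigma>"
  have \<iota>: "?\<iota> permutes {..<d}" by (rule permutes_inv[OF \<sigma>])
  have "AE s in cube_measure {..<d}. 0 < (1::real) \<longrightarrow> (\<forall>i\<in>{..<n}. \<forall>j\<in>{..<d}.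
    has_partial j (\<lambda>u. inner (x u) (e i)) (partial j (\<lambda>u. inner (x u) (e i)) (cube_sym d \<tau> \<sigma> s)) (cube_sym d \<tau> \<sigma> s))"
    by (rule AE_weighted_map[OF wm AE_all_partials[OF x]])
  then have jac: "AE s in cube_measure {..<d}. jac_minor d e (x \<circ> cube_sym d \<tau> \<sigma>) P s = c * (1 * jac_minor d e x P (cube_sym d \<tau> \<sigma> s))"
    if P: "P \<in> ord_inj d n" for P
    using AE_space
  proof eventually_elim
    case (elim s)
    then have s: "s \<in> unit_cube {..<d}" by (simp add: space_cube)
    define D where "D j i = partial j (\<lambda>u. inner (x u) (e (P i))) (cube_sym d \<tau> \<sigma> s)" for i j
    have Pn: "P i < n" if "i < d" for i using P that by (auto simp: ord_inj_def)
    define sg :: "nat \<Rightarrow> real" where "sg j = (if \<tau> j then -1 else 1)" for j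
    have part: "partial j (\<lambda>u. inner ((x \<circ> cube_sym d \<tau> \<sigma>) u) (e (P i))) s = sg j * D (?\<iota> j) i"
      if "j < d" "i < d" for i j
    proof (rule partial_eqI)
      show "s j \<in> {0..1}" using s that by (auto dest: unit_cubeD)
      have "has_partial j ((\<lambda>u. inner (x u) (e (P i))) \<circ> cube_sym d \<tau> \<sigma>) (sg j * D (?\<iota> j) i) s"
        unfolding sg_def using elim(1) Pn permutes_less[OF \<iota>] that
        by (intro has_partial_cube_sym[OF \<sigma> \<open>j < d\<close> s]) (auto simp: D_def)
      then show "has_partial j (\<lambda>u. inner ((x \<circ> cube_sym d \<tau> \<sigma>) u) (e (P i))) (sg j * D (?\<iota> j) i) s"
        by (simp add: comp_def)
    qed
    have sg: "(\<Prod>j<d. sg j) = (-1) ^ card {j\<in>{..<d}. \<tau> j}"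
      unfolding sg_def by (simp add: prod.inter_filter[symmetric] del: lessThan_iff)
    have "jac_minor d e (x \<circ> cube_sym d \<tau> \<sigma>) P s =
        (\<Prod>j<d. sg j) * (of_int (sign ?\<iota>) * jac_minor d e x P (cube_sym d \<tau> \<sigma> s))"
    proof (rule jac_minor_scale_permute[OF \<iota>, where c=sg])
      fix i j assume ij: "i < d" "j < d"
      show "partial j (\<lambda>u. inner ((x \<circ> cube_sym d \<tau> \<sigma>) u) (e (P i))) s =
          sg j * partial (?\<iota> j) (\<lambda>u. inner (x u) (e (P i))) (cube_sym d \<tau> \<sigma> s)"
        using part[OF ij(2,1)] by (simp only: D_def)
    qed
    also have "sign ?\<iota> = sign \<sigma>"
      using \<sigma> by (intro sign_inverse permutes_imp_permutation[of "{..<d}"]) simp_all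
    finally show ?case by (simp only: c_def sg mult_1 mult.assoc)
  qed
  have "sig d n e (x \<circ> cube_sym d \<tau> \<sigma>) m (P, \<pi>) = hyperoct_act d n \<tau> \<sigma> (sig d n e x) m (P, \<pi>)" for m P \<pi>
  proof (cases "(P, \<pi>) \<in> level_index d n m")
    case True
    have "perm_sym d m \<tau> \<sigma> \<pi> \<in> {..<d} \<rightarrow>\<^sub>E {p. p permutes {..<m}}"
      using level_indexD(4)[OF True] permutes_less[OF \<sigma>] by (auto simp: perm_sym_def intro!: permutes_rev_perm)
    then have k': "(P, perm_sym d m \<tau> \<sigma> \<pi>) \<in> level_index d n m"
      using True by (simp add: level_index_def)
    have "sig d n e (x \<circ> cube_sym d \<tau> \<sigma>) m (P, \<pi>) = c ^ m * sig d n e x m (P, perm_sym d m \<tau> \<sigma> \<pi>)"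
      by (rule transport_sig[OF True k' wm x sc jac cube_sym_sig_domain[OF \<sigma> level_indexD(4)[OF True]]])
    moreover have "c = (-1) ^ (card {j\<in>{..<d}. \<tau> j} + (if evenperm \<sigma> then 0 else 1))"
      by (simp add: c_def sign_def power_add)
    ultimately show ?thesis using True by (simp add: hyperoct_act_def power_mult[symmetric] mult.commute)
  qed (simp add: sig_def hyperoct_act_def)
  then show ?thesis by (intro ext) (metis surj_pair)
qed

section \<open>The Cauchy-Binet formula and equivariance under linear maps\<close>

lemma sorting_permutation_exists:
  fixes f :: "nat \<Rightarrow> real"
  assumes inj: "inj_on f {..<m}"
  obtains p where "p permutes {..<m}" "strict_mono_on {..<m} (\<lambda>i. f (p i))"
proof -
  define xs where "xs = sort_key f [0..<m]"
  define p where "p i = (if i < m then xs ! i else i)" for i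
  have xs: "length xs = m" "set xs = {..<m}" "distinct xs" "sorted (map f xs)"
    by (auto simp: xs_def)
  have "bij_betw ((!) xs) {..<m} {..<m}" by (rule bij_betw_nth) (simp_all only: xs)
  then have "bij_betw p {..<m} {..<m}" by (rule bij_betw_cong[THEN iffD1, rotated]) (simp add: p_def)
  then have p: "p permutes {..<m}" by (rule bij_imp_permutes) (simp add: p_def)
  moreover have "strict_mono_on {..<m} (\<lambda>i. f (p i))"
  proof (rule strict_mono_onI)
    fix i k assume ik: "i \<in> {..<m}" "k \<in> {..<m}" "i < k"
    then have "f (xs ! i) \<le> f (xs ! k)" using sorted_nth_mono[OF xs(4), of i k] xs(1) by simp
    moreover have "p i \<noteq> p k" using ik xs by (simp add: p_def nth_eq_iff_index_eq)
    then have "f (p i) \<noteq> f (p k)"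
      using inj permutes_less[OF p] ik by (auto simp: inj_on_def)
    ultimately show "f (p i) < f (p k)" using ik by (simp add: p_def)
  qed
  ultimately show thesis by (rule that)
qed

abbreviation mdet :: "nat \<Rightarrow> (nat \<Rightarrow> nat \<Rightarrow> real) \<Rightarrow> real" where
  "mdet d M \<equiv> Determinant.det (Matrix.mat d d (\<lambda>(i, j). M i j))"

lemma mdet_permutations:
  "mdet d M = (\<Sum>p\<in>{p. p permutes {..<d}}. of_int (sign p) * (\<Prod>i<d. M i (p i)))"
proof -
  have "mdet d M = (\<Sum>p\<in>{p. p permutes {0..<d}}.
     of_int (sign p) * (\<Prod>i=0..<d. Matrix.mat d d (\<lambda>(i, j). M i j) $$ (i, p i)))"
    by (subst det_def') (auto intro!: sum.cong)
  also have "\<dots> = (\<Sum>p\<in>{p. p permutes {0..<d}}. of_int (sign p) * (\<Prod>i=0..<d. M i (p i)))"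
    by (intro sum.cong refl arg_cong2[where f="(*)"] prod.cong) (auto simp: permutes_less atLeast0LessThan)
  finally show ?thesis by (simp add: atLeast0LessThan)
qed

lemma mdet_permute_rows:
  assumes "q permutes {..<d}"
  shows "mdet d (\<lambda>i. M (q i)) = of_int (sign q) * mdet d M"
proof -
  have "Matrix.mat d d (\<lambda>(i, j). M (q i) j) = Matrix.mat d d (\<lambda>(i, j). Matrix.mat d d (\<lambda>(i, j). M i j) $$ (q i, j))"
    using permutes_less[OF assms] by (intro cong_mat) auto
  then show ?thesis
    using det_permute_rows[of "Matrix.mat d d (\<lambda>(i, j). M i j)" d q] assms by (simp add: atLeast0LessThan)
qed

lemma mdet_identical_rows:
  assumes "i < d" "k < d" "i \<noteq> k" "M i = M k"
  shows "mdet d M = 0"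
  by (rule det_identical_rows[where n=d and i=i and j=k]) (use assms in \<open>auto intro!: eq_vecI\<close>)

text \<open>Every injection factors uniquely as a permutation followed by an increasing map; the
  permutation is the inverse of the one that sorts the values.\<close>

lemma bij_betw_ord_inj:
  "bij_betw (\<lambda>(P, q). \<lambda>i\<in>{..<d}. P (q i)) (ord_inj d n \<times> {q. q permutes {..<d}})
    {f \<in> {..<d} \<rightarrow>\<^sub>E {..<n}. inj_on f {..<d}}"
  unfolding bij_betw_def
proof
  let ?F = "\<lambda>(P, q). \<lambda>i\<in>{..<d}. P (q i)"
  show "inj_on ?F (ord_inj d n \<times> {q. q permutes {..<d}})"
  proof (rule inj_onI, clarify)
    fix P q P' q'
    assume P: "P \<in> ord_inj d n" "P' \<in> ord_inj d n" and q: "q permutes {..<d}" "q' permutes {..<d}"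
      and eq: "(\<lambda>i\<in>{..<d}. P (q i)) = (\<lambda>i\<in>{..<d}. P' (q' i))"
    have eq': "P (q i) = P' (q' i)" if "i < d" for i using fun_cong[OF eq, of i] that by simp
    let ?f = "\<lambda>i. real (P (q i))" and ?\<iota> = "inv_into UNIV q" and ?\<iota>' = "inv_into UNIV q'"
    have \<iota>: "?\<iota> permutes {..<d}" "?\<iota>' permutes {..<d}" using q by (auto intro: permutes_inv)
    have f: "?f (?\<iota> i) = P i" for i using permutes_inverses(1)[OF q(1)] by simp
    have f': "?f (?\<iota>' i) = P' i" if "i < d" for i
      using eq'[OF permutes_less[OF \<iota>(2) that]] permutes_inverses(1)[OF q(2)] by simp
    have "?\<iota> = ?\<iota>'"
    proof (rule sorting_permutation_unique[where f="?f", OF \<iota>(1) _ \<iota>(2)])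
      show "strict_mono_on {..<d} (\<lambda>i. ?f (?\<iota> i))" using P(1) unfolding f by (simp add: ord_inj_def strict_mono_on_def)
      show "strict_mono_on {..<d} (\<lambda>i. ?f (?\<iota>' i))" using P(2) f' by (simp add: ord_inj_def strict_mono_on_def)
    qed
    then have qq: "q = q'" using permutes_inv_inv[OF q(1)] permutes_inv_inv[OF q(2)] by metis
    have "P i = P' i" if "i \<in> {..<d}" for i
      using f[of i] f'[of i] that \<open>?\<iota> = ?\<iota>'\<close> by simp
    then have "P = P'" using P by (intro PiE_ext[of P "{..<d}" "\<lambda>_. {..<n}" P']) (auto simp: ord_inj_def)
    then show "P = P' \<and> q = q'" using qq by simp
  qed
  show "?F ` (ord_inj d n \<times> {q. q permutes {..<d}}) = {f \<in> {..<d} \<rightarrow>\<^sub>E {..<n}. inj_on f {..<d}}"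
  proof (intro subset_antisym subsetI)
    fix f assume "f \<in> ?F ` (ord_inj d n \<times> {q. q permutes {..<d}})"
    then obtain P q where Pq: "P \<in> ord_inj d n" "q permutes {..<d}" "f = (\<lambda>i\<in>{..<d}. P (q i))" by auto
    have "inj_on P {..<d}" using Pq(1) strict_mono_on_imp_inj_on by (auto simp: ord_inj_def)
    then have "inj_on f {..<d}"
      using permutes_less[OF Pq(2)] permutes_inj_on[OF Pq(2), of "{..<d}"] by (auto simp: Pq(3) inj_on_def)
    then show "f \<in> {f \<in> {..<d} \<rightarrow>\<^sub>E {..<n}. inj_on f {..<d}}"
      using Pq permutes_less[OF Pq(2)] by (auto simp: ord_inj_def)
  next
    fix f assume f: "f \<in> {f \<in> {..<d} \<rightarrow>\<^sub>E {..<n}. inj_on f {..<d}}"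
    then have "inj_on (\<lambda>i. real (f i)) {..<d}" by (auto simp: inj_on_def)
    then obtain p where p: "p permutes {..<d}" "strict_mono_on {..<d} (\<lambda>i. real (f (p i)))"
      by (rule sorting_permutation_exists)
    define P where "P = (\<lambda>i\<in>{..<d}. f (p i))"
    have "P \<in> ord_inj d n"
      using f p permutes_less[OF p(1)] by (auto simp: P_def ord_inj_def strict_mono_on_def)
    moreover have "f = ?F (P, inv_into UNIV p)"
    proof (rule PiE_ext[of f "{..<d}" "\<lambda>_. {..<n}"])
      show "?F (P, inv_into UNIV p) \<in> {..<d} \<rightarrow>\<^sub>E {..<n}"
        using \<open>P \<in> _\<close> permutes_less[OF permutes_inv[OF p(1)]] by (auto simp: ord_inj_def)
      fix i assume "i \<in> {..<d}"
      then show "f i = ?F (P, inv_into UNIV p) i"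
        using permutes_less[OF permutes_inv[OF p(1)]] permutes_inverses(1)[OF p(1)] by (simp add: P_def)
    qed (use f in auto)
    moreover have "inv_into UNIV p permutes {..<d}" by (rule permutes_inv[OF p(1)])
    ultimately show "f \<in> ?F ` (ord_inj d n \<times> {q. q permutes {..<d}})" by blast
  qed
qed

text \<open>Expanding the product of sums runs over all maps from rows to the summation index. Maps
  that are not injective give determinants with two equal rows; the injective ones are grouped by
  their increasing part, and their permutation parts assemble the determinant of
  \<open>a\<close>.\<close>

lemma Cauchy_Binet:
  "mdet d (\<lambda>i j. \<Sum>k<n. a i k * b k j) =
    (\<Sum>P\<in>ord_inj d n. mdet d (\<lambda>i l. a i (P l)) * mdet d (\<lambda>l j. b (P l) j))"
proof -
  let ?S = "{p. p permutes {..<d}}" and ?E = "{..<d} \<rightarrow>\<^sub>E {..<n}"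
  have "mdet d (\<lambda>i j. \<Sum>k<n. a i k * b k j)
    = (\<Sum>p\<in>?S. of_int (sign p) * (\<Sum>f\<in>?E. \<Prod>i<d. a i (f i) * b (f i) (p i)))"
    unfolding mdet_permutations by (simp add: prod_sum_PiE)
  also have "\<dots> = (\<Sum>p\<in>?S. \<Sum>f\<in>?E. (\<Prod>i<d. a i (f i)) * (of_int (sign p) * (\<Prod>i<d. b (f i) (p i))))"
    by (simp add: sum_distrib_left prod.distrib mult_ac)
  also have "\<dots> = (\<Sum>f\<in>?E. \<Sum>p\<in>?S. (\<Prod>i<d. a i (f i)) * (of_int (sign p) * (\<Prod>i<d. b (f i) (p i))))"
    by (rule sum.swap)
  also have "\<dots> = (\<Sum>f\<in>?E. (\<Prod>i<d. a i (f i)) * mdet d (\<lambda>i. b (f i)))"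
    unfolding mdet_permutations sum_distrib_left ..
  also have "\<dots> = (\<Sum>f\<in>{f\<in>?E. inj_on f {..<d}}. (\<Prod>i<d. a i (f i)) * mdet d (\<lambda>i. b (f i)))"
  proof (rule sum.mono_neutral_right)
    show "\<forall>f\<in>?E - {f \<in> ?E. inj_on f {..<d}}. (\<Prod>i<d. a i (f i)) * mdet d (\<lambda>i. b (f i)) = 0"
    proof
      fix f assume "f \<in> ?E - {f \<in> ?E. inj_on f {..<d}}"
      then obtain i k where "i < d" "k < d" "i \<noteq> k" "f i = f k" by (auto simp: inj_on_def)
      then show "(\<Prod>i<d. a i (f i)) * mdet d (\<lambda>i. b (f i)) = 0"
        using mdet_identical_rows[of i d k "\<lambda>i. b (f i)"] by simp
    qed
  qed (auto intro: finite_PiE)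
  also have "\<dots> = (\<Sum>(P, q)\<in>ord_inj d n \<times> ?S. (\<Prod>i<d. a i (P (q i))) * mdet d (\<lambda>i. b (P (q i))))"
  proof (subst sum.reindex_bij_betw[OF bij_betw_ord_inj, symmetric], rule sum.cong[OF refl], clarify)
    fix P q
    have "mdet d (\<lambda>i. b ((\<lambda>i\<in>{..<d}. P (q i)) i)) = mdet d (\<lambda>i. b (P (q i)))"
      by (rule arg_cong[where f=Determinant.det], rule cong_mat) auto
    then show "(\<Prod>i<d. a i ((\<lambda>i\<in>{..<d}. P (q i)) i)) * mdet d (\<lambda>i. b ((\<lambda>i\<in>{..<d}. P (q i)) i)) =
        (\<Prod>i<d. a i (P (q i))) * mdet d (\<lambda>i. b (P (q i)))" by simp
  qed
  also have "\<dots> = (\<Sum>P\<in>ord_inj d n. \<Sum>q\<in>?S. (\<Prod>i<d. a i (P (q i))) * mdet d (\<lambda>i. b (P (q i))))"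
    by (rule sum.cartesian_product[symmetric])
  also have "\<dots> = (\<Sum>P\<in>ord_inj d n. \<Sum>q\<in>?S. (of_int (sign q) * (\<Prod>i<d. a i (P (q i)))) * mdet d (\<lambda>l. b (P l)))"
    using mdet_permute_rows[of _ d "\<lambda>l. b (P l)" for P] by (intro sum.cong refl) (simp add: mult_ac)
  also have "\<dots> = (\<Sum>P\<in>ord_inj d n. mdet d (\<lambda>i l. a i (P l)) * mdet d (\<lambda>l j. b (P l) j))"
    by (simp add: mdet_permutations[of d "\<lambda>i l. a i (P l)" for P] sum_distrib_right)
  finally show ?thesis .
qed

section \<open>Linear maps of the target\<close>

lemma orthonormal_expansion:
  assumes "orthonormal_basis n e"
  shows "(\<Sum>k<n. inner y (e k) *\<^sub>R e k) = y"
proof -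
  let ?S = "{y. (\<Sum>k<n. inner y (e k) *\<^sub>R e k) = y}"
  have "subspace ?S"
    by (auto simp: subspace_def inner_add_left scaleR_add_left sum.distrib scaleR_sum_right[symmetric]
        simp flip: scaleR_scaleR)
  moreover have "e ` {..<n} \<subseteq> ?S"
  proof
    fix z assume "z \<in> e ` {..<n}"
    then obtain i where i: "i < n" "z = e i" by auto
    have "(\<Sum>k<n. inner z (e k) *\<^sub>R e k) = (\<Sum>k<n. if k = i then e k else 0)"
      using assms i by (intro sum.cong) (auto simp: orthonormal_basis_def)
    then show "z \<in> ?S" using i by simp
  qed
  ultimately have "span (e ` {..<n}) \<subseteq> ?S" by (rule span_minimal[rotated])
  then show ?thesis using assms by (auto simp: orthonormal_basis_def)
qed

lemma linear_expansion:
  assumes "orthonormal_basis n e" "linear A"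
  shows "A y = (\<Sum>k<n. inner y (e k) *\<^sub>R A (e k))"
proof -
  have "A y = A (\<Sum>k<n. inner y (e k) *\<^sub>R e k)" using orthonormal_expansion[OF assms(1)] by simp
  also have "\<dots> = (\<Sum>k<n. inner y (e k) *\<^sub>R A (e k))"
    by (simp add: linear_sum[OF assms(2)] linear_scale[OF assms(2)])
  finally show ?thesis .
qed

lemma linear_inner_expansion:
  assumes "orthonormal_basis n e" "linear A"
  shows "inner (A y) v = (\<Sum>k<n. inner (A (e k)) v * inner y (e k))"
  by (subst linear_expansion[OF assms]) (simp add: inner_sum_left mult.commute)

lemma Lip_linear:
  fixes x :: "point \<Rightarrow> 'v::real_inner" and A :: "'v \<Rightarrow> 'v" and e :: "nat \<Rightarrow> 'v"
  assumes on: "orthonormal_basis n e" and A: "linear A" and x: "x \<in> Lip d"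
  shows "A \<circ> x \<in> Lip d"
proof -
  obtain L where L: "L \<ge> 0" "\<And>s t. s \<in> unit_cube {..<d} \<Longrightarrow> t \<in> unit_cube {..<d} \<Longrightarrow>
      dist (x s) (x t) \<le> L * L2_set (\<lambda>j. s j - t j) {..<d}"
    using Lip_realD[OF x] by blast
  \<comment> \<open>A bound for the operator norm of \<open>A\<close>, read off from the expansion
    in the finite basis.\<close>
  define K where "K = (\<Sum>k<n. norm (e k) * norm (A (e k)))"
  have K: "0 \<le> K" unfolding K_def by (intro sum_nonneg) auto
  have bnd: "norm (A y) \<le> K * norm y" for y
  proof -
    have "norm (A y) \<le> (\<Sum>k<n. norm (inner y (e k) *\<^sub>R A (e k)))"
      by (subst linear_expansion[OF on A]) (rule norm_sum)
    also have "\<dots> \<le> (\<Sum>k<n. (norm y * norm (e k)) * norm (A (e k)))"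
      by (intro sum_mono) (simp add: mult_right_mono Cauchy_Schwarz_ineq2)
    finally show ?thesis by (simp add: K_def sum_distrib_left sum_distrib_right mult_ac)
  qed
  have "dist ((A \<circ> x) s) ((A \<circ> x) t) \<le> (K * L) * L2_set (\<lambda>j. s j - t j) {..<d}"
    if "s \<in> unit_cube {..<d}" "t \<in> unit_cube {..<d}" for s t
  proof -
    have "dist ((A \<circ> x) s) ((A \<circ> x) t) = norm (A (x s - x t))" by (simp add: dist_norm linear_diff[OF A])
    also have "\<dots> \<le> K * dist (x s) (x t)" using bnd by (simp add: dist_norm)
    also have "\<dots> \<le> K * (L * L2_set (\<lambda>j. s j - t j) {..<d})" by (intro mult_left_mono L(2) that K)
    finally show ?thesis by (simp add: mult_ac)
  qed
  then show ?thesis unfolding Lip_def by blast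
qed

text \<open>The Jacobian matrix of \<open>A \<circ> x\<close> is a product of two matrices with
  inner dimension \<open>n\<close>, so Cauchy-Binet applies. The exceptional set comes from the
  \<open>n\<close> coordinate functions of \<open>x\<close> and serves all \<open>Q\<close> at
  once.\<close>

lemma jac_minor_linear:
  fixes x :: "point \<Rightarrow> 'v::real_inner" and A :: "'v \<Rightarrow> 'v"
  assumes on: "orthonormal_basis n e" and A: "linear A" and x: "x \<in> Lip d"
  shows "AE s in cube_measure {..<d}. \<forall>Q::nat \<Rightarrow> nat. jac_minor d e (A \<circ> x) Q s =
    (\<Sum>P\<in>ord_inj d n. wedge_coord d e (\<lambda>j. A (e (P j))) Q * jac_minor d e x P s)"
  using AE_all_partials[OF x, of n e] AE_space
proof (eventually_elim, intro allI)
  fix s and Q :: "nat \<Rightarrow> nat" assume ae: "\<forall>i\<in>{..<n}. \<forall>j\<in>{..<d}. has_partial j (\<lambda>u. inner (x u) (e i)) (partial j (\<lambda>u. inner (x u) (e i)) s) s"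
    and s: "s \<in> space (cube_measure {..<d})"
  define D where "D k j = partial j (\<lambda>u. inner (x u) (e k)) s" for k j
  have part: "partial j (\<lambda>u. inner ((A \<circ> x) u) (e (Q i))) s = (\<Sum>k<n. inner (A (e k)) (e (Q i)) * D k j)" if "j < d" for i j
  proof (rule partial_eqI)
    show "s j \<in> {0..1}" using s that by (auto simp: space_cube dest: unit_cubeD)
    have "has_partial j (\<lambda>u. \<Sum>k<n. inner (A (e k)) (e (Q i)) * inner (x u) (e k)) (\<Sum>k<n. inner (A (e k)) (e (Q i)) * D k j) s"
      using ae that by (intro has_vector_derivative_sum has_vector_derivative_mult_right) (auto simp: D_def)
    then show "has_partial j (\<lambda>u. inner ((A \<circ> x) u) (e (Q i))) (\<Sum>k<n. inner (A (e k)) (e (Q i)) * D k j) s"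
      by (simp add: linear_inner_expansion[OF on A, symmetric])
  qed
  have "jac_minor d e (A \<circ> x) Q s = mdet d (\<lambda>i j. \<Sum>k<n. inner (A (e k)) (e (Q i)) * D k j)"
    unfolding jac_minor_def by (rule arg_cong[where f=Determinant.det], rule cong_mat) (auto simp: part[simplified])
  then show "jac_minor d e (A \<circ> x) Q s =
    (\<Sum>P\<in>ord_inj d n. wedge_coord d e (\<lambda>j. A (e (P j))) Q * jac_minor d e x P s)"
    by (simp add: Cauchy_Binet wedge_coord_def jac_minor_def D_def)
qed

lemma sig_linear:
  fixes x :: "point \<Rightarrow> 'v::real_inner" and A :: "'v \<Rightarrow> 'v"
  assumes on: "orthonormal_basis n e" and A: "linear A" and x: "x \<in> Lip d"
  shows "sig d n e (A \<circ> x) = GL_act d n e A (sig d n e x)"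
proof -
  have "sig d n e (A \<circ> x) m (Q, \<pi>) = GL_act d n e A (sig d n e x) m (Q, \<pi>)" for m Q \<pi>
  proof (cases "(Q, \<pi>) \<in> level_index d n m")
    case True
    let ?D = "sig_domain d m \<pi> (\<lambda>_. 0) (\<lambda>_. 1)" and ?E = "{..<m} \<rightarrow>\<^sub>E ord_inj d n"
    let ?w = "\<lambda>i P. wedge_coord d e (\<lambda>j. A (e (P j))) (Q i)"
    have D: "?D \<in> sets (cubes d {..<m})" by (rule sets_sig_domain[OF level_indexD(4)[OF True]])
    have k: "(P, \<pi>) \<in> level_index d n m" if "P \<in> ?E" for P
      using that level_indexD(2)[OF True] by (simp add: level_index_def)
    have int: "integrable (cubes d {..<m}) (\<lambda>t. indicator ?D t * (\<Prod>i<m. jac_minor d e x (P i) (t i)))" for P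
      by (intro integrable_sig D bounded_borel_jac_minor x) simp
    have "AE t in cubes d {..<m}. \<forall>i\<in>{..<m}. \<forall>Q. jac_minor d e (A \<circ> x) Q (t i) =
        (\<Sum>P\<in>ord_inj d n. wedge_coord d e (\<lambda>j. A (e (P j))) Q * jac_minor d e x P (t i))"
      by (intro AE_cubes_all jac_minor_linear[OF on A x]) simp
    then have "AE t in cubes d {..<m}. indicator ?D t * (\<Prod>i<m. jac_minor d e (A \<circ> x) (Q i) (t i)) =
        (\<Sum>P\<in>?E. (\<Prod>i<m. ?w i (P i)) * (indicator ?D t * (\<Prod>i<m. jac_minor d e x (P i) (t i))))"
    proof eventually_elim
      case (elim t)
      then have "(\<Prod>i<m. jac_minor d e (A \<circ> x) (Q i) (t i)) = (\<Prod>i<m. \<Sum>P\<in>ord_inj d n. ?w i P * jac_minor d e x P (t i))"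
        by (intro prod.cong) auto
      also have "\<dots> = (\<Sum>P\<in>?E. \<Prod>i<m. ?w i (P i) * jac_minor d e x (P i) (t i))"
        by (rule prod_sum_PiE) auto
      finally show ?case by (simp add: prod.distrib sum_distrib_left mult_ac)
    qed
    then have "sig d n e (A \<circ> x) m (Q, \<pi>) = (LINT t|cubes d {..<m}.
        (\<Sum>P\<in>?E. (\<Prod>i<m. ?w i (P i)) * (indicator ?D t * (\<Prod>i<m. jac_minor d e x (P i) (t i)))))"
      unfolding sig_eq_integral[OF True]
      by (intro integral_cong_AE borel_measurable_times borel_measurable_indicator D borel_measurable_sum
          borel_measurable_const borel_measurable_prod bounded_borel_row bounded_borel_jac_minor Lip_linear[OF on A x] x)
    also have "\<dots> = (\<Sum>P\<in>?E. (\<Prod>i<m. ?w i (P i)) * sig d n e x m (P, \<pi>))"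
      using int by (subst Bochner_Integration.integral_sum) (auto simp: sig_eq_integral[OF k] intro!: sum.cong)
    finally show ?thesis using True by (simp add: GL_act_def)
  qed (simp add: sig_def GL_act_def)
  then show ?thesis by (intro ext) (metis surj_pair)
qed

section \<open>Shuffle products\<close>

lemma AE_entries_distinct:
  assumes I: "finite I" "i \<in> I" "k \<in> I" "i \<noteq> k" and j: "j < d"
  shows "AE t in cubes d I. t i j \<noteq> t k j"
proof (rule AE_PiM_slice[where j=i])
  have [measurable]: "(\<lambda>t. t i j) \<in> borel_measurable (cubes d I)" "(\<lambda>t. t k j) \<in> borel_measurable (cubes d I)"
    using I j by (auto intro: measurable_entry)
  show "{t \<in> space (cubes d I). t i j \<noteq> t k j} \<in> sets (cubes d I)"
    by (rule borel_measurable_neq) measurable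
  show "AE u in cube_measure {..<d}. (x(i := u)) i j \<noteq> (x(i := u)) k j" for x
    using I j AE_cube_ne[of "{..<d}" j "x k j"] by simp
qed (use I in \<open>auto intro: prob_space_cube\<close>)

lemma AE_columns_injective:
  "AE t in cubes d {..<m}. \<forall>j<d. inj_on (\<lambda>i. t i j) {..<m}"
proof -
  have "AE t in cubes d {..<m}. \<forall>j\<in>{..<d}. \<forall>i\<in>{..<m}. \<forall>k\<in>{..<m}. i \<noteq> k \<longrightarrow> t i j \<noteq> t k j"
  proof (intro AE_finite_allI finite_lessThan)
    fix j i k assume "j \<in> {..<d}" "i \<in> {..<m}" "k \<in> {..<m}"
    then show "AE t in cubes d {..<m}. i \<noteq> k \<longrightarrow> t i j \<noteq> t k j"
      using AE_entries_distinct[of "{..<m}" i k j d] by (cases "i = k") auto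
  qed
  then show ?thesis by (elim eventually_mono) (auto simp: inj_on_def)
qed

text \<open>Inside one domain the order of the entries of a column is fixed by
  \<open>\<rho>\<close>. This is what makes membership in a product domain constant on each
  domain.\<close>

lemma sig_domain_order:
  assumes \<rho>: "\<And>j. j < d \<Longrightarrow> \<rho> j permutes {..<m}" and t: "t \<in> sig_domain d m \<rho> (\<lambda>_. 0) (\<lambda>_. 1)"
    and ik: "i < m" "k < m" "j < d"
  shows "t i j < t k j \<longleftrightarrow> inv_into UNIV (\<rho> j) i < inv_into UNIV (\<rho> j) k"
proof -
  let ?\<iota> = "inv_into UNIV (\<rho> j)"
  have mono: "strict_mono_on {..<m} (\<lambda>i. t (\<rho> j i) j)"
    using t ik by (simp add: sig_domain_unit_eq[OF \<rho>])
  have \<iota>: "?\<iota> i \<in> {..<m}" "?\<iota> k \<in> {..<m}" using permutes_less[OF permutes_inv[OF \<rho>[OF ik(3)]]] ik by auto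
  have "t (\<rho> j (?\<iota> i)) j < t (\<rho> j (?\<iota> k)) j \<longleftrightarrow> ?\<iota> i < ?\<iota> k"
    by (rule strict_mono_on_less[OF mono \<iota>])
  then show ?thesis by (simp add: permutes_inverses(1)[OF \<rho>[OF ik(3)]])
qed

text \<open>Fubini between the first \<open>m\<close> rows and the remaining ones, the latter
  renumbered from 0. \<open>H\<close> is allowed to couple the two groups of rows, as happens in
  Chen's identity.\<close>

lemma integral_split_rows:
  fixes H :: "(nat \<Rightarrow> point) \<Rightarrow> (nat \<Rightarrow> point) \<Rightarrow> real"
  assumes H: "\<And>x. x \<in> space (cubes d {..<m}) \<Longrightarrow> H x \<in> borel_measurable (cubes d {..<m'})"
    and int: "integrable (cubes d {..<m + m'}) (\<lambda>t. H (restrict t {..<m}) (\<lambda>i\<in>{..<m'}. t (i + m)))"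
  shows "(LINT t|cubes d {..<m + m'}. H (restrict t {..<m}) (\<lambda>i\<in>{..<m'}. t (i + m)))
    = (LINT x|cubes d {..<m}. LINT y|cubes d {..<m'}. H x y)"
proof -
  let ?J = "{m..<m + m'}"
  have un: "{..<m} \<union> ?J = {..<m + m'}" and disj: "{..<m} \<inter> ?J = {}" by auto
  have shift: "distr (cubes d ?J) (cubes d {..<m'}) (\<lambda>\<omega>. \<lambda>i\<in>{..<m'}. \<omega> (i + m)) = cubes d {..<m'}"
    by (intro distr_PiM_reindex prob_space_cube) (auto simp: inj_on_def)
  have sm: "(\<lambda>\<omega>. \<lambda>i\<in>{..<m'}. \<omega> (i + m)) \<in> measurable (cubes d ?J) (cubes d {..<m'})"
    by (intro measurable_restrict measurable_component_singleton) auto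
  have "(LINT t|cubes d {..<m + m'}. H (restrict t {..<m}) (\<lambda>i\<in>{..<m'}. t (i + m)))
    = (LINT x|cubes d {..<m}. LINT y|cubes d ?J. H (restrict (merge {..<m} ?J (x, y)) {..<m})
        (\<lambda>i\<in>{..<m'}. merge {..<m} ?J (x, y) (i + m)))"
    by (rule cubes.product_integral_fold[OF disj finite_lessThan finite_atLeastLessThan,
          of d "\<lambda>t. H (restrict t {..<m}) (\<lambda>i\<in>{..<m'}. t (i + m))", unfolded un, OF int])
  also have "\<dots> = (LINT x|cubes d {..<m}. LINT y|cubes d {..<m'}. H x y)"
  proof (rule Bochner_Integration.integral_cong[OF refl])
    fix x assume x: "x \<in> space (cubes d {..<m})"
    have "restrict (merge {..<m} ?J (x, y)) {..<m} = x" for y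
      using x by (auto simp: merge_def space_PiM PiE_def extensional_def fun_eq_iff)
    moreover have "(\<lambda>i\<in>{..<m'}. merge {..<m} ?J (x, y) (i + m)) = (\<lambda>i\<in>{..<m'}. y (i + m))" for y
      by (auto simp: merge_def fun_eq_iff)
    ultimately have "(LINT y|cubes d ?J. H (restrict (merge {..<m} ?J (x, y)) {..<m}) (\<lambda>i\<in>{..<m'}. merge {..<m} ?J (x, y) (i + m)))
      = (LINT y|cubes d ?J. H x (\<lambda>i\<in>{..<m'}. y (i + m)))" by simp
    also have "\<dots> = (LINT y|cubes d {..<m'}. H x y)"
      using integral_distr[OF sm H[OF x]] unfolding shift by simp
    finally show "(LINT y|cubes d ?J. H (restrict (merge {..<m} ?J (x, y)) {..<m}) (\<lambda>i\<in>{..<m'}. merge {..<m} ?J (x, y) (i + m)))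
      = (LINT y|cubes d {..<m'}. H x y)" .
  qed
  finally show ?thesis .
qed

lemma integral_product_rows:
  fixes f h :: "(nat \<Rightarrow> point) \<Rightarrow> real"
  assumes h: "h \<in> borel_measurable (cubes d {..<m'})"
    and int: "integrable (cubes d {..<m + m'}) (\<lambda>t. f (restrict t {..<m}) * h (\<lambda>i\<in>{..<m'}. t (i + m)))"
  shows "(LINT t|cubes d {..<m + m'}. f (restrict t {..<m}) * h (\<lambda>i\<in>{..<m'}. t (i + m)))
    = (LINT t|cubes d {..<m}. f t) * (LINT t|cubes d {..<m'}. h t)"
  using integral_split_rows[of m d "\<lambda>x y. f x * h y" m', OF borel_measurable_times[OF borel_measurable_const h] int]
  by simp

lemma prod_lessThan_add:
  fixes g :: "nat \<Rightarrow> real"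
  shows "(\<Prod>i<m + m'. g i) = (\<Prod>i<m. g i) * (\<Prod>i<m'. g (i + m))"
  by (induction m') (simp_all add: mult.assoc add.commute)

definition concat_rows :: "nat \<Rightarrow> nat \<Rightarrow> (nat \<Rightarrow> 'a) \<Rightarrow> (nat \<Rightarrow> 'a) \<Rightarrow> nat \<Rightarrow> 'a" where
  "concat_rows m m' P Q = (\<lambda>i\<in>{..<m + m'}. if i < m then P i else Q (i - m))"

text \<open>The product of two domains is, up to a null set, the disjoint union of the domains
  that meet it, because membership depends only on the order of the entries in each column.\<close>

lemma shuffle_product:
  assumes k: "(P, \<pi>) \<in> level_index d n m" and k': "(P', \<pi>') \<in> level_index d n m'"
  obtains S where "S \<subseteq> {..<d} \<rightarrow>\<^sub>E {p. p permutes {..<m + m'}}"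
    "\<And>\<rho>. \<rho> \<in> S \<Longrightarrow> (concat_rows m m' P P', \<rho>) \<in> level_index d n (m + m')"
    "\<And>x. x \<in> Lip d \<Longrightarrow> sig d n e x m (P, \<pi>) * sig d n e x m' (P', \<pi>')
      = (\<Sum>\<rho>\<in>S. sig d n e x (m + m') (concat_rows m m' P P', \<rho>))"
proof -
  let ?D = "\<lambda>m \<pi>. sig_domain d m \<pi> (\<lambda>_. 0) (\<lambda>_. 1)" and ?M = "m + m'"
  let ?R = "{..<d} \<rightarrow>\<^sub>E {p. p permutes {..<?M}}"
  define B where "B = {t \<in> space (cubes d {..<?M}). restrict t {..<m} \<in> ?D m \<pi> \<and> (\<lambda>i\<in>{..<m'}. t (i + m)) \<in> ?D m' \<pi>'}"
  \<comment> \<open>The generalized shuffles of \<open>\<pi>\<close> and \<open>\<pi>'\<close>: the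
    families whose domain meets the product domain \<open>B\<close>. By \<open>B_indep\<close> such
    a domain lies entirely inside \<open>B\<close>.\<close>
  define S where "S = {\<rho> \<in> ?R. ?D ?M \<rho> \<inter> B \<noteq> {}}"
  note \<pi> = level_indexD(4)[OF k] and \<pi>' = level_indexD(4)[OF k']
  have \<pi>_less: "\<pi> j i < m" if "j < d" "i < m" for i j using permutes_less[OF \<pi>] that by blast
  have \<pi>'_less: "\<pi>' j i < m'" if "j < d" "i < m'" for i j using permutes_less[OF \<pi>'] that by blast
  have res: "restrict t {..<m} \<in> space (cubes d {..<m})" "(\<lambda>i\<in>{..<m'}. t (i + m)) \<in> space (cubes d {..<m'})"
    if "t \<in> space (cubes d {..<?M})" for t
    using cubesD[OF that] by (auto simp: space_cubes)
  have B_iff: "t \<in> B \<longleftrightarrow> (\<forall>j<d. (\<forall>i<m. \<forall>k<m. i < k \<longrightarrow> t (\<pi> j i) j < t (\<pi> j k) j) \<and>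
      (\<forall>i<m'. \<forall>k<m'. i < k \<longrightarrow> t (\<pi>' j i + m) j < t (\<pi>' j k + m) j))"
    if t: "t \<in> space (cubes d {..<?M})" for t
    unfolding B_def using t res[OF t] \<pi>_less \<pi>'_less
    by (auto simp: sig_domain_unit_eq[OF \<pi>] sig_domain_unit_eq[OF \<pi>'] strict_mono_on_def)
  have B_indep: "t \<in> B \<longleftrightarrow> t' \<in> B" if \<rho>: "\<rho> \<in> ?R" and t: "t \<in> ?D ?M \<rho>" "t' \<in> ?D ?M \<rho>" for t t' \<rho>
  proof -
    have \<rho>': "\<rho> j permutes {..<?M}" if "j < d" for j using \<rho> that by auto
    have ts: "t \<in> space (cubes d {..<?M})" "t' \<in> space (cubes d {..<?M})" using t by (auto simp: sig_domain_unit_eq[OF \<rho>'])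
    have "t i j < t k j \<longleftrightarrow> t' i j < t' k j" if "i < ?M" "k < ?M" "j < d" for i k j
      using sig_domain_order[OF \<rho>' t(1) that] sig_domain_order[OF \<rho>' t(2) that] by simp
    then have "t (\<pi> j i) j < t (\<pi> j k) j \<longleftrightarrow> t' (\<pi> j i) j < t' (\<pi> j k) j" if "i < m" "k < m" "j < d" for i k j
      using that \<pi>_less by (simp add: trans_less_add1)
    moreover have "t (\<pi>' j i + m) j < t (\<pi>' j k + m) j \<longleftrightarrow> t' (\<pi>' j i + m) j < t' (\<pi>' j k + m) j" if "i < m'" "k < m'" "j < d" for i k j
      using that \<pi>'_less \<open>\<And>k j i. \<lbrakk>i < ?M; k < ?M; j < d\<rbrakk> \<Longrightarrow> t i j < t k j \<longleftrightarrow> t' i j < t' k j\<close> by simp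
    ultimately show ?thesis unfolding B_iff[OF ts(1)] B_iff[OF ts(2)] by auto
  qed
  have Rfin: "finite ?R" by (rule permutation_families)
  have sets: "?D ?M \<rho> \<in> sets (cubes d {..<?M})" if "\<rho> \<in> ?R" for \<rho>
    using that by (intro sets_sig_domain) auto
  \<comment> \<open>Away from repeated entries in a column, a point lies in exactly one domain,
    found by sorting each of its columns.\<close>
  have ind: "AE t in cubes d {..<?M}. indicator B t = (\<Sum>\<rho>\<in>S. indicator (?D ?M \<rho>) t :: real)"
    using AE_columns_injective[of d ?M] AE_space
  proof eventually_elim
    case (elim t)
    have "\<exists>p. j < d \<longrightarrow> p permutes {..<?M} \<and> strict_mono_on {..<?M} (\<lambda>i. t (p i) j)" for j
    proof (cases "j < d")
      case True
      then have "inj_on (\<lambda>i. t i j) {..<?M}" using elim(1) by blast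
      then show ?thesis by (rule sorting_permutation_exists) blast
    qed simp
    then obtain p where p: "\<And>j. j < d \<Longrightarrow> p j permutes {..<?M}" "\<And>j. j < d \<Longrightarrow> strict_mono_on {..<?M} (\<lambda>i. t (p j i) j)"
      by metis
    define \<rho> where "\<rho> = restrict p {..<d}"
    have \<rho>: "\<rho> \<in> ?R" using p(1) by (auto simp: \<rho>_def)
    then have \<rho>': "\<rho> j permutes {..<?M}" if "j < d" for j using that by auto
    have t\<rho>: "t \<in> ?D ?M \<rho>"
      by (subst sig_domain_unit_eq[OF \<rho>']) (use p(2) elim(2) in \<open>auto simp: \<rho>_def\<close>)
    have uniq: "t \<in> ?D ?M \<rho>' \<longleftrightarrow> \<rho>' = \<rho>" if "\<rho>' \<in> ?R" for \<rho>'
      using sig_domain_disjoint[OF that \<rho> _ t\<rho>] t\<rho> by blast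
    have "(\<Sum>\<rho>'\<in>S. indicator (?D ?M \<rho>') t :: real) = (\<Sum>\<rho>'\<in>S. if \<rho>' = \<rho> then 1 else 0)"
      by (intro sum.cong) (auto simp: S_def uniq indicator_def)
    also have "\<dots> = (if \<rho> \<in> S then 1 else 0)"
      using Rfin by (simp add: S_def)
    also have "\<rho> \<in> S \<longleftrightarrow> t \<in> B"
      using B_indep[OF \<rho> t\<rho>] t\<rho> \<rho> unfolding S_def by blast
    finally show ?case by (simp add: indicator_def)
  qed
  show thesis
  proof (rule that[of S])
    show "S \<subseteq> ?R" by (auto simp: S_def)
    show idx: "(concat_rows m m' P P', \<rho>) \<in> level_index d n ?M" if "\<rho> \<in> S" for \<rho>
      using that level_indexD(3)[OF k] level_indexD(3)[OF k'] by (auto simp: level_index_def concat_rows_def S_def)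
    fix x :: "point \<Rightarrow> 'a" assume x: "x \<in> Lip d"
    let ?g = "\<lambda>i. jac_minor d e x (concat_rows m m' P P' i)"
    let ?f = "\<lambda>t. indicator (?D m \<pi>) t * (\<Prod>i<m. jac_minor d e x (P i) (t i)) :: real"
    let ?h = "\<lambda>t. indicator (?D m' \<pi>') t * (\<Prod>i<m'. jac_minor d e x (P' i) (t i)) :: real"
    have bb: "bounded_borel {..<d} (jac_minor d e x Q)" for Q by (rule bounded_borel_jac_minor[OF x])
    have int: "integrable (cubes d {..<?M}) (\<lambda>t. indicator (?D ?M \<rho>) t * (\<Prod>i<?M. ?g i (t i)))" if "\<rho> \<in> S" for \<rho>
      using that by (intro integrable_sig sets bb) (auto simp: S_def)
    have eq: "AE t in cubes d {..<?M}. (\<Sum>\<rho>\<in>S. indicator (?D ?M \<rho>) t * (\<Prod>i<?M. ?g i (t i)))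
        = ?f (restrict t {..<m}) * ?h (\<lambda>i\<in>{..<m'}. t (i + m))"
      using ind AE_space
    proof eventually_elim
      case (elim t)
      have e2: "(\<Prod>i<?M. ?g i (t i)) = (\<Prod>i<m. jac_minor d e x (P i) (t i)) * (\<Prod>i<m'. jac_minor d e x (P' i) (t (i + m)))"
        unfolding prod_lessThan_add by (simp add: concat_rows_def)
      have e3: "indicator B t = (indicator (?D m \<pi>) (restrict t {..<m}) * indicator (?D m' \<pi>') (\<lambda>i\<in>{..<m'}. t (i + m)) :: real)"
        using elim(2) by (simp add: B_def indicator_def)
      have "(\<Sum>\<rho>\<in>S. indicator (?D ?M \<rho>) t * (\<Prod>i<?M. ?g i (t i))) = indicator B t * (\<Prod>i<?M. ?g i (t i))"
        unfolding elim(1) by (rule sum_distrib_right[symmetric])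
      also have "\<dots> = ?f (restrict t {..<m}) * ?h (\<lambda>i\<in>{..<m'}. t (i + m))"
        unfolding e2 e3 by simp
      finally show ?case .
    qed
    have "?f \<in> borel_measurable (cubes d {..<m})"
      by (rule borel_measurable_times[OF borel_measurable_indicator[OF sets_sig_domain[OF \<pi>]] measurable_prod_rows])
        (auto intro: bounded_borelD bb)
    moreover have "?h \<in> borel_measurable (cubes d {..<m'})"
      by (rule borel_measurable_times[OF borel_measurable_indicator[OF sets_sig_domain[OF \<pi>']] measurable_prod_rows])
        (auto intro: bounded_borelD bb)
    ultimately have fm: "?f \<in> borel_measurable (cubes d {..<m})" "?h \<in> borel_measurable (cubes d {..<m'})" .
    have rm: "(\<lambda>t. restrict t {..<m}) \<in> measurable (cubes d {..<?M}) (cubes d {..<m})"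
      "(\<lambda>t. \<lambda>i\<in>{..<m'}. t (i + m)) \<in> measurable (cubes d {..<?M}) (cubes d {..<m'})"
      by (intro measurable_restrict measurable_component_singleton; auto)+
    have meas: "(\<lambda>t. ?f (restrict t {..<m}) * ?h (\<lambda>i\<in>{..<m'}. t (i + m))) \<in> borel_measurable (cubes d {..<?M})"
      by (intro borel_measurable_times[OF measurable_compose[OF rm(1) fm(1)] measurable_compose[OF rm(2) fm(2)]])
    have sint: "integrable (cubes d {..<?M}) (\<lambda>t. \<Sum>\<rho>\<in>S. indicator (?D ?M \<rho>) t * (\<Prod>i<?M. ?g i (t i)))"
      by (intro Bochner_Integration.integrable_sum int)
    have pint: "integrable (cubes d {..<?M}) (\<lambda>t. ?f (restrict t {..<m}) * ?h (\<lambda>i\<in>{..<m'}. t (i + m)))"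
      using integrable_cong_AE[OF borel_measurable_integrable[OF sint] meas eq] sint by simp
    have "(\<Sum>\<rho>\<in>S. sig d n e x ?M (concat_rows m m' P P', \<rho>))
      = (LINT t|cubes d {..<?M}. (\<Sum>\<rho>\<in>S. indicator (?D ?M \<rho>) t * (\<Prod>i<?M. ?g i (t i))))"
      using int idx by (subst Bochner_Integration.integral_sum) (auto simp: sig_eq_integral)
    also have "\<dots> = (LINT t|cubes d {..<?M}. ?f (restrict t {..<m}) * ?h (\<lambda>i\<in>{..<m'}. t (i + m)))"
      by (rule integral_cong_AE[OF borel_measurable_integrable[OF sint] meas eq])
    also have "\<dots> = sig d n e x m (P, \<pi>) * sig d n e x m' (P', \<pi>')"
      unfolding sig_eq_integral[OF k] sig_eq_integral[OF k'] by (rule integral_product_rows[OF fm(2) pint])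
    finally show "sig d n e x m (P, \<pi>) * sig d n e x m' (P', \<pi>') = (\<Sum>\<rho>\<in>S. sig d n e x ?M (concat_rows m m' P P', \<rho>))" ..
  qed
qed

section \<open>Functions given by finite functionals\<close>

lemma pairing_eq:
  assumes "finite M" "{m. \<exists>k. l m k \<noteq> 0} \<subseteq> M"
  shows "pairing d n l r = (\<Sum>m\<in>M. \<Sum>k\<in>level_index d n m. l m k * r m k)"
  unfolding pairing_def
proof (rule sum.mono_neutral_left[OF assms], intro ballI sum.neutral)
  fix m k assume "m \<in> M - {m. \<exists>k. l m k \<noteq> 0}"
  then have "l m k = 0" by blast
  then show "l m k * r m k = 0" by simp
qed

text \<open>Only values on classes are constrained, so closure under the algebra operations can be
  shown for arbitrary functions; extensionality enters once, in
  \<open>shuffle_subalgebra\<close>.\<close>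

definition represented :: "nat \<Rightarrow> nat \<Rightarrow> (nat \<Rightarrow> 'v::real_inner) \<Rightarrow> ((point \<Rightarrow> 'v) set \<Rightarrow> real) \<Rightarrow> bool" where
  "represented d n e f \<longleftrightarrow> (\<exists>l\<in>finite_functionals d n. \<forall>X\<in>LipJ d n e. f X = pairing d n l (sigJ d n e X))"

lemma represented_cong:
  assumes "represented d n e f" "\<And>X. X \<in> LipJ d n e \<Longrightarrow> g X = f X"
  shows "represented d n e g"
  using assms unfolding represented_def by auto

lemma represented_coordinate:
  assumes k: "k \<in> level_index d n m"
  shows "represented d n e (\<lambda>X. sigJ d n e X m k)"
proof -
  define l :: tensor_seq where "l m' k' = (if m' = m \<and> k' = k then 1 else 0)" for m' k'
  have supp: "{m. \<exists>k. l m k \<noteq> 0} \<subseteq> {m}" by (auto simp: l_def)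
  have "pairing d n l r = r m k" for r
    using k unfolding pairing_eq[OF _ supp, simplified] by (simp add: l_def if_distrib[of "\<lambda>x. x * _"] cong: if_cong)
  moreover have "l \<in> finite_functionals d n"
    using k finite_subset[OF supp] by (auto simp: finite_functionals_def T_space_def l_def)
  ultimately show ?thesis unfolding represented_def by metis
qed

lemma represented_add:
  assumes "represented d n e f" "represented d n e g"
  shows "represented d n e (\<lambda>X. f X + g X)"
proof -
  obtain l l' where l: "l \<in> finite_functionals d n" "\<And>X. X \<in> LipJ d n e \<Longrightarrow> f X = pairing d n l (sigJ d n e X)"
    and l': "l' \<in> finite_functionals d n" "\<And>X. X \<in> LipJ d n e \<Longrightarrow> g X = pairing d n l' (sigJ d n e X)"
    using assms unfolding represented_def by metis
  let ?M = "{m. \<exists>k. l m k \<noteq> 0} \<union> {m. \<exists>k. l' m k \<noteq> 0}"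
  have M: "finite ?M" using l(1) l'(1) by (simp add: finite_functionals_def)
  have supp: "{m. \<exists>k. l m k + l' m k \<noteq> 0} \<subseteq> ?M"
  proof
    fix m assume "m \<in> {m. \<exists>k. l m k + l' m k \<noteq> 0}"
    then obtain k where "l m k + l' m k \<noteq> 0" by blast
    then have "l m k \<noteq> 0 \<or> l' m k \<noteq> 0" by linarith
    then show "m \<in> ?M" by blast
  qed
  have "pairing d n (\<lambda>m k. l m k + l' m k) r = pairing d n l r + pairing d n l' r" for r
    unfolding pairing_eq[OF M supp] pairing_eq[OF M Un_upper1] pairing_eq[OF M Un_upper2]
    by (simp add: distrib_right sum.distrib)
  moreover have "(\<lambda>m k. l m k + l' m k) \<in> finite_functionals d n"
    using l(1) l'(1) finite_subset[OF supp M] by (auto simp: finite_functionals_def T_space_def)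
  ultimately show ?thesis unfolding represented_def using l l' by (metis (no_types, lifting))
qed

lemma represented_scale:
  assumes "represented d n e f"
  shows "represented d n e (\<lambda>X. c * f X)"
proof -
  obtain l where l: "l \<in> finite_functionals d n" "\<And>X. X \<in> LipJ d n e \<Longrightarrow> f X = pairing d n l (sigJ d n e X)"
    using assms unfolding represented_def by metis
  let ?M = "{m. \<exists>k. l m k \<noteq> 0}"
  have M: "finite ?M" using l(1) by (simp add: finite_functionals_def)
  have supp: "{m. \<exists>k. c * l m k \<noteq> 0} \<subseteq> ?M" by auto
  have "pairing d n (\<lambda>m k. c * l m k) r = c * pairing d n l r" for r
    unfolding pairing_eq[OF M supp] pairing_eq[OF M order_refl] by (simp add: sum_distrib_left mult.assoc)
  moreover have "(\<lambda>m k. c * l m k) \<in> finite_functionals d n"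
    using l(1) finite_subset[OF supp M] by (auto simp: finite_functionals_def T_space_def)
  ultimately show ?thesis unfolding represented_def using l by (metis (no_types, lifting))
qed

lemma represented_sum:
  assumes "finite A" "\<And>a. a \<in> A \<Longrightarrow> represented d n e (f a)"
  shows "represented d n e (\<lambda>X. \<Sum>a\<in>A. f a X)"
  using assms
proof (induction A rule: finite_induct)
  case empty
  have "(\<lambda>_ _. 0) \<in> finite_functionals d n" by (auto simp: finite_functionals_def T_space_def)
  moreover have "pairing d n (\<lambda>_ _. 0) r = 0" for r by (simp add: pairing_def)
  ultimately show ?case unfolding represented_def by (metis sum.empty)
next
  case (insert a A)
  then show ?case by (simp add: represented_add)
qed

lemma represented_coordinate_product:
  assumes k: "k \<in> level_index d n m" and k': "k' \<in> level_index d n m'"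
  shows "represented d n e (\<lambda>X. sigJ d n e X m k * sigJ d n e X m' k')"
proof -
  obtain P \<pi> P' \<pi>' where kk: "k = (P, \<pi>)" "k' = (P', \<pi>')" by (metis surj_pair)
  obtain S where S: "S \<subseteq> {..<d} \<rightarrow>\<^sub>E {p. p permutes {..<m + m'}}"
    "\<And>\<rho>. \<rho> \<in> S \<Longrightarrow> (concat_rows m m' P P', \<rho>) \<in> level_index d n (m + m')"
    "\<And>x. x \<in> Lip d \<Longrightarrow> sig d n e x m (P, \<pi>) * sig d n e x m' (P', \<pi>')
      = (\<Sum>\<rho>\<in>S. sig d n e x (m + m') (concat_rows m m' P P', \<rho>))"
    using shuffle_product[OF k[unfolded kk] k'[unfolded kk], where e=e] by metis
  have "finite S" using S(1) permutation_families(1) by (rule finite_subset)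
  then have "represented d n e (\<lambda>X. \<Sum>\<rho>\<in>S. sigJ d n e X (m + m') (concat_rows m m' P P', \<rho>))"
    by (intro represented_sum represented_coordinate S(2))
  moreover have "sigJ d n e X m k * sigJ d n e X m' k' = (\<Sum>\<rho>\<in>S. sigJ d n e X (m + m') (concat_rows m m' P P', \<rho>))"
    if "X \<in> LipJ d n e" for X
    unfolding sigJ_def kk by (rule S(3)[OF LipJ_rep(2)[OF that]])
  ultimately show ?thesis by (rule represented_cong)
qed

lemma represented_mult:
  assumes "represented d n e f" "represented d n e g"
  shows "represented d n e (\<lambda>X. f X * g X)"
proof -
  obtain l l' where l: "l \<in> finite_functionals d n" "\<And>X. X \<in> LipJ d n e \<Longrightarrow> f X = pairing d n l (sigJ d n e X)"
    and l': "l' \<in> finite_functionals d n" "\<And>X. X \<in> LipJ d n e \<Longrightarrow> g X = pairing d n l' (sigJ d n e X)"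
    using assms unfolding represented_def by metis
  let ?M = "{m. \<exists>k. l m k \<noteq> 0}" and ?M' = "{m. \<exists>k. l' m k \<noteq> 0}"
  have M: "finite ?M" "finite ?M'" using l(1) l'(1) by (auto simp: finite_functionals_def)
  have "represented d n e (\<lambda>X. \<Sum>m\<in>?M. \<Sum>m'\<in>?M'. \<Sum>k\<in>level_index d n m. \<Sum>k'\<in>level_index d n m'.
      (l m k * l' m' k') * (sigJ d n e X m k * sigJ d n e X m' k'))"
    by (intro represented_sum M finite_level_index represented_scale represented_coordinate_product)
  moreover have "f X * g X = (\<Sum>m\<in>?M. \<Sum>m'\<in>?M'. \<Sum>k\<in>level_index d n m. \<Sum>k'\<in>level_index d n m'.
      (l m k * l' m' k') * (sigJ d n e X m k * sigJ d n e X m' k'))" if "X \<in> LipJ d n e" for X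
    unfolding l(2)[OF that] l'(2)[OF that] pairing_def
    by (simp add: sum_distrib_left sum_distrib_right mult_ac)
  ultimately show ?thesis by (rule represented_cong)
qed

lemma represented_one:
  "represented d n e (\<lambda>X. 1)"
proof -
  \<comment> \<open>The only index of level 0: the empty family of \<open>P\<close> and, in each
    column, the identity as the permutation of the empty set.\<close>
  have k: "(\<lambda>_. undefined, \<lambda>j\<in>{..<d}. id) \<in> level_index d n 0"
    by (auto simp: level_index_def)
  have "sigJ d n e X 0 (\<lambda>_. undefined, \<lambda>j\<in>{..<d}. id) = 1" for X
    using k by (simp add: sigJ_def sig_def)
  then show ?thesis using represented_coordinate[OF k, of e] by simp
qed

lemma continuous_map_represented:
  assumes d: "d \<ge> 1" and f: "represented d n e f"
  shows "continuous_map (LipJ_topology d n e) euclideanreal f"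
proof -
  interpret M: Metric_space "LipJ d n e" "mu_inf d n e" by (rule Metric_space_LipJ)
  interpret H: Metric_space "H_space d n" "H_dist d n" by (rule Metric_space_H_space)
  obtain l where l: "l \<in> finite_functionals d n" "\<And>X. X \<in> LipJ d n e \<Longrightarrow> f X = pairing d n l (sigJ d n e X)"
    using f unfolding represented_def by metis
  \<comment> \<open>Each coordinate is 1-Lipschitz for \<open>H_dist\<close>, so
    \<open>\<epsilon>\<close> itself serves as the radius.\<close>
  have coord: "continuous_map (H_topology d n) euclideanreal (\<lambda>r. r m k)" if k: "k \<in> level_index d n m" for m k
    unfolding mtopology_is_euclidean[symmetric] H.metric_continuous_map[OF Met_TC.Metric_space_axioms]
  proof (intro conjI ballI allI impI)
    fix r and \<epsilon> :: real assume "r \<in> H_space d n" "0 < \<epsilon>"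
    then show "\<exists>\<delta>>0. \<forall>r'. r' \<in> H_space d n \<and> H_dist d n r r' < \<delta> \<longrightarrow> dist (r m k) (r' m k) < \<epsilon>"
      using entry_le_H_dist[OF _ _ k] by (intro exI[of _ \<epsilon>]) (auto simp: dist_real_def intro: le_less_trans)
  qed simp
  have "continuous_map (H_topology d n) euclideanreal (pairing d n l)"
    unfolding pairing_def using l(1)
    by (intro continuous_map_sum continuous_map_real_mult_left coord) (auto simp: finite_functionals_def)
  then have "continuous_map (LipJ_topology d n e) euclideanreal (pairing d n l \<circ> sigJ d n e)"
    by (rule continuous_map_compose[OF continuous_map_sigJ[OF d]])
  then show ?thesis
    by (rule continuous_map_eq) (simp add: l(2))
qed

lemma shuffle_subalgebra:
  assumes d: "d \<ge> 1"
  shows "continuous_subalgebra (LipJ_topology d n e)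
    ((\<lambda>l. \<lambda>X\<in>LipJ d n e. pairing d n l (sigJ d n e X)) ` finite_functionals d n)"
proof -
  interpret M: Metric_space "LipJ d n e" "mu_inf d n e" by (rule Metric_space_LipJ)
  let ?F = "(\<lambda>l. \<lambda>X\<in>LipJ d n e. pairing d n l (sigJ d n e X)) ` finite_functionals d n"
  have F_iff: "f \<in> ?F \<longleftrightarrow> f \<in> extensional (LipJ d n e) \<and> represented d n e f" for f
  proof
    assume "f \<in> extensional (LipJ d n e) \<and> represented d n e f"
    then obtain l where "l \<in> finite_functionals d n" "f \<in> extensional (LipJ d n e)"
      "\<And>X. X \<in> LipJ d n e \<Longrightarrow> f X = pairing d n l (sigJ d n e X)"
      unfolding represented_def by metis
    then have "f = (\<lambda>X\<in>LipJ d n e. pairing d n l (sigJ d n e X))" by (auto simp: extensional_def fun_eq_iff)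
    then show "f \<in> ?F" using \<open>l \<in> _\<close> by blast
  qed (auto simp: represented_def)
  have restr: "represented d n e (\<lambda>X\<in>LipJ d n e. f X)" if "represented d n e f" for f
    using that unfolding represented_def by simp
  show ?thesis
    unfolding continuous_subalgebra_def M.topspace_mtopology
  proof (intro conjI ballI allI)
    show "?F \<subseteq> {f \<in> extensional (LipJ d n e). continuous_map (LipJ_topology d n e) euclideanreal f}"
      using F_iff continuous_map_represented[OF d] by blast
  qed (auto simp only: F_iff restrict_extensional intro!: restr represented_one represented_add represented_scale represented_mult)
qed

section \<open>Mixed partial derivatives of indefinite integrals\<close>

text \<open>Fubini with the inserted coordinate outermost, the order in which an indefinite integral
  in that coordinate appears.\<close>

lemma integral_PiM_insert:
  fixes f :: "('i \<Rightarrow> 'a) \<Rightarrow> real"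
  assumes M: "\<And>i. prob_space (M i)" and i: "i \<notin> I" and f: "integrable (PiM (insert i I) M) f"
  shows "(LINT x|PiM (insert i I) M. f x) = (LINT y|M i. LINT x|PiM I M. f (x(i := y)))"
proof -
  interpret pair_sigma_finite "M i" "PiM I M"
    using M by (intro pair_sigma_finite.intro prob_space_imp_sigma_finite prob_space_PiM) auto
  have d: "distr (M i \<Otimes>\<^sub>M PiM I M) (PiM (insert i I) M) (\<lambda>(y, x). x(i := y)) = PiM (insert i I) M"
    by (rule distr_pair_PiM_eq_PiM) (use M in auto)
  have m: "(\<lambda>(y, x). x(i := y)) \<in> measurable (M i \<Otimes>\<^sub>M PiM I M) (PiM (insert i I) M)"
    by measurable
  have "integrable (M i \<Otimes>\<^sub>M PiM I M) (\<lambda>p. f ((\<lambda>(y, x). x(i := y)) p))"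
    by (rule integrable_distr[OF m]) (simp only: d f)
  moreover have "(LINT x|PiM (insert i I) M. f x) = (LINT p|(M i \<Otimes>\<^sub>M PiM I M). f ((\<lambda>(y, x). x(i := y)) p))"
    using integral_distr[OF m, of f] f unfolding d by auto
  ultimately show ?thesis
    using integral_fst'[of "\<lambda>p. f ((\<lambda>(y, x). x(i := y)) p)"] by simp
qed

lemma (in prob_space) abs_integral_le:
  fixes f :: "'a \<Rightarrow> real"
  assumes f: "f \<in> borel_measurable M" and B: "\<And>x. x \<in> space M \<Longrightarrow> \<bar>f x\<bar> \<le> B"
  shows "\<bar>LINT x|M. f x\<bar> \<le> B"
proof -
  have int: "integrable M f"
    by (rule integrable_const_bound[where B=B]) (use f B in auto)
  have "\<bar>LINT x|M. f x\<bar> \<le> (LINT x|M. \<bar>f x\<bar>)" by (rule integral_abs_bound)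
  also have "\<dots> \<le> (LINT x|M. B)"
    using int B by (intro integral_mono) auto
  finally show ?thesis by (simp add: prob_space)
qed

text \<open>Serves two purposes: with the uniform bound \<open>B\<close> it gives Lipschitz
  continuity of \<open>cumulative\<close>, and with a small \<open>\<eta>\<close> it compares the
  indefinite integrals of two nearby integrands.\<close>

lemma indefinite_integral_lipschitz:
  fixes h :: "real \<Rightarrow> real"
  assumes h: "h \<in> borel_measurable I01" and \<eta>: "\<And>v. v \<in> {0..1} \<Longrightarrow> \<bar>h v\<bar> \<le> \<eta>"
    and uc: "u \<in> {0..1}" "c \<in> {0..1}"
  shows "\<bar>(LINT v|I01. indicator {..u} v * h v) - (LINT v|I01. indicator {..c} v * h v)\<bar> \<le> \<eta> * \<bar>u - c\<bar>"
proof -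
  interpret prob_space I01 by (rule prob_space_I01)
  have [measurable]: "indicator A \<in> borel_measurable I01" if "A \<in> sets borel" for A :: "real set"
    using that by (intro measurable_I01) simp
  have \<eta>0: "0 \<le> \<eta>" using \<eta>[of 0] by simp
  have int: "integrable I01 (\<lambda>v. indicator {..w} v * h v)" for w
    by (rule integrable_const_bound[where B=\<eta>])
      (use h \<eta> \<eta>0 in \<open>auto intro!: AE_I2 split: split_indicator\<close>)
  \<comment> \<open>Exactly the set on which the two indicators differ.\<close>
  define A where "A = {min u c<..max u c}"
  have A: "A \<in> sets I01" "A \<subseteq> {0..1}" using uc by (auto simp: A_def sets_I01)
  have mA: "measure I01 A = \<bar>u - c\<bar>"
    using A uc by (subst measure_restrict_space) (auto simp: A_def min_def max_def)
  have "\<bar>(LINT v|I01. indicator {..u} v * h v) - (LINT v|I01. indicator {..c} v * h v)\<bar>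
    = \<bar>LINT v|I01. (indicator {..u} v * h v - indicator {..c} v * h v)\<bar>"
    by (simp add: Bochner_Integration.integral_diff[OF int int])
  also have "\<dots> \<le> (LINT v|I01. \<bar>indicator {..u} v * h v - indicator {..c} v * h v\<bar>)"
    by (rule integral_abs_bound)
  also have "\<dots> \<le> (LINT v|I01. \<eta> * indicator A v)"
  proof (rule integral_mono)
    show "integrable I01 (\<lambda>v. \<bar>indicator {..u} v * h v - indicator {..c} v * h v\<bar>)"
      by (intro integrable_abs Bochner_Integration.integrable_diff int)
    show "integrable I01 (\<lambda>v. \<eta> * indicator A v)"
      using A by (intro integrable_mult_right integrable_real_indicator) (auto simp: emeasure_eq_measure)
    show "\<bar>indicator {..u} v * h v - indicator {..c} v * h v\<bar> \<le> \<eta> * indicator A v" if "v \<in> space I01" for v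
      using \<eta>[of v] that by (auto simp: A_def split: split_indicator)
  qed
  also have "\<dots> = \<eta> * \<bar>u - c\<bar>" using A by (simp add: mA Int_absorb2)
  finally show ?thesis .
qed

text \<open>The indefinite integral of \<open>g\<close> after differentiation in the coordinates in \<open>S\<close>.\<close>

definition cumulative :: "nat set \<Rightarrow> (point \<Rightarrow> real) \<Rightarrow> nat set \<Rightarrow> point \<Rightarrow> real" where
  "cumulative I g S t = (LINT s|cube_measure (I - S).
     (if \<forall>i\<in>I - S. s i \<le> t i then g (merge S (I - S) (t, s)) else 0))"

context
  fixes I :: "nat set" and g :: "point \<Rightarrow> real" and B :: real
  assumes fin: "finite I" and g: "g \<in> borel_measurable (cube_measure I)"
    and B: "\<And>s. s \<in> unit_cube I \<Longrightarrow> \<bar>g s\<bar> \<le> B"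
begin

private lemma B_nonneg: "0 \<le> B"
proof -
  have "(\<lambda>i\<in>I. 0) \<in> unit_cube I" by (auto simp: unit_cube_def)
  from B[OF this] show ?thesis by simp
qed

private lemma merge_unit_cube:
  "S \<subseteq> I \<Longrightarrow> t \<in> unit_cube I \<Longrightarrow> s \<in> unit_cube (I - S) \<Longrightarrow> merge S (I - S) (t, s) \<in> unit_cube I"
  by (auto simp: unit_cube_def merge_def PiE_iff extensional_def)

private lemma cumulative_integrand:
  assumes S: "S \<subseteq> I"
  shows "(\<lambda>(t, s). if \<forall>i\<in>I - S. s i \<le> t i then g (merge S (I - S) (t, s)) else 0)
    \<in> borel_measurable (cube_measure I \<Otimes>\<^sub>M cube_measure (I - S))"
proof -
  let ?N = "cube_measure I \<Otimes>\<^sub>M cube_measure (I - S)"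
  have f: "(\<lambda>p. fst p i) \<in> borel_measurable ?N" if "i \<in> I" for i
    by (rule measurable_compose[OF measurable_fst borel_measurable_component[OF that]])
  have s: "(\<lambda>p. snd p i) \<in> borel_measurable ?N" if "i \<in> I - S" for i
    by (rule measurable_compose[OF measurable_snd borel_measurable_component[OF that]])
  have "(\<lambda>p. merge S (I - S) p) \<in> measurable ?N (cube_measure I)"
  proof (rule measurable_cubeI)
    fix i assume i: "i \<in> I"
    show "(\<lambda>p. merge S (I - S) p i) \<in> borel_measurable ?N"
      using f[OF i] s[of i] i by (cases "i \<in> S") (simp_all add: merge_def split_beta)
  qed (auto simp: space_pair_measure space_cube intro!: merge_unit_cube[OF S])
  from measurable_compose[OF this g] have m: "(\<lambda>p. g (merge S (I - S) p)) \<in> borel_measurable ?N" .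
  have p: "Measurable.pred ?N (\<lambda>p. \<forall>i\<in>I - S. snd p i \<le> fst p i)"
  proof (intro pred_intros_finite(3) finite_Diff fin)
    fix i assume "i \<in> I - S"
    then show "Measurable.pred ?N (\<lambda>p. snd p i \<le> fst p i)"
      unfolding pred_def by (intro borel_measurable_le s f) auto
  qed
  show ?thesis
    unfolding split_beta using measurable_If[OF m borel_measurable_const[where c=0] p[unfolded pred_def]]
    by (simp only: prod.collapse)
qed

private lemma cumulative_section:
  assumes S: "S \<subseteq> I" and t: "t \<in> unit_cube I"
  shows "(\<lambda>s. if \<forall>i\<in>I - S. s i \<le> t i then g (merge S (I - S) (t, s)) else 0) \<in> borel_measurable (cube_measure (I - S))"
    and "s \<in> space (cube_measure (I - S)) \<Longrightarrow> \<bar>if \<forall>i\<in>I - S. s i \<le> t i then g (merge S (I - S) (t, s)) else 0\<bar> \<le> B"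
proof -
  have "t \<in> space (cube_measure I)" using t by (simp add: space_cube)
  from measurable_compose[OF measurable_Pair1'[OF this] cumulative_integrand[OF S]]
  show "(\<lambda>s. if \<forall>i\<in>I - S. s i \<le> t i then g (merge S (I - S) (t, s)) else 0) \<in> borel_measurable (cube_measure (I - S))"
    by simp
  show "s \<in> space (cube_measure (I - S)) \<Longrightarrow> \<bar>if \<forall>i\<in>I - S. s i \<le> t i then g (merge S (I - S) (t, s)) else 0\<bar> \<le> B"
    using B[OF merge_unit_cube[OF S t]] B_nonneg by (simp add: space_cube)
qed

lemma borel_measurable_cumulative:
  assumes "S \<subseteq> I"
  shows "cumulative I g S \<in> borel_measurable (cube_measure I)"
  unfolding cumulative_def
  by (rule sigma_finite_measure.borel_measurable_lebesgue_integral[OF prob_space_imp_sigma_finite[OF prob_space_cube]])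
    (rule cumulative_integrand[OF assms])

lemma cumulative_bound:
  assumes "S \<subseteq> I" "t \<in> unit_cube I"
  shows "\<bar>cumulative I g S t\<bar> \<le> B"
  unfolding cumulative_def
  by (rule prob_space.abs_integral_le[OF prob_space_cube]) (rule cumulative_section[OF assms], assumption?)+

lemma cumulative_all:
  assumes t: "t \<in> unit_cube I"
  shows "cumulative I g I t = g t"
proof -
  interpret prob_space "cube_measure {}" by (rule prob_space_cube)
  have "merge I {} (t, s) = t" for s
    using t by (auto simp: merge_def unit_cube_def PiE_iff extensional_def fun_eq_iff)
  then show ?thesis by (simp add: cumulative_def prob_space)
qed

text \<open>One coordinate is split off by Fubini; along it the function becomes an indefinite
  integral in one variable, ready for Lebesgue differentiation.\<close>

lemma cumulative_insert:
  assumes S: "S \<subseteq> I" and j: "j \<in> I - S" and t: "t \<in> unit_cube I"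
  shows "cumulative I g S t = (LINT v|I01. indicator {..t j} v * cumulative I g (insert j S) (t(j := v)))"
proof -
  interpret prob_space "cube_measure (I - S)" by (rule prob_space_cube)
  let ?J = "I - insert j S"
  have ins: "insert j ?J = I - S" using j by auto
  let ?f = "\<lambda>s. if \<forall>i\<in>I - S. s i \<le> t i then g (merge S (I - S) (t, s)) else 0"
  have "integrable (cube_measure (I - S)) ?f"
    by (rule integrable_const_bound[where B=B]) (use cumulative_section[OF S t] in auto)
  then have "integrable (PiM (insert j ?J) (\<lambda>_. I01)) ?f" by (simp only: ins cube_measure_def)
  from integral_PiM_insert[OF prob_space_I01 _ this]
  have "(LINT s|PiM (insert j ?J) (\<lambda>_. I01). ?f s) = (LINT v|I01. LINT s|PiM ?J (\<lambda>_. I01). ?f (s(j := v)))"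
    by simp
  then have "cumulative I g S t = (LINT v|I01. LINT s|cube_measure ?J. ?f (s(j := v)))"
    by (simp only: ins cube_measure_def cumulative_def)
  also have "\<dots> = (LINT v|I01. indicator {..t j} v * cumulative I g (insert j S) (t(j := v)))"
  proof (rule Bochner_Integration.integral_cong[OF refl])
    fix v :: real
    have "merge S (I - S) (t, s(j := v)) = merge (insert j S) ?J (t(j := v), s)" for s
      using j by (auto simp: merge_def fun_eq_iff)
    moreover have "(\<forall>i\<in>I - S. (s(j := v)) i \<le> t i) \<longleftrightarrow> v \<le> t j \<and> (\<forall>i\<in>?J. s i \<le> (t(j := v)) i)" for s
      using j by auto
    ultimately have "?f (s(j := v)) = indicator {..t j} v *
        (if \<forall>i\<in>?J. s i \<le> (t(j := v)) i then g (merge (insert j S) ?J (t(j := v), s)) else 0)" for s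
      by (simp add: indicator_def)
    then show "(LINT s|cube_measure ?J. ?f (s(j := v))) = indicator {..t j} v * cumulative I g (insert j S) (t(j := v))"
      by (simp add: cumulative_def)
  qed
  finally show ?thesis .
qed

private lemma section_measurable:
  assumes "S \<subseteq> I" "j \<in> I" "t \<in> unit_cube I"
  shows "(\<lambda>v. cumulative I g S (t(j := v))) \<in> borel_measurable I01"
proof (rule measurable_compose[OF _ borel_measurable_cumulative[OF assms(1)]])
  show "(\<lambda>v. t(j := v)) \<in> measurable I01 (cube_measure I)"
  proof (rule measurable_cubeI)
    fix i assume "i \<in> I"
    show "(\<lambda>v. (t(j := v)) i) \<in> borel_measurable I01"
      using measurable_I01[OF measurable_ident, unfolded id_def] by (cases "i = j") simp_all
  qed (use assms in \<open>auto intro: unit_cube_upd\<close>)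
qed

private lemma cumulative_line:
  assumes S: "S \<subseteq> I" and j: "j \<in> I - S" and t: "t \<in> unit_cube I" and c: "c \<in> {0..1}"
  shows "cumulative I g S (t(j := c)) = (LINT v|I01. indicator {..c} v * cumulative I g (insert j S) (t(j := v)))"
  using cumulative_insert[OF S j unit_cube_upd[OF t _ c]] j by simp

lemma cumulative_lipschitz1:
  assumes S: "S \<subseteq> I" and j: "j \<in> I - S" and t: "t \<in> unit_cube I" and u: "u \<in> {0..1}" "c \<in> {0..1}"
  shows "\<bar>cumulative I g S (t(j := u)) - cumulative I g S (t(j := c))\<bar> \<le> B * \<bar>u - c\<bar>"
  unfolding cumulative_line[OF S j t u(1)] cumulative_line[OF S j t u(2)]
  using S j t u
  by (intro indefinite_integral_lipschitz section_measurable cumulative_bound unit_cube_upd) auto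

lemma cumulative_lipschitz:
  assumes S: "S \<subseteq> I" and F: "finite F" "F \<subseteq> I - S"
    and t: "t \<in> unit_cube I" "t' \<in> unit_cube I" "\<And>i. i \<notin> F \<Longrightarrow> t i = t' i"
  shows "\<bar>cumulative I g S t - cumulative I g S t'\<bar> \<le> B * (\<Sum>i\<in>F. \<bar>t i - t' i\<bar>)"
  using F t
proof (induction F arbitrary: t rule: finite_induct)
  case empty
  then have "t = t'" by auto
  then show ?case by simp
next
  case (insert k F)
  let ?t = "t(k := t' k)"
  have t'k: "t' k \<in> {0..1}" "t k \<in> {0..1}" using insert.prems by (auto dest: unit_cubeD)
  have "\<bar>cumulative I g S ?t - cumulative I g S t'\<bar> \<le> B * (\<Sum>i\<in>F. \<bar>?t i - t' i\<bar>)"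
    by (intro insert.IH unit_cube_upd) (use insert.prems t'k in auto)
  also have "(\<Sum>i\<in>F. \<bar>?t i - t' i\<bar>) = (\<Sum>i\<in>F. \<bar>t i - t' i\<bar>)"
    using insert.hyps by (intro sum.cong) auto
  finally have "\<bar>cumulative I g S ?t - cumulative I g S t'\<bar> \<le> B * (\<Sum>i\<in>F. \<bar>t i - t' i\<bar>)" .
  moreover have "\<bar>cumulative I g S t - cumulative I g S ?t\<bar> \<le> B * \<bar>t k - t' k\<bar>"
    using cumulative_lipschitz1[OF S _ insert.prems(2) t'k(2) t'k(1), of k] insert.prems by simp
  ultimately show ?case using insert.hyps by (simp add: distrib_left)
qed

text \<open>The exceptional set of the derivative in direction \<open>j\<close> can be chosen independently of the
  coordinates outside of \<open>insert j S\<close>: rational values suffice by Lipschitz continuity.\<close>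

lemma cumulative_derivative:
  assumes S: "S \<subseteq> I" and j: "j \<in> I - S"
  obtains N where "N \<in> sets (cube_measure I)" "AE t in cube_measure I. t \<in> N"
    "\<And>t t'. t \<in> N \<Longrightarrow> t' \<in> unit_cube I \<Longrightarrow> (\<And>i. i \<in> insert j S \<Longrightarrow> t' i = t i) \<Longrightarrow>
      has_partial j (cumulative I g S) (cumulative I g (insert j S) t') t'"
proof -
  let ?J = "I - insert j S" and ?H = "cumulative I g (insert j S)"
  have jS: "insert j S \<subseteq> I" using S j by auto
  define Q where "Q = PiE ?J (\<lambda>_. \<rat> \<inter> {0..1::real})"
  have Qc: "countable Q" unfolding Q_def using fin by (intro countable_PiE countable_Int1 countable_rat) auto
  have Q01: "r \<in> unit_cube ?J" if "r \<in> Q" for r using that by (auto simp: Q_def unit_cube_def PiE_iff)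
  \<comment> \<open>Replaces the coordinates not yet differentiated by those of a rational point
    \<open>r\<close>; the derivative is first studied for these countably many choices.\<close>
  define ov where "ov t r = merge (insert j S) ?J (t, r)" for t r :: point
  have ov: "ov t r \<in> unit_cube I" if "t \<in> unit_cube I" "r \<in> Q" for t r
    unfolding ov_def by (rule merge_unit_cube[OF jS that(1) Q01[OF that(2)]])
  have ovj: "ov t r j = t j" for t r by (simp add: ov_def merge_def)
  have ovm: "(\<lambda>t. ov t r) \<in> measurable (cube_measure I) (cube_measure I)" if "r \<in> Q" for r
  proof (rule measurable_cubeI)
    fix i assume "i \<in> I"
    then show "(\<lambda>t. ov t r i) \<in> borel_measurable (cube_measure I)"
      using borel_measurable_component[of i I] by (cases "i \<in> insert j S") (simp_all add: ov_def merge_def)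
  qed (use ov that in \<open>auto simp: space_cube\<close>)
  define G where "G r = {t \<in> space (cube_measure I). has_partial j (cumulative I g S) (?H (ov t r)) (ov t r)}" for r
  have G_eq: "G r = {t \<in> space (cube_measure I). ((\<lambda>c. cumulative I g S ((ov t r)(j := c))) has_vector_derivative ?H (ov t r)) (at (t j) within {0..1})}" for r
    by (simp add: G_def ovj)
  have cont: "continuous_on {0..1} (\<lambda>c. cumulative I g S (t(j := c)))" if t: "t \<in> unit_cube I" for t
    by (rule lipschitz_on_continuous_on[where L=B], rule lipschitz_onI)
      (use cumulative_lipschitz1[OF S j t] B_nonneg in \<open>auto simp: dist_real_def\<close>)
  have jI: "j \<in> I" using j by simp
  have Gs: "G r \<in> sets (cube_measure I)" if r: "r \<in> Q" for r
    unfolding G_eq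
  proof (rule sets_has_vector_derivative)
    show "(\<lambda>t. cumulative I g S ((ov t r)(j := u))) \<in> borel_measurable (cube_measure I)" if "u \<in> {0..1}" for u
      by (rule measurable_compose[OF measurable_compose[OF ovm[OF r] measurable_cube_upd[OF jI that]] borel_measurable_cumulative[OF S]])
    have triv: "(ov t r)(j := t j) = ov t r" for t using ovj[of t r] by (metis fun_upd_triv)
    have "(\<lambda>t. cumulative I g S (ov t r)) \<in> borel_measurable (cube_measure I)"
      by (rule measurable_compose[OF ovm[OF r] borel_measurable_cumulative[OF S]])
    then show "(\<lambda>t. cumulative I g S ((ov t r)(j := t j))) \<in> borel_measurable (cube_measure I)"
      by (simp only: triv)
    show "(\<lambda>t. t j) \<in> borel_measurable (cube_measure I)" by (rule borel_measurable_component[OF jI])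
    show "(\<lambda>t. ?H (ov t r)) \<in> borel_measurable (cube_measure I)"
      by (rule measurable_compose[OF ovm[OF r] borel_measurable_cumulative[OF jS]])
    show "t j \<in> {0..1}" if "t \<in> space (cube_measure I)" for t
      using that jI unfolding space_cube by (rule unit_cubeD)
    show "continuous_on {0..1} (\<lambda>c. cumulative I g S ((ov t r)(j := c)))" if "t \<in> space (cube_measure I)" for t
      using that unfolding space_cube by (intro cont ov r)
  qed
  define N where "N = {t \<in> space (cube_measure I). \<forall>r\<in>Q. t \<in> G r}"
  have "Q \<noteq> {}" by (auto simp: Q_def PiE_eq_empty_iff intro!: bexI[of _ 0])
  then have "(\<Inter>r\<in>Q. G r) \<in> sets (cube_measure I)"
    by (rule sets.countable_INT'[OF Qc]) (use Gs in auto)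
  moreover have "N = space (cube_measure I) \<inter> (\<Inter>r\<in>Q. G r)" by (auto simp: N_def)
  ultimately have N: "N \<in> sets (cube_measure I)" by (simp add: sets.Int)
  \<comment> \<open>Along direction \<open>j\<close> through \<open>ov t r\<close> the function is
    an indefinite integral of one variable, so differentiability holds on almost all of each
    line.\<close>
  have "AE t in cube_measure I. t \<in> G r" if r: "r \<in> Q" for r
  proof (rule AE_cube_slice[OF fin jI])
    have "{t \<in> space (cube_measure I). t \<in> G r} = G r" by (auto simp: G_def)
    then show "{t \<in> space (cube_measure I). t \<in> G r} \<in> sets (cube_measure I)" using Gs[OF r] by simp
    fix t assume t: "t \<in> unit_cube I"
    have up: "(ov (t(j := u)) r)(j := c) = (ov t r)(j := c)" "ov (t(j := u)) r = (ov t r)(j := u)" for u c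
      by (auto simp: ov_def merge_def fun_eq_iff)
    have "AE u in I01. ((\<lambda>c. LINT v|I01. indicator {..c} v * ?H ((ov t r)(j := v))) has_vector_derivative ?H ((ov t r)(j := u))) (at u within {0..1})"
      by (rule AE_has_derivative_indefinite_integral[where B=B])
        (intro section_measurable jS jI ov t r cumulative_bound unit_cube_upd; assumption)+
    then show "AE u in I01. t(j := u) \<in> G r"
      using AE_space
    proof eventually_elim
      case (elim u)
      then have u: "u \<in> {0..1}" by simp
      have "((\<lambda>c. cumulative I g S ((ov t r)(j := c))) has_vector_derivative ?H ((ov t r)(j := u))) (at u within {0..1})"
        by (rule has_vector_derivative_transform[OF u _ elim(1)]) (simp add: cumulative_line[OF S j ov[OF t r]])
      then show ?case using unit_cube_upd[OF t jI u] by (simp add: G_eq up space_cube)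
    qed
  qed
  then have "AE t in cube_measure I. \<forall>r\<in>Q. t \<in> G r"
    using Qc by (simp add: AE_ball_countable)
  with AE_space have NAE: "AE t in cube_measure I. t \<in> N"
    by eventually_elim (simp add: N_def)
  show thesis
  proof (rule that[OF N NAE])
    fix t t' assume tN: "t \<in> N" and t': "t' \<in> unit_cube I" and agree: "\<And>i. i \<in> insert j S \<Longrightarrow> t' i = t i"
    have t: "t \<in> unit_cube I" using tN by (simp add: N_def space_cube)
    have tj: "t' j = t j" "t j \<in> {0..1}" using agree unit_cubeD[OF t jI] by auto
    let ?f = "\<lambda>c. cumulative I g S (t'(j := c))"
    show "has_partial j (cumulative I g S) (?H t') t'"
      unfolding has_vector_derivative_iff_quotient
    proof (intro allI impI)
      fix e :: real assume e: "0 < e"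
      \<comment> \<open>Moving all coordinates outside \<open>insert j S\<close> by at most
        \<open>\<delta>\<close> changes \<open>?H\<close> by at most \<open>e / 4\<close>; the
        summands 1 cover \<open>B = 0\<close> and an empty index set.\<close>
      define \<delta> where "\<delta> = e / (4 * (B + 1) * (real (card ?J) + 1))"
      have \<delta>: "0 < \<delta>" using e B_nonneg by (simp add: \<delta>_def)
      have "\<exists>q. q \<in> \<rat> \<inter> {0..1} \<and> \<bar>t' i - q\<bar> \<le> \<delta>" if "i \<in> ?J" for i
      proof -
        have "t' i \<in> {0..1}" using unit_cubeD[OF t'] that by blast
        from rational_near[OF this \<delta>] show ?thesis by (metis IntI abs_minus_commute less_imp_le)
      qed
      then obtain q where q: "\<And>i. i \<in> ?J \<Longrightarrow> q i \<in> \<rat> \<inter> {0..1} \<and> \<bar>t' i - q i\<bar> \<le> \<delta>" by metis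
      define r where "r = restrict q ?J"
      have r: "r \<in> Q" using q by (auto simp: r_def Q_def)
      let ?o = "ov t r"
      note o = ov[OF t r]
      have diff: "\<And>i. i \<notin> ?J \<Longrightarrow> t' i = ?o i"
        using agree t' by (auto simp: ov_def merge_def unit_cube_def PiE_iff extensional_def)
      have sum: "B * (\<Sum>i\<in>?J. \<bar>t' i - ?o i\<bar>) \<le> e / 4"
      proof -
        have "(\<Sum>i\<in>?J. \<bar>t' i - ?o i\<bar>) \<le> (\<Sum>i\<in>?J. \<delta>)"
          using q by (intro sum_mono) (auto simp: ov_def merge_def r_def)
        then have "B * (\<Sum>i\<in>?J. \<bar>t' i - ?o i\<bar>) \<le> (B + 1) * ((real (card ?J) + 1) * \<delta>)"
          using B_nonneg \<delta> by (intro mult_mono sum_nonneg) (auto simp: algebra_simps)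
        also have "\<dots> = e / 4"
        proof -
          have "a * (b * (e / (4 * a * b))) = e / 4" if "0 < a" "0 < b" for a b :: real
            using that by (simp add: field_simps)
          from this[of "B + 1" "real (card ?J) + 1"] show ?thesis using B_nonneg by (simp only: \<delta>_def)
        qed
        finally show ?thesis .
      qed
      have H_close: "\<bar>?H (t'(j := v)) - ?H (?o(j := v))\<bar> \<le> e / 4" if v: "v \<in> {0..1}" for v
      proof -
        have "\<bar>?H (t'(j := v)) - ?H (?o(j := v))\<bar> \<le> B * (\<Sum>i\<in>?J. \<bar>(t'(j := v)) i - (?o(j := v)) i\<bar>)"
          using diff v jI fin t' o by (intro cumulative_lipschitz[OF jS]) (auto intro!: unit_cube_upd)
        also have "(\<Sum>i\<in>?J. \<bar>(t'(j := v)) i - (?o(j := v)) i\<bar>) = (\<Sum>i\<in>?J. \<bar>t' i - ?o i\<bar>)"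
          by (intro sum.cong) auto
        finally show ?thesis using sum by linarith
      qed
      have "has_partial j (cumulative I g S) (?H ?o) ?o" using tN r by (auto simp: N_def G_def)
      then obtain \<epsilon> where \<epsilon>: "\<epsilon> > 0" "\<And>u. u \<in> {0..1} \<Longrightarrow> u \<noteq> t j \<Longrightarrow> \<bar>u - t j\<bar> < \<epsilon> \<Longrightarrow>
          \<bar>(cumulative I g S (?o(j := u)) - cumulative I g S (?o(j := t j))) / (u - t j) - ?H ?o\<bar> < e / 4"
        unfolding has_vector_derivative_iff_quotient ovj using e by (metis divide_pos_pos zero_less_numeral)
      show "\<exists>\<delta>>0. \<forall>u\<in>{0..1}. u \<noteq> t' j \<longrightarrow> \<bar>u - t' j\<bar> < \<delta> \<longrightarrow> \<bar>(?f u - ?f (t' j)) / (u - t' j) - ?H t'\<bar> < e"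
        unfolding tj(1)
      proof (intro exI[of _ \<epsilon>] conjI ballI impI \<epsilon>(1))
        fix u assume u: "u \<in> {0..1}" "u \<noteq> t j" "\<bar>u - t j\<bar> < \<epsilon>"
        let ?p = "\<lambda>c. cumulative I g S (?o(j := c))"
        let ?k = "\<lambda>v. ?H (t'(j := v)) - ?H (?o(j := v))"
        have pm: "(\<lambda>v. ?H (t'(j := v))) \<in> borel_measurable I01" "(\<lambda>v. ?H (?o(j := v))) \<in> borel_measurable I01"
          by (intro section_measurable jS jI t' o)+
        have km: "?k \<in> borel_measurable I01" by (intro borel_measurable_diff pm)
        interpret P: prob_space I01 by (rule prob_space_I01)
        have int: "integrable I01 (\<lambda>v. indicator {..c} v * ?H (w(j := v)))" if w: "w \<in> unit_cube I" for c w
        proof (rule P.integrable_const_bound[where B=B])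
          show "(\<lambda>v. indicator {..c} v * ?H (w(j := v))) \<in> borel_measurable I01"
            by (intro borel_measurable_times section_measurable jS jI w measurable_I01 borel_measurable_indicator) simp
          show "AE v in I01. norm (indicator {..c} v * ?H (w(j := v))) \<le> B"
            using cumulative_bound[OF jS unit_cube_upd[OF w jI]] B_nonneg by (intro AE_I2) (auto split: split_indicator)
        qed
        \<comment> \<open>Along direction \<open>j\<close> the two functions differ by the
          indefinite integral of \<open>?k\<close>, which is bounded by \<open>e / 4\<close>, so the
          difference quotients differ by at most that much. The derivative at the rational point and
          the closeness of \<open>?H\<close> add two more errors of at most
          \<open>e / 4\<close>.\<close>
        have K: "?f c - ?p c = (LINT v|I01. indicator {..c} v * ?k v)" if "c \<in> {0..1}" for c
          unfolding cumulative_line[OF S j t' that] cumulative_line[OF S j o that] right_diff_distrib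
          by (rule Bochner_Integration.integral_diff[symmetric, OF int[OF t'] int[OF o]])
        have "\<bar>(?f u - ?p u) - (?f (t j) - ?p (t j))\<bar> \<le> e / 4 * \<bar>u - t j\<bar>"
          unfolding K[OF u(1)] K[OF tj(2)] by (rule indefinite_integral_lipschitz[OF km H_close u(1) tj(2)])
        then have "\<bar>((?f u - ?p u) - (?f (t j) - ?p (t j))) / (u - t j)\<bar> \<le> e / 4"
          using u by (simp add: abs_divide divide_le_eq)
        moreover have "((?f u - ?p u) - (?f (t j) - ?p (t j))) / (u - t j) = (?f u - ?f (t j)) / (u - t j) - (?p u - ?p (t j)) / (u - t j)"
          by (simp add: diff_divide_distrib)
        moreover have "\<bar>?H t' - ?H ?o\<bar> \<le> e / 4"
          using H_close[OF tj(2)] tj(1) ovj by (metis fun_upd_triv)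
        ultimately show "\<bar>(?f u - ?f (t j)) / (u - t j) - ?H t'\<bar> < e"
          using \<epsilon>(2)[OF u] e by linarith
      qed
    qed
  qed
qed

text \<open>The next derivative evaluates the current one at all points of a line. Agreement is
  therefore claimed for every \<open>t'\<close> that shares with some \<open>t \<in> A\<close> the
  coordinates in \<open>js\<close>, the remaining ones being arbitrary.\<close>

lemma foldr_partial_cumulative:
  assumes F: "\<And>t. t \<in> unit_cube I \<Longrightarrow> F t = cumulative I g {} t" and js: "distinct js" "set js \<subseteq> I"
  shows "\<exists>A\<in>sets (cube_measure I). (AE t in cube_measure I. t \<in> A) \<and>
    (\<forall>t\<in>A. \<forall>t'\<in>unit_cube I. (\<forall>i\<in>set js. t' i = t i) \<longrightarrow> foldr partial js F t' = cumulative I g (set js) t')"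
  using js
proof (induction js)
  case Nil
  then show ?case using F by (intro bexI[of _ "space (cube_measure I)"]) auto
next
  case (Cons j js)
  then obtain A where A: "A \<in> sets (cube_measure I)" "AE t in cube_measure I. t \<in> A"
    "\<And>t t'. t \<in> A \<Longrightarrow> t' \<in> unit_cube I \<Longrightarrow> (\<forall>i\<in>set js. t' i = t i) \<Longrightarrow> foldr partial js F t' = cumulative I g (set js) t'"
    by auto
  have S: "set js \<subseteq> I" and j: "j \<in> I - set js" using Cons.prems by auto
  obtain N where N: "N \<in> sets (cube_measure I)" "AE t in cube_measure I. t \<in> N"
    "\<And>t t'. t \<in> N \<Longrightarrow> t' \<in> unit_cube I \<Longrightarrow> (\<And>i. i \<in> insert j (set js) \<Longrightarrow> t' i = t i) \<Longrightarrow>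
      has_partial j (cumulative I g (set js)) (cumulative I g (insert j (set js)) t') t'"
    using cumulative_derivative[OF S j] by blast
  show ?case
  proof (intro bexI[of _ "A \<inter> N"] conjI ballI impI)
    show "A \<inter> N \<in> sets (cube_measure I)" using A(1) N(1) by (rule sets.Int)
    show "AE t in cube_measure I. t \<in> A \<inter> N" using A(2) N(2) by eventually_elim simp
    fix t t' assume t: "t \<in> A \<inter> N" and t': "t' \<in> unit_cube I" and agree: "\<forall>i\<in>set (j # js). t' i = t i"
    have t'j: "t' j \<in> {0..1}" using unit_cubeD[OF t'] j by blast
    have d: "has_partial j (cumulative I g (set js)) (cumulative I g (insert j (set js)) t') t'"
      using t agree by (intro N(3)[of t t'] t') auto
    have "has_partial j (foldr partial js F) (cumulative I g (insert j (set js)) t') t'"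
    proof (rule has_vector_derivative_transform[OF t'j _ d])
      fix u :: real assume u: "u \<in> {0..1}"
      show "foldr partial js F (t'(j := u)) = cumulative I g (set js) (t'(j := u))"
        using t agree j u by (intro A(3)[of t] unit_cube_upd t') auto
    qed
    then show "foldr partial (j # js) F t' = cumulative I g (set (j # js)) t'"
      using partial_eqI[of t' j, OF t'j] by simp
  qed
qed

lemma AE_foldr_partial:
  assumes F: "\<And>t. t \<in> unit_cube I \<Longrightarrow> F t = cumulative I g {} t" and js: "distinct js" "set js = I"
  shows "AE t in cube_measure I. foldr partial js F t = g t"
proof -
  obtain A where A: "AE t in cube_measure I. t \<in> A"
    "\<And>t. t \<in> A \<Longrightarrow> t \<in> unit_cube I \<Longrightarrow> foldr partial js F t = cumulative I g I t"
    using foldr_partial_cumulative[OF F js(1)] js(2) by (metis order_refl)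
  from A(1) AE_space show ?thesis
    by eventually_elim (simp add: A(2) cumulative_all space_cube)
qed

end

section \<open>Chen's identity\<close>

lemma weighted_map_coordinate:
  assumes w: "weighted_map I01 w \<psi>" and q: "q < d"
  shows "weighted_map (cube_measure {..<d}) (\<lambda>s. w (s q)) (reparam d (\<lambda>j. if j = q then \<psi> else (\<lambda>u. u)))"
proof -
  have "weighted_map (cube_measure {..<d}) (\<lambda>s. \<Prod>j<d. (if j = q then w else (\<lambda>_. 1)) (s j))
      (\<lambda>s. \<lambda>j\<in>{..<d}. (if j = q then \<psi> else (\<lambda>u. u)) (s j))"
    unfolding cube_measure_def
    by (intro weighted_map_PiM[where w="\<lambda>j. if j = q then w else (\<lambda>_. 1)" and \<psi>="\<lambda>j. if j = q then \<psi> else (\<lambda>u. u)"] prob_space_I01)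
      (auto simp: w weighted_map_distr distr_id)
  moreover have "(\<Prod>j<d. (if j = q then w else (\<lambda>_. 1)) (s j)) = w (s q)" for s
  proof -
    have "(\<Prod>j<d. (if j = q then w else (\<lambda>_. 1)) (s j)) = (\<Prod>j<d. if j = q then w (s q) else 1)"
      by (intro prod.cong) auto
    then show ?thesis using q by simp
  qed
  ultimately show ?thesis by (simp add: reparam_def[abs_def])
qed

text \<open>One half is stretched over the whole interval and the other is collapsed to an endpoint,
  so that the map is monotone and fixes 0 and 1. The weights are the derivatives and vanish on the
  collapsed half.\<close>

definition half0 :: "nat \<Rightarrow> nat \<Rightarrow> real \<Rightarrow> real" where
  "half0 q j = (if j = q then (\<lambda>u. min (2 * u) 1) else (\<lambda>u. u))"

definition half1 :: "nat \<Rightarrow> nat \<Rightarrow> real \<Rightarrow> real" where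
  "half1 q j = (if j = q then (\<lambda>u. max (2 * u - 1) 0) else (\<lambda>u. u))"

definition weight0 :: "nat \<Rightarrow> point \<Rightarrow> real" where
  "weight0 q s = (if s q < 1/2 then 2 else 0)"

definition weight1 :: "nat \<Rightarrow> point \<Rightarrow> real" where
  "weight1 q s = (if s q < 1/2 then 0 else 2)"

lemma weighted_map_half0:
  assumes "q < d"
  shows "weighted_map (cube_measure {..<d}) (weight0 q) (reparam d (half0 q))"
proof -
  let ?w = "\<lambda>u::real. if u < 1/2 then 2 else 0 :: real"
  have "weighted_map I01 ?w (\<lambda>u. min (2 * u) 1)"
  proof (rule weighted_map_I01)
    fix c :: real assume c: "c \<in> {0..1}"
    have "(\<integral>\<^sup>+u. ennreal (?w u) * indicator {0..c} u \<partial>lborel) = (\<integral>\<^sup>+u. 2 * indicator ({0..c} \<inter> {..<1/2}) u \<partial>lborel)"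
      by (intro nn_integral_cong) (auto split: split_indicator)
    also have "\<dots> = 2 * emeasure lborel ({0..c} \<inter> {..<1/2})"
      by (rule nn_integral_cmult_indicator) simp
    also have "{0..c} \<inter> {..<1/2} = (if c < 1/2 then {0..c} else {0..<1/2})" using c by auto
    also have "2 * emeasure lborel (if c < 1/2 then {0..c} else {0..<1/2}) = ennreal 2 * ennreal (min c (1/2))"
      using c by simp
    also have "\<dots> = ennreal (min (2 * c) 1)"
      using c by (subst ennreal_mult[symmetric]) (auto simp: min_def)
    finally show "(\<integral>\<^sup>+u. ennreal (?w u) * indicator {0..c} u \<partial>lborel) = ennreal (min (2 * c) 1)" .
  qed (auto intro!: continuous_intros mono_onI)
  from weighted_map_coordinate[OF this assms] show ?thesis
    by (simp add: weight0_def[abs_def] half0_def[abs_def])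
qed

lemma weighted_map_half1:
  assumes "q < d"
  shows "weighted_map (cube_measure {..<d}) (weight1 q) (reparam d (half1 q))"
proof -
  let ?w = "\<lambda>u::real. if u < 1/2 then 0 else 2 :: real"
  have "weighted_map I01 ?w (\<lambda>u. max (2 * u - 1) 0)"
  proof (rule weighted_map_I01)
    fix c :: real assume c: "c \<in> {0..1}"
    have "(\<integral>\<^sup>+u. ennreal (?w u) * indicator {0..c} u \<partial>lborel) = (\<integral>\<^sup>+u. 2 * indicator {1/2..c} u \<partial>lborel)"
      by (intro nn_integral_cong) (auto split: split_indicator)
    also have "\<dots> = 2 * emeasure lborel {1/2..c}"
      by (rule nn_integral_cmult_indicator) simp
    also have "\<dots> = ennreal 2 * ennreal (max (c - 1/2) 0)"
      by (cases "1/2 \<le> c") auto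
    also have "\<dots> = ennreal (max (2 * c - 1) 0)"
      by (subst ennreal_mult[symmetric]) (auto simp: max_def)
    finally show "(\<integral>\<^sup>+u. ennreal (?w u) * indicator {0..c} u \<partial>lborel) = ennreal (max (2 * c - 1) 0)" .
  qed (auto intro!: continuous_intros mono_onI)
  from weighted_map_coordinate[OF this assms] show ?thesis
    by (simp add: weight1_def[abs_def] half1_def[abs_def])
qed

lemma half_range: "u \<in> {0..1} \<Longrightarrow> half0 q j u \<in> {0..1}" "u \<in> {0..1} \<Longrightarrow> half1 q j u \<in> {0..1}"
  by (auto simp: half0_def half1_def)

lemma half_continuous: "continuous_on {0..1} (half0 q j)" "continuous_on {0..1} (half1 q j)"
  by (auto simp: half0_def half1_def intro!: continuous_intros)

lemma compose_at_half:
  assumes "s \<in> unit_cube {..<d}" "q < d"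
  shows "s q \<le> 1/2 \<Longrightarrow> reparam d (half0 q) s = s(q := 2 * s q)"
    and "1/2 \<le> s q \<Longrightarrow> reparam d (half1 q) s = s(q := 2 * s q - 1)"
    and "compose_at q x y s = (if s q < 1/2 then x (reparam d (half0 q) s) else y (reparam d (half1 q) s))"
proof -
  show 0: "reparam d (half0 q) s = s(q := 2 * s q)" if "s q \<le> 1/2"
    using assms that by (auto simp: reparam_def half0_def unit_cube_def PiE_iff extensional_def fun_eq_iff)
  show 1: "reparam d (half1 q) s = s(q := 2 * s q - 1)" if "1/2 \<le> s q"
    using assms that by (auto simp: reparam_def half1_def unit_cube_def PiE_iff extensional_def fun_eq_iff)
  show "compose_at q x y s = (if s q < 1/2 then x (reparam d (half0 q) s) else y (reparam d (half1 q) s))"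
    using 0 1 by (simp add: compose_at_def)
qed

text \<open>Composability makes the two pieces agree where \<open>s q = 1/2\<close>, which gives
  continuity across the seam; this is how it enters Chen's identity.\<close>

lemma sections_continuous_compose:
  fixes x y :: "point \<Rightarrow> 'v::real_inner"
  assumes x: "x \<in> Lip d" and y: "y \<in> Lip d" and q: "q < d" and comp: "composable d q x y"
  shows "sections_continuous {..<d} (\<lambda>s. inner (compose_at q x y s) v)"
proof -
  let ?f = "(\<lambda>s. inner (x s) v) \<circ> reparam d (half0 q)" and ?h = "(\<lambda>s. inner (y s) v) \<circ> reparam d (half1 q)"
  have f: "sections_continuous {..<d} ?f"
    using weighted_map_half0[OF q]
    by (intro sections_continuous_reparam Lip_inner x half_continuous half_range) (auto simp: weighted_map_def)
  have h: "sections_continuous {..<d} ?h"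
    using weighted_map_half1[OF q]
    by (intro sections_continuous_reparam Lip_inner y half_continuous half_range) (auto simp: weighted_map_def)
  have eq: "inner (compose_at q x y s) v = (if s q < 1/2 then ?f s else ?h s)" if "s \<in> unit_cube {..<d}" for s
    using compose_at_half(3)[OF that q, of x y] by simp
  have mid: "?f s = ?h s" if s: "s \<in> unit_cube {..<d}" "s q = 1/2" for s
    using compose_at_half(1,2)[OF s(1) q] s comp by (simp add: composable_def)
  show ?thesis
    unfolding sections_continuous_def
  proof (intro conjI ballI)
    have [measurable]: "?f \<in> borel_measurable (cube_measure {..<d})" "?h \<in> borel_measurable (cube_measure {..<d})"
      "(\<lambda>s. s q) \<in> borel_measurable (cube_measure {..<d})"
      using f h q by (auto simp: sections_continuous_def intro: borel_measurable_component)
    have "(\<lambda>s. if s q < 1/2 then ?f s else ?h s) \<in> borel_measurable (cube_measure {..<d})" by measurable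
    then show "(\<lambda>s. inner (compose_at q x y s) v) \<in> borel_measurable (cube_measure {..<d})"
      by (rule measurable_cong[THEN iffD1, rotated]) (simp only: eq space_cube)
    fix s j assume s: "s \<in> unit_cube {..<d}" "j \<in> {..<d}"
    have cf: "continuous_on {0..1} (\<lambda>u. ?f (s(j := u)))" and ch: "continuous_on {0..1} (\<lambda>u. ?h (s(j := u)))"
      using f h s unfolding sections_continuous_def by blast+
    have "continuous_on {0..1} (\<lambda>u. if (s(j := u)) q \<le> 1/2 then ?f (s(j := u)) else ?h (s(j := u)))"
    proof (cases "j = q")
      case True
      show ?thesis
      proof (rule continuous_on_cases_le[where h="\<lambda>u. (s(j := u)) q"])
        show "?f (s(j := u)) = ?h (s(j := u))" if "u \<in> {0..1}" "(s(j := u)) q = 1/2" for u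
          by (rule mid[OF unit_cube_upd[OF s that(1)] that(2)])
        show "continuous_on {u \<in> {0..1}. (s(j := u)) q \<le> 1/2} (\<lambda>u. ?f (s(j := u)))"
          by (rule continuous_on_subset[OF cf]) blast
        show "continuous_on {u \<in> {0..1}. 1/2 \<le> (s(j := u)) q} (\<lambda>u. ?h (s(j := u)))"
          by (rule continuous_on_subset[OF ch]) blast
      qed (use True in simp)
    next
      case False
      then show ?thesis using cf ch by (cases "s q \<le> 1/2") simp_all
    qed
    then show "continuous_on {0..1} (\<lambda>u. inner (compose_at q x y (s(j := u))) v)"
    proof (rule continuous_on_cong[THEN iffD1, rotated -1])
      fix u :: real assume u: "u \<in> {0..1}"
      show "(if (s(j := u)) q \<le> 1/2 then ?f (s(j := u)) else ?h (s(j := u))) = inner (compose_at q x y (s(j := u))) v"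
        using eq[OF unit_cube_upd[OF s u]] mid[OF unit_cube_upd[OF s u]]
        by (cases "(s(j := u)) q = 1/2") (auto simp: less_le)
    qed simp
  qed
qed

text \<open>Differentiability is local: near \<open>s\<close> the function \<open>F\<close> is
  \<open>f\<close> after an affine stretching of coordinate \<open>q\<close>, hence the factor 2 in
  direction \<open>q\<close> alone.\<close>

lemma has_partial_piece:
  fixes f F :: "point \<Rightarrow> real"
  assumes f: "f \<in> Lip d" and j: "j < d" and s: "s \<in> unit_cube {..<d}"
    and \<psi>: "\<And>i u. i < d \<Longrightarrow> u \<in> {0..1} \<Longrightarrow> \<psi> i u \<in> {0..1}"
    and \<delta>: "0 < \<delta>" and aff: "\<And>u. \<bar>u - s q\<bar> < \<delta> \<Longrightarrow> \<psi> q u = 2 * u + b"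
    and id: "\<And>i. i \<noteq> q \<Longrightarrow> \<psi> i = (\<lambda>u. u)"
    and F: "\<And>t. t \<in> unit_cube {..<d} \<Longrightarrow> \<bar>t q - s q\<bar> < \<delta> \<Longrightarrow> F t = f (reparam d \<psi> t)"
    and l: "has_partial j f l (reparam d \<psi> s)"
  shows "has_partial j F ((if j = q then 2 else 1) * l) s"
proof -
  have sj: "s j \<in> {0..1}" using s j by (auto dest: unit_cubeD)
  have "(\<psi> j has_vector_derivative (if j = q then 2 else 1)) (at (s j) within {0..1})"
  proof (cases "j = q")
    case True
    have "((\<lambda>u. 2 * u + b) has_vector_derivative 2) (at (s j) within {0..1})"
      by (auto intro!: derivative_eq_intros)
    then have "(\<psi> j has_vector_derivative 2) (at (s j) within {0..1})"
      by (rule has_vector_derivative_transform_within[OF _ \<delta> sj]) (use aff True in \<open>auto simp: dist_real_def\<close>)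
    then show ?thesis using True by simp
  qed (auto simp: id intro!: derivative_eq_intros)
  then have "has_partial j (f \<circ> reparam d \<psi>) ((if j = q then 2 else 1) * l) s"
    by (intro has_partial_reparam f j s disjI2 l) (rule \<psi>)
  then show ?thesis
  proof (rule has_vector_derivative_transform_within[OF _ \<delta> sj])
    fix u assume u: "u \<in> {0..1}" "dist u (s j) < \<delta>"
    then show "(f \<circ> reparam d \<psi>) (s(j := u)) = F (s(j := u))"
      using F[OF unit_cube_upd[OF s _ u(1)]] j \<delta> by (auto simp: dist_real_def)
  qed
qed

text \<open>At each point one of the two weights is zero. Writing the minor as a sum lets the
  product over rows be expanded by \<open>prod_split_alternatives\<close>.\<close>

lemma jac_minor_compose:
  fixes x y :: "point \<Rightarrow> 'v::real_inner"
  assumes x: "x \<in> Lip d" and y: "y \<in> Lip d" and q: "q < d"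
  shows "AE s in cube_measure {..<d}. \<forall>P\<in>ord_inj d n. jac_minor d e (compose_at q x y) P s =
    weight0 q s * jac_minor d e x P (reparam d (half0 q) s) + weight1 q s * jac_minor d e y P (reparam d (half1 q) s)"
proof -
  have ne: "AE s in cube_measure {..<d}. s q \<noteq> 1/2" by (rule AE_cube_ne) (use q in auto)
  show ?thesis
    using AE_weighted_map[OF weighted_map_half0[OF q] AE_all_partials[OF x, of n e]]
      AE_weighted_map[OF weighted_map_half1[OF q] AE_all_partials[OF y, of n e]] ne AE_space
  proof (eventually_elim, intro ballI)
    fix s P
    assume ax: "0 < weight0 q s \<longrightarrow> (\<forall>i\<in>{..<n}. \<forall>j\<in>{..<d}. has_partial j (\<lambda>u. inner (x u) (e i)) (partial j (\<lambda>u. inner (x u) (e i)) (reparam d (half0 q) s)) (reparam d (half0 q) s))"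
      and ay: "0 < weight1 q s \<longrightarrow> (\<forall>i\<in>{..<n}. \<forall>j\<in>{..<d}. has_partial j (\<lambda>u. inner (y u) (e i)) (partial j (\<lambda>u. inner (y u) (e i)) (reparam d (half1 q) s)) (reparam d (half1 q) s))"
      and sq: "s q \<noteq> 1/2" and s: "s \<in> space (cube_measure {..<d})" and P: "P \<in> ord_inj d n"
    have s: "s \<in> unit_cube {..<d}" using s by (simp add: space_cube)
    have Pn: "P i < n" if "i < d" for i using P that by (auto simp: ord_inj_def)
    have two: "(\<Prod>j<d. if j = q then 2 else 1 :: real) = 2" using q by simp
    have sj: "s j \<in> {0..1}" if "j < d" for j using s that by (auto dest: unit_cubeD)
    show "jac_minor d e (compose_at q x y) P s =
      weight0 q s * jac_minor d e x P (reparam d (half0 q) s) + weight1 q s * jac_minor d e y P (reparam d (half1 q) s)"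
    proof (cases "s q < 1/2")
      case True
      have "partial j (\<lambda>u. inner (compose_at q x y u) (e (P i))) s =
        (if j = q then 2 else 1) * partial j (\<lambda>u. inner (x u) (e (P i))) (reparam d (half0 q) s)" if "i < d" "j < d" for i j
      proof (rule partial_eqI, rule sj[OF that(2)], rule has_partial_piece[where \<delta>="1/2 - s q" and b=0 and q=q and \<psi>="half0 q"],
          rule Lip_inner[OF x], rule that(2), rule s, rule half_range(1), assumption)
        show "inner (compose_at q x y t) (e (P i)) = inner (x (reparam d (half0 q) t)) (e (P i))"
          if "t \<in> unit_cube {..<d}" "\<bar>t q - s q\<bar> < 1/2 - s q" for t
          using compose_at_half(3)[OF that(1) q, of x y] that(2) by auto
        show "has_partial j (\<lambda>u. inner (x u) (e (P i))) (partial j (\<lambda>u. inner (x u) (e (P i))) (reparam d (half0 q) s)) (reparam d (half0 q) s)"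
          using ax Pn that True by (auto simp: weight0_def)
      qed (use True in \<open>auto simp: half0_def\<close>)
      then have "jac_minor d e (compose_at q x y) P s = (\<Prod>j<d. if j = q then 2 else 1) * jac_minor d e x P (reparam d (half0 q) s)"
        by (rule jac_minor_scale)
      then show ?thesis using True two by (simp add: weight0_def weight1_def)
    next
      case False
      then have gt: "1/2 < s q" using sq by simp
      have "partial j (\<lambda>u. inner (compose_at q x y u) (e (P i))) s =
        (if j = q then 2 else 1) * partial j (\<lambda>u. inner (y u) (e (P i))) (reparam d (half1 q) s)" if "i < d" "j < d" for i j
      proof (rule partial_eqI, rule sj[OF that(2)], rule has_partial_piece[where \<delta>="s q - 1/2" and b="-1" and q=q and \<psi>="half1 q"],
          rule Lip_inner[OF y], rule that(2), rule s, rule half_range(2), assumption)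
        show "inner (compose_at q x y t) (e (P i)) = inner (y (reparam d (half1 q) t)) (e (P i))"
          if "t \<in> unit_cube {..<d}" "\<bar>t q - s q\<bar> < s q - 1/2" for t
          using compose_at_half(3)[OF that(1) q, of x y] that(2) by auto
        show "has_partial j (\<lambda>u. inner (y u) (e (P i))) (partial j (\<lambda>u. inner (y u) (e (P i))) (reparam d (half1 q) s)) (reparam d (half1 q) s)"
          using ay Pn that False by (auto simp: weight1_def)
      qed (use gt in \<open>auto simp: half1_def\<close>)
      then have "jac_minor d e (compose_at q x y) P s = (\<Prod>j<d. if j = q then 2 else 1) * jac_minor d e y P (reparam d (half1 q) s)"
        by (rule jac_minor_scale)
      then show ?thesis using False two by (simp add: weight0_def weight1_def)
    qed
  qed
qed

text \<open>Rows below \<open>r\<close> come from the first map, the others from the second. In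
  column \<open>q\<close> the two groups occupy different halves of the composite, so after
  stretching no comparison between them remains; all other columns keep the full order.\<close>

definition chen_domain :: "nat \<Rightarrow> nat \<Rightarrow> nat \<Rightarrow> nat \<Rightarrow> (nat \<Rightarrow> point) set" where
  "chen_domain d m q r = {t \<in> space (cubes d {..<m}). \<forall>j\<in>{..<d}. \<forall>i\<in>{..<m}. \<forall>k\<in>{..<m}.
     i < k \<and> (j \<noteq> q \<or> k < r \<or> r \<le> i) \<longrightarrow> t i j < t k j}"

lemma sets_chen_domain: "chen_domain d m q r \<in> sets (cubes d {..<m})"
  unfolding chen_domain_def
proof (rule predE, intro pred_intros_finite(3) finite_lessThan pred_intros_logic(4))
  fix j i k assume "j \<in> {..<d}" "i \<in> {..<m}" "k \<in> {..<m}"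
  then have [measurable]: "(\<lambda>t. t i j) \<in> borel_measurable (cubes d {..<m})" "(\<lambda>t. t k j) \<in> borel_measurable (cubes d {..<m})"
    by (auto intro: measurable_entry)
  show "Measurable.pred (cubes d {..<m}) (\<lambda>t. t i j < t k j)" by measurable
qed simp

lemma restrict_in_chen_domain:
  assumes "(\<lambda>i\<in>{..<m}. g i) \<in> space (cubes d {..<m})"
  shows "(\<lambda>i\<in>{..<m}. g i) \<in> chen_domain d m q r \<longleftrightarrow>
    (\<forall>j<d. \<forall>i<m. \<forall>k<m. i < k \<and> (j \<noteq> q \<or> k < r \<or> r \<le> i) \<longrightarrow> g i j < g k j)"
  using assms by (simp add: chen_domain_def Ball_def)

abbreviation id_domain :: "nat \<Rightarrow> nat \<Rightarrow> (nat \<Rightarrow> point) set" where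
  "id_domain d m \<equiv> sig_domain d m (\<lambda>_. id) (\<lambda>_. 0) (\<lambda>_. 1)"

lemma id_domain_eq:
  "id_domain d m = {t \<in> space (cubes d {..<m}). \<forall>j<d. \<forall>i<m. \<forall>k<m. i < k \<longrightarrow> t i j < t k j}"
  by (subst sig_domain_unit_eq) (auto simp: permutes_id strict_mono_on_def)

lemma sets_id_domain: "id_domain d m \<in> sets (cubes d {..<m})"
  by (rule sets_sig_domain) (simp add: permutes_id)

lemma chen_domain_trivial: "chen_domain d m q 0 = id_domain d m" "chen_domain d m q m = id_domain d m"
  by (auto simp: chen_domain_def id_domain_eq)

lemma bounded_borel_weighted:
  assumes "weighted_map (cube_measure {..<d}) w \<psi>" "\<And>s. \<bar>w s\<bar> \<le> 2" "bounded_borel {..<d} g"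
  shows "bounded_borel {..<d} (\<lambda>s. w s * g (\<psi> s))"
proof -
  obtain B where B: "\<And>s. s \<in> unit_cube {..<d} \<Longrightarrow> \<bar>g s\<bar> \<le> B" using assms(3) by (auto simp: bounded_borel_def)
  have \<psi>: "\<psi> \<in> measurable (cube_measure {..<d}) (cube_measure {..<d})" and w: "w \<in> borel_measurable (cube_measure {..<d})"
    using assms(1) by (auto simp: weighted_map_def)
  have "\<bar>w s * g (\<psi> s)\<bar> \<le> 2 * B" if "s \<in> unit_cube {..<d}" for s
    unfolding abs_mult using assms(2) B[of "\<psi> s"] measurable_space[OF \<psi>, of s] that by (intro mult_mono) (auto simp: space_cube)
  then show ?thesis
    unfolding bounded_borel_def
    using borel_measurable_times[OF w measurable_compose[OF \<psi> bounded_borelD[OF assms(3)]]] by blast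
qed

text \<open>Every term except \<open>k = r\<close> contains a vanishing factor. The point is that
  the right side does not mention \<open>r\<close>, which varies from point to point of the
  domain.\<close>

lemma prod_split_alternatives:
  fixes a b :: "nat \<Rightarrow> real"
  assumes r: "r \<le> m" and a: "\<And>i. r \<le> i \<Longrightarrow> i < m \<Longrightarrow> a i = 0" and b: "\<And>i. i < r \<Longrightarrow> b i = 0"
  shows "(\<Prod>i<m. a i + b i) = (\<Sum>k\<le>m. \<Prod>i<m. if i < k then a i else b i)"
proof -
  have "(\<Prod>i<m. if i < k then a i else b i) = 0" if k: "k \<le> m" "k \<noteq> r" for k
  proof (cases "k < r")
    case True
    then show ?thesis using r b[of k] by (intro prod_zero) (auto intro!: bexI[of _ k])
  next
    case False
    then show ?thesis using k a[of r] by (intro prod_zero) (auto intro!: bexI[of _ r])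
  qed
  then have "(\<Sum>k\<le>m. \<Prod>i<m. if i < k then a i else b i) = (\<Sum>k\<le>m. if k = r then \<Prod>i<m. if i < r then a i else b i else 0)"
    by (intro sum.cong) auto
  also have "\<dots> = (\<Prod>i<m. if i < r then a i else b i)" using r by simp
  also have "\<dots> = (\<Prod>i<m. a i + b i)" using a b by (intro prod.cong) auto
  finally show ?thesis ..
qed

lemma compose_decomposition:
  fixes x y :: "point \<Rightarrow> 'v::real_inner"
  assumes x: "x \<in> Lip d" and y: "y \<in> Lip d" and q: "q < d" and comp: "composable d q x y"
    and P: "P \<in> {..<m} \<rightarrow>\<^sub>E ord_inj d n"
  shows "(LINT t|cubes d {..<m}. indicator (id_domain d m) t * (\<Prod>i<m. jac_minor d e (compose_at q x y) (P i) (t i)))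
    = (\<Sum>r\<le>m. LINT t|cubes d {..<m}. indicator (chen_domain d m q r) t *
        (\<Prod>i<m. (if i < r then jac_minor d e x (P i) else jac_minor d e y (P i)) (t i)))"
proof -
  let ?w = "\<lambda>r i. if i < r then weight0 q else weight1 q"
  let ?\<psi> = "\<lambda>r i. if i < r then reparam d (half0 q) else reparam d (half1 q)"
  let ?h = "\<lambda>r i. if i < r then jac_minor d e x (P i) else jac_minor d e y (P i)"
  let ?g = "\<lambda>r i s. ?w r i s * ?h r i (?\<psi> r i s)"
  let ?D = "id_domain d m"
  have wm: "weighted_map (cube_measure {..<d}) (?w r i) (?\<psi> r i)" for r i :: nat
    using weighted_map_half0[OF q] weighted_map_half1[OF q] by simp
  have hb: "bounded_borel {..<d} (?h r i)" for r i
    using bounded_borel_jac_minor[OF x] bounded_borel_jac_minor[OF y] by simp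
  have gb: "bounded_borel {..<d} (?g r i)" for r i
    by (rule bounded_borel_weighted[OF wm _ hb]) (auto simp: weight0_def weight1_def)
  have z: "(\<lambda>t. \<Prod>i<m. jac_minor d e (compose_at q x y) (P i) (t i)) \<in> borel_measurable (cubes d {..<m})"
    by (intro measurable_prod_rows borel_measurable_jac_minor sections_continuous_compose[OF x y q comp])
  have Dint: "integrable (cubes d {..<m}) (\<lambda>t. indicator ?D t * (\<Prod>i<m. ?g r i (t i)))" for r
    by (intro integrable_sig sets_id_domain gb) simp
  have Ps: "P i \<in> ord_inj d n" if "i < m" for i using P that by auto
  have "AE t in cubes d {..<m}. \<forall>i\<in>{..<m}. \<forall>P\<in>ord_inj d n. jac_minor d e (compose_at q x y) P (t i) =
    weight0 q (t i) * jac_minor d e x P (reparam d (half0 q) (t i)) + weight1 q (t i) * jac_minor d e y P (reparam d (half1 q) (t i))"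
    by (intro AE_cubes_all jac_minor_compose[OF x y q]) simp
  then have "AE t in cubes d {..<m}. indicator ?D t * (\<Prod>i<m. jac_minor d e (compose_at q x y) (P i) (t i))
    = (\<Sum>r\<le>m. indicator ?D t * (\<Prod>i<m. ?g r i (t i)))"
  proof eventually_elim
    case (elim t)
    show ?case
    proof (cases "t \<in> ?D")
      case True
      let ?a = "\<lambda>i. weight0 q (t i) * jac_minor d e x (P i) (reparam d (half0 q) (t i))"
        and ?b = "\<lambda>i. weight1 q (t i) * jac_minor d e y (P i) (reparam d (half1 q) (t i))"
      have mono: "t i q < t k q" if "i < k" "k < m" for i k using True q that by (auto simp: id_domain_eq)
      \<comment> \<open>The first row whose coordinate \<open>q\<close> lies in the second half, or
        \<open>m\<close> if there is none; as column \<open>q\<close> increases, all later rows lie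
        there too.\<close>
      define r where "r = (if \<exists>i<m. \<not> t i q < 1/2 then LEAST i. i < m \<and> \<not> t i q < 1/2 else m)"
      have r: "r \<le> m \<and> (\<forall>i<r. t i q < 1/2) \<and> (\<forall>i. r \<le> i \<longrightarrow> i < m \<longrightarrow> \<not> t i q < 1/2)"
      proof (cases "\<exists>i<m. \<not> t i q < 1/2")
        case True
        then have rr: "r = (LEAST i. i < m \<and> \<not> t i q < 1/2)" by (simp add: r_def)
        have lr: "r < m \<and> \<not> t r q < 1/2" unfolding rr using True by (metis (mono_tags, lifting) LeastI)
        have "t i q < 1/2" if "i < r" for i
          using not_less_Least[of i "\<lambda>i. i < m \<and> \<not> t i q < 1/2"] that lr unfolding rr by auto
        moreover have "\<not> t i q < 1/2" if "r \<le> i" "i < m" for i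
          using lr mono[of r i] that by (cases "r = i") auto
        ultimately show ?thesis using lr by auto
      next
        case False
        then show ?thesis by (auto simp: r_def)
      qed
      have "(\<Prod>i<m. ?a i + ?b i) = (\<Sum>k\<le>m. \<Prod>i<m. if i < k then ?a i else ?b i)"
        by (rule prod_split_alternatives[of r]) (use r in \<open>auto simp: weight0_def weight1_def\<close>)
      also have "(\<Prod>i<m. ?a i + ?b i) = (\<Prod>i<m. jac_minor d e (compose_at q x y) (P i) (t i))"
        using elim Ps by (intro prod.cong) auto
      also have "(\<Sum>k\<le>m. \<Prod>i<m. if i < k then ?a i else ?b i) = (\<Sum>r\<le>m. \<Prod>i<m. ?g r i (t i))"
        by (intro sum.cong prod.cong) auto
      finally show ?thesis using True by simp
    qed simp
  qed
  then have "(LINT t|cubes d {..<m}. indicator ?D t * (\<Prod>i<m. jac_minor d e (compose_at q x y) (P i) (t i)))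
    = (LINT t|cubes d {..<m}. (\<Sum>r\<le>m. indicator ?D t * (\<Prod>i<m. ?g r i (t i))))"
    by (rule integral_cong_AE[rotated -1])
      (intro borel_measurable_times borel_measurable_indicator sets_id_domain z
        borel_measurable_integrable Bochner_Integration.integrable_sum Dint)+
  also have "\<dots> = (\<Sum>r\<le>m. LINT t|cubes d {..<m}. indicator ?D t * (\<Prod>i<m. ?g r i (t i)))"
    by (rule Bochner_Integration.integral_sum) (rule Dint)
  also have "\<dots> = (\<Sum>r\<le>m. LINT t|cubes d {..<m}. indicator (chen_domain d m q r) t * (\<Prod>i<m. ?h r i (t i)))"
  proof (rule sum.cong[OF refl])
    fix r assume "r \<in> {..m}"
    have "(LINT t|cubes d {..<m}. indicator ?D t * (\<Prod>i<m. ?g r i (t i)))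
      = (\<Prod>i<m. 1) * (LINT t|cubes d {..<m}. indicator (chen_domain d m q r) t * (\<Prod>i<m. ?h r i (t i)))"
    \<comment> \<open>Each row is stretched by the map of its own half. Where all weights are
      nonzero, rows below \<open>r\<close> lie in the first half and the others in the second, so in
      column \<open>q\<close> the comparison across the cut is automatic and drops out.\<close>
    proof (rule transport_integral[where w="?w r" and \<psi>="?\<psi> r"])
      show "?g r i \<in> borel_measurable (cube_measure {..<d})" for i by (rule bounded_borelD[OF gb])
      show "?h r i \<in> borel_measurable (cube_measure {..<d})" for i by (rule bounded_borelD[OF hb])
      show "?D \<in> sets (cubes d {..<m})" by (rule sets_id_domain)
      show "chen_domain d m q r \<in> sets (cubes d {..<m})" by (rule sets_chen_domain)
      fix t assume t: "t \<in> space (cubes d {..<m})" and nz: "\<And>i. i \<in> {..<m} \<Longrightarrow> ?w r i (t i) \<noteq> 0"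
      have lo: "t i q < 1/2" if "i < r" "i < m" for i using nz[of i] that by (auto simp: weight0_def split: if_splits)
      have hi: "\<not> t i q < 1/2" if "r \<le> i" "i < m" for i using nz[of i] that by (auto simp: weight1_def split: if_splits)
      have t': "(\<lambda>i\<in>{..<m}. ?\<psi> r i (t i)) \<in> space (cubes d {..<m})"
        using cubesD[OF t] by (auto simp: space_cubes intro!: reparam_unit_cube half_range[unfolded atLeastAtMost_iff])
      have ord: "(i < k \<longrightarrow> t i j < t k j) \<longleftrightarrow>
          (i < k \<and> (j \<noteq> q \<or> k < r \<or> r \<le> i) \<longrightarrow> ?\<psi> r i (t i) j < ?\<psi> r k (t k) j)"
        if "j < d" "i < m" "k < m" for j i k
        using that lo[of i] lo[of k] hi[of i] hi[of k]
        by (cases "j = q"; cases "i < r"; cases "k < r") (auto simp: reparam_def half0_def half1_def)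
      have "t \<in> ?D \<longleftrightarrow> (\<forall>j<d. \<forall>i<m. \<forall>k<m. i < k \<longrightarrow> t i j < t k j)"
        unfolding id_domain_eq using t by blast
      also have "\<dots> \<longleftrightarrow> (\<forall>j<d. \<forall>i<m. \<forall>k<m. i < k \<and> (j \<noteq> q \<or> k < r \<or> r \<le> i) \<longrightarrow> ?\<psi> r i (t i) j < ?\<psi> r k (t k) j)"
        by (intro all_cong1 imp_cong[OF refl] ord)
      also have "\<dots> \<longleftrightarrow> (\<lambda>i\<in>{..<m}. ?\<psi> r i (t i)) \<in> chen_domain d m q r"
        using restrict_in_chen_domain[OF t'] by (rule sym)
      finally show "t \<in> ?D \<longleftrightarrow> (\<lambda>i\<in>{..<m}. ?\<psi> r i (t i)) \<in> chen_domain d m q r" .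
    qed (use wm in auto)
    then show "(LINT t|cubes d {..<m}. indicator ?D t * (\<Prod>i<m. ?g r i (t i)))
      = (LINT t|cubes d {..<m}. indicator (chen_domain d m q r) t * (\<Prod>i<m. ?h r i (t i)))" by simp
  qed
  finally show ?thesis .
qed

section \<open>The inner terms of Chen's identity\<close>

lemma measurable_rows_upd:
  "(\<lambda>(s, u). u(m := s)) \<in> measurable (cube_measure {..<d} \<Otimes>\<^sub>M cubes d {..<m}) (cubes d {..<Suc m})"
proof -
  have "(\<lambda>(s, u). u(m := s)) \<in> measurable (cube_measure {..<d} \<Otimes>\<^sub>M cubes d {..<m}) (cubes d (insert m {..<m}))"
    by measurable
  then show ?thesis by (simp only: lessThan_Suc)
qed

text \<open>\<open>g\<close> is a density for the last row: everything except its coordinates other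
  than \<open>q\<close> is integrated out. It is chosen before \<open>\<phi>\<close>, so that one
  \<open>g\<close> serves both for the indicators that build the first signature factor and for the
  second factor as test function.\<close>

lemma integrate_out_rows:
  assumes q: "q < d" and f: "\<And>i. i < Suc m \<Longrightarrow> bounded_borel {..<d} (f i)"
  obtains g where "bounded_borel ({..<d} - {q}) g"
    "\<And>\<phi>. bounded_borel ({..<d} - {q}) \<phi> \<Longrightarrow>
      (LINT t|cubes d {..<Suc m}. indicator (id_domain d (Suc m)) t * (\<Prod>i<Suc m. f i (t i)) * \<phi> (restrict (t m) ({..<d} - {q})))
      = (LINT s|cube_measure ({..<d} - {q}). g s * \<phi> s)"
proof -
  let ?I = "{..<d} - {q}"
  define F where "F t = indicator (id_domain d (Suc m)) t * (\<Prod>i<Suc m. f i (t i))" for t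
  have bb: "bounded_borel {..<d} (f i)" if "i \<in> {..<Suc m}" for i using f that by simp
  obtain K where K: "0 \<le> K" "\<And>t. t \<in> space (cubes d {..<Suc m}) \<Longrightarrow> \<bar>F t\<bar> \<le> K"
    unfolding F_def using prod_rows_bounded[of "{..<Suc m}" d f, OF bb] by metis
  have F: "F \<in> borel_measurable (cubes d {..<Suc m})"
    unfolding F_def by (intro borel_measurable_times borel_measurable_indicator sets_id_domain measurable_prod_rows bounded_borelD bb)
  define L where "L s = (LINT u|cubes d {..<m}. F (u(m := s)))" for s
  define g where "g s = (LINT v|I01. L (s(q := v)))" for s
  have insq: "insert q ?I = {..<d}" using q by auto
  have J1: "(\<lambda>(s, u). F (u(m := s))) \<in> borel_measurable (cube_measure {..<d} \<Otimes>\<^sub>M cubes d {..<m})"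
    using measurable_compose[OF measurable_rows_upd F] by (simp add: split_beta)
  have L: "L \<in> borel_measurable (cube_measure {..<d})"
    unfolding L_def
    by (rule sigma_finite_measure.borel_measurable_lebesgue_integral[OF prob_space_imp_sigma_finite[OF prob_space_cubes] J1])
  have upd: "u(m := s) \<in> space (cubes d {..<Suc m})" if "s \<in> unit_cube {..<d}" "u \<in> space (cubes d {..<m})" for s u
    using that by (auto simp: space_cubes PiE_iff extensional_def)
  have L_bound: "\<bar>L s\<bar> \<le> K" if s: "s \<in> unit_cube {..<d}" for s
    unfolding L_def
  proof (rule prob_space.abs_integral_le[OF prob_space_cubes])
    have "s \<in> space (cube_measure {..<d})" using s by (simp add: space_cube)
    from measurable_compose[OF measurable_Pair1'[OF this] J1]
    show "(\<lambda>u. F (u(m := s))) \<in> borel_measurable (cubes d {..<m})" by simp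
  qed (intro K(2) upd s)
  have add: "(\<lambda>(s, v). s(q := v)) \<in> measurable (cube_measure ?I \<Otimes>\<^sub>M I01) (cube_measure {..<d})"
  proof -
    have "(\<lambda>(s, v). s(q := v)) \<in> measurable (PiM ?I (\<lambda>_. I01) \<Otimes>\<^sub>M I01) (PiM (insert q ?I) (\<lambda>_. I01))" by measurable
    then show ?thesis by (simp only: insq cube_measure_def)
  qed
  have J2: "(\<lambda>(s, v). L (s(q := v))) \<in> borel_measurable (cube_measure ?I \<Otimes>\<^sub>M I01)"
    using measurable_compose[OF add L] by (simp add: split_beta)
  have g: "g \<in> borel_measurable (cube_measure ?I)"
    unfolding g_def
    by (rule sigma_finite_measure.borel_measurable_lebesgue_integral[OF prob_space_imp_sigma_finite[OF prob_space_I01] J2])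
  have addq: "s(q := v) \<in> unit_cube {..<d}" if "s \<in> unit_cube ?I" "v \<in> {0..1}" for s v
    using that q by (auto simp: unit_cube_def PiE_iff extensional_def)
  have "\<bar>g s\<bar> \<le> K" if s: "s \<in> unit_cube ?I" for s
    unfolding g_def
  proof (rule prob_space.abs_integral_le[OF prob_space_I01])
    have "s \<in> space (cube_measure ?I)" using s by (simp add: space_cube)
    from measurable_compose[OF measurable_Pair1'[OF this] J2]
    show "(\<lambda>v. L (s(q := v))) \<in> borel_measurable I01" by simp
  qed (use addq[OF s] L_bound in simp)
  then have gbb: "bounded_borel ?I g" using g unfolding bounded_borel_def by blast
  show thesis
  proof (rule that[OF gbb])
    fix \<phi> assume \<phi>: "bounded_borel ?I \<phi>"
    obtain B where B: "\<And>s. s \<in> unit_cube ?I \<Longrightarrow> \<bar>\<phi> s\<bar> \<le> B" using \<phi> by (auto simp: bounded_borel_def)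
    have res: "(\<lambda>s. restrict s ?I) \<in> measurable (cube_measure {..<d}) (cube_measure ?I)"
      unfolding cube_measure_def by (rule measurable_restrict_subset) auto
    have res': "restrict s ?I \<in> unit_cube ?I" if "s \<in> unit_cube {..<d}" for s
      using measurable_space[OF res] that by (simp add: space_cube)
    note \<phi>m = measurable_compose[OF res bounded_borelD[OF \<phi>]]
    have last: "m \<in> {..<Suc m}" by simp
    interpret R: prob_space "cubes d {..<Suc m}" by (rule prob_space_cubes)
    interpret C: prob_space "cube_measure {..<d}" by (rule prob_space_cube)
    have KB: "\<bar>a * b\<bar> \<le> K * B" if "\<bar>a\<bar> \<le> K" "\<bar>b\<bar> \<le> B" for a b
      unfolding abs_mult using that K(1) by (intro mult_mono) auto
    have int1: "integrable (cubes d {..<Suc m}) (\<lambda>t. F t * \<phi> (restrict (t m) ?I))"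
    proof (rule R.integrable_const_bound[where B="K * B"])
      show "AE t in cubes d {..<Suc m}. norm (F t * \<phi> (restrict (t m) ?I)) \<le> K * B"
        unfolding real_norm_def using cubesD[OF _ last] by (intro AE_I2 KB K(2) B res') auto
      show "(\<lambda>t. F t * \<phi> (restrict (t m) ?I)) \<in> borel_measurable (cubes d {..<Suc m})"
        by (intro borel_measurable_times F measurable_compose[OF measurable_row[OF last] \<phi>m])
    qed
    have int2: "integrable (cube_measure {..<d}) (\<lambda>s. L s * \<phi> (restrict s ?I))"
    proof (rule C.integrable_const_bound[where B="K * B"])
      show "AE s in cube_measure {..<d}. norm (L s * \<phi> (restrict s ?I)) \<le> K * B"
        unfolding real_norm_def by (intro AE_I2 KB L_bound B res') (auto simp: space_cube)
    qed (intro borel_measurable_times L \<phi>m)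
    have "(LINT t|cubes d {..<Suc m}. F t * \<phi> (restrict (t m) ?I))
      = (LINT s|cube_measure {..<d}. LINT u|cubes d {..<m}. F (u(m := s)) * \<phi> (restrict ((u(m := s)) m) ?I))"
      using integral_PiM_insert[of "\<lambda>_. cube_measure {..<d}" m "{..<m}" "\<lambda>t. F t * \<phi> (restrict (t m) ?I)",
          OF prob_space_cube _ int1[unfolded lessThan_Suc]] by (simp only: lessThan_Suc) simp
    also have "\<dots> = (LINT s|cube_measure {..<d}. L s * \<phi> (restrict s ?I))"
      by (simp add: L_def)
    also have "\<dots> = (LINT s|cube_measure ?I. LINT v|I01. L (s(q := v)) * \<phi> (restrict (s(q := v)) ?I))"
      using cube.product_integral_insert[of ?I q "\<lambda>s. L s * \<phi> (restrict s ?I)"] int2 insq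
      by (simp add: cube_measure_def)
    also have "\<dots> = (LINT s|cube_measure ?I. g s * \<phi> s)"
    proof (rule Bochner_Integration.integral_cong[OF refl])
      fix s assume "s \<in> space (cube_measure ?I)"
      then have "restrict (s(q := v)) ?I = s" for v
        by (auto simp: space_cube unit_cube_def PiE_iff extensional_def fun_eq_iff)
      then show "(LINT v|I01. L (s(q := v)) * \<phi> (restrict (s(q := v)) ?I)) = g s * \<phi> s" by (simp add: g_def)
    qed
    finally show "(LINT t|cubes d {..<Suc m}. indicator (id_domain d (Suc m)) t * (\<Prod>i<Suc m. f i (t i)) * \<phi> (restrict (t m) ?I))
      = (LINT s|cube_measure ?I. g s * \<phi> s)" by (simp only: F_def)
  qed
qed

text \<open>In increasing order the last row dominates the others, so the upper bounds reduce to it;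
  the bound 1 in coordinate \<open>q\<close> is automatic.\<close>

lemma id_domain_head:
  assumes q: "q < d" and t: "t \<in> space (cubes d {..<Suc m})"
  shows "t \<in> sig_domain d (Suc m) (\<lambda>_. id) (\<lambda>_. 0) (\<tau>(q := 1)) \<longleftrightarrow>
    t \<in> id_domain d (Suc m) \<and> (\<forall>j\<in>{..<d} - {q}. t m j \<le> \<tau> j)" (is "?L \<longleftrightarrow> ?R")
proof -
  have t01: "0 \<le> t i j" "t i j \<le> 1" if "i < Suc m" "j < d" for i j
    using unit_cubeD[OF cubesD[OF t]] that by auto
  have L_iff: "?L \<longleftrightarrow> (\<forall>j<d. \<forall>i<Suc m. t i j \<le> (\<tau>(q := 1)) j \<and> (\<forall>k<Suc m. i < k \<longrightarrow> t i j < t k j))"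
    by (subst sig_domain_eq) (use t t01 in \<open>auto simp: permutes_id\<close>)
  have R_iff: "?R \<longleftrightarrow> (\<forall>j<d. \<forall>i<Suc m. \<forall>k<Suc m. i < k \<longrightarrow> t i j < t k j) \<and> (\<forall>j<d. j \<noteq> q \<longrightarrow> t m j \<le> \<tau> j)"
    using t by (auto simp: id_domain_eq)
  show ?thesis
  proof
    assume ?L
    then have l: "\<And>i j. j < d \<Longrightarrow> i < Suc m \<Longrightarrow> t i j \<le> (\<tau>(q := 1)) j"
      "\<And>i j k. j < d \<Longrightarrow> i < Suc m \<Longrightarrow> k < Suc m \<Longrightarrow> i < k \<Longrightarrow> t i j < t k j" unfolding L_iff by blast+
    have "t m j \<le> \<tau> j" if "j < d" "j \<noteq> q" for j using l(1)[of j m] that by simp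
    then show ?R unfolding R_iff using l(2) by blast
  next
    assume ?R
    then have r: "\<And>i j k. j < d \<Longrightarrow> i < Suc m \<Longrightarrow> k < Suc m \<Longrightarrow> i < k \<Longrightarrow> t i j < t k j"
      "\<And>j. j < d \<Longrightarrow> j \<noteq> q \<Longrightarrow> t m j \<le> \<tau> j" unfolding R_iff by blast+
    have "t i j \<le> (\<tau>(q := 1)) j" if "j < d" "i < Suc m" for i j
      using r(1)[of j i m] r(2)[of j] t01[of i j] that by (cases "j = q"; cases "i = m") auto
    then show ?L unfolding L_iff using r(1) by blast
  qed
qed

text \<open>In increasing order the first row is the smallest, so it carries all lower bounds; this
  needs at least one row.\<close>

lemma id_domain_tail:
  assumes q: "q < d" and p: "0 < p" and t: "t \<in> space (cubes d {..<p})"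
  shows "t \<in> sig_domain d p (\<lambda>_. id) (\<tau>(q := 0)) (\<lambda>_. 1) \<longleftrightarrow>
    t \<in> id_domain d p \<and> (\<forall>j\<in>{..<d} - {q}. \<tau> j \<le> t 0 j)" (is "?L \<longleftrightarrow> ?R")
proof -
  have t01: "0 \<le> t i j" "t i j \<le> 1" if "i < p" "j < d" for i j
    using unit_cubeD[OF cubesD[OF t]] that by auto
  have L_iff: "?L \<longleftrightarrow> (\<forall>j<d. \<forall>i<p. (\<tau>(q := 0)) j \<le> t i j \<and> (\<forall>k<p. i < k \<longrightarrow> t i j < t k j))"
    by (subst sig_domain_eq) (use t t01 in \<open>auto simp: permutes_id\<close>)
  have R_iff: "?R \<longleftrightarrow> (\<forall>j<d. \<forall>i<p. \<forall>k<p. i < k \<longrightarrow> t i j < t k j) \<and> (\<forall>j<d. j \<noteq> q \<longrightarrow> \<tau> j \<le> t 0 j)"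
    using t by (auto simp: id_domain_eq)
  show ?thesis
  proof
    assume ?L
    then have l: "\<And>i j. j < d \<Longrightarrow> i < p \<Longrightarrow> (\<tau>(q := 0)) j \<le> t i j"
      "\<And>i j k. j < d \<Longrightarrow> i < p \<Longrightarrow> k < p \<Longrightarrow> i < k \<Longrightarrow> t i j < t k j" unfolding L_iff by blast+
    have "\<tau> j \<le> t 0 j" if "j < d" "j \<noteq> q" for j using l(1)[of j 0] that p by simp
    then show ?R unfolding R_iff using l(2) by blast
  next
    assume ?R
    then have r: "\<And>i j k. j < d \<Longrightarrow> i < p \<Longrightarrow> k < p \<Longrightarrow> i < k \<Longrightarrow> t i j < t k j"
      "\<And>j. j < d \<Longrightarrow> j \<noteq> q \<Longrightarrow> \<tau> j \<le> t 0 j" unfolding R_iff by blast+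
    have "(\<tau>(q := 0)) j \<le> t i j" if "j < d" "i < p" for i j
      using r(1)[of j 0 i] r(2)[of j] t01[of i j] that p by (cases "j = q"; cases "i = 0") auto
    then show ?L unfolding L_iff using r(1) by blast
  qed
qed

text \<open>A function that agrees almost everywhere with a Borel function is measurable for the
  completion; for the iterated partial derivative this agreement is what is available.\<close>

lemma integral_completion_cong:
  fixes f h :: "'a \<Rightarrow> real"
  assumes f: "f \<in> borel_measurable M" and eq: "AE x in M. h x = f x"
  shows "(LINT x|completion M. h x) = (LINT x|M. f x)"
proof -
  have eq': "AE x in completion M. h x = f x" by (rule AE_completion[OF eq])
  have f': "f \<in> borel_measurable (completion M)" by (rule measurable_completion[OF f])
  have h: "h \<in> borel_measurable (completion M)"
  proof (rule measurableI)
    fix A :: "real set" assume "A \<in> sets borel"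
    then have A: "f -` A \<inter> space (completion M) \<in> sets (completion M)" by (rule measurable_sets[OF f'])
    have "AE x in completion M. x \<in> f -` A \<inter> space (completion M) \<longleftrightarrow> x \<in> h -` A \<inter> space (completion M)"
      using eq' by eventually_elim auto
    then show "h -` A \<inter> space (completion M) \<in> sets (completion M)"
      by (rule completion.in_sets_AE[OF _ A]) auto
  qed simp
  have "(LINT x|completion M. h x) = (LINT x|completion M. f x)"
    by (rule integral_cong_AE[OF h f' eq'])
  then show ?thesis using integral_completion[OF f] by simp
qed

lemma bounded_borel_tail:
  assumes q: "q < d" and p: "0 < p" and G: "G \<in> borel_measurable (cubes d {..<p})"
    and K: "0 \<le> K" "\<And>t. t \<in> space (cubes d {..<p}) \<Longrightarrow> \<bar>G t\<bar> \<le> K"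
  shows "bounded_borel ({..<d} - {q}) (\<lambda>\<tau>. LINT t|cubes d {..<p}. (if \<forall>j\<in>{..<d} - {q}. \<tau> j \<le> t 0 j then G t else 0))"
proof -
  let ?I = "{..<d} - {q}"
  let ?N = "cube_measure ?I \<Otimes>\<^sub>M cubes d {..<p}"
  have pred: "Measurable.pred ?N (\<lambda>z. \<forall>j\<in>?I. fst z j \<le> snd z 0 j)"
  proof (intro pred_intros_finite(3) finite_Diff finite_lessThan)
    fix j assume j: "j \<in> ?I"
    show "Measurable.pred ?N (\<lambda>z. fst z j \<le> snd z 0 j)"
      unfolding pred_def using j p
      by (intro borel_measurable_le measurable_compose[OF measurable_fst borel_measurable_component]
          measurable_compose[OF measurable_snd measurable_entry]) auto
  qed
  have J: "(\<lambda>(\<tau>, t). if \<forall>j\<in>?I. \<tau> j \<le> t 0 j then G t else 0) \<in> borel_measurable ?N"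
    unfolding split_beta
    by (rule measurable_If[OF measurable_compose[OF measurable_snd G] borel_measurable_const pred[unfolded pred_def]])
  have "\<bar>LINT t|cubes d {..<p}. (if \<forall>j\<in>?I. \<tau> j \<le> t 0 j then G t else 0)\<bar> \<le> K" if \<tau>: "\<tau> \<in> unit_cube ?I" for \<tau>
  proof (rule prob_space.abs_integral_le[OF prob_space_cubes])
    have "\<tau> \<in> space (cube_measure ?I)" using \<tau> by (simp add: space_cube)
    from measurable_compose[OF measurable_Pair1'[OF this] J]
    show "(\<lambda>t. if \<forall>j\<in>?I. \<tau> j \<le> t 0 j then G t else 0) \<in> borel_measurable (cubes d {..<p})" by simp
  qed (use K in auto)
  moreover have "(\<lambda>\<tau>. LINT t|cubes d {..<p}. (if \<forall>j\<in>?I. \<tau> j \<le> t 0 j then G t else 0)) \<in> borel_measurable (cube_measure ?I)"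
    by (rule sigma_finite_measure.borel_measurable_lebesgue_integral[OF prob_space_imp_sigma_finite[OF prob_space_cubes] J])
  ultimately show ?thesis unfolding bounded_borel_def by blast
qed

text \<open>Across the cut it suffices to compare the adjacent rows \<open>r\<close> and
  \<open>Suc r\<close>, by transitivity inside the two groups.\<close>

lemma chen_domain_split:
  assumes q: "q < d" and p: "0 < p" and t: "t \<in> space (cubes d {..<Suc r + p})"
  shows "t \<in> chen_domain d (Suc r + p) q (Suc r) \<longleftrightarrow>
    restrict t {..<Suc r} \<in> id_domain d (Suc r) \<and> (\<lambda>i\<in>{..<p}. t (i + Suc r)) \<in> id_domain d p \<and>
    (\<forall>j\<in>{..<d} - {q}. t r j < t (Suc r) j)" (is "?L \<longleftrightarrow> ?A \<and> ?B \<and> ?C")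
proof -
  have sp: "restrict t {..<Suc r} \<in> space (cubes d {..<Suc r})" "(\<lambda>i\<in>{..<p}. t (i + Suc r)) \<in> space (cubes d {..<p})"
    using cubesD[OF t] by (auto simp: space_cubes)
  have A_iff: "?A \<longleftrightarrow> (\<forall>j<d. \<forall>i<Suc r. \<forall>k<Suc r. i < k \<longrightarrow> t i j < t k j)"
    using sp by (simp add: id_domain_eq)
  have B_iff: "?B \<longleftrightarrow> (\<forall>j<d. \<forall>i<p. \<forall>k<p. i < k \<longrightarrow> t (i + Suc r) j < t (k + Suc r) j)"
    using sp by (simp add: id_domain_eq)
  have L_iff: "?L \<longleftrightarrow> (\<forall>j<d. \<forall>i<Suc r + p. \<forall>k<Suc r + p. i < k \<longrightarrow> j \<noteq> q \<or> k < Suc r \<or> Suc r \<le> i \<longrightarrow> t i j < t k j)"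
    using t by (auto simp: chen_domain_def)
  show ?thesis
  proof
    assume ?L
    then have l: "\<And>i j k. j < d \<Longrightarrow> i < Suc r + p \<Longrightarrow> k < Suc r + p \<Longrightarrow> i < k \<Longrightarrow> j \<noteq> q \<or> k < Suc r \<or> Suc r \<le> i \<Longrightarrow> t i j < t k j"
      unfolding L_iff by blast
    show "?A \<and> ?B \<and> ?C"
      unfolding A_iff B_iff using l p by auto
  next
    assume "?A \<and> ?B \<and> ?C"
    then have a: "\<And>i j k. j < d \<Longrightarrow> i < Suc r \<Longrightarrow> k < Suc r \<Longrightarrow> i < k \<Longrightarrow> t i j < t k j"
      and b: "\<And>i j k. j < d \<Longrightarrow> i < p \<Longrightarrow> k < p \<Longrightarrow> i < k \<Longrightarrow> t (i + Suc r) j < t (k + Suc r) j"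
      and c: "\<And>j. j < d \<Longrightarrow> j \<noteq> q \<Longrightarrow> t r j < t (Suc r) j"
      unfolding A_iff B_iff by auto
    have "t i j < t k j" if h: "j < d" "i < Suc r + p" "k < Suc r + p" "i < k" "j \<noteq> q \<or> k < Suc r \<or> Suc r \<le> i" for i j k
    proof (cases "k < Suc r")
      case True
      then show ?thesis using a h by auto
    next
      case k: False
      show ?thesis
      proof (cases "Suc r \<le> i")
        case True
        then show ?thesis using b[of j "i - Suc r" "k - Suc r"] h k by auto
      next
        case False
        have "t i j \<le> t r j" using a[of j i r] h False by (cases "i = r") auto
        also have "t r j < t (Suc r) j" using c h k False by auto
        also have "t (Suc r) j \<le> t k j"
        proof (cases "k = Suc r")
          case False
          then have l: "0 < k - Suc r" "k - Suc r < p" "k - Suc r + Suc r = k" using h k by auto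
          have "t (0 + Suc r) j < t (k - Suc r + Suc r) j" by (rule b[OF h(1) p l(2,1)])
          then show ?thesis unfolding l(3) by simp
        qed simp
        finally show ?thesis .
      qed
    qed
    then show ?L unfolding L_iff by blast
  qed
qed

text \<open>Rows are numbered from 0, so row \<open>r\<close> is the last one governed by
  \<open>x\<close>. Its coordinates other than \<open>q\<close> are the variable of the outer
  integral; the rows governed by \<open>y\<close> enter through \<open>Y\<close>. The density
  \<open>g\<close> of the head is both the mixed partial derivative of the first signature and the
  weight against which \<open>Y\<close> is integrated.\<close>

lemma chen_integral_eq:
  fixes x y :: "point \<Rightarrow> 'v::real_inner"
  assumes x: "x \<in> Lip d" and y: "y \<in> Lip d" and q: "q < d" and p: "0 < p"
  shows "(LINT t|cubes d {..<Suc r + p}. indicator (chen_domain d (Suc r + p) q (Suc r)) t *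
      (\<Prod>i<Suc r + p. (if i < Suc r then jac_minor d e x (P i) else jac_minor d e y (P i)) (t i)))
    = chen_integral d e q (Suc r + p) P x y (Suc r)"
proof -
  let ?I = "{..<d} - {q}" and ?r = "Suc r"
  let ?f = "\<lambda>i. jac_minor d e x (P i)" and ?h = "\<lambda>i. jac_minor d e y (P (i + ?r))"
  let ?g = "\<lambda>i. if i < ?r then jac_minor d e x (P i) else jac_minor d e y (P i)"
  define F where "F t = indicator (id_domain d ?r) t * (\<Prod>i<?r. ?f i (t i))" for t :: "nat \<Rightarrow> point"
  define G where "G t = indicator (id_domain d p) t * (\<Prod>i<p. ?h i (t i))" for t :: "nat \<Rightarrow> point"
  define Y where "Y \<tau> = (LINT t|cubes d {..<p}. (if \<forall>j\<in>?I. \<tau> j \<le> t 0 j then G t else 0))" for \<tau> :: point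
  have bx: "bounded_borel {..<d} (jac_minor d e x Q)" and bY: "bounded_borel {..<d} (jac_minor d e y Q)" for Q
    by (intro bounded_borel_jac_minor x y)+
  have Gm: "G \<in> borel_measurable (cubes d {..<p})"
    unfolding G_def by (intro borel_measurable_times borel_measurable_indicator sets_id_domain measurable_prod_rows bounded_borelD bY)
  obtain K where K: "0 \<le> K" "\<And>t. t \<in> space (cubes d {..<p}) \<Longrightarrow> \<bar>G t\<bar> \<le> K"
    unfolding G_def using prod_rows_bounded[of "{..<p}" d ?h, OF bY] by metis
  have Y: "bounded_borel ?I Y" unfolding Y_def by (rule bounded_borel_tail[OF q p Gm K])
  obtain g where g: "bounded_borel ?I g"
    "\<And>\<phi>. bounded_borel ?I \<phi> \<Longrightarrow> (LINT t|cubes d {..<?r}. F t * \<phi> (restrict (t r) ?I)) = (LINT s|cube_measure ?I. g s * \<phi> s)"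
    unfolding F_def
  proof (rule integrate_out_rows[OF q, where m=r and f="?f"])
    show "bounded_borel {..<d} (?f i)" for i by (rule bx)
  qed (rule that, assumption, simp only: F_def)
  have tail: "sig_comp d e p (\<lambda>i. P (i + ?r)) (\<lambda>_. id) y (\<tau>(q := 0)) (\<lambda>_. 1) = Y \<tau>" for \<tau>
    unfolding sig_comp_def set_lebesgue_integral_def Y_def
    by (intro Bochner_Integration.integral_cong refl) (auto simp: G_def id_domain_tail[OF q p] indicator_def)
  have head: "sig_comp d e ?r P (\<lambda>_. id) x (\<lambda>_. 0) (\<tau>(q := 1)) = cumulative ?I g {} \<tau>" if \<tau>: "\<tau> \<in> unit_cube ?I" for \<tau>
  proof -
    let ?\<phi> = "\<lambda>s. if \<forall>j\<in>?I. s j \<le> \<tau> j then 1 else 0 :: real"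
    have "bounded_borel ?I ?\<phi>"
      unfolding bounded_borel_def
    proof
      have "Measurable.pred (cube_measure ?I) (\<lambda>s. \<forall>j\<in>?I. s j \<le> \<tau> j)"
      proof (intro pred_intros_finite(3) finite_Diff finite_lessThan)
        fix j assume j: "j \<in> ?I"
        show "Measurable.pred (cube_measure ?I) (\<lambda>s. s j \<le> \<tau> j)"
          unfolding pred_def by (intro borel_measurable_le borel_measurable_component[OF j] borel_measurable_const)
      qed
      then show "?\<phi> \<in> borel_measurable (cube_measure ?I)"
        unfolding pred_def by (intro measurable_If borel_measurable_const)
    qed (auto intro!: exI[of _ 1])
    note red = g(2)[OF this]
    have "sig_comp d e ?r P (\<lambda>_. id) x (\<lambda>_. 0) (\<tau>(q := 1)) = (LINT t|cubes d {..<?r}. F t * ?\<phi> (restrict (t r) ?I))"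
      unfolding sig_comp_def set_lebesgue_integral_def
      by (intro Bochner_Integration.integral_cong refl) (auto simp: F_def id_domain_head[OF q] indicator_def)
    also have "\<dots> = cumulative ?I g {} \<tau>"
      unfolding red cumulative_def
    proof (simp only: Diff_empty, rule Bochner_Integration.integral_cong[OF refl])
      fix s assume "s \<in> space (cube_measure ?I)"
      then have "merge {} ?I (\<tau>, s) = s"
        by (auto simp: merge_def space_cube unit_cube_def PiE_iff extensional_def fun_eq_iff)
      then show "g s * ?\<phi> s = (if \<forall>i\<in>?I. s i \<le> \<tau> i then g (merge {} ?I (\<tau>, s)) else 0)" by simp
    qed
    finally show ?thesis .
  qed
  obtain B where B: "\<And>s. s \<in> unit_cube ?I \<Longrightarrow> \<bar>g s\<bar> \<le> B" using g(1) by (auto simp: bounded_borel_def)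
  \<comment> \<open>On the cube the first factor is the indefinite integral of \<open>g\<close>, so
    iterated differentiation returns \<open>g\<close> almost everywhere.\<close>
  have "AE \<tau> in cube_measure ?I. mixed_partial d q (\<lambda>t. sig_comp d e ?r P (\<lambda>_. id) x (\<lambda>_. 0) (t(q := 1))) \<tau> = g \<tau>"
    unfolding mixed_partial_def
    by (rule AE_foldr_partial[OF _ bounded_borelD[OF g(1)] B head]) auto
  then have ae: "AE \<tau> in cube_measure ?I. mixed_partial d q (\<lambda>t. sig_comp d e ?r P (\<lambda>_. id) x (\<lambda>_. 0) (t(q := 1))) \<tau> * Y \<tau> = g \<tau> * Y \<tau>"
    by eventually_elim simp
  have chen: "chen_integral d e q (?r + p) P x y ?r = (LINT \<tau>|cube_measure ?I. g \<tau> * Y \<tau>)"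
    unfolding chen_integral_def add_diff_cancel_left' tail
    by (rule integral_completion_cong[OF borel_measurable_times[OF bounded_borelD[OF g(1)] bounded_borelD[OF Y]] ae])
  define H where "H u v = F u * (if \<forall>j\<in>?I. u r j < v 0 j then G v else 0)" for u v :: "nat \<Rightarrow> point"
  have eqH: "indicator (chen_domain d (?r + p) q ?r) t * (\<Prod>i<?r + p. ?g i (t i))
      = H (restrict t {..<?r}) (\<lambda>i\<in>{..<p}. t (i + ?r))" if t: "t \<in> space (cubes d {..<?r + p})" for t
  proof -
    have "(\<Prod>i<?r + p. ?g i (t i)) = (\<Prod>i<?r. ?f i (t i)) * (\<Prod>i<p. ?h i (t (i + ?r)))"
      unfolding prod_lessThan_add[of _ ?r p] by simp
    then show ?thesis
      using chen_domain_split[OF q p t] p by (auto simp: H_def F_def G_def indicator_def)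
  qed
  have Hm: "H u \<in> borel_measurable (cubes d {..<p})" for u
    unfolding H_def
  proof (intro borel_measurable_times borel_measurable_const measurable_If Gm)
    have "Measurable.pred (cubes d {..<p}) (\<lambda>v. \<forall>j\<in>?I. u r j < v 0 j)"
    proof (intro pred_intros_finite(3) finite_Diff finite_lessThan)
      fix j assume j: "j \<in> ?I"
      show "Measurable.pred (cubes d {..<p}) (\<lambda>v. u r j < v 0 j)"
        unfolding pred_def using j p by (intro borel_measurable_less borel_measurable_const measurable_entry) auto
    qed
    then show "{v \<in> space (cubes d {..<p}). \<forall>j\<in>?I. u r j < v 0 j} \<in> sets (cubes d {..<p})" by (simp add: pred_def)
  qed
  have "integrable (cubes d {..<?r + p}) (\<lambda>t. indicator (chen_domain d (?r + p) q ?r) t * (\<Prod>i<?r + p. ?g i (t i)))"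
    using bx bY by (intro integrable_sig sets_chen_domain) auto
  then have Hint: "integrable (cubes d {..<?r + p}) (\<lambda>t. H (restrict t {..<?r}) (\<lambda>i\<in>{..<p}. t (i + ?r)))"
    by (rule Bochner_Integration.integrable_cong[THEN iffD1, rotated -1]) (use eqH in auto)
  have "(LINT t|cubes d {..<?r + p}. indicator (chen_domain d (?r + p) q ?r) t * (\<Prod>i<?r + p. ?g i (t i)))
    = (LINT t|cubes d {..<?r + p}. H (restrict t {..<?r}) (\<lambda>i\<in>{..<p}. t (i + ?r)))"
    by (intro Bochner_Integration.integral_cong refl eqH)
  also have "\<dots> = (LINT u|cubes d {..<?r}. LINT v|cubes d {..<p}. H u v)"
    by (rule integral_split_rows[OF Hm Hint])
  also have "\<dots> = (LINT u|cubes d {..<?r}. F u * Y (restrict (u r) ?I))"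
  proof (rule Bochner_Integration.integral_cong[OF refl])
    fix u
    \<comment> \<open>Strict and weak comparison across the cut differ only on a null set of
      \<open>v\<close>, which turns the inner integral into \<open>Y\<close>.\<close>
    have "AE v in cubes d {..<p}. \<forall>j\<in>?I. v 0 j \<noteq> u r j"
    proof (intro AE_finite_allI finite_Diff finite_lessThan)
      fix j assume "j \<in> ?I"
      then show "AE v in cubes d {..<p}. v 0 j \<noteq> u r j"
        using p by (intro AE_cubes[where Q="\<lambda>s. s j \<noteq> u r j"] AE_cube_ne) auto
    qed
    then have ae: "AE v in cubes d {..<p}. H u v = F u * (if \<forall>j\<in>?I. restrict (u r) ?I j \<le> v 0 j then G v else 0)"
    proof eventually_elim
      case (elim v)
      have "(\<forall>j\<in>?I. u r j < v 0 j) \<longleftrightarrow> (\<forall>j\<in>?I. restrict (u r) ?I j \<le> v 0 j)"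
      proof (intro ball_cong refl)
        fix j assume j: "j \<in> ?I"
        then have "v 0 j \<noteq> u r j" using elim by blast
        then show "u r j < v 0 j \<longleftrightarrow> restrict (u r) ?I j \<le> v 0 j" using j by auto
      qed
      then show ?case by (simp only: H_def)
    qed
    have m: "(\<lambda>v. F u * (if \<forall>j\<in>?I. restrict (u r) ?I j \<le> v 0 j then G v else 0)) \<in> borel_measurable (cubes d {..<p})"
    proof (intro borel_measurable_times borel_measurable_const measurable_If Gm)
      have "Measurable.pred (cubes d {..<p}) (\<lambda>v. \<forall>j\<in>?I. restrict (u r) ?I j \<le> v 0 j)"
      proof (intro pred_intros_finite(3) finite_Diff finite_lessThan)
        fix j assume j: "j \<in> ?I"
        show "Measurable.pred (cubes d {..<p}) (\<lambda>v. restrict (u r) ?I j \<le> v 0 j)"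
          unfolding pred_def using j p by (intro borel_measurable_le borel_measurable_const measurable_entry) auto
      qed
      then show "{v \<in> space (cubes d {..<p}). \<forall>j\<in>?I. restrict (u r) ?I j \<le> v 0 j} \<in> sets (cubes d {..<p})" by (simp add: pred_def)
    qed
    have "(LINT v|cubes d {..<p}. H u v)
      = (LINT v|cubes d {..<p}. F u * (if \<forall>j\<in>?I. restrict (u r) ?I j \<le> v 0 j then G v else 0))"
      by (rule integral_cong_AE[OF Hm m ae])
    also have "\<dots> = F u * Y (restrict (u r) ?I)" unfolding Y_def by (rule integral_mult_right_zero)
    finally show "(LINT v|cubes d {..<p}. H u v) = F u * Y (restrict (u r) ?I)" .
  qed
  also have "\<dots> = (LINT \<tau>|cube_measure ?I. g \<tau> * Y \<tau>)" by (rule g(2)[OF Y])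
  finally show ?thesis unfolding chen .
qed

lemma chen_identity:
  fixes x y :: "point \<Rightarrow> 'v::real_inner"
  assumes x: "x \<in> Lip d" and y: "y \<in> Lip d" and q: "q < d" and m: "1 \<le> m"
    and comp: "composable d q x y" and P: "P \<in> {..<m} \<rightarrow>\<^sub>E ord_inj d n"
  shows "sig_coord d e m P (\<lambda>_. id) (compose_at q x y) =
    sig_coord d e m P (\<lambda>_. id) x + sig_coord d e m P (\<lambda>_. id) y +
    (\<Sum>r=1..m-1. chen_integral d e q m P x y r)"
proof -
  have coord: "sig_coord d e m P (\<lambda>_. id) z
    = (LINT t|cubes d {..<m}. indicator (id_domain d m) t * (\<Prod>i<m. jac_minor d e z (P i) (t i)))" for z :: "point \<Rightarrow> 'v"
    by (simp add: sig_comp_def set_lebesgue_integral_def)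
  let ?E = "\<lambda>r. LINT t|cubes d {..<m}. indicator (chen_domain d m q r) t *
        (\<Prod>i<m. (if i < r then jac_minor d e x (P i) else jac_minor d e y (P i)) (t i))"
  \<comment> \<open>For \<open>r = 0\<close> and \<open>r = m\<close> all rows come from one map,
    which gives the signatures of \<open>y\<close> and of \<open>x\<close>; since
    \<open>1 \<le> m\<close>, these two terms are distinct.\<close>
  have "{..m} = insert 0 (insert m {1..m - 1})" using m by auto
  then have "(\<Sum>r\<le>m. ?E r) = ?E 0 + (?E m + (\<Sum>r=1..m-1. ?E r))" using m by simp
  moreover have "?E 0 = sig_coord d e m P (\<lambda>_. id) y"
    unfolding coord by (simp add: chen_domain_trivial)
  moreover have "?E m = sig_coord d e m P (\<lambda>_. id) x"
    unfolding coord chen_domain_trivial by (intro Bochner_Integration.integral_cong refl arg_cong2[where f="(*)"] prod.cong) auto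
  moreover have "?E r = chen_integral d e q m P x y r" if r: "r \<in> {1..m - 1}" for r
  proof -
    obtain r' where r': "r = Suc r'" using r by (cases r) auto
    have m': "m = Suc r' + (m - r)" and pos: "0 < m - r" using r r' by auto
    show ?thesis
      unfolding r' by (rule chen_integral_eq[OF x y q pos, of r' e P, folded m'])
  qed
  ultimately show ?thesis
    unfolding coord[of "compose_at q x y"] compose_decomposition[OF x y q comp P] by simp
qed


theorem theorem7:
  fixes d n :: nat and e :: "nat \<Rightarrow> 'v::real_inner"
  assumes "d \<ge> 1" and "orthonormal_basis n e"
  shows
    "(Metric_space (LipJ d n e) (mu_inf d n e) \<and>
      Metric_space (H_space d n) (H_dist d n) \<and>
      sig d n e respects jac_equiv d n e \<and>
      sigJ d n e ` LipJ d n e \<subseteq> H_space d n)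
     \<and>
     ((\<forall>x\<in>Lip d. \<forall>m.
         (level_norm d n m (sig d n e x m))\<^sup>2
           \<le> real (n choose d) ^ m * Linf_norm d n (jac_minor d e x) ^ (2 * m) / (fact m) ^ d) \<and>
      continuous_map (LipJ_topology d n e) (H_topology d n) (sigJ d n e))
     \<and>
     (\<forall>x\<in>Lip d. \<forall>\<psi>.
        (\<forall>j<d. (\<exists>L. L-lipschitz_on {0..1} (\<psi> j)) \<and>
               bij_betw (\<psi> j) {0..1} {0..1} \<and> mono_on {0..1} (\<psi> j)) \<longrightarrow>
        sig d n e x = sig d n e (x \<circ> reparam d \<psi>))
     \<and>
     (\<forall>q<d. \<forall>x\<in>Lip d. \<forall>y\<in>Lip d. \<forall>m\<ge>1. \<forall>P\<in>{..<m} \<rightarrow>\<^sub>E ord_inj d n.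
        composable d q x y \<longrightarrow>
        sig_coord d e m P (\<lambda>_. id) (compose_at q x y) =
          sig_coord d e m P (\<lambda>_. id) x + sig_coord d e m P (\<lambda>_. id) y +
          (\<Sum>r=1..m-1. chen_integral d e q m P x y r))
     \<and>
     continuous_subalgebra (LipJ_topology d n e)
       ((\<lambda>l. \<lambda>X\<in>LipJ d n e. pairing d n l (sigJ d n e X)) ` finite_functionals d n)
     \<and>
     (\<forall>x\<in>Lip d.
        (\<forall>\<tau> \<sigma>. \<sigma> permutes {..<d} \<longrightarrow>
           sig d n e (x \<circ> cube_sym d \<tau> \<sigma>) = hyperoct_act d n \<tau> \<sigma> (sig d n e x)) \<and>
        (\<forall>A. linear A \<and> bij A \<longrightarrow>
           sig d n e (A \<circ> x) = GL_act d n e A (sig d n e x)))"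
proof (intro conjI ballI allI impI)
  show "Metric_space (LipJ d n e) (mu_inf d n e)" by (rule Metric_space_LipJ)
  show "Metric_space (H_space d n) (H_dist d n)" by (rule Metric_space_H_space)
  show "sig d n e respects jac_equiv d n e" by (rule sig_respects)
  show "sigJ d n e ` LipJ d n e \<subseteq> H_space d n"
    unfolding sigJ_def using sig_in_H_space[OF assms(1)] LipJ_rep(2) by blast
  show "continuous_map (LipJ_topology d n e) (H_topology d n) (sigJ d n e)"
    by (rule continuous_map_sigJ[OF assms(1)])
  show "continuous_subalgebra (LipJ_topology d n e)
      ((\<lambda>l. \<lambda>X\<in>LipJ d n e. pairing d n l (sigJ d n e X)) ` finite_functionals d n)"
    by (rule shuffle_subalgebra[OF assms(1)])
  fix x :: "point \<Rightarrow> 'v" assume x: "x \<in> Lip d"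
  show "(level_norm d n m (sig d n e x m))\<^sup>2
      \<le> real (n choose d) ^ m * Linf_norm d n (jac_minor d e x) ^ (2 * m) / (fact m) ^ d" for m
    by (rule factorial_decay[OF assms(1) x])
  show "sig d n e x = sig d n e (x \<circ> reparam d \<psi>)"
    if "\<forall>j<d. (\<exists>L. L-lipschitz_on {0..1} (\<psi> j)) \<and> bij_betw (\<psi> j) {0..1} {0..1} \<and> mono_on {0..1} (\<psi> j)" for \<psi>
    by (rule sig_reparam[OF x that, symmetric])
  show "sig d n e (x \<circ> cube_sym d \<tau> \<sigma>) = hyperoct_act d n \<tau> \<sigma> (sig d n e x)"
    if "\<sigma> permutes {..<d}" for \<tau> \<sigma>
    by (rule sig_cube_sym[OF x that])
  show "sig d n e (A \<circ> x) = GL_act d n e A (sig d n e x)" if "linear A \<and> bij A" for A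
    using that by (intro sig_linear assms(2) x) simp
  show "sig_coord d e m P (\<lambda>_. id) (compose_at q x y) =
      sig_coord d e m P (\<lambda>_. id) x + sig_coord d e m P (\<lambda>_. id) y +
      (\<Sum>r=1..m-1. chen_integral d e q m P x y r)"
    if "q < d" "y \<in> Lip d" "1 \<le> m" "P \<in> {..<m} \<rightarrow>\<^sub>E ord_inj d n" "composable d q x y" for q y m P
    by (rule chen_identity[OF x that(2,1,3,5,4)])
qed

end
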